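(* Let $C$ be a right semiperfect coalgebra over a field $K$. Let $\mathscr X$ be a poset and let $\mathscr R:\mathscr X\longrightarrow\mathscr Ent_C$ be an entwined $C$-representation of $\mathscr X$. (1) For each $x\in\mathscr X$, there is an extension functor $ex_x^C:\mathbf M_{\mathscr R_x}^C(\psi_x)\longrightarrow Mod^C-\mathscr R$ which is left adjoint to the evaluation functor $ev_x^C:Mod^C-\mathscr R\longrightarrow\mathbf M^C_{\mathscr R_x}(\psi_x)$, $\mathscr M\mapsto\mathscr M_x$. (2) The family $\{ex_x^C(V\otimes H_r)\mid x\in\mathscr X,\ r\in\mathscr R_x,\ V\in Proj^f(C)\}$ is a set of projective generators for $Mod^C-\mathscr R$, where $Proj^f(C)$ is the set of isomorphism classes of finite dimensional projective right $C$-comodules.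
   Context: Conventions. $\otimes=\otimes_K$; coalgebras are coassociative counital $K$-coalgebras; $\Delta_C(c)=c_1\otimes c_2$ and comodule coactions are written $m\mapsto m_0\otimes m_1$ (summation suppressed). For a small $K$-linear category $\mathcal R$, a right $\mathcal R$-module is a $K$-linear functor $\mathcal R^{op}\to Vect_K$; for $m\in\mathcal M(r)$, $f\in\mathcal R(s,r)$ write $mf:=\mathcal M(f)(m)\in\mathcal M(s)$; $H_r:=\mathcal R(-,r)$. $C$ is right semiperfect if the category of right $C$-comodules has enough projectives. A poset is viewed as a category with a single morphism $x\to y$ when $x\le y$. Entwining structure. $(\mathcal R,C,\psi)$ consists of a small $K$-linear category $\mathcal R$, a $K$-coalgebra $C$ and $K$-linear maps $\psi_{rs}:C\otimes\mathcal R(r,s)\to\mathcal R(r,s)\otimes C$, written $\psi(c\otimes f)=f_\psi\otimes c^\psi$, such that for $f\in\mathcal R(r,s)$, $g\in\mathcal R(s,t)$, $c\in C$: $(gf)_\psi\otimes c^\psi=g_\psi f_\psi\otimes {c^\psi}^\psi$ ($\psi$ is first applied to $c\otimes g$, then to $c^\psi\otimes f$); $\varepsilon_C(c^\psi)f_\psi=\varepsilon_C(c)f$; $f_\psi\otimes\Delta_C(c^\psi)={f_\psi}_\psi\otimes {c_1}^\psi\otimes {c_2}^\psi$ ($\psi$ is first applied to $c_2\otimes f$, then to $c_1\otimes f_\psi$); $\psi(c\otimes id_r)=id_r\otimes c$. Entwined modules. $\mathbf M_{\mathcal R}^C(\psi)$ has as objects right $\mathcal R$-modules $\mathcal M$ with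 a right $C$-comodule structure on each $\mathcal M(s)$ such that $(mf)_0\otimes(mf)_1=m_0f_\psi\otimes {m_1}^\psi$ for $f\in\mathcal R(s,r)$, $m\in\mathcal M(r)$; morphisms are morphisms of right $\mathcal R$-modules that are $C$-colinear at each object. For a right $C$-comodule $V$ and $r\in\mathcal R$, $V\otimes H_r\in\mathbf M_{\mathcal R}^C(\psi)$ is $(V\otimes H_r)(r')=V\otimes\mathcal R(r',r)$ with action $(v\otimes g)f=v\otimes gf$ and coaction $v\otimes g\mapsto v_0\otimes g_\psi\otimes {v_1}^\psi$. Representations. $\mathscr Ent_C$ is the category of entwining structures $(\mathcal R,C,\psi)$ with $C$ fixed; a morphism $\alpha:(\mathcal R,C,\psi)\to(\mathcal S,C,\psi')$ is a $K$-linear functor $\alpha:\mathcal R\to\mathcal S$ with $\alpha(f_\psi)\otimes c^\psi=\alpha(f)_{\psi'}\otimes c^{\psi'}$. It induces $\alpha_\ast:\mathbf M_{\mathcal S}^C(\psi')\to\mathbf M_{\mathcal R}^C(\psi)$, $(\alpha_\ast\mathcal N)(r)=\mathcal N(\alpha(r))$ (same coaction, $\mathcal R$ acting through $\alpha$), with left adjoint $\alpha^\ast$: $(\alpha^\ast\mathcal M)(s)$ is the quotient of $\bigoplus_{r}\mathcal M(r)\otimes\mathcal S(s,\alpha(r))$ by the span of all $m'\otimes\alpha(g)f-m'g\otimes f$, with coaction $m\otimes f\mapsto m_0\otimes f_{\psi'}\otimes {m_1}^{\psi'}$. An entwined $C$-representation of $\mathscr X$ is a functor $\mathscr R:\mathscr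 X\to\mathscr Ent_C$, $x\mapsto(\mathscr R_x,C,\psi_x)$; for $\alpha:x\to y$ in $\mathscr X$ write $\alpha_\ast,\alpha^\ast$ for $\mathscr R_{\alpha\ast},\mathscr R_\alpha^\ast$. Modules over $\mathscr R$. An object $\mathscr M$ of $Mod^C-\mathscr R$ consists of $\mathscr M_x\in\mathbf M^C_{\mathscr R_x}(\psi_x)$ for each $x\in\mathscr X$ and morphisms $\mathscr M_\alpha:\mathscr M_x\to\alpha_\ast\mathscr M_y$ in $\mathbf M^C_{\mathscr R_x}(\psi_x)$ for each $\alpha:x\to y$ (equivalently $\mathscr M^\alpha:\alpha^\ast\mathscr M_x\to\mathscr M_y$), with $\mathscr M_{id_x}=id$ and $\mathscr M_{\beta\alpha}=\alpha_\ast(\mathscr M_\beta)\circ\mathscr M_\alpha$. A morphism $\eta:\mathscr M\to\mathscr N$ consists of morphisms $\eta_x:\mathscr M_x\to\mathscr N_x$ with $\mathscr N_\alpha\circ\eta_x=\alpha_\ast(\eta_y)\circ\mathscr M_\alpha$. Extension functor. $ex_x^C(\mathcal M)_y=\alpha^\ast\mathcal M$ if there is $\alpha:x\to y$ in $\mathscr X$, and $0$ if $x\not\le y$; for $\beta:y\to y'$ with $x\le y$, the map $ex_x^C(\mathcal M)^\beta:\beta^\ast\alpha^\ast\mathcal M\to(\beta\alpha)^\ast\mathcal M$ is the canonical identification. *)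

theory Defs
  imports "HOL-Algebra.Algebra"
begin

text \<open>
  One type \<open>'u\<close> plays the role of the universe of small sets: the field, the coalgebra, the
  objects and morphisms of the small linear categories, and all comodules and modules have their
  carriers inside \<open>'u\<close>.  Only infinity of \<open>'u\<close> is ever assumed, so that any given data can be
  placed in such a universe.  Tensor products, direct sums and quotients are first formed
  in the usual way, in a larger type, and then copied back into \<open>'u\<close> along an injection
  (\<open>small_copy\<close>), which exists for cardinality reasons.
\<close>

section \<open>Categories\<close>

text \<open>Hom sets need not be disjoint, so composition is indexed by the three objects:
  \<open>cmp A a b c g f\<close> is the composite of \<open>f : a \<rightarrow> b\<close> and \<open>g : b \<rightarrow> c\<close>.\<close>

record ('o, 'a) cat =
  Ob :: "'o set"
  Hom :: "'o \<Rightarrow> 'o \<Rightarrow> 'a set"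
  ident :: "'o \<Rightarrow> 'a"
  cmp :: "'o \<Rightarrow> 'o \<Rightarrow> 'o \<Rightarrow> 'a \<Rightarrow> 'a \<Rightarrow> 'a"

locale category =
  fixes A :: "('o, 'a) cat"
  assumes ident_in: "a \<in> Ob A \<Longrightarrow> ident A a \<in> Hom A a a"
    and cmp_in: "\<lbrakk>a \<in> Ob A; b \<in> Ob A; c \<in> Ob A; f \<in> Hom A a b; g \<in> Hom A b c\<rbrakk>
      \<Longrightarrow> cmp A a b c g f \<in> Hom A a c"
    and cmp_ident_right: "\<lbrakk>a \<in> Ob A; b \<in> Ob A; f \<in> Hom A a b\<rbrakk>
      \<Longrightarrow> cmp A a a b f (ident A a) = f"
    and cmp_ident_left: "\<lbrakk>a \<in> Ob A; b \<in> Ob A; f \<in> Hom A a b\<rbrakk>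
      \<Longrightarrow> cmp A a b b (ident A b) f = f"
    and cmp_assoc: "\<lbrakk>a \<in> Ob A; b \<in> Ob A; c \<in> Ob A; d \<in> Ob A;
      f \<in> Hom A a b; g \<in> Hom A b c; h \<in> Hom A c d\<rbrakk>
      \<Longrightarrow> cmp A a c d h (cmp A a b c g f) = cmp A a b d (cmp A b c d h g) f"

record ('o, 'a, 'p, 'b) func =
  fob :: "'o \<Rightarrow> 'p"
  farr :: "'o \<Rightarrow> 'o \<Rightarrow> 'a \<Rightarrow> 'b"

locale cat_functor = A: category A + B: category B
  for A :: "('o, 'a) cat" and B :: "('p, 'b) cat" +
  fixes F :: "('o, 'a, 'p, 'b) func"
  assumes fob_in: "a \<in> Ob A \<Longrightarrow> fob F a \<in> Ob B"
    and farr_in: "\<lbrakk>a \<in> Ob A; b \<in> Ob A; f \<in> Hom A a b\<rbrakk>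
      \<Longrightarrow> farr F a b f \<in> Hom B (fob F a) (fob F b)"
    and farr_ident: "a \<in> Ob A \<Longrightarrow> farr F a a (ident A a) = ident B (fob F a)"
    and farr_cmp: "\<lbrakk>a \<in> Ob A; b \<in> Ob A; c \<in> Ob A; f \<in> Hom A a b; g \<in> Hom A b c\<rbrakk>
      \<Longrightarrow> farr F a c (cmp A a b c g f)
        = cmp B (fob F a) (fob F b) (fob F c) (farr F b c g) (farr F a b f)"

definition left_adjoint ::
  "('o, 'a) cat \<Rightarrow> ('p, 'b) cat \<Rightarrow> ('o, 'a, 'p, 'b) func \<Rightarrow> ('p, 'b, 'o, 'a) func \<Rightarrow> bool" where
  "left_adjoint A B F G \<longleftrightarrow> cat_functor A B F \<and> cat_functor B A G \<and>
    (\<exists>\<phi>. (\<forall>a \<in> Ob A. \<forall>b \<in> Ob B.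
             bij_betw (\<phi> a b) (Hom B (fob F a) b) (Hom A a (fob G b))) \<and>
         (\<forall>a \<in> Ob A. \<forall>a' \<in> Ob A. \<forall>b \<in> Ob B. \<forall>b' \<in> Ob B.
            \<forall>u \<in> Hom A a' a. \<forall>v \<in> Hom B b b'. \<forall>h \<in> Hom B (fob F a) b.
              \<phi> a' b' (cmp B (fob F a') (fob F a) b' (cmp B (fob F a) b b' v h) (farr F a' a u))
              = cmp A a' a (fob G b') (cmp A a (fob G b) (fob G b') (farr G b b' v) (\<phi> a b h)) u))"

definition epi :: "('o, 'a) cat \<Rightarrow> 'o \<Rightarrow> 'o \<Rightarrow> 'a \<Rightarrow> bool" where
  "epi A a b e \<longleftrightarrow> e \<in> Hom A a b \<and>
    (\<forall>c \<in> Ob A. \<forall>f \<in> Hom A b c. \<forall>g \<in> Hom A b c. cmp A a b c f e = cmp A a b c g e \<longrightarrow> f = g)"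

definition isomorphic :: "('o, 'a) cat \<Rightarrow> 'o \<Rightarrow> 'o \<Rightarrow> bool" where
  "isomorphic A a b \<longleftrightarrow> (\<exists>f \<in> Hom A a b. \<exists>g \<in> Hom A b a.
    cmp A a b a g f = ident A a \<and> cmp A b a b f g = ident A b)"

definition projective :: "('o, 'a) cat \<Rightarrow> 'o \<Rightarrow> bool" where
  "projective A p \<longleftrightarrow> p \<in> Ob A \<and>
    (\<forall>a \<in> Ob A. \<forall>b \<in> Ob A. \<forall>e f. epi A a b e \<and> f \<in> Hom A p b
      \<longrightarrow> (\<exists>h \<in> Hom A p a. cmp A p a b e h = f))"

definition enough_projectives :: "('o, 'a) cat \<Rightarrow> bool" where
  "enough_projectives A \<longleftrightarrow> (\<forall>a \<in> Ob A. \<exists>p e. projective A p \<and> epi A p a e)"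

definition generating :: "('o, 'a) cat \<Rightarrow> 'o set \<Rightarrow> bool" where
  "generating A G \<longleftrightarrow> G \<subseteq> Ob A \<and>
    (\<forall>a \<in> Ob A. \<forall>b \<in> Ob A. \<forall>f \<in> Hom A a b. \<forall>g \<in> Hom A a b. f \<noteq> g
      \<longrightarrow> (\<exists>p \<in> G. \<exists>h \<in> Hom A p a. cmp A p a b f h \<noteq> cmp A p a b g h))"

definition projective_generators :: "('o, 'a) cat \<Rightarrow> 'o set \<Rightarrow> bool" where
  "projective_generators A G \<longleftrightarrow> (\<forall>p \<in> G. projective A p) \<and> generating A G"

definition poset_cat :: "('x::order, unit) cat" where
  "poset_cat = \<lparr>Ob = UNIV, Hom = (\<lambda>x y. if x \<le> y then {()} else {}),
     ident = (\<lambda>_. ()), cmp = (\<lambda>_ _ _ _ _. ())\<rparr>"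

section \<open>Linear algebra inside the universe\<close>

text \<open>Vector spaces are the library's modules, over a field.  The fields \<open>mult\<close> and \<open>one\<close>
  that the record type inherits from rings play no role.\<close>

definition self_mod :: "'u ring \<Rightarrow> ('u, 'u) module" where
  "self_mod K = \<lparr>carrier = carrier K, monoid.mult = (\<otimes>\<^bsub>K\<^esub>), monoid.one = \<one>\<^bsub>K\<^esub>,
     ring.zero = \<zero>\<^bsub>K\<^esub>, ring.add = (\<oplus>\<^bsub>K\<^esub>), smult = (\<otimes>\<^bsub>K\<^esub>)\<rparr>"

definition lin_map ::
  "'u ring \<Rightarrow> ('u, 'a, 'y) module_scheme \<Rightarrow> ('u, 'b, 'z) module_scheme \<Rightarrow> ('a \<Rightarrow> 'b) \<Rightarrow> bool" where
  "lin_map K V W f \<longleftrightarrow> f \<in> carrier V \<rightarrow> carrier W \<and>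
     (\<forall>x \<in> carrier V. \<forall>y \<in> carrier V. f (x \<oplus>\<^bsub>V\<^esub> y) = f x \<oplus>\<^bsub>W\<^esub> f y) \<and>
     (\<forall>a \<in> carrier K. \<forall>x \<in> carrier V. f (a \<odot>\<^bsub>V\<^esub> x) = a \<odot>\<^bsub>W\<^esub> f x)"

text \<open>Maps that are compared for equality are taken to be \<open>extensional\<close>, i.e.
  \<open>undefined\<close> outside their domain.\<close>

definition Lin ::
  "'u ring \<Rightarrow> ('u, 'a, 'y) module_scheme \<Rightarrow> ('u, 'b, 'z) module_scheme \<Rightarrow> ('a \<Rightarrow> 'b) set" where
  "Lin K V W = {f \<in> extensional (carrier V). lin_map K V W f}"

definition mspan :: "'u ring \<Rightarrow> ('u, 'a, 'z) module_scheme \<Rightarrow> 'a set \<Rightarrow> 'a set" where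
  "mspan K M S = \<Inter>{N. submodule N K M \<and> S \<subseteq> N}"

definition fin_dim :: "'u ring \<Rightarrow> ('u, 'a, 'z) module_scheme \<Rightarrow> bool" where
  "fin_dim K M \<longleftrightarrow> (\<exists>S \<subseteq> carrier M. finite S \<and> mspan K M S = carrier M)"

definition mquot :: "('u, 'a, 'z) module_scheme \<Rightarrow> 'a set \<Rightarrow> ('u, 'a set) module" where
  "mquot M N = \<lparr>carrier = a_rcosets\<^bsub>M\<^esub> N, monoid.mult = undefined, monoid.one = undefined,
     ring.zero = N, ring.add = set_add M,
     smult = (\<lambda>a A. \<Union>x \<in> A. N +>\<^bsub>M\<^esub> (a \<odot>\<^bsub>M\<^esub> x))\<rparr>"

definition dsum :: "'i set \<Rightarrow> ('i \<Rightarrow> ('u, 'a, 'z) module_scheme) \<Rightarrow> ('u, 'i \<Rightarrow> 'a) module" where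
  "dsum I M = \<lparr>carrier = {f \<in> \<Pi>\<^sub>E i \<in> I. carrier (M i). finite {i \<in> I. f i \<noteq> \<zero>\<^bsub>M i\<^esub>}},
     monoid.mult = undefined, monoid.one = undefined,
     ring.zero = (\<lambda>i \<in> I. \<zero>\<^bsub>M i\<^esub>),
     ring.add = (\<lambda>f g. \<lambda>i \<in> I. f i \<oplus>\<^bsub>M i\<^esub> g i),
     smult = (\<lambda>a f. \<lambda>i \<in> I. a \<odot>\<^bsub>M i\<^esub> f i)\<rparr>"

definition dinj :: "'i set \<Rightarrow> ('i \<Rightarrow> ('u, 'a, 'z) module_scheme) \<Rightarrow> 'i \<Rightarrow> 'a \<Rightarrow> ('i \<Rightarrow> 'a)" where
  "dinj I M i x = (\<lambda>j \<in> I. if j = i then x else \<zero>\<^bsub>M j\<^esub>)"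

definition small_enc :: "'a set \<Rightarrow> 'a \<Rightarrow> 'u" where
  "small_enc S = (SOME e. inj_on e S)"

definition small_copy :: "('u, 'a, 'z) module_scheme \<Rightarrow> ('u, 'u) module" where
  "small_copy M =
    (let e = small_enc (carrier M); d = inv_into (carrier M) e in
     \<lparr>carrier = e ` carrier M, monoid.mult = undefined, monoid.one = undefined,
      ring.zero = e \<zero>\<^bsub>M\<^esub>,
      ring.add = (\<lambda>x y. e (d x \<oplus>\<^bsub>M\<^esub> d y)),
      smult = (\<lambda>a x. e (a \<odot>\<^bsub>M\<^esub> d x))\<rparr>)"

subsection \<open>Tensor products\<close>

context
  fixes K :: "'u ring"
    and V :: "('u, 'u, 'y) module_scheme"
    and W :: "('u, 'u, 'z) module_scheme"
begin

definition free_mod :: "('u, 'u \<times> 'u \<Rightarrow> 'u) module" where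
  "free_mod = dsum (carrier V \<times> carrier W) (\<lambda>_. self_mod K)"

definition free_gen :: "'u \<Rightarrow> 'u \<Rightarrow> 'u \<times> 'u \<Rightarrow> 'u" where
  "free_gen v w = dinj (carrier V \<times> carrier W) (\<lambda>_. self_mod K) (v, w) \<one>\<^bsub>K\<^esub>"

definition tensor_rel :: "('u \<times> 'u \<Rightarrow> 'u) set" where
  "tensor_rel = mspan K free_mod
    ({free_gen (v \<oplus>\<^bsub>V\<^esub> v') w \<ominus>\<^bsub>free_mod\<^esub> (free_gen v w \<oplus>\<^bsub>free_mod\<^esub> free_gen v' w) |
        v v' w. v \<in> carrier V \<and> v' \<in> carrier V \<and> w \<in> carrier W} \<union>
     {free_gen v (w \<oplus>\<^bsub>W\<^esub> w') \<ominus>\<^bsub>free_mod\<^esub> (free_gen v w \<oplus>\<^bsub>free_mod\<^esub> free_gen v w') |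
        v w w'. v \<in> carrier V \<and> w \<in> carrier W \<and> w' \<in> carrier W} \<union>
     {free_gen (a \<odot>\<^bsub>V\<^esub> v) w \<ominus>\<^bsub>free_mod\<^esub> (a \<odot>\<^bsub>free_mod\<^esub> free_gen v w) |
        a v w. a \<in> carrier K \<and> v \<in> carrier V \<and> w \<in> carrier W} \<union>
     {free_gen v (a \<odot>\<^bsub>W\<^esub> w) \<ominus>\<^bsub>free_mod\<^esub> (a \<odot>\<^bsub>free_mod\<^esub> free_gen v w) |
        a v w. a \<in> carrier K \<and> v \<in> carrier V \<and> w \<in> carrier W})"

definition tensor :: "('u, 'u) module" where
  "tensor = small_copy (mquot free_mod tensor_rel)"

definition tens :: "'u \<Rightarrow> 'u \<Rightarrow> 'u" where
  "tens v w = small_enc (carrier (mquot free_mod tensor_rel))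
                (tensor_rel +>\<^bsub>free_mod\<^esub> free_gen v w)"

text \<open>The linear map \<open>V \<otimes> W \<rightarrow> U\<close> induced by a bilinear map \<open>\<beta>\<close>.  In Sweedler's notation,
  \<open>tlift K V W U \<beta> t\<close> is \<open>\<beta> t\<^sub>1 t\<^sub>2\<close> for \<open>t = t\<^sub>1 \<otimes> t\<^sub>2\<close> (summation suppressed).\<close>

definition tlift :: "('u, 'b, 'x) module_scheme \<Rightarrow> ('u \<Rightarrow> 'u \<Rightarrow> 'b) \<Rightarrow> 'u \<Rightarrow> 'b" where
  "tlift U \<beta> = (THE h. h \<in> Lin K tensor U \<and>
     (\<forall>v \<in> carrier V. \<forall>w \<in> carrier W. h (tens v w) = \<beta> v w))"

end

section \<open>Coalgebras and comodules\<close>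

record 'u coalg = "('u, 'u) module" +
  comult :: "'u \<Rightarrow> 'u"
  counit :: "'u \<Rightarrow> 'u"

definition coalgebra :: "'u ring \<Rightarrow> 'u coalg \<Rightarrow> bool" where
  "coalgebra K C \<longleftrightarrow>
    (let CC = tensor K C C; CCC = tensor K C CC in
     module K C \<and>
     lin_map K C CC (comult C) \<and>
     lin_map K C (self_mod K) (counit C) \<and>
     (\<forall>c \<in> carrier C.
        tlift K C C CCC (\<lambda>a b. tens K C CC a (comult C b)) (comult C c)
        = tlift K C C CCC
            (\<lambda>a b. tlift K C C CCC (\<lambda>a1 a2. tens K C CC a1 (tens K C C a2 b)) (comult C a))
            (comult C c)) \<and>
     (\<forall>c \<in> carrier C. tlift K C C C (\<lambda>a b. counit C a \<odot>\<^bsub>C\<^esub> b) (comult C c) = c) \<and>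
     (\<forall>c \<in> carrier C. tlift K C C C (\<lambda>a b. counit C b \<odot>\<^bsub>C\<^esub> a) (comult C c) = c))"

record 'u comod = "('u, 'u) module" +
  coact :: "'u \<Rightarrow> 'u"

definition comodule :: "'u ring \<Rightarrow> 'u coalg \<Rightarrow> 'u comod \<Rightarrow> bool" where
  "comodule K C V \<longleftrightarrow>
    (let CC = tensor K C C; VCC = tensor K V CC in
     module K V \<and>
     lin_map K V (tensor K V C) (coact V) \<and>
     (\<forall>v \<in> carrier V.
        tlift K V C VCC (\<lambda>v0 c. tens K V CC v0 (comult C c)) (coact V v)
        = tlift K V C VCC
            (\<lambda>v' c. tlift K V C VCC (\<lambda>v0 v1. tens K V CC v0 (tens K C C v1 c)) (coact V v'))
            (coact V v)) \<and>
     (\<forall>v \<in> carrier V. tlift K V C V (\<lambda>v0 v1. counit C v1 \<odot>\<^bsub>V\<^esub> v0) (coact V v) = v))"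

definition comod_maps :: "'u ring \<Rightarrow> 'u coalg \<Rightarrow> 'u comod \<Rightarrow> 'u comod \<Rightarrow> ('u \<Rightarrow> 'u) set" where
  "comod_maps K C V W = {f \<in> Lin K V W. \<forall>v \<in> carrier V.
     coact W (f v) = tlift K V C (tensor K W C) (\<lambda>v0 v1. tens K W C (f v0) v1) (coact V v)}"

definition comod_cat :: "'u ring \<Rightarrow> 'u coalg \<Rightarrow> ('u comod, 'u \<Rightarrow> 'u) cat" where
  "comod_cat K C = \<lparr>Ob = {V. comodule K C V}, Hom = comod_maps K C,
     ident = (\<lambda>V. \<lambda>v \<in> carrier V. v),
     cmp = (\<lambda>U V W g f. compose (carrier U) g f)\<rparr>"

definition right_semiperfect :: "'u ring \<Rightarrow> 'u coalg \<Rightarrow> bool" where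
  "right_semiperfect K C \<longleftrightarrow> enough_projectives (comod_cat K C)"

text \<open>A choice of one representative from each isomorphism class of finite dimensional
  projective right comodules.\<close>

definition is_Proj_f :: "'u ring \<Rightarrow> 'u coalg \<Rightarrow> 'u comod set \<Rightarrow> bool" where
  "is_Proj_f K C P \<longleftrightarrow>
    (\<forall>V \<in> P. projective (comod_cat K C) V \<and> fin_dim K V) \<and>
    (\<forall>V. projective (comod_cat K C) V \<and> fin_dim K V
       \<longrightarrow> (\<exists>!W. W \<in> P \<and> isomorphic (comod_cat K C) V W))"

section \<open>Entwining structures\<close>

record 'u lincat =
  lob :: "'u set"
  lhom :: "'u \<Rightarrow> 'u \<Rightarrow> ('u, 'u) module"
  lid :: "'u \<Rightarrow> 'u"
  lcmp :: "'u \<Rightarrow> 'u \<Rightarrow> 'u \<Rightarrow> 'u \<Rightarrow> 'u \<Rightarrow> 'u"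

definition underlying :: "('u, 'z) lincat_scheme \<Rightarrow> ('u, 'u) cat" where
  "underlying R = \<lparr>Ob = lob R, Hom = (\<lambda>r s. carrier (lhom R r s)), ident = lid R, cmp = lcmp R\<rparr>"

definition lin_category :: "'u ring \<Rightarrow> ('u, 'z) lincat_scheme \<Rightarrow> bool" where
  "lin_category K R \<longleftrightarrow> category (underlying R) \<and>
     (\<forall>r \<in> lob R. \<forall>s \<in> lob R. module K (lhom R r s)) \<and>
     (\<forall>r \<in> lob R. \<forall>s \<in> lob R. \<forall>t \<in> lob R.
        (\<forall>f \<in> carrier (lhom R r s). lin_map K (lhom R s t) (lhom R r t) (\<lambda>g. lcmp R r s t g f)) \<and>
        (\<forall>g \<in> carrier (lhom R s t). lin_map K (lhom R r s) (lhom R r t) (\<lambda>f. lcmp R r s t g f)))"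

definition lin_functor ::
  "'u ring \<Rightarrow> ('u, 'y) lincat_scheme \<Rightarrow> ('u, 'z) lincat_scheme \<Rightarrow> ('u, 'u, 'u, 'u) func \<Rightarrow> bool" where
  "lin_functor K R S \<alpha> \<longleftrightarrow> cat_functor (underlying R) (underlying S) \<alpha> \<and>
     (\<forall>r \<in> lob R. \<forall>s \<in> lob R.
        lin_map K (lhom R r s) (lhom S (fob \<alpha> r) (fob \<alpha> s)) (farr \<alpha> r s))"

text \<open>\<open>psi R r s\<close> is the map from \<open>C \<otimes> R(r,s)\<close> to \<open>R(r,s) \<otimes> C\<close>.\<close>

record 'u entw = "'u lincat" +
  psi :: "'u \<Rightarrow> 'u \<Rightarrow> 'u \<Rightarrow> 'u"

definition entwining :: "'u ring \<Rightarrow> 'u coalg \<Rightarrow> 'u entw \<Rightarrow> bool" where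
  "entwining K C R \<longleftrightarrow>
    (let H = lhom R; HC = (\<lambda>r s. tensor K (H r s) C); CC = tensor K C C;
         \<psi> = (\<lambda>r s c f. psi R r s (tens K C (H r s) c f)) in
     lin_category K R \<and>
     (\<forall>r \<in> lob R. \<forall>s \<in> lob R. lin_map K (tensor K C (H r s)) (HC r s) (psi R r s)) \<and>
     (\<forall>r \<in> lob R. \<forall>s \<in> lob R. \<forall>t \<in> lob R.
        \<forall>f \<in> carrier (H r s). \<forall>g \<in> carrier (H s t). \<forall>c \<in> carrier C.
          \<psi> r t c (lcmp R r s t g f)
          = tlift K (H s t) C (HC r t)
              (\<lambda>g' c'. tlift K (H r s) C (HC r t)
                 (\<lambda>f' c''. tens K (H r t) C (lcmp R r s t g' f') c'') (\<psi> r s c' f))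
              (\<psi> s t c g)) \<and>
     (\<forall>r \<in> lob R. \<forall>s \<in> lob R. \<forall>f \<in> carrier (H r s). \<forall>c \<in> carrier C.
        tlift K (H r s) C (H r s) (\<lambda>f' c'. counit C c' \<odot>\<^bsub>H r s\<^esub> f') (\<psi> r s c f)
        = counit C c \<odot>\<^bsub>H r s\<^esub> f) \<and>
     (\<forall>r \<in> lob R. \<forall>s \<in> lob R. \<forall>f \<in> carrier (H r s). \<forall>c \<in> carrier C.
        let T = tensor K (H r s) CC in
        tlift K (H r s) C T (\<lambda>f' c'. tens K (H r s) CC f' (comult C c')) (\<psi> r s c f)
        = tlift K C C T
            (\<lambda>c1 c2. tlift K (H r s) C T
               (\<lambda>f' c2'. tlift K (H r s) C T
                  (\<lambda>f'' c1'. tens K (H r s) CC f'' (tens K C C c1' c2')) (\<psi> r s c1 f'))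
               (\<psi> r s c2 f))
            (comult C c)) \<and>
     (\<forall>r \<in> lob R. \<forall>c \<in> carrier C. \<psi> r r c (lid R r) = tens K (H r r) C (lid R r) c))"

definition ent_maps ::
  "'u ring \<Rightarrow> 'u coalg \<Rightarrow> 'u entw \<Rightarrow> 'u entw \<Rightarrow> ('u, 'u, 'u, 'u) func set" where
  "ent_maps K C R S = {\<alpha>. lin_functor K R S \<alpha> \<and>
     fob \<alpha> \<in> extensional (lob R) \<and>
     farr \<alpha> = (\<lambda>r \<in> lob R. \<lambda>s \<in> lob R. \<lambda>f \<in> carrier (lhom R r s). farr \<alpha> r s f) \<and>
     (\<forall>r \<in> lob R. \<forall>s \<in> lob R. \<forall>f \<in> carrier (lhom R r s). \<forall>c \<in> carrier C.
        let H = lhom R r s; H' = lhom S (fob \<alpha> r) (fob \<alpha> s) in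
        tlift K H C (tensor K H' C) (\<lambda>f' c'. tens K H' C (farr \<alpha> r s f') c')
          (psi R r s (tens K C H c f))
        = psi S (fob \<alpha> r) (fob \<alpha> s) (tens K C H' c (farr \<alpha> r s f)))}"

definition ent_cat :: "'u ring \<Rightarrow> 'u coalg \<Rightarrow> ('u entw, ('u, 'u, 'u, 'u) func) cat" where
  "ent_cat K C = \<lparr>Ob = {R. entwining K C R}, Hom = ent_maps K C,
     ident = (\<lambda>R. \<lparr>fob = (\<lambda>r \<in> lob R. r),
       farr = (\<lambda>r \<in> lob R. \<lambda>s \<in> lob R. \<lambda>f \<in> carrier (lhom R r s). f)\<rparr>),
     cmp = (\<lambda>R S T \<beta> \<alpha>. \<lparr>fob = (\<lambda>r \<in> lob R. fob \<beta> (fob \<alpha> r)),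
       farr = (\<lambda>r \<in> lob R. \<lambda>s \<in> lob R. \<lambda>f \<in> carrier (lhom R r s).
                 farr \<beta> (fob \<alpha> r) (fob \<alpha> s) (farr \<alpha> r s f))\<rparr>)\<rparr>"

section \<open>Entwined modules\<close>

text \<open>\<open>em_act M r s m f\<close> is \<open>mf \<in> M(s)\<close> for \<open>m \<in> M(r)\<close> and \<open>f \<in> R(s,r)\<close>.\<close>

record 'u entmod =
  em_at :: "'u \<Rightarrow> 'u comod"
  em_act :: "'u \<Rightarrow> 'u \<Rightarrow> 'u \<Rightarrow> 'u \<Rightarrow> 'u"

definition right_module :: "'u ring \<Rightarrow> 'u entw \<Rightarrow> 'u entmod \<Rightarrow> bool" where
  "right_module K R M \<longleftrightarrow>
     (\<forall>r \<in> lob R. module K (em_at M r)) \<and>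
     (\<forall>r \<in> lob R. \<forall>s \<in> lob R.
        (\<forall>f \<in> carrier (lhom R s r). lin_map K (em_at M r) (em_at M s) (\<lambda>m. em_act M r s m f)) \<and>
        (\<forall>m \<in> carrier (em_at M r). lin_map K (lhom R s r) (em_at M s) (em_act M r s m))) \<and>
     (\<forall>r \<in> lob R. \<forall>m \<in> carrier (em_at M r). em_act M r r m (lid R r) = m) \<and>
     (\<forall>r \<in> lob R. \<forall>s \<in> lob R. \<forall>t \<in> lob R. \<forall>m \<in> carrier (em_at M r).
        \<forall>f \<in> carrier (lhom R s r). \<forall>g \<in> carrier (lhom R t s).
          em_act M r t m (lcmp R t s r f g) = em_act M s t (em_act M r s m f) g)"

definition entwined_module :: "'u ring \<Rightarrow> 'u coalg \<Rightarrow> 'u entw \<Rightarrow> 'u entmod \<Rightarrow> bool" where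
  "entwined_module K C R M \<longleftrightarrow> right_module K R M \<and>
     (\<forall>r \<in> lob R. comodule K C (em_at M r)) \<and>
     (\<forall>r \<in> lob R. \<forall>s \<in> lob R. \<forall>f \<in> carrier (lhom R s r). \<forall>m \<in> carrier (em_at M r).
        let MC = tensor K (em_at M s) C in
        coact (em_at M s) (em_act M r s m f)
        = tlift K (em_at M r) C MC
            (\<lambda>m0 m1. tlift K (lhom R s r) C MC
               (\<lambda>f' c'. tens K (em_at M s) C (em_act M r s m0 f') c')
               (psi R s r (tens K C (lhom R s r) m1 f)))
            (coact (em_at M r) m))"

definition entmod_maps ::
  "'u ring \<Rightarrow> 'u coalg \<Rightarrow> 'u entw \<Rightarrow> 'u entmod \<Rightarrow> 'u entmod \<Rightarrow> ('u \<Rightarrow> 'u \<Rightarrow> 'u) set" where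
  "entmod_maps K C R M N = {\<eta> \<in> \<Pi>\<^sub>E r \<in> lob R. comod_maps K C (em_at M r) (em_at N r).
     \<forall>r \<in> lob R. \<forall>s \<in> lob R. \<forall>m \<in> carrier (em_at M r). \<forall>f \<in> carrier (lhom R s r).
       \<eta> s (em_act M r s m f) = em_act N r s (\<eta> r m) f}"

definition entmod_cat ::
  "'u ring \<Rightarrow> 'u coalg \<Rightarrow> 'u entw \<Rightarrow> ('u entmod, 'u \<Rightarrow> 'u \<Rightarrow> 'u) cat" where
  "entmod_cat K C R = \<lparr>Ob = {M. entwined_module K C R M}, Hom = entmod_maps K C R,
     ident = (\<lambda>M. \<lambda>r \<in> lob R. \<lambda>m \<in> carrier (em_at M r). m),
     cmp = (\<lambda>L M N \<theta> \<eta>. \<lambda>r \<in> lob R. compose (carrier (em_at L r)) (\<theta> r) (\<eta> r))\<rparr>"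

definition tensor_H :: "'u ring \<Rightarrow> 'u coalg \<Rightarrow> 'u entw \<Rightarrow> 'u comod \<Rightarrow> 'u \<Rightarrow> 'u entmod" where
  "tensor_H K C R V r =
    (let H = (\<lambda>r'. lhom R r' r); VH = (\<lambda>r'. tensor K V (H r')) in
     \<lparr>em_at = (\<lambda>r'. module.extend (VH r') (comod.fields
        (tlift K V (H r') (tensor K (VH r') C)
          (\<lambda>v g. tlift K V C (tensor K (VH r') C)
             (\<lambda>v0 v1. tlift K (H r') C (tensor K (VH r') C)
                (\<lambda>g' c'. tens K (VH r') C (tens K V (H r') v0 g') c')
                (psi R r' r (tens K C (H r') v1 g)))
             (coact V v))))),
      em_act = (\<lambda>r' s t f.
        tlift K V (H r') (VH s) (\<lambda>v g. tens K V (H s) v (lcmp R s r' r g f)) t)\<rparr>)"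

definition zero_entmod :: "'u ring \<Rightarrow> 'u coalg \<Rightarrow> 'u entmod" where
  "zero_entmod K C =
    (let Z = \<lparr>carrier = {undefined}, monoid.mult = undefined, monoid.one = undefined,
              ring.zero = undefined,
              ring.add = (\<lambda>_ _. undefined), smult = (\<lambda>_ _. undefined)\<rparr> in
     \<lparr>em_at = (\<lambda>r. module.extend Z (comod.fields (\<lambda>_. \<zero>\<^bsub>tensor K Z C\<^esub>))),
      em_act = (\<lambda>_ _ _ _. undefined)\<rparr>)"

section \<open>Restriction and induction of entwined modules\<close>

definition restr_mod :: "('u, 'u, 'u, 'u) func \<Rightarrow> 'u entmod \<Rightarrow> 'u entmod" where
  "restr_mod \<alpha> N = \<lparr>em_at = (\<lambda>r. em_at N (fob \<alpha> r)),
     em_act = (\<lambda>r s m f. em_act N (fob \<alpha> r) (fob \<alpha> s) m (farr \<alpha> s r f))\<rparr>"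

definition restr_map ::
  "'u entw \<Rightarrow> ('u, 'u, 'u, 'u) func \<Rightarrow> ('u \<Rightarrow> 'u \<Rightarrow> 'u) \<Rightarrow> ('u \<Rightarrow> 'u \<Rightarrow> 'u)" where
  "restr_map R \<alpha> \<eta> = (\<lambda>r \<in> lob R. \<eta> (fob \<alpha> r))"

context
  fixes K :: "'u ring" and C :: "'u coalg" and R S :: "'u entw"
    and \<alpha> :: "('u, 'u, 'u, 'u) func" and M :: "'u entmod"
begin

definition ind_sum :: "'u \<Rightarrow> ('u, 'u \<Rightarrow> 'u) module" where
  "ind_sum s = dsum (lob R) (\<lambda>r. tensor K (em_at M r) (lhom S s (fob \<alpha> r)))"

definition ind_elt :: "'u \<Rightarrow> 'u \<Rightarrow> 'u \<Rightarrow> 'u \<Rightarrow> 'u \<Rightarrow> 'u" where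
  "ind_elt s r m f = dinj (lob R) (\<lambda>r. tensor K (em_at M r) (lhom S s (fob \<alpha> r))) r
     (tens K (em_at M r) (lhom S s (fob \<alpha> r)) m f)"

definition ind_rel :: "'u \<Rightarrow> ('u \<Rightarrow> 'u) set" where
  "ind_rel s = mspan K (ind_sum s)
     {ind_elt s r' m' (lcmp S s (fob \<alpha> r) (fob \<alpha> r') (farr \<alpha> r r' g) f)
        \<ominus>\<^bsub>ind_sum s\<^esub> ind_elt s r (em_act M r' r m' g) f |
      r r' m' g f. r \<in> lob R \<and> r' \<in> lob R \<and> m' \<in> carrier (em_at M r') \<and>
        g \<in> carrier (lhom R r r') \<and> f \<in> carrier (lhom S s (fob \<alpha> r))}"

definition ind_space :: "'u \<Rightarrow> ('u, 'u) module" where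
  "ind_space s = small_copy (mquot (ind_sum s) (ind_rel s))"

definition ind_gen :: "'u \<Rightarrow> 'u \<Rightarrow> 'u \<Rightarrow> 'u \<Rightarrow> 'u" where
  "ind_gen s r m f = small_enc (carrier (mquot (ind_sum s) (ind_rel s)))
     (ind_rel s +>\<^bsub>ind_sum s\<^esub> ind_elt s r m f)"

text \<open>The linear map that sends the class of each \<open>m \<otimes> f\<close> to \<open>\<beta> r m f\<close>.\<close>

definition ind_lift ::
  "'u \<Rightarrow> ('u, 'b, 'z) module_scheme \<Rightarrow> ('u \<Rightarrow> 'u \<Rightarrow> 'u \<Rightarrow> 'b) \<Rightarrow> 'u \<Rightarrow> 'b" where
  "ind_lift s U \<beta> = (THE h. h \<in> Lin K (ind_space s) U \<and>
     (\<forall>r \<in> lob R. \<forall>m \<in> carrier (em_at M r). \<forall>f \<in> carrier (lhom S s (fob \<alpha> r)).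
        h (ind_gen s r m f) = \<beta> r m f))"

definition ind_mod :: "'u entmod" where
  "ind_mod = \<lparr>em_at = (\<lambda>s. module.extend (ind_space s) (comod.fields
       (ind_lift s (tensor K (ind_space s) C)
         (\<lambda>r m f. tlift K (em_at M r) C (tensor K (ind_space s) C)
            (\<lambda>m0 m1. tlift K (lhom S s (fob \<alpha> r)) C (tensor K (ind_space s) C)
               (\<lambda>f' c'. tens K (ind_space s) C (ind_gen s r m0 f') c')
               (psi S s (fob \<alpha> r) (tens K C (lhom S s (fob \<alpha> r)) m1 f)))
            (coact (em_at M r) m))))),
     em_act = (\<lambda>s s' t h.
       ind_lift s (ind_space s') (\<lambda>r m f. ind_gen s' r m (lcmp S s' s (fob \<alpha> r) f h)) t)\<rparr>"

end

definition ind_map ::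
  "'u ring \<Rightarrow> 'u entw \<Rightarrow> 'u entw \<Rightarrow> ('u, 'u, 'u, 'u) func \<Rightarrow> 'u entmod \<Rightarrow> 'u entmod
    \<Rightarrow> ('u \<Rightarrow> 'u \<Rightarrow> 'u) \<Rightarrow> ('u \<Rightarrow> 'u \<Rightarrow> 'u)" where
  "ind_map K R S \<alpha> M N \<eta> = (\<lambda>s \<in> lob S.
     ind_lift K R S \<alpha> M s (ind_space K R S \<alpha> N s) (\<lambda>r m f. ind_gen K R S \<alpha> N s r (\<eta> r m) f))"

section \<open>Modules over an entwined representation\<close>

type_synonym ('x, 'u) rep = "('x, unit, 'u entw, ('u, 'u, 'u, 'u) func) func"

definition ent_representation :: "'u ring \<Rightarrow> 'u coalg \<Rightarrow> ('x::order, 'u) rep \<Rightarrow> bool" where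
  "ent_representation K C \<R> \<longleftrightarrow> cat_functor poset_cat (ent_cat K C) \<R>"

record ('x, 'u) repmod =
  rm_at :: "'x \<Rightarrow> 'u entmod"
  rm_map :: "'x \<Rightarrow> 'x \<Rightarrow> 'u \<Rightarrow> 'u \<Rightarrow> 'u"

definition rep_module ::
  "'u ring \<Rightarrow> 'u coalg \<Rightarrow> ('x::order, 'u) rep \<Rightarrow> ('x, 'u) repmod \<Rightarrow> bool" where
  "rep_module K C \<R> M \<longleftrightarrow>
     (\<forall>x. entwined_module K C (fob \<R> x) (rm_at M x)) \<and>
     (\<forall>x y. x \<le> y \<longrightarrow> rm_map M x y
        \<in> entmod_maps K C (fob \<R> x) (rm_at M x) (restr_mod (farr \<R> x y ()) (rm_at M y))) \<and>
     (\<forall>x. rm_map M x x = ident (entmod_cat K C (fob \<R> x)) (rm_at M x)) \<and>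
     (\<forall>x y z. x \<le> y \<and> y \<le> z \<longrightarrow>
        rm_map M x z
        = cmp (entmod_cat K C (fob \<R> x)) (rm_at M x)
            (restr_mod (farr \<R> x y ()) (rm_at M y)) (restr_mod (farr \<R> x z ()) (rm_at M z))
            (restr_map (fob \<R> x) (farr \<R> x y ()) (rm_map M y z)) (rm_map M x y))"

definition rep_module_maps ::
  "'u ring \<Rightarrow> 'u coalg \<Rightarrow> ('x::order, 'u) rep \<Rightarrow> ('x, 'u) repmod \<Rightarrow> ('x, 'u) repmod
    \<Rightarrow> ('x \<Rightarrow> 'u \<Rightarrow> 'u \<Rightarrow> 'u) set" where
  "rep_module_maps K C \<R> M N = {\<eta>.
     (\<forall>x. \<eta> x \<in> entmod_maps K C (fob \<R> x) (rm_at M x) (rm_at N x)) \<and>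
     (\<forall>x y. x \<le> y \<longrightarrow>
        cmp (entmod_cat K C (fob \<R> x)) (rm_at M x) (rm_at N x)
          (restr_mod (farr \<R> x y ()) (rm_at N y)) (rm_map N x y) (\<eta> x)
        = cmp (entmod_cat K C (fob \<R> x)) (rm_at M x)
          (restr_mod (farr \<R> x y ()) (rm_at M y)) (restr_mod (farr \<R> x y ()) (rm_at N y))
          (restr_map (fob \<R> x) (farr \<R> x y ()) (\<eta> y)) (rm_map M x y))}"

definition rep_module_cat ::
  "'u ring \<Rightarrow> 'u coalg \<Rightarrow> ('x::order, 'u) rep
    \<Rightarrow> (('x, 'u) repmod, 'x \<Rightarrow> 'u \<Rightarrow> 'u \<Rightarrow> 'u) cat" where
  "rep_module_cat K C \<R> = \<lparr>Ob = {M. rep_module K C \<R> M}, Hom = rep_module_maps K C \<R>,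
     ident = (\<lambda>M x. ident (entmod_cat K C (fob \<R> x)) (rm_at M x)),
     cmp = (\<lambda>L M N \<theta> \<eta> x.
       cmp (entmod_cat K C (fob \<R> x)) (rm_at L x) (rm_at M x) (rm_at N x) (\<theta> x) (\<eta> x))\<rparr>"

definition ev_functor ::
  "'x \<Rightarrow> (('x, 'u) repmod, 'x \<Rightarrow> 'u \<Rightarrow> 'u \<Rightarrow> 'u, 'u entmod, 'u \<Rightarrow> 'u \<Rightarrow> 'u) func" where
  "ev_functor x = \<lparr>fob = (\<lambda>M. rm_at M x), farr = (\<lambda>M N \<eta>. \<eta> x)\<rparr>"

text \<open>For \<open>\<beta> : y \<rightarrow> z\<close>, the canonical identification of \<open>\<beta>\<^sup>*\<alpha>\<^sup>*M\<close> with \<open>(\<beta>\<alpha>)\<^sup>*M\<close> sends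
  \<open>(m \<otimes> f) \<otimes> g\<close> to \<open>m \<otimes> \<beta>(f)g\<close>; composed with the unit \<open>t \<mapsto> t \<otimes> id\<close> of the adjunction
  it becomes the map \<open>m \<otimes> f \<mapsto> m \<otimes> \<beta>(f)\<close> from \<open>\<alpha>\<^sup>*M\<close> to the restriction of \<open>(\<beta>\<alpha>)\<^sup>*M\<close>
  along \<open>\<beta>\<close>.\<close>

definition ex_obj ::
  "'u ring \<Rightarrow> 'u coalg \<Rightarrow> ('x::order, 'u) rep \<Rightarrow> 'x \<Rightarrow> 'u entmod \<Rightarrow> ('x, 'u) repmod" where
  "ex_obj K C \<R> x M =
    \<lparr>rm_at = (\<lambda>y. if x \<le> y then ind_mod K C (fob \<R> x) (fob \<R> y) (farr \<R> x y ()) M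
                  else zero_entmod K C),
     rm_map = (\<lambda>y z. let \<beta> = farr \<R> y z () in
       (\<lambda>s \<in> lob (fob \<R> y).
         if x \<le> y then
           ind_lift K (fob \<R> x) (fob \<R> y) (farr \<R> x y ()) M s
             (ind_space K (fob \<R> x) (fob \<R> z) (farr \<R> x z ()) M (fob \<beta> s))
             (\<lambda>r m f. ind_gen K (fob \<R> x) (fob \<R> z) (farr \<R> x z ()) M (fob \<beta> s) r m
                (farr \<beta> s (fob (farr \<R> x y ()) r) f))
         else
           (\<lambda>t \<in> carrier (em_at (zero_entmod K C) s).
              if x \<le> z
              then \<zero>\<^bsub>ind_space K (fob \<R> x) (fob \<R> z) (farr \<R> x z ()) M (fob \<beta> s)\<^esub>
              else \<zero>\<^bsub>em_at (zero_entmod K C) (fob \<beta> s)\<^esub>)))\<rparr>"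

definition ex_functor ::
  "'u ring \<Rightarrow> 'u coalg \<Rightarrow> ('x::order, 'u) rep \<Rightarrow> 'x
    \<Rightarrow> ('u entmod, 'u \<Rightarrow> 'u \<Rightarrow> 'u, ('x, 'u) repmod, 'x \<Rightarrow> 'u \<Rightarrow> 'u \<Rightarrow> 'u) func" where
  "ex_functor K C \<R> x =
    \<lparr>fob = ex_obj K C \<R> x,
     farr = (\<lambda>M N \<eta> y.
       if x \<le> y then ind_map K (fob \<R> x) (fob \<R> y) (farr \<R> x y ()) M N \<eta>
       else ident (entmod_cat K C (fob \<R> y)) (zero_entmod K C))\<rparr>"

end

theory Submission
  imports Defs
begin

text \<open>
  Induction along \<open>\<alpha>\<close> has a universal property: a morphism out of \<open>\<alpha>\<^sup>*M\<close> is the same as a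
  morphism out of \<open>M\<close>, given by its values on the units \<open>m \<otimes> id\<close>.  Since the structure maps of
  \<open>ex\<^sub>x M\<close> carry units to units, a morphism \<open>ex\<^sub>x M \<rightarrow> N\<close> is determined by its values on the
  units at \<open>x\<close>, and these may be prescribed by any morphism \<open>M \<rightarrow> N\<^sub>x\<close>; this is the adjunction.

  Combined with \<open>Hom(V \<otimes> H\<^sub>r, L) = Hom\<^sup>C(V, L(r))\<close> it identifies \<open>Hom(ex\<^sub>x(V \<otimes> H\<^sub>r), N)\<close> with
  \<open>Hom\<^sup>C(V, N\<^sub>x(r))\<close>.  Epimorphisms are pointwise surjective, because they have a pointwise
  cokernel, so \<open>ex\<^sub>x(V \<otimes> H\<^sub>r)\<close> is projective if \<open>V\<close> is.  For generation it remains to see that the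
  finite dimensional projective comodules generate.  A projective comodule \<open>P\<close> is a retract of a
  direct sum of finite dimensional subcomodules; hence each \<open>p \<in> P\<close> is fixed by a colinear
  endomorphism \<open>\<phi>\<close> of \<open>P\<close> of finite rank.  By Fitting's argument some power of \<open>\<phi>\<close> is bijective on
  its image, and this image is a finite dimensional retract of \<open>P\<close> containing \<open>p\<close>.

  Computations in Sweedler's notation become nested applications of \<open>tlift\<close>, which obeys the laws
  of a monadic bind; coactions are compared on generators \<open>b v g\<close> for twisted bilinear maps \<open>b\<close>.
\<close>

section \<open>Linear maps and spans\<close>

text \<open>A tensor product is an opaque quotient copied into \<open>'u\<close>, so elements are
  never inspected: maps out of it are compared on pure tensors, and every use of
  \<open>tlift\<close> demands a bilinear integrand. Hence the syntax-directed linearity rules, and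
  hence the elementwise form of the comodule axioms, of colinearity and of compatibility, which are
  then checked on generators.

  That K is a field enters through complements. A linear retraction onto a subspace, supplied by
  Zorn's lemma, is in general not colinear, but tensored with C it still splits the tensored
  inclusion; this is how a stable subspace inherits a coaction and its axioms.

  Semiperfectness provides projective comodules of possibly infinite dimension. An endomorphism of
  finite rank gives the powers finite dimensional images, and an image with the smallest possible
  spanning set must be stable.

  Epimorphisms are defined by cancellation, so surjectivity requires a test object inside the
  category: the pointwise cokernels have to be assembled into a module over the representation.

  In a poset there is at most one arrow from x to y, so the extension has at y a single induced
  module or zero.\<close>

locale universe = field K for K :: "'u ring" (structure) +
  assumes infinite_universe: "infinite (UNIV :: 'u set)"
begin

text \<open>Unlike \<open>lin_map\<close>, this predicate records that source and target are
  modules, so a single fact about a map supplies all side conditions needed to compute with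
  it.\<close>

definition klin :: "('u, 'a, 'y) module_scheme \<Rightarrow> ('u, 'b, 'z) module_scheme \<Rightarrow> ('a \<Rightarrow> 'b) \<Rightarrow> bool"
  where "klin V W f \<longleftrightarrow> module K V \<and> module K W \<and> lin_map K V W f"

lemma mod_simps [simp]:
  assumes "module K V"
  shows "\<zero>\<^bsub>V\<^esub> \<in> carrier V"
    and "x \<in> carrier V \<Longrightarrow> y \<in> carrier V \<Longrightarrow> x \<oplus>\<^bsub>V\<^esub> y \<in> carrier V"
    and "x \<in> carrier V \<Longrightarrow> \<ominus>\<^bsub>V\<^esub> x \<in> carrier V"
    and "x \<in> carrier V \<Longrightarrow> y \<in> carrier V \<Longrightarrow> x \<ominus>\<^bsub>V\<^esub> y \<in> carrier V"
    and "a \<in> carrier K \<Longrightarrow> x \<in> carrier V \<Longrightarrow> a \<odot>\<^bsub>V\<^esub> x \<in> carrier V"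
    and "x \<in> carrier V \<Longrightarrow> \<zero>\<^bsub>V\<^esub> \<oplus>\<^bsub>V\<^esub> x = x"
    and "x \<in> carrier V \<Longrightarrow> x \<oplus>\<^bsub>V\<^esub> \<zero>\<^bsub>V\<^esub> = x"
    and "x \<in> carrier V \<Longrightarrow> \<one> \<odot>\<^bsub>V\<^esub> x = x"
    and "x \<in> carrier V \<Longrightarrow> \<zero> \<odot>\<^bsub>V\<^esub> x = \<zero>\<^bsub>V\<^esub>"
    and "a \<in> carrier K \<Longrightarrow> a \<odot>\<^bsub>V\<^esub> \<zero>\<^bsub>V\<^esub> = \<zero>\<^bsub>V\<^esub>"
    and "x \<in> carrier V \<Longrightarrow> x \<ominus>\<^bsub>V\<^esub> x = \<zero>\<^bsub>V\<^esub>"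
    and "x \<in> carrier V \<Longrightarrow> y \<in> carrier V \<Longrightarrow> (x \<oplus>\<^bsub>V\<^esub> y) \<ominus>\<^bsub>V\<^esub> y = x"
    and "x \<in> carrier V \<Longrightarrow> y \<in> carrier V \<Longrightarrow> (x \<ominus>\<^bsub>V\<^esub> y) \<oplus>\<^bsub>V\<^esub> y = x"
    and "x \<in> carrier V \<Longrightarrow> x \<ominus>\<^bsub>V\<^esub> \<zero>\<^bsub>V\<^esub> = x"
proof -
  interpret V: module K V by fact
  show "\<zero>\<^bsub>V\<^esub> \<in> carrier V" "x \<in> carrier V \<Longrightarrow> y \<in> carrier V \<Longrightarrow> x \<oplus>\<^bsub>V\<^esub> y \<in> carrier V"
    "x \<in> carrier V \<Longrightarrow> \<ominus>\<^bsub>V\<^esub> x \<in> carrier V"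
    "a \<in> carrier K \<Longrightarrow> x \<in> carrier V \<Longrightarrow> a \<odot>\<^bsub>V\<^esub> x \<in> carrier V"
    "x \<in> carrier V \<Longrightarrow> \<zero>\<^bsub>V\<^esub> \<oplus>\<^bsub>V\<^esub> x = x"
    "x \<in> carrier V \<Longrightarrow> x \<oplus>\<^bsub>V\<^esub> \<zero>\<^bsub>V\<^esub> = x"
    "x \<in> carrier V \<Longrightarrow> \<one> \<odot>\<^bsub>V\<^esub> x = x" "x \<in> carrier V \<Longrightarrow> \<zero> \<odot>\<^bsub>V\<^esub> x = \<zero>\<^bsub>V\<^esub>"
    "a \<in> carrier K \<Longrightarrow> a \<odot>\<^bsub>V\<^esub> \<zero>\<^bsub>V\<^esub> = \<zero>\<^bsub>V\<^esub>"
    "x \<in> carrier V \<Longrightarrow> y \<in> carrier V \<Longrightarrow> x \<ominus>\<^bsub>V\<^esub> y \<in> carrier V"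
    "x \<in> carrier V \<Longrightarrow> x \<ominus>\<^bsub>V\<^esub> x = \<zero>\<^bsub>V\<^esub>"
    "x \<in> carrier V \<Longrightarrow> y \<in> carrier V \<Longrightarrow> (x \<oplus>\<^bsub>V\<^esub> y) \<ominus>\<^bsub>V\<^esub> y = x"
    "x \<in> carrier V \<Longrightarrow> y \<in> carrier V \<Longrightarrow> (x \<ominus>\<^bsub>V\<^esub> y) \<oplus>\<^bsub>V\<^esub> y = x"
    "x \<in> carrier V \<Longrightarrow> x \<ominus>\<^bsub>V\<^esub> \<zero>\<^bsub>V\<^esub> = x"
    by (auto simp: a_minus_def V.M.a_assoc V.M.r_neg V.M.l_neg)
qed

text \<open>Negation is a scalar multiple, so closure under scalars takes care of it in
  \<open>submodI\<close> and \<open>klinD\<close>.\<close>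

lemma minus_eq_smult:
  assumes "module K V" "x \<in> carrier V"
  shows "\<ominus>\<^bsub>V\<^esub> x = (\<ominus> \<one>) \<odot>\<^bsub>V\<^esub> x"
  using module.smult_l_minus[OF assms(1), of \<one> x] assms by simp

lemma minus_zero_imp_eq:
  assumes "module K V" "x \<in> carrier V" "y \<in> carrier V" "x \<ominus>\<^bsub>V\<^esub> y = \<zero>\<^bsub>V\<^esub>"
  shows "x = y"
  by (metis assms mod_simps(13) mod_simps(6))

lemma klinI:
  assumes "module K V" "module K W"
    and "\<And>x. x \<in> carrier V \<Longrightarrow> f x \<in> carrier W"
    and "\<And>x y. x \<in> carrier V \<Longrightarrow> y \<in> carrier V \<Longrightarrow> f (x \<oplus>\<^bsub>V\<^esub> y) = f x \<oplus>\<^bsub>W\<^esub> f y"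
    and "\<And>a x. a \<in> carrier K \<Longrightarrow> x \<in> carrier V \<Longrightarrow> f (a \<odot>\<^bsub>V\<^esub> x) = a \<odot>\<^bsub>W\<^esub> f x"
  shows "klin V W f"
  using assms by (auto simp: klin_def lin_map_def)

lemma klinD:
  assumes "klin V W f"
  shows "module K V" "module K W"
    and "x \<in> carrier V \<Longrightarrow> f x \<in> carrier W"
    and "x \<in> carrier V \<Longrightarrow> y \<in> carrier V \<Longrightarrow> f (x \<oplus>\<^bsub>V\<^esub> y) = f x \<oplus>\<^bsub>W\<^esub> f y"
    and "a \<in> carrier K \<Longrightarrow> x \<in> carrier V \<Longrightarrow> f (a \<odot>\<^bsub>V\<^esub> x) = a \<odot>\<^bsub>W\<^esub> f x"
    and "f \<zero>\<^bsub>V\<^esub> = \<zero>\<^bsub>W\<^esub>"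
    and "x \<in> carrier V \<Longrightarrow> f (\<ominus>\<^bsub>V\<^esub> x) = \<ominus>\<^bsub>W\<^esub> f x"
    and "x \<in> carrier V \<Longrightarrow> y \<in> carrier V \<Longrightarrow> f (x \<ominus>\<^bsub>V\<^esub> y) = f x \<ominus>\<^bsub>W\<^esub> f y"
proof -
  note d = assms[unfolded klin_def lin_map_def Pi_def]
  show V: "module K V" and W: "module K W" using d by auto
  show cl: "f x \<in> carrier W" if "x \<in> carrier V" for x using that d by auto
  show add: "f (x \<oplus>\<^bsub>V\<^esub> y) = f x \<oplus>\<^bsub>W\<^esub> f y" if "x \<in> carrier V" "y \<in> carrier V" for x y
    using d that by auto
  show sm: "f (a \<odot>\<^bsub>V\<^esub> x) = a \<odot>\<^bsub>W\<^esub> f x" if "a \<in> carrier K" "x \<in> carrier V" for a x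
    using d that by auto
  show "f \<zero>\<^bsub>V\<^esub> = \<zero>\<^bsub>W\<^esub>"
    using sm[of \<zero> "\<zero>\<^bsub>V\<^esub>"] V W cl[of "\<zero>\<^bsub>V\<^esub>"] by simp
  show ng: "f (\<ominus>\<^bsub>V\<^esub> x) = \<ominus>\<^bsub>W\<^esub> f x" if "x \<in> carrier V" for x
    using sm[of "\<ominus> \<one>" x] V W cl[of x] that by (simp add: minus_eq_smult)
  show "f (x \<ominus>\<^bsub>V\<^esub> y) = f x \<ominus>\<^bsub>W\<^esub> f y" if "x \<in> carrier V" "y \<in> carrier V" for x y
    using add[of x "\<ominus>\<^bsub>V\<^esub> y"] ng[of y] V that by (simp add: a_minus_def)
qed

lemma klin_cong:
  assumes "klin V W f" "\<And>x. x \<in> carrier V \<Longrightarrow> f x = g x"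
  shows "klin V W g"
  by (rule klinI) (use klinD[OF assms(1)] in \<open>simp_all add: assms(2)[symmetric]\<close>)

lemma klin_restrict [simp]: "klin V W (restrict f (carrier V)) \<longleftrightarrow> klin V W f"
  by (auto intro: klin_cong)

lemma Lin_iff: "module K V \<Longrightarrow> module K W \<Longrightarrow> f \<in> Lin K V W \<longleftrightarrow> klin V W f \<and> f \<in> extensional (carrier V)"
  by (auto simp: Lin_def klin_def)

lemma klin_id: "module K V \<Longrightarrow> klin V V (\<lambda>x. x)"
  by (rule klinI) auto

lemma klin_zero: "module K V \<Longrightarrow> module K W \<Longrightarrow> klin V W (\<lambda>x. \<zero>\<^bsub>W\<^esub>)"
  by (rule klinI) auto

lemma klin_comp: "klin U V f \<Longrightarrow> klin V W h \<Longrightarrow> klin U W (\<lambda>x. h (f x))"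
  by (rule klinI) (auto simp: klinD)

lemma klin_add:
  assumes "klin V W f" "klin V W g"
  shows "klin V W (\<lambda>x. f x \<oplus>\<^bsub>W\<^esub> g x)"
proof -
  interpret W: module K W using assms(1) klinD by blast
  show ?thesis
    by (rule klinI) (use assms in \<open>auto simp: klinD W.M.a_ac W.smult_r_distr\<close>)
qed

lemma klin_smult:
  assumes "klin V W f" "a \<in> carrier K"
  shows "klin V W (\<lambda>x. a \<odot>\<^bsub>W\<^esub> f x)"
proof -
  interpret W: module K W using assms(1) klinD by blast
  show ?thesis
    by (rule klinI)
      (use assms in \<open>auto simp: klinD W.smult_r_distr W.smult_assoc1[symmetric] m_comm\<close>)
qed

lemma klin_smult_left:
  assumes "klin V (self_mod K) f" "module K W" "w \<in> carrier W"
  shows "klin V W (\<lambda>x. f x \<odot>\<^bsub>W\<^esub> w)"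
proof -
  interpret W: module K W by fact
  show ?thesis
    by (rule klinI) (use assms klinD[OF assms(1)] in
      \<open>auto simp: self_mod_def W.smult_l_distr W.smult_assoc1\<close>)
qed

lemma self_mod_simps [simp]:
  "carrier (self_mod K) = carrier K" "\<zero>\<^bsub>self_mod K\<^esub> = \<zero>" "x \<oplus>\<^bsub>self_mod K\<^esub> y = x \<oplus> y"
  "a \<odot>\<^bsub>self_mod K\<^esub> x = a \<otimes> x"
  by (auto simp: self_mod_def)

lemma self_mod_module: "module K (self_mod K)"
proof (intro moduleI)
  show "abelian_group (self_mod K)"
  proof (rule abelian_groupI)
    show "\<exists>y\<in>carrier (self_mod K). y \<oplus>\<^bsub>self_mod K\<^esub> x = \<zero>\<^bsub>self_mod K\<^esub>"
      if "x \<in> carrier (self_mod K)" for x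
      using that by (intro bexI[of _ "\<ominus> x"]) (auto simp: l_neg)
  qed (auto simp: a_ac)
qed (auto simp: is_cring l_distr r_distr m_assoc)

section \<open>Subspaces, spans and generating sets\<close>

lemma submodI:
  assumes "module K M" "N \<subseteq> carrier M" "\<zero>\<^bsub>M\<^esub> \<in> N"
    and "\<And>x y. x \<in> N \<Longrightarrow> y \<in> N \<Longrightarrow> x \<oplus>\<^bsub>M\<^esub> y \<in> N"
    and "\<And>a x. a \<in> carrier K \<Longrightarrow> x \<in> N \<Longrightarrow> a \<odot>\<^bsub>M\<^esub> x \<in> N"
  shows "submodule N K M"
  by (rule module.submoduleI[OF assms(1)])
    (use assms minus_eq_smult[OF assms(1)] in auto)

lemma submodD:
  assumes "module K M" "submodule N K M"
  shows "x \<in> N \<Longrightarrow> x \<in> carrier M" "N \<subseteq> carrier M" "\<zero>\<^bsub>M\<^esub> \<in> N"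
    and "x \<in> N \<Longrightarrow> y \<in> N \<Longrightarrow> x \<oplus>\<^bsub>M\<^esub> y \<in> N"
    and "x \<in> N \<Longrightarrow> y \<in> N \<Longrightarrow> x \<ominus>\<^bsub>M\<^esub> y \<in> N"
    and "a \<in> carrier K \<Longrightarrow> x \<in> N \<Longrightarrow> a \<odot>\<^bsub>M\<^esub> x \<in> N"
proof -
  note e = module.submoduleE[OF assms]
  show "x \<in> N \<Longrightarrow> x \<in> carrier M" "N \<subseteq> carrier M"
    "x \<in> N \<Longrightarrow> y \<in> N \<Longrightarrow> x \<oplus>\<^bsub>M\<^esub> y \<in> N" "x \<in> N \<Longrightarrow> y \<in> N \<Longrightarrow> x \<ominus>\<^bsub>M\<^esub> y \<in> N"
    "a \<in> carrier K \<Longrightarrow> x \<in> N \<Longrightarrow> a \<odot>\<^bsub>M\<^esub> x \<in> N"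
    using e by (auto simp: a_minus_def)
  obtain y where "y \<in> N" using e(2) by auto
  then show "\<zero>\<^bsub>M\<^esub> \<in> N" using e(1) e(4)[of \<zero> y] assms(1) by auto
qed

lemma submod_whole: "module K M \<Longrightarrow> submodule (carrier M) K M"
  by (rule submodI) auto

lemma submod_zero: "module K M \<Longrightarrow> submodule {\<zero>\<^bsub>M\<^esub>} K M"
  by (rule submodI) auto

lemma submod_eq:
  assumes "klin V W f" "klin V W g"
  shows "submodule {x \<in> carrier V. f x = g x} K V"
  by (rule submodI) (use assms in \<open>auto simp: klinD\<close>)

lemma submod_vimage:
  assumes "klin V W f" "submodule N K W"
  shows "submodule {x \<in> carrier V. f x \<in> N} K V"
  by (rule submodI) (use assms submodD[OF _ assms(2)] in \<open>auto simp: klinD\<close>)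

lemma submod_image:
  assumes "klin V W f" "submodule N K V"
  shows "submodule (f ` N) K W"
proof (rule submodI)
  note n = submodD[OF klinD(1)[OF assms(1)] assms(2)]
  show "module K W" "f ` N \<subseteq> carrier W" using klinD[OF assms(1)] n by auto
  show "\<zero>\<^bsub>W\<^esub> \<in> f ` N" using klinD(6)[OF assms(1)] n by force
  show "x \<oplus>\<^bsub>W\<^esub> y \<in> f ` N" if "x \<in> f ` N" "y \<in> f ` N" for x y
    using that klinD(4)[OF assms(1)] n by (auto simp flip: klinD(4)[OF assms(1)])
  show "a \<odot>\<^bsub>W\<^esub> x \<in> f ` N" if "a \<in> carrier K" "x \<in> f ` N" for a x
    using that n by (auto simp flip: klinD(5)[OF assms(1)])
qed

lemma mspan_sub:
  assumes "module K M" "S \<subseteq> carrier M"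
  shows "submodule (mspan K M S) K M"
proof (rule submodI)
  note d = submodD[OF assms(1)]
  show "mspan K M S \<subseteq> carrier M"
    using submod_whole[OF assms(1)] assms(2) by (auto simp: mspan_def)
qed (auto simp: mspan_def assms(1) submodD)

lemma mspan_incl: "x \<in> S \<Longrightarrow> x \<in> mspan K M S"
  by (auto simp: mspan_def)

lemma mspan_least: "x \<in> mspan K M S \<Longrightarrow> submodule N K M \<Longrightarrow> S \<subseteq> N \<Longrightarrow> x \<in> N"
  by (auto simp: mspan_def)

lemma mspan_mono: "S \<subseteq> S' \<Longrightarrow> mspan K M S \<subseteq> mspan K M S'"
  by (auto simp: mspan_def)

lemma mspan_carrier: "module K M \<Longrightarrow> S \<subseteq> carrier M \<Longrightarrow> x \<in> mspan K M S \<Longrightarrow> x \<in> carrier M"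
  by (rule submodD(1)[OF _ mspan_sub])

text \<open>The elements m + a c already form a subspace containing \<open>insert c S\<close>. This
  one-step description of a span stands in for coordinates in \<open>retraction\<close> and
  \<open>exchange\<close>.\<close>

lemma mspan_insertE:
  assumes M: "module K M" and S: "S \<subseteq> carrier M" and c: "c \<in> carrier M"
    and x: "x \<in> mspan K M (insert c S)"
  obtains m a where "m \<in> mspan K M S" "a \<in> carrier K" "x = m \<oplus>\<^bsub>M\<^esub> a \<odot>\<^bsub>M\<^esub> c"
proof -
  interpret M: module K M by fact
  note s = submodD[OF M mspan_sub[OF M S]]
  let ?N = "{m \<oplus>\<^bsub>M\<^esub> a \<odot>\<^bsub>M\<^esub> c | m a. m \<in> mspan K M S \<and> a \<in> carrier K}"
  have "x \<in> ?N"
  proof (rule mspan_least[OF x])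
    show "submodule ?N K M"
    proof (rule submodI[OF M])
      show "?N \<subseteq> carrier M" using s c by auto
      show "\<zero>\<^bsub>M\<^esub> \<in> ?N" using s(3) c M by (intro CollectI exI[of _ "\<zero>\<^bsub>M\<^esub>"] exI[of _ \<zero>]) auto
      show "u \<oplus>\<^bsub>M\<^esub> v \<in> ?N" if u: "u \<in> ?N" and v: "v \<in> ?N" for u v
      proof -
        obtain m a where m: "u = m \<oplus>\<^bsub>M\<^esub> a \<odot>\<^bsub>M\<^esub> c" "m \<in> mspan K M S" "a \<in> carrier K"
          using u by auto
        obtain n b where n: "v = n \<oplus>\<^bsub>M\<^esub> b \<odot>\<^bsub>M\<^esub> c" "n \<in> mspan K M S" "b \<in> carrier K"
          using v by auto
        have "u \<oplus>\<^bsub>M\<^esub> v = (m \<oplus>\<^bsub>M\<^esub> n) \<oplus>\<^bsub>M\<^esub> (a \<oplus> b) \<odot>\<^bsub>M\<^esub> c"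
          using m n s(1) c by (simp add: M.M.a_ac M.smult_l_distr)
        then show ?thesis using m n s(4) by auto
      qed
      show "b \<odot>\<^bsub>M\<^esub> v \<in> ?N" if b: "b \<in> carrier K" and v: "v \<in> ?N" for b v
      proof -
        obtain m a where m: "v = m \<oplus>\<^bsub>M\<^esub> a \<odot>\<^bsub>M\<^esub> c" "m \<in> mspan K M S" "a \<in> carrier K"
          using v by auto
        have "b \<odot>\<^bsub>M\<^esub> v = b \<odot>\<^bsub>M\<^esub> m \<oplus>\<^bsub>M\<^esub> (b \<otimes> a) \<odot>\<^bsub>M\<^esub> c"
          using m b s(1) c by (simp add: M.smult_r_distr M.smult_assoc1)
        then show ?thesis using m b s(6) by auto
      qed
    qed
    show "insert c S \<subseteq> ?N"
    proof
      fix y assume "y \<in> insert c S"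
      then consider "y = c" | "y \<in> S" by auto
      then show "y \<in> ?N"
      proof cases
        case 1
        then show ?thesis using s(3) c M
          by (intro CollectI exI[of _ "\<zero>\<^bsub>M\<^esub>"] exI[of _ \<one>]) auto
      next
        case 2
        then have "y = y \<oplus>\<^bsub>M\<^esub> \<zero> \<odot>\<^bsub>M\<^esub> c" using S c M by auto
        then show ?thesis using mspan_incl[OF 2, of M] by blast
      qed
    qed
  qed
  then show ?thesis using that by blast
qed

definition gens :: "('u, 'a, 'y) module_scheme \<Rightarrow> 'a set \<Rightarrow> bool" where
  "gens M S \<longleftrightarrow> module K M \<and> S \<subseteq> carrier M \<and> mspan K M S = carrier M"

lemma gens_induct:
  "gens M S \<Longrightarrow> submodule N K M \<Longrightarrow> S \<subseteq> N \<Longrightarrow> x \<in> carrier M \<Longrightarrow> x \<in> N"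
  unfolding gens_def using mspan_least by metis

text \<open>The equalizer of \<open>f\<close> and \<open>g\<close> is a subspace, hence everything
  once it contains generators. Most identities below are reduced to pure tensors or to classes of
  generators in this way.\<close>

lemma gens_eq:
  assumes "gens V S" "klin V W f" "klin V W g" "\<And>x. x \<in> S \<Longrightarrow> f x = g x" "x \<in> carrier V"
  shows "f x = g x"
  using gens_induct[OF assms(1) submod_eq[OF assms(2,3)] _ assms(5)] assms(1,4)
  by (auto simp: gens_def)

lemma gensI:
  assumes "module K M" "S \<subseteq> carrier M"
    and "\<And>N. submodule N K M \<Longrightarrow> S \<subseteq> N \<Longrightarrow> carrier M \<subseteq> N"
  shows "gens M S"
  using assms mspan_sub[OF assms(1,2)] mspan_incl[of _ S M] mspan_carrier[OF assms(1,2)]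
  unfolding gens_def by blast

lemma span_image:
  assumes f: "klin V W f" and S: "S \<subseteq> carrier V"
  shows "f ` mspan K V S = mspan K W (f ` S)"
proof
  note V = klinD(1)[OF f] and W = klinD(2)[OF f]
  have fS: "f ` S \<subseteq> carrier W" using S klinD(3)[OF f] by auto
  show "f ` mspan K V S \<subseteq> mspan K W (f ` S)"
    using mspan_least[OF _ submod_vimage[OF f mspan_sub[OF W fS]], of _ S] S mspan_incl[of _ "f ` S" W]
    by blast
  show "mspan K W (f ` S) \<subseteq> f ` mspan K V S"
    using mspan_least[OF _ submod_image[OF f mspan_sub[OF V S]]] mspan_incl[of _ S V] by blast
qed

lemma gens_image:
  assumes "klin V W f" "f ` carrier V = carrier W" "gens V S"
  shows "gens W (f ` S)"
  using span_image[OF assms(1), of S] assms klinD(2)[OF assms(1)] by (auto simp: gens_def)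

end

section \<open>Small copies, quotients and direct sums\<close>

context universe
begin

section \<open>Sets that fit into the universe\<close>

definition small :: "'a set \<Rightarrow> bool" where
  "small A \<longleftrightarrow> (\<exists>e :: 'a \<Rightarrow> 'u. inj_on e A)"

lemma small_enc_inj: "small S \<Longrightarrow> inj_on (small_enc S :: 'a \<Rightarrow> 'u) S"
  unfolding small_def small_enc_def by (erule someI_ex)

lemma small_image: "small A \<Longrightarrow> small (f ` A)"
proof -
  assume "small A"
  then obtain e :: "_ \<Rightarrow> 'u" where e: "inj_on e A" by (auto simp: small_def)
  have "inj_on (\<lambda>y. e (inv_into A f y)) (f ` A)"
    by (rule inj_onI) (metis e inj_onD inv_into_into f_inv_into_f)
  then show ?thesis by (auto simp: small_def)
qed

lemma small_univ: "small (A :: 'u set)"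
  by (auto simp: small_def intro: exI[of _ id])

definition upair :: "'u \<times> 'u \<Rightarrow> 'u" where "upair = (SOME p. inj p)"

text \<open>Infinity of \<open>'u\<close> enters here through |U x U| = |U|, and once more in
  \<open>small_finite_sets\<close> through a copy of the natural numbers.\<close>

lemma upair_inj: "inj upair"
proof -
  obtain p :: "'u \<times> 'u \<Rightarrow> 'u" where "inj p"
    using card_of_Times_same_infinite[OF infinite_universe] card_of_ordIso bij_betw_imp_inj_on
    by (metis UNIV_Times_UNIV)
  then show ?thesis unfolding upair_def using someI[of inj p] by simp
qed

lemma upair_eq [simp]: "upair x = upair y \<longleftrightarrow> x = y"
  using upair_inj by (auto dest: injD)

text \<open>Injective only among lists of equal length: \<open>[]\<close> is coded by
  \<open>undefined\<close>, which may also be the code of a longer list.\<close>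

primrec list_code :: "'u list \<Rightarrow> 'u" where
  "list_code [] = undefined"
| "list_code (x # xs) = upair (x, list_code xs)"

lemma list_code_inj: "length xs = length ys \<Longrightarrow> list_code xs = list_code ys \<Longrightarrow> xs = ys"
  by (induction xs ys rule: list_induct2) auto

text \<open>A finite set is coded by an enumerating list; its length is stored as well, because
  \<open>list_code\<close> separates only lists of the same length.\<close>

lemma small_finite_sets: "small {S :: 'u set. finite S}"
proof -
  obtain n :: "nat \<Rightarrow> 'u" where n: "inj n"
    using infinite_universe infinite_countable_subset by blast
  define l where "l S = (SOME xs. set xs = S)" for S :: "'u set"
  have l: "set (l S) = S" if "finite S" for S
    unfolding l_def by (rule someI_ex) (use that finite_list in blast)
  have "inj_on (\<lambda>S. upair (n (length (l S)), list_code (l S))) {S :: 'u set. finite S}"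
    by (rule inj_onI) (metis (mono_tags, lifting) l list_code_inj mem_Collect_eq n injD
        prod.inject upair_eq)
  then show ?thesis by (auto simp: small_def)
qed

text \<open>A function that differs from \<open>z\<close> at finitely many places is recovered from
  the finite set of coded pairs (index, value) on that support. Therefore direct sums over small
  index sets can be copied into \<open>'u\<close>.\<close>

lemma small_finsupp:
  fixes z :: "'i \<Rightarrow> 'u"
  assumes "small I"
  shows "small {f \<in> extensional I. finite {i \<in> I. f i \<noteq> z i}}" (is "small ?F")
proof -
  obtain e :: "_ \<Rightarrow> 'u" where e: "inj_on e I" using assms by (auto simp: small_def)
  obtain s :: "'u set \<Rightarrow> 'u" where s: "inj_on s {S. finite S}"
    using small_finite_sets by (auto simp: small_def)
  define c where "c f = (\<lambda>i. upair (e i, f i)) ` {i \<in> I. f i \<noteq> z i}" for f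
  have "inj_on c ?F"
  proof (rule inj_onI)
    fix f g assume f: "f \<in> ?F" and g: "g \<in> ?F" and eq: "c f = c g"
    have *: "f' i = g' i"
      if "i \<in> I" "c f' \<subseteq> c g'" "f' i \<noteq> z i" for i f' g'
    proof -
      have "upair (e i, f' i) \<in> c g'" using that by (auto simp: c_def)
      then show ?thesis using that(1) e by (auto simp: c_def dest: inj_onD)
    qed
    show "f = g"
    proof (rule extensionalityI[of _ I])
      fix i assume "i \<in> I"
      then have "f i \<noteq> z i \<Longrightarrow> f i = g i" "g i \<noteq> z i \<Longrightarrow> g i = f i" using eq *[of i f g] *[of i g f] by auto
      then show "f i = g i" by metis
    qed (use f g in auto)
  qed
  moreover have "c ` ?F \<subseteq> {S. finite S}" by (auto simp: c_def)
  ultimately have "inj_on (s \<circ> c) ?F" using s by (meson comp_inj_on inj_on_subset)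
  then show ?thesis by (auto simp: small_def)
qed

text \<open>The kernel condition makes \<open>f\<close> constant on the fibres of \<open>p\<close>,
  so the section \<open>inv_into\<close> may be arbitrary. Maps out of tensor products, induced
  modules, sums of comodules and cokernels all come from this lemma.\<close>

lemma lin_factor:
  assumes p: "klin M Q p" "p ` carrier M = carrier Q" and f: "klin M U f"
    and ker: "\<And>x. x \<in> carrier M \<Longrightarrow> p x = \<zero>\<^bsub>Q\<^esub> \<Longrightarrow> f x = \<zero>\<^bsub>U\<^esub>"
  shows "klin Q U (\<lambda>y. f (inv_into (carrier M) p y))"
    and "x \<in> carrier M \<Longrightarrow> f (inv_into (carrier M) p (p x)) = f x"
proof -
  note pD = klinD[OF p(1)] and fD = klinD[OF f]
  have *: "f x = f x'" if "x \<in> carrier M" "x' \<in> carrier M" "p x = p x'" for x x'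
    by (rule minus_zero_imp_eq[of U]) (use that ker[of "x \<ominus>\<^bsub>M\<^esub> x'"] pD fD in \<open>auto simp: pD fD\<close>)
  show v: "f (inv_into (carrier M) p (p x)) = f x" if "x \<in> carrier M" for x
    using that by (intro *) (auto simp: f_inv_into_f inv_into_into)
  have s: "\<exists>x\<in>carrier M. y = p x" if "y \<in> carrier Q" for y
    using p(2) that by blast
  show "klin Q U (\<lambda>y. f (inv_into (carrier M) p y))"
  proof (rule klinI)
    show "f (inv_into (carrier M) p y) \<in> carrier U" if "y \<in> carrier Q" for y
      using s[OF that] v fD by force
    show "f (inv_into (carrier M) p (y \<oplus>\<^bsub>Q\<^esub> y')) =
      f (inv_into (carrier M) p y) \<oplus>\<^bsub>U\<^esub> f (inv_into (carrier M) p y')"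
      if y: "y \<in> carrier Q" and y': "y' \<in> carrier Q" for y y'
    proof -
      obtain x x' where "x \<in> carrier M" "y = p x" "x' \<in> carrier M" "y' = p x'"
        using s[OF y] s[OF y'] by auto
      moreover from this have "y \<oplus>\<^bsub>Q\<^esub> y' = p (x \<oplus>\<^bsub>M\<^esub> x')" using pD by simp
      ultimately show ?thesis using pD(1) by (simp add: v fD)
    qed
    show "f (inv_into (carrier M) p (a \<odot>\<^bsub>Q\<^esub> y)) = a \<odot>\<^bsub>U\<^esub> f (inv_into (carrier M) p y)"
      if a: "a \<in> carrier K" and y: "y \<in> carrier Q" for a y
    proof -
      obtain x where "x \<in> carrier M" "y = p x" using s[OF y] by auto
      moreover from this have "a \<odot>\<^bsub>Q\<^esub> y = p (a \<odot>\<^bsub>M\<^esub> x)" using pD a by simp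
      ultimately show ?thesis using pD(1) a by (simp add: v fD)
    qed
  qed (use pD fD in auto)
qed

text \<open>Only the operations of \<open>Q\<close> are assumed to be images of those of
  \<open>M\<close>; the module axioms for \<open>Q\<close> are transported along \<open>p\<close>.
  Quotients and small copies are the two instances.\<close>

lemma klin_transport:
  assumes M: "module K M" and im: "p ` carrier M = carrier Q" and zero: "\<zero>\<^bsub>Q\<^esub> = p \<zero>\<^bsub>M\<^esub>"
    and add: "\<And>x y. x \<in> carrier M \<Longrightarrow> y \<in> carrier M \<Longrightarrow> p x \<oplus>\<^bsub>Q\<^esub> p y = p (x \<oplus>\<^bsub>M\<^esub> y)"
    and sm: "\<And>a x. a \<in> carrier K \<Longrightarrow> x \<in> carrier M \<Longrightarrow> a \<odot>\<^bsub>Q\<^esub> p x = p (a \<odot>\<^bsub>M\<^esub> x)"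
  shows "klin M Q p"
proof -
  interpret M: module K M by fact
  have car: "\<exists>x\<in>carrier M. y = p x" if "y \<in> carrier Q" for y
    using im that by blast
  have cl: "p x \<in> carrier Q" if "x \<in> carrier M" for x using im that by blast
  have "abelian_group Q"
  proof (rule abelian_groupI)
    fix y assume "y \<in> carrier Q"
    then obtain x where "x \<in> carrier M" "y = p x" using car by auto
    then show "\<exists>z\<in>carrier Q. z \<oplus>\<^bsub>Q\<^esub> y = \<zero>\<^bsub>Q\<^esub>"
      by (intro bexI[of _ "p (\<ominus>\<^bsub>M\<^esub> x)"]) (auto simp: add zero cl M.M.l_neg)
  qed (auto dest!: car simp: add zero cl M.M.a_ac)
  then have "module K Q"
    by (intro moduleI is_cring)
      (auto dest!: car simp: add sm cl M.smult_l_distr M.smult_r_distr M.smult_assoc1)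
  then show ?thesis
    by (intro klinI M) (auto simp: add sm cl)
qed

lemma mquot_lin:
  assumes M: "module K M" and N: "submodule N K M"
  shows "klin M (mquot M N) (\<lambda>x. N +>\<^bsub>M\<^esub> x)"
    and "(\<lambda>x. N +>\<^bsub>M\<^esub> x) ` carrier M = carrier (mquot M N)"
    and "x \<in> carrier M \<Longrightarrow> N +>\<^bsub>M\<^esub> x = \<zero>\<^bsub>mquot M N\<^esub> \<longleftrightarrow> x \<in> N"
proof -
  interpret M: module K M by fact
  interpret N: abelian_subgroup N M
    by (rule abelian_subgroupI2[OF M.M.a_comm_group submodule.axioms(1)[OF N]])
  note n = submodD[OF M N]
  let ?Q = "mquot M N" and ?p = "\<lambda>x. N +>\<^bsub>M\<^esub> x"
  show im: "?p ` carrier M = carrier ?Q"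
    by (auto simp: mquot_def A_RCOSETS_def' a_r_coset_def')
  have eq: "?p x = ?p y \<longleftrightarrow> x \<ominus>\<^bsub>M\<^esub> y \<in> N" if "x \<in> carrier M" "y \<in> carrier M" for x y
    using N.a_rcos_module[OF that(2,1)] N.a_repr_independence'[OF _ that(2)]
      N.a_repr_independenceD[OF that(1)] unfolding a_minus_def by metis
  have zero: "\<zero>\<^bsub>?Q\<^esub> = ?p \<zero>\<^bsub>M\<^esub>"
    using M.M.a_coset_add_zero n by (simp add: mquot_def)
  have add: "?p x \<oplus>\<^bsub>?Q\<^esub> ?p y = ?p (x \<oplus>\<^bsub>M\<^esub> y)" if "x \<in> carrier M" "y \<in> carrier M" for x y
    using that N.a_rcos_sum by (simp add: mquot_def)
  have sm: "a \<odot>\<^bsub>?Q\<^esub> ?p x = ?p (a \<odot>\<^bsub>M\<^esub> x)" if "a \<in> carrier K" "x \<in> carrier M" for a x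
  proof -
    \<comment> \<open>\<open>mquot\<close> defines a scalar multiple of a coset as a union over all
      representatives; every member of that union is shown to be the same coset.\<close>
    have "?p (a \<odot>\<^bsub>M\<^esub> y) = ?p (a \<odot>\<^bsub>M\<^esub> x)" if "y \<in> ?p x" for y
    proof -
      have y: "y \<in> carrier M" "y \<ominus>\<^bsub>M\<^esub> x \<in> N"
        using that \<open>x \<in> carrier M\<close> N.a_rcos_module_imp[of x y] N.a_elemrcos_carrier[of x y]
        by (auto simp: a_minus_def)
      have "a \<odot>\<^bsub>M\<^esub> y \<ominus>\<^bsub>M\<^esub> a \<odot>\<^bsub>M\<^esub> x = a \<odot>\<^bsub>M\<^esub> (y \<ominus>\<^bsub>M\<^esub> x)"
        using y \<open>a \<in> carrier K\<close> \<open>x \<in> carrier M\<close>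
        by (simp add: a_minus_def M.smult_r_distr M.smult_r_minus)
      then show ?thesis using eq y n \<open>a \<in> carrier K\<close> \<open>x \<in> carrier M\<close> by simp
    qed
    moreover have "?p x \<noteq> {}" using N.a_rcos_self that by blast
    ultimately show ?thesis by (simp add: mquot_def)
  qed
  show "klin M ?Q ?p" by (rule klin_transport[OF M im zero add sm])
  show "?p x = \<zero>\<^bsub>?Q\<^esub> \<longleftrightarrow> x \<in> N" if "x \<in> carrier M"
    using eq[of x "\<zero>\<^bsub>M\<^esub>"] that zero M by simp
qed

lemma small_copy_lin:
  assumes M: "module K M" and s: "small (carrier M)"
  shows "klin M (small_copy M :: ('u, 'u) module) (small_enc (carrier M))"
    and "carrier (small_copy M :: ('u, 'u) module) = small_enc (carrier M) ` carrier M"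
proof -
  let ?Q = "small_copy M :: ('u, 'u) module" and ?p = "small_enc (carrier M) :: _ \<Rightarrow> 'u"
  note inj = small_enc_inj[OF s]
  have im: "?p ` carrier M = carrier ?Q" by (simp add: small_copy_def Let_def)
  then show "carrier ?Q = ?p ` carrier M" ..
  note iv = inv_into_f_f[OF inj]
  have add: "?p x \<oplus>\<^bsub>?Q\<^esub> ?p y = ?p (x \<oplus>\<^bsub>M\<^esub> y)" if "x \<in> carrier M" "y \<in> carrier M" for x y
    using that by (simp add: small_copy_def Let_def iv)
  have sm: "a \<odot>\<^bsub>?Q\<^esub> ?p x = ?p (a \<odot>\<^bsub>M\<^esub> x)" if "a \<in> carrier K" "x \<in> carrier M" for a x
    using that by (simp add: small_copy_def Let_def iv)
  have zero: "\<zero>\<^bsub>?Q\<^esub> = ?p \<zero>\<^bsub>M\<^esub>" by (simp add: small_copy_def Let_def)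
  show "klin M ?Q ?p" by (rule klin_transport[OF M im zero add sm])
qed

text \<open>Quotient followed by copy into \<open>'u\<close>, the common shape of
  \<open>tensor\<close> and \<open>ind_space\<close>, so that both are handled by one lemma.\<close>

definition squot :: "('u, 'a, 'z) module_scheme \<Rightarrow> 'a set \<Rightarrow> ('u, 'u) module" where
  "squot M N = small_copy (mquot M N)"

definition sproj :: "('u, 'a, 'z) module_scheme \<Rightarrow> 'a set \<Rightarrow> 'a \<Rightarrow> 'u" where
  "sproj M N x = small_enc (carrier (mquot M N)) (N +>\<^bsub>M\<^esub> x)"

lemma squot_lin:
  assumes M: "module K M" and N: "submodule N K M" and s: "small (carrier M)"
  shows "klin M (squot M N) (sproj M N)"
    and "sproj M N ` carrier M = carrier (squot M N)"
    and "x \<in> carrier M \<Longrightarrow> sproj M N x = \<zero>\<^bsub>squot M N\<^esub> \<longleftrightarrow> x \<in> N"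
proof -
  note q = mquot_lin[OF M N]
  have sq: "small (carrier (mquot M N))" using small_image[OF s] q(2) by metis
  note c = small_copy_lin[OF klinD(2)[OF q(1)] sq]
  show "klin M (squot M N) (sproj M N)"
    unfolding squot_def sproj_def[abs_def] by (rule klin_comp[OF q(1) c(1)])
  show "sproj M N ` carrier M = carrier (squot M N)"
    unfolding squot_def sproj_def[abs_def] c(2) q(2)[symmetric] by (simp add: image_comp o_def)
  show "sproj M N x = \<zero>\<^bsub>squot M N\<^esub> \<longleftrightarrow> x \<in> N" if x: "x \<in> carrier M"
  proof -
    have "sproj M N x = \<zero>\<^bsub>squot M N\<^esub> \<longleftrightarrow> N +>\<^bsub>M\<^esub> x = \<zero>\<^bsub>mquot M N\<^esub>"
      unfolding sproj_def squot_def klinD(6)[OF c(1), symmetric]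
      using inj_on_eq_iff[OF small_enc_inj[OF sq]] klinD(3)[OF q(1) x] klinD(2)[OF q(1)] by auto
    then show ?thesis using q(3) x by simp
  qed
qed

subsection \<open>Direct sums\<close>

lemma dsum_simps:
  "carrier (dsum I M) = {f \<in> \<Pi>\<^sub>E i \<in> I. carrier (M i). finite {i \<in> I. f i \<noteq> \<zero>\<^bsub>M i\<^esub>}}"
  "\<zero>\<^bsub>dsum I M\<^esub> = (\<lambda>i \<in> I. \<zero>\<^bsub>M i\<^esub>)"
  "f \<oplus>\<^bsub>dsum I M\<^esub> g = (\<lambda>i \<in> I. f i \<oplus>\<^bsub>M i\<^esub> g i)"
  "a \<odot>\<^bsub>dsum I M\<^esub> f = (\<lambda>i \<in> I. a \<odot>\<^bsub>M i\<^esub> f i)"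
  by (auto simp: dsum_def)

lemma dsum_module:
  assumes M: "\<And>i. i \<in> I \<Longrightarrow> module K (M i)"
  shows "module K (dsum I M)"
proof (intro moduleI is_cring abelian_groupI)
  let ?D = "dsum I M"
  have fin: "finite {i \<in> I. h i \<noteq> \<zero>\<^bsub>M i\<^esub>}"
    if "finite {i \<in> I. f i \<noteq> \<zero>\<^bsub>M i\<^esub>}" "finite {i \<in> I. g i \<noteq> \<zero>\<^bsub>M i\<^esub>}"
      "\<And>i. i \<in> I \<Longrightarrow> f i = \<zero>\<^bsub>M i\<^esub> \<Longrightarrow> g i = \<zero>\<^bsub>M i\<^esub> \<Longrightarrow> h i = \<zero>\<^bsub>M i\<^esub>"
    for f g h
    by (rule finite_subset[of _ "{i \<in> I. f i \<noteq> \<zero>\<^bsub>M i\<^esub>} \<union> {i \<in> I. g i \<noteq> \<zero>\<^bsub>M i\<^esub>}"])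
      (use that in auto)
  have A: "abelian_group (M i)" if "i \<in> I" for i using M[OF that] module.axioms(2) by blast
  note ac = abelian_monoid.a_ac[OF abelian_group.axioms(1)[OF A]]
  show add: "f \<oplus>\<^bsub>?D\<^esub> g \<in> carrier ?D" if "f \<in> carrier ?D" "g \<in> carrier ?D" for f g
    using that fin[of f g "\<lambda>i \<in> I. f i \<oplus>\<^bsub>M i\<^esub> g i"] unfolding dsum_simps
    by (fastforce simp: PiE_iff M)
  show sm: "a \<odot>\<^bsub>?D\<^esub> f \<in> carrier ?D" if "a \<in> carrier K" "f \<in> carrier ?D" for a f
    using that fin[of f f "\<lambda>i \<in> I. a \<odot>\<^bsub>M i\<^esub> f i"] unfolding dsum_simps
    by (fastforce simp: PiE_iff M)
  show "\<zero>\<^bsub>?D\<^esub> \<in> carrier ?D" unfolding dsum_simps by (auto simp: M)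
  show "f \<oplus>\<^bsub>?D\<^esub> g \<oplus>\<^bsub>?D\<^esub> h = f \<oplus>\<^bsub>?D\<^esub> (g \<oplus>\<^bsub>?D\<^esub> h)"
    if "f \<in> carrier ?D" "g \<in> carrier ?D" "h \<in> carrier ?D" for f g h
    using that unfolding dsum_simps
    by (auto simp: PiE_iff abelian_monoid.a_assoc[OF abelian_group.axioms(1)[OF A]] intro!: restrict_ext)
  show "f \<oplus>\<^bsub>?D\<^esub> g = g \<oplus>\<^bsub>?D\<^esub> f" if "f \<in> carrier ?D" "g \<in> carrier ?D" for f g
    using that unfolding dsum_simps
    by (auto simp: PiE_iff intro!: restrict_ext intro: abelian_monoid.a_comm[OF abelian_group.axioms(1)[OF A]])
  show "\<zero>\<^bsub>?D\<^esub> \<oplus>\<^bsub>?D\<^esub> f = f" if "f \<in> carrier ?D" for f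
    using that unfolding dsum_simps
    by (auto simp: PiE_iff M intro!: extensionalityI[of _ I])
  show "\<exists>g\<in>carrier ?D. g \<oplus>\<^bsub>?D\<^esub> f = \<zero>\<^bsub>?D\<^esub>" if "f \<in> carrier ?D" for f
    using that sm[of "\<ominus> \<one>" f]
    by (intro bexI[of _ "(\<ominus> \<one>) \<odot>\<^bsub>?D\<^esub> f"])
      (auto simp: dsum_simps PiE_iff M minus_eq_smult[symmetric] abelian_group.l_neg[OF A] intro!: restrict_ext)
  show "(a \<oplus> b) \<odot>\<^bsub>?D\<^esub> f = a \<odot>\<^bsub>?D\<^esub> f \<oplus>\<^bsub>?D\<^esub> b \<odot>\<^bsub>?D\<^esub> f"
    if "a \<in> carrier K" "b \<in> carrier K" "f \<in> carrier ?D" for a b f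
    using that by (auto simp: dsum_simps PiE_iff module.smult_l_distr[OF M] intro!: restrict_ext)
  show "a \<odot>\<^bsub>?D\<^esub> (f \<oplus>\<^bsub>?D\<^esub> g) = a \<odot>\<^bsub>?D\<^esub> f \<oplus>\<^bsub>?D\<^esub> a \<odot>\<^bsub>?D\<^esub> g"
    if "a \<in> carrier K" "f \<in> carrier ?D" "g \<in> carrier ?D" for a f g
    using that by (auto simp: dsum_simps PiE_iff module.smult_r_distr[OF M] intro!: restrict_ext)
  show "a \<otimes> b \<odot>\<^bsub>?D\<^esub> f = a \<odot>\<^bsub>?D\<^esub> (b \<odot>\<^bsub>?D\<^esub> f)"
    if "a \<in> carrier K" "b \<in> carrier K" "f \<in> carrier ?D" for a b f
    using that by (auto simp: dsum_simps PiE_iff module.smult_assoc1[OF M] intro!: restrict_ext)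
  show "\<one> \<odot>\<^bsub>?D\<^esub> f = f" if "f \<in> carrier ?D" for f
    using that by (auto simp: dsum_simps PiE_iff M intro!: extensionalityI[of _ I])
qed

lemma dinj_lin:
  assumes M: "\<And>i. i \<in> I \<Longrightarrow> module K (M i)" and i: "i \<in> I"
  shows "klin (M i) (dsum I M) (dinj I M i)"
proof (rule klinI)
  show "module K (dsum I M)" by (rule dsum_module[OF M])
  show "dinj I M i x \<in> carrier (dsum I M)" if "x \<in> carrier (M i)" for x
    using that finite_subset[of "{j \<in> I. dinj I M i x j \<noteq> \<zero>\<^bsub>M j\<^esub>}" "{i}"]
    by (auto simp: dsum_simps dinj_def M)
qed (use i M in \<open>auto simp: dsum_simps dinj_def intro!: restrict_ext\<close>)

text \<open>Induction on a finite set containing the support: each step splits off the coordinate at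
  one index and leaves an element supported on the smaller set.\<close>

lemma dsum_gens:
  assumes M: "\<And>i. i \<in> I \<Longrightarrow> module K (M i)"
  shows "gens (dsum I M) {dinj I M i x | i x. i \<in> I \<and> x \<in> carrier (M i)}"
proof (rule gensI)
  let ?D = "dsum I M"
  show D: "module K ?D" by (rule dsum_module[OF M])
  show "{dinj I M i x | i x. i \<in> I \<and> x \<in> carrier (M i)} \<subseteq> carrier ?D"
    using klinD(3)[OF dinj_lin[OF M]] by auto
  fix N assume N: "submodule N K ?D" "{dinj I M i x | i x. i \<in> I \<and> x \<in> carrier (M i)} \<subseteq> N"
  have "f \<in> N" if "f \<in> carrier ?D" "{i \<in> I. f i \<noteq> \<zero>\<^bsub>M i\<^esub>} \<subseteq> F" "finite F" for f F
    using that(3,1,2)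
  proof (induction F arbitrary: f)
    case empty
    have "f = \<zero>\<^bsub>?D\<^esub>"
      using empty by (intro extensionalityI[of _ I]) (auto simp: dsum_simps PiE_iff)
    then show ?case using submodD(3)[OF D N(1)] by simp
  next
    case (insert i F)
    show ?case
    proof (cases "i \<in> I")
      case False
      then show ?thesis using insert.prems by (intro insert.IH) auto
    next
      case True
      let ?g = "f(i := \<zero>\<^bsub>M i\<^esub>)"
      have g: "?g \<in> carrier ?D"
      proof -
        have "finite {j \<in> I. ?g j \<noteq> \<zero>\<^bsub>M j\<^esub>}"
          by (rule finite_subset[of _ "{j \<in> I. f j \<noteq> \<zero>\<^bsub>M j\<^esub>}"])
            (use insert.prems(1) in \<open>auto simp: dsum_simps\<close>)
        moreover have "?g \<in> (\<Pi>\<^sub>E i \<in> I. carrier (M i))"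
          using insert.prems(1) True by (auto simp: dsum_simps PiE_iff M extensional_def)
        ultimately show ?thesis by (simp only: dsum_simps mem_Collect_eq)
      qed
      have "?g \<in> N" by (rule insert.IH[OF g]) (use insert.prems in auto)
      moreover have "dinj I M i (f i) \<in> N"
        using N(2) True insert.prems(1) by (auto simp: dsum_simps)
      moreover have "f = ?g \<oplus>\<^bsub>?D\<^esub> dinj I M i (f i)"
        using insert.prems(1) True
        by (intro extensionalityI[of _ I]) (auto simp: dsum_simps dinj_def PiE_iff M)
      ultimately show ?thesis using submodD(4)[OF D N(1)] by metis
    qed
  qed
  then show "carrier ?D \<subseteq> N" by (auto simp: dsum_simps)
qed

lemma dsum_lift:
  assumes M: "\<And>i. i \<in> I \<Longrightarrow> module K (M i)" and U: "module K U"
    and f: "\<And>i. i \<in> I \<Longrightarrow> klin (M i) U (f i)"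
  obtains g where "klin (dsum I M) U g"
    "\<And>i x. i \<in> I \<Longrightarrow> x \<in> carrier (M i) \<Longrightarrow> g (dinj I M i x) = f i x"
proof -
  interpret U: module K U by fact
  let ?D = "dsum I M"
  have D: "module K ?D" by (rule dsum_module[OF M])
  define sp where "sp F = {i \<in> I. F i \<noteq> \<zero>\<^bsub>M i\<^esub>}" for F
  define g where "g F = finsum U (\<lambda>i. f i (F i)) (sp F)" for F
  have cl: "f i (F i) \<in> carrier U" if "i \<in> I" "F \<in> carrier ?D" for i F
    using that by (intro klinD(3)[OF f]) (auto simp: dsum_simps)
  \<comment> \<open>The sum may run over any finite superset of the support. Additivity needs this,
    since \<open>F\<close>, \<open>G\<close> and their sum have different supports.\<close>
  have g: "g F = finsum U (\<lambda>i. f i (F i)) A" if "finite A" "sp F \<subseteq> A" "A \<subseteq> I" "F \<in> carrier ?D" for F A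
    unfolding g_def
  proof (rule U.M.add.finprod_mono_neutral_cong_left)
    show "f i (F i) = \<zero>\<^bsub>U\<^esub>" if "i \<in> A - sp F" for i
      using that \<open>A \<subseteq> I\<close> klinD(6)[OF f[of i]] by (auto simp: sp_def)
  qed (use that cl in auto)
  have spf: "finite (sp F)" "sp F \<subseteq> I" if "F \<in> carrier ?D" for F
    using that by (auto simp: sp_def dsum_simps)
  have "klin ?D U g"
  proof (rule klinI[OF D U])
    show "g F \<in> carrier U" if "F \<in> carrier ?D" for F
      unfolding g_def using that spf[OF that] cl by (intro U.M.finsum_closed) auto
    show "g (F \<oplus>\<^bsub>?D\<^esub> G) = g F \<oplus>\<^bsub>U\<^esub> g G" if F: "F \<in> carrier ?D" and G: "G \<in> carrier ?D" for F G
    proof -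
      let ?A = "sp F \<union> sp G"
      have A: "finite ?A" "?A \<subseteq> I" using spf F G by auto
      have FG: "F \<oplus>\<^bsub>?D\<^esub> G \<in> carrier ?D" using D F G by simp
      have "sp (F \<oplus>\<^bsub>?D\<^esub> G) \<subseteq> ?A" by (auto simp: sp_def dsum_simps M)
      then have "g (F \<oplus>\<^bsub>?D\<^esub> G) = finsum U (\<lambda>i. f i ((F \<oplus>\<^bsub>?D\<^esub> G) i)) ?A" using g A FG by auto
      also have "\<dots> = finsum U (\<lambda>i. f i (F i) \<oplus>\<^bsub>U\<^esub> f i (G i)) ?A"
      proof (rule U.M.add.finprod_cong')
        show "f i ((F \<oplus>\<^bsub>?D\<^esub> G) i) = f i (F i) \<oplus>\<^bsub>U\<^esub> f i (G i)" if "i \<in> ?A" for i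
          using that A(2) F G klinD(4)[OF f[of i], of "F i" "G i"] by (auto simp: dsum_simps PiE_iff)
      qed (use cl A F G in auto)
      also have "\<dots> = finsum U (\<lambda>i. f i (F i)) ?A \<oplus>\<^bsub>U\<^esub> finsum U (\<lambda>i. f i (G i)) ?A"
        using cl F G A(2) by (intro U.M.finsum_addf) auto
      also have "\<dots> = g F \<oplus>\<^bsub>U\<^esub> g G" using g[OF A(1) _ A(2)] F G by simp
      finally show ?thesis .
    qed
    show "g (a \<odot>\<^bsub>?D\<^esub> F) = a \<odot>\<^bsub>U\<^esub> g F" if a: "a \<in> carrier K" and F: "F \<in> carrier ?D" for a F
    proof -
      have aF: "a \<odot>\<^bsub>?D\<^esub> F \<in> carrier ?D" using D a F by simp
      have "sp (a \<odot>\<^bsub>?D\<^esub> F) \<subseteq> sp F" using a by (auto simp: sp_def dsum_simps M)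
      then have "g (a \<odot>\<^bsub>?D\<^esub> F) = finsum U (\<lambda>i. f i ((a \<odot>\<^bsub>?D\<^esub> F) i)) (sp F)" using g aF spf[OF F] by auto
      also have "\<dots> = finsum U (\<lambda>i. a \<odot>\<^bsub>U\<^esub> f i (F i)) (sp F)"
      proof (rule U.M.add.finprod_cong')
        show "f i ((a \<odot>\<^bsub>?D\<^esub> F) i) = a \<odot>\<^bsub>U\<^esub> f i (F i)" if "i \<in> sp F" for i
          using that spf[OF F] a F klinD(5)[OF f[of i], of a "F i"] by (auto simp: dsum_simps PiE_iff)
      qed (use cl spf[OF F] F a in auto)
      also have "\<dots> = a \<odot>\<^bsub>U\<^esub> g F"
        unfolding g_def using cl spf[OF F] F a by (intro U.finsum_smult_ldistr[symmetric]) auto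
      finally show ?thesis .
    qed
  qed
  moreover have "g (dinj I M i x) = f i x" if "i \<in> I" "x \<in> carrier (M i)" for i x
  proof -
    have "sp (dinj I M i x) \<subseteq> {i}" by (auto simp: sp_def dinj_def)
    then have "g (dinj I M i x) = finsum U (\<lambda>j. f j (dinj I M i x j)) {i}"
      using that klinD(3)[OF dinj_lin[of I M i, OF M that(1)] that(2)] by (intro g) auto
    also have "\<dots> = f i x"
      using that klinD(3)[OF f[OF that(1)] that(2)] by (simp add: dinj_def)
    finally show ?thesis .
  qed
  ultimately show ?thesis using that by blast
qed

lemma dsum_small:
  fixes M :: "'i \<Rightarrow> ('u, 'u, 'z) module_scheme"
  assumes "small I"
  shows "small (carrier (dsum I M))"
proof -
  have "carrier (dsum I M) \<subseteq> {f \<in> extensional I. finite {i \<in> I. f i \<noteq> \<zero>\<^bsub>M i\<^esub>}}"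
    by (auto simp: dsum_simps PiE_iff)
  then show ?thesis
    using small_finsupp[OF assms, of "\<lambda>i. \<zero>\<^bsub>M i\<^esub>"] inj_on_subset unfolding small_def by blast
qed

end

section \<open>Tensor products\<close>

context universe
begin

abbreviation tnsr (infixl "\<otimes>\<^sub>K" 70) where "V \<otimes>\<^sub>K W \<equiv> tensor K V W"

section \<open>Bilinear maps and the universal property of the tensor product\<close>

definition bilin where
  "bilin V W U \<beta> \<longleftrightarrow> module K V \<and> module K W \<and>
    (\<forall>v \<in> carrier V. klin W U (\<lambda>w. \<beta> v w)) \<and> (\<forall>w \<in> carrier W. klin V U (\<lambda>v. \<beta> v w))"

lemma bilinI:
  assumes "module K V" "module K W"
    and "\<And>v. v \<in> carrier V \<Longrightarrow> klin W U (\<lambda>w. \<beta> v w)"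
    and "\<And>w. w \<in> carrier W \<Longrightarrow> klin V U (\<lambda>v. \<beta> v w)"
  shows "bilin V W U \<beta>"
  using assms by (auto simp: bilin_def)

lemma bilinD:
  assumes "bilin V W U \<beta>"
  shows "module K V" "module K W" "module K U"
    and "v \<in> carrier V \<Longrightarrow> w \<in> carrier W \<Longrightarrow> \<beta> v w \<in> carrier U"
    and "v \<in> carrier V \<Longrightarrow> klin W U (\<lambda>w. \<beta> v w)"
    and "w \<in> carrier W \<Longrightarrow> klin V U (\<lambda>v. \<beta> v w)"
proof -
  show V: "module K V" and W: "module K W"
    and l: "v \<in> carrier V \<Longrightarrow> klin W U (\<lambda>w. \<beta> v w)" for v
    using assms by (auto simp: bilin_def)
  show "module K U" using klinD(2)[OF l[OF mod_simps(1)[OF V]]] .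
  show "v \<in> carrier V \<Longrightarrow> w \<in> carrier W \<Longrightarrow> \<beta> v w \<in> carrier U"
    using klinD(3)[OF l] .
qed (use assms in \<open>auto simp: bilin_def\<close>)

lemma bilin_left:
  assumes "bilin V W U \<beta>" "klin Y V f" "w \<in> carrier W"
  shows "klin Y U (\<lambda>x. \<beta> (f x) w)"
  using klin_comp[OF assms(2) bilinD(6)[OF assms(1,3)]] .

lemma bilin_right:
  assumes "bilin V W U \<beta>" "klin Y W f" "v \<in> carrier V"
  shows "klin Y U (\<lambda>x. \<beta> v (f x))"
  using klin_comp[OF assms(2) bilinD(5)[OF assms(1,3)]] .

context
  fixes V :: "('u, 'u, 'y) module_scheme" and W :: "('u, 'u, 'z) module_scheme"
  assumes V: "module K V" and W: "module K W"
begin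

lemma tensor_eq_squot: "V \<otimes>\<^sub>K W = squot (free_mod K V W) (tensor_rel K V W)"
  by (simp add: tensor_def squot_def)

lemma tens_eq_sproj: "tens K V W v w = sproj (free_mod K V W) (tensor_rel K V W) (free_gen K V W v w)"
  by (simp add: tens_def sproj_def)

private lemma free_module: "module K (free_mod K V W)"
  unfolding free_mod_def by (rule dsum_module) (rule self_mod_module)

private lemma free_gen_in:
  "v \<in> carrier V \<Longrightarrow> w \<in> carrier W \<Longrightarrow> free_gen K V W v w \<in> carrier (free_mod K V W)"
  unfolding free_mod_def free_gen_def
  by (rule klinD(3)[OF dinj_lin]) (auto simp: self_mod_module)

private lemma free_gens:
  "gens (free_mod K V W) {free_gen K V W v w | v w. v \<in> carrier V \<and> w \<in> carrier W}"
proof (rule gensI[OF free_module])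
  fix N assume N: "submodule N K (free_mod K V W)"
    and sub: "{free_gen K V W v w | v w. v \<in> carrier V \<and> w \<in> carrier W} \<subseteq> N"
  let ?M = "\<lambda>_. self_mod K"
  have "dinj (carrier V \<times> carrier W) ?M i a \<in> N"
    if i: "i \<in> carrier V \<times> carrier W" and a: "a \<in> carrier (?M i)" for i a
  proof -
    obtain v w where vw: "i = (v, w)" "v \<in> carrier V" "w \<in> carrier W" using i by auto
    have "a \<odot>\<^bsub>free_mod K V W\<^esub> free_gen K V W v w \<in> N"
      by (rule submodD(6)[OF free_module N]) (use sub vw a in auto)
    moreover have "dinj (carrier V \<times> carrier W) ?M i a = a \<odot>\<^bsub>free_mod K V W\<^esub> free_gen K V W v w"
      using a i klinD(5)[OF dinj_lin[of "carrier V \<times> carrier W" ?M i], of a \<one>]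
      unfolding free_gen_def free_mod_def vw(1)[symmetric] by (simp add: self_mod_module)
    ultimately show ?thesis by simp
  qed
  then show "carrier (free_mod K V W) \<subseteq> N"
    using gens_induct[OF dsum_gens[of "carrier V \<times> carrier W" ?M, OF self_mod_module]] N
    unfolding free_mod_def by blast
qed (use free_gen_in in auto)

private lemma free_small: "small (carrier (free_mod K V W))"
proof -
  have "small (carrier V \<times> carrier W)"
    using upair_inj unfolding small_def by (meson inj_on_subset subset_UNIV)
  then show ?thesis unfolding free_mod_def by (rule dsum_small)
qed

private lemma tensor_rel_sub: "submodule (tensor_rel K V W) K (free_mod K V W)"
  unfolding tensor_rel_def
  by (rule mspan_sub[OF free_module])
    (auto intro!: mod_simps[OF free_module] free_gen_in simp: V W)

private lemmas sq = squot_lin[OF free_module tensor_rel_sub free_small, folded tensor_eq_squot]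

lemma tensor_module [simp]: "module K (V \<otimes>\<^sub>K W)"
  using klinD(2)[OF sq(1)] .

private lemma tens_rel:
  assumes "x \<ominus>\<^bsub>free_mod K V W\<^esub> y \<in> tensor_rel K V W"
    "x \<in> carrier (free_mod K V W)" "y \<in> carrier (free_mod K V W)"
  shows "sproj (free_mod K V W) (tensor_rel K V W) x = sproj (free_mod K V W) (tensor_rel K V W) y"
proof (rule minus_zero_imp_eq[OF tensor_module])
  note q = klinD[OF sq(1)]
  show "sproj (free_mod K V W) (tensor_rel K V W) x \<ominus>\<^bsub>V \<otimes>\<^sub>K W\<^esub>
    sproj (free_mod K V W) (tensor_rel K V W) y = \<zero>\<^bsub>V \<otimes>\<^sub>K W\<^esub>"
    using sq(3)[of "x \<ominus>\<^bsub>free_mod K V W\<^esub> y"] assms free_module by (simp add: q(8))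
qed (use assms klinD(3)[OF sq(1)] in auto)

lemma tens_bilin: "bilin V W (V \<otimes>\<^sub>K W) (tens K V W)"
proof -
  note q = klinD[OF sq(1)]
  have cl: "tens K V W v w \<in> carrier (V \<otimes>\<^sub>K W)" if "v \<in> carrier V" "w \<in> carrier W" for v w
    unfolding tens_eq_sproj by (rule q(3)[OF free_gen_in[OF that]])
  note s = mod_simps[OF free_module] free_gen_in V W
  have eq: "sproj (free_mod K V W) (tensor_rel K V W) x = sproj (free_mod K V W) (tensor_rel K V W) y"
    if "x \<ominus>\<^bsub>free_mod K V W\<^esub> y \<in> S" "tensor_rel K V W = mspan K (free_mod K V W) S"
    "x \<in> carrier (free_mod K V W)" "y \<in> carrier (free_mod K V W)" for x y S
    by (rule tens_rel) (use that mspan_incl[of _ S "free_mod K V W"] in auto)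
  note eqs = eq[OF _ tensor_rel_def]
  show ?thesis
  proof (intro bilinI klinI V W tensor_module cl)
    fix v w w' assume *: "v \<in> carrier V" "w \<in> carrier W" "w' \<in> carrier W"
    show "tens K V W v (w \<oplus>\<^bsub>W\<^esub> w') = tens K V W v w \<oplus>\<^bsub>V \<otimes>\<^sub>K W\<^esub> tens K V W v w'"
      unfolding tens_eq_sproj q(4)[OF free_gen_in free_gen_in, OF *(1,2) *(1,3), symmetric]
      by (rule eqs) (use * in \<open>auto simp: s\<close>)
  next
    fix v a w assume *: "v \<in> carrier V" "a \<in> carrier K" "w \<in> carrier W"
    show "tens K V W v (a \<odot>\<^bsub>W\<^esub> w) = a \<odot>\<^bsub>V \<otimes>\<^sub>K W\<^esub> tens K V W v w"
      unfolding tens_eq_sproj q(5)[OF *(2) free_gen_in[OF *(1,3)], symmetric]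
      by (rule eqs) (use * in \<open>auto simp: s\<close>)
  next
    fix w v v' assume *: "w \<in> carrier W" "v \<in> carrier V" "v' \<in> carrier V"
    show "tens K V W (v \<oplus>\<^bsub>V\<^esub> v') w = tens K V W v w \<oplus>\<^bsub>V \<otimes>\<^sub>K W\<^esub> tens K V W v' w"
      unfolding tens_eq_sproj q(4)[OF free_gen_in free_gen_in, OF *(2,1) *(3,1), symmetric]
      by (rule eqs) (use * in \<open>auto simp: s\<close>)
  next
    fix w a v assume *: "w \<in> carrier W" "a \<in> carrier K" "v \<in> carrier V"
    show "tens K V W (a \<odot>\<^bsub>V\<^esub> v) w = a \<odot>\<^bsub>V \<otimes>\<^sub>K W\<^esub> tens K V W v w"
      unfolding tens_eq_sproj q(5)[OF *(2) free_gen_in[OF *(3,1)], symmetric]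
      by (rule eqs) (use * in \<open>auto simp: s\<close>)
  qed (use V in auto)
qed

lemma tens_closed [simp]:
  "v \<in> carrier V \<Longrightarrow> w \<in> carrier W \<Longrightarrow> tens K V W v w \<in> carrier (V \<otimes>\<^sub>K W)"
  using bilinD(4)[OF tens_bilin] .

lemma tensor_gens: "gens (V \<otimes>\<^sub>K W) {tens K V W v w | v w. v \<in> carrier V \<and> w \<in> carrier W}"
proof -
  have "{tens K V W v w | v w. v \<in> carrier V \<and> w \<in> carrier W} =
    sproj (free_mod K V W) (tensor_rel K V W) `
      {free_gen K V W v w | v w. v \<in> carrier V \<and> w \<in> carrier W}"
    by (auto simp: tens_eq_sproj)
  then show ?thesis using gens_image[OF sq(1,2) free_gens] by simp
qed

lemma tensor_eq:
  assumes "klin (V \<otimes>\<^sub>K W) U f" "klin (V \<otimes>\<^sub>K W) U g"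
    "\<And>v w. v \<in> carrier V \<Longrightarrow> w \<in> carrier W \<Longrightarrow> f (tens K V W v w) = g (tens K V W v w)"
    "t \<in> carrier (V \<otimes>\<^sub>K W)"
  shows "f t = g t"
  by (rule gens_eq[OF tensor_gens assms(1,2) _ assms(4)]) (use assms(3) in auto)

text \<open>This gives the definite description \<open>tlift\<close> its meaning. Existence extends
  \<beta> linearly to the free module, where bilinearity kills the four families of relations, and
  factors through the quotient; uniqueness holds because pure tensors generate and
  \<open>Lin\<close> fixes the values outside the carrier.\<close>

lemma tlift_ex1:
  assumes \<beta>: "bilin V W U \<beta>"
  shows "\<exists>!h. h \<in> Lin K (V \<otimes>\<^sub>K W) U \<and>
     (\<forall>v \<in> carrier V. \<forall>w \<in> carrier W. h (tens K V W v w) = \<beta> v w)"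
proof (rule ex_ex1I)
  note b = bilinD[OF \<beta>]
  let ?I = "carrier V \<times> carrier W" and ?M = "\<lambda>_. self_mod K"
  let ?p = "sproj (free_mod K V W) (tensor_rel K V W)"
  obtain g where "klin (dsum ?I ?M) U g"
    "\<And>i x. i \<in> ?I \<Longrightarrow> x \<in> carrier (?M i) \<Longrightarrow> g (dinj ?I ?M i x) = x \<odot>\<^bsub>U\<^esub> \<beta> (fst i) (snd i)"
    by (rule dsum_lift[of ?I ?M U "\<lambda>i x. x \<odot>\<^bsub>U\<^esub> \<beta> (fst i) (snd i)"])
      (auto intro!: klin_smult_left klin_id simp: self_mod_module b)
  then have g: "klin (free_mod K V W) U g"
    and gv: "\<And>v w. v \<in> carrier V \<Longrightarrow> w \<in> carrier W \<Longrightarrow> g (free_gen K V W v w) = \<beta> v w"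
    unfolding free_mod_def free_gen_def using b by auto
  note gD = klinD[OF g]
  note s = mod_simps[OF free_module] free_gen_in V W
  have "tensor_rel K V W \<subseteq> {x \<in> carrier (free_mod K V W). g x = \<zero>\<^bsub>U\<^esub>}"
  proof
    fix x assume "x \<in> tensor_rel K V W"
    then show "x \<in> {x \<in> carrier (free_mod K V W). g x = \<zero>\<^bsub>U\<^esub>}"
      unfolding tensor_rel_def
    proof (rule mspan_least[OF _ submod_eq[OF g klin_zero[OF free_module b(3)]]])
      have "\<And>v w w'. v \<in> carrier V \<Longrightarrow> w \<in> carrier W \<Longrightarrow> w' \<in> carrier W \<Longrightarrow>
        \<beta> v (w \<oplus>\<^bsub>W\<^esub> w') = \<beta> v w \<oplus>\<^bsub>U\<^esub> \<beta> v w'"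
        "\<And>v v' w. v \<in> carrier V \<Longrightarrow> v' \<in> carrier V \<Longrightarrow> w \<in> carrier W \<Longrightarrow>
        \<beta> (v \<oplus>\<^bsub>V\<^esub> v') w = \<beta> v w \<oplus>\<^bsub>U\<^esub> \<beta> v' w"
        "\<And>a v w. a \<in> carrier K \<Longrightarrow> v \<in> carrier V \<Longrightarrow> w \<in> carrier W \<Longrightarrow> \<beta> v (a \<odot>\<^bsub>W\<^esub> w) = a \<odot>\<^bsub>U\<^esub> \<beta> v w"
        "\<And>a v w. a \<in> carrier K \<Longrightarrow> v \<in> carrier V \<Longrightarrow> w \<in> carrier W \<Longrightarrow> \<beta> (a \<odot>\<^bsub>V\<^esub> v) w = a \<odot>\<^bsub>U\<^esub> \<beta> v w"
        using klinD(4,5)[OF b(5)] klinD(4,5)[OF b(6)] by auto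
      then show "{free_gen K V W (v \<oplus>\<^bsub>V\<^esub> v') w \<ominus>\<^bsub>free_mod K V W\<^esub> (free_gen K V W v w \<oplus>\<^bsub>free_mod K V W\<^esub> free_gen K V W v' w) |
        v v' w. v \<in> carrier V \<and> v' \<in> carrier V \<and> w \<in> carrier W} \<union>
     {free_gen K V W v (w \<oplus>\<^bsub>W\<^esub> w') \<ominus>\<^bsub>free_mod K V W\<^esub> (free_gen K V W v w \<oplus>\<^bsub>free_mod K V W\<^esub> free_gen K V W v w') |
        v w w'. v \<in> carrier V \<and> w \<in> carrier W \<and> w' \<in> carrier W} \<union>
     {free_gen K V W (a \<odot>\<^bsub>V\<^esub> v) w \<ominus>\<^bsub>free_mod K V W\<^esub> (a \<odot>\<^bsub>free_mod K V W\<^esub> free_gen K V W v w) |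
        a v w. a \<in> carrier K \<and> v \<in> carrier V \<and> w \<in> carrier W} \<union>
     {free_gen K V W v (a \<odot>\<^bsub>W\<^esub> w) \<ominus>\<^bsub>free_mod K V W\<^esub> (a \<odot>\<^bsub>free_mod K V W\<^esub> free_gen K V W v w) |
        a v w. a \<in> carrier K \<and> v \<in> carrier V \<and> w \<in> carrier W}
       \<subseteq> {x \<in> carrier (free_mod K V W). g x = \<zero>\<^bsub>U\<^esub>}"
        using b(3,4) by (auto simp: gD(4,5,8) gv s)
    qed
  qed
  then have ker: "\<And>x. x \<in> carrier (free_mod K V W) \<Longrightarrow> ?p x = \<zero>\<^bsub>V \<otimes>\<^sub>K W\<^esub> \<Longrightarrow> g x = \<zero>\<^bsub>U\<^esub>"
    using sq(3) by auto
  note f = lin_factor[OF sq(1,2) g ker]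
  let ?h = "restrict (\<lambda>y. g (inv_into (carrier (free_mod K V W)) ?p y)) (carrier (V \<otimes>\<^sub>K W))"
  have "?h \<in> Lin K (V \<otimes>\<^sub>K W) U \<and> (\<forall>v \<in> carrier V. \<forall>w \<in> carrier W. ?h (tens K V W v w) = \<beta> v w)"
    using f b(3) gv free_gen_in tens_closed by (auto simp: Lin_iff tens_eq_sproj)
  then show "\<exists>h. h \<in> Lin K (V \<otimes>\<^sub>K W) U \<and> (\<forall>v \<in> carrier V. \<forall>w \<in> carrier W. h (tens K V W v w) = \<beta> v w)"
    by blast
  fix h h' assume hh: "h \<in> Lin K (V \<otimes>\<^sub>K W) U \<and> (\<forall>v \<in> carrier V. \<forall>w \<in> carrier W. h (tens K V W v w) = \<beta> v w)"
    "h' \<in> Lin K (V \<otimes>\<^sub>K W) U \<and> (\<forall>v \<in> carrier V. \<forall>w \<in> carrier W. h' (tens K V W v w) = \<beta> v w)"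
  show "h = h'"
    by (rule extensionalityI[of _ "carrier (V \<otimes>\<^sub>K W)"])
      (use hh b(3) in \<open>auto simp: Lin_iff intro: tensor_eq[of U h h']\<close>)
qed

lemma tlift_props:
  assumes "bilin V W U \<beta>"
  shows "klin (V \<otimes>\<^sub>K W) U (tlift K V W U \<beta>)"
    and "tlift K V W U \<beta> \<in> extensional (carrier (V \<otimes>\<^sub>K W))"
    and "v \<in> carrier V \<Longrightarrow> w \<in> carrier W \<Longrightarrow> tlift K V W U \<beta> (tens K V W v w) = \<beta> v w"
  using theI'[OF tlift_ex1[OF assms], folded tlift_def] bilinD(3)[OF assms] by (auto simp: Lin_iff)

end

section \<open>The calculus of Sweedler sums\<close>

lemma tlift_tens [simp]:
  assumes "bilin V W U \<beta>" "v \<in> carrier V" "w \<in> carrier W"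
  shows "tlift K V W U \<beta> (tens K V W v w) = \<beta> v w"
  using tlift_props[OF bilinD(1,2)[OF assms(1)] assms(1)] assms by auto

lemma tlift_lin:
  assumes "bilin V W U \<beta>"
  shows "klin (V \<otimes>\<^sub>K W) U (tlift K V W U \<beta>)"
  using tlift_props[OF bilinD(1,2)[OF assms(1)] assms(1)] by auto

lemma tlift_closed:
  "t \<in> carrier (V \<otimes>\<^sub>K W) \<Longrightarrow> bilin V W U \<beta> \<Longrightarrow> tlift K V W U \<beta> t \<in> carrier U"
  using klinD(3)[OF tlift_lin] .

lemma tlift_cong:
  assumes "\<And>v w. v \<in> carrier V \<Longrightarrow> w \<in> carrier W \<Longrightarrow> \<beta> v w = \<beta>' v w"
  shows "tlift K V W U \<beta> t = tlift K V W U \<beta>' t"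
  using assms by (simp add: tlift_def)

text \<open>Both sides are linear in \<open>t\<close> and agree on pure tensors. Moving a linear map
  under the summation is the basic step of all later Sweedler computations.\<close>

lemma lin_tlift:
  assumes "klin U U' h" "bilin V W U \<beta>" "t \<in> carrier (V \<otimes>\<^sub>K W)"
  shows "h (tlift K V W U \<beta> t) = tlift K V W U' (\<lambda>v w. h (\<beta> v w)) t"
proof (rule tensor_eq[OF bilinD(1,2)[OF assms(2)] _ _ _ assms(3)])
  have b: "bilin V W U' (\<lambda>v w. h (\<beta> v w))"
    using bilinD[OF assms(2)] by (intro bilinI klin_comp[OF _ assms(1)]) auto
  show "klin (V \<otimes>\<^sub>K W) U' (\<lambda>t. h (tlift K V W U \<beta> t))"
    by (rule klin_comp[OF tlift_lin[OF assms(2)] assms(1)])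
  show "klin (V \<otimes>\<^sub>K W) U' (tlift K V W U' (\<lambda>v w. h (\<beta> v w)))" by (rule tlift_lin[OF b])
  show "\<And>v w. v \<in> carrier V \<Longrightarrow> w \<in> carrier W \<Longrightarrow>
    h (tlift K V W U \<beta> (tens K V W v w)) = tlift K V W U' (\<lambda>v w. h (\<beta> v w)) (tens K V W v w)"
    using b assms by simp
qed

lemma tlift_self:
  assumes "module K V" "module K W" "t \<in> carrier (V \<otimes>\<^sub>K W)"
  shows "tlift K V W (V \<otimes>\<^sub>K W) (tens K V W) t = t"
  by (rule tensor_eq[OF assms(1,2) tlift_lin[OF tens_bilin] klin_id _ assms(3)])
    (auto simp: assms tens_bilin)

lemma tens_lin_left: "klin Y V f \<Longrightarrow> module K W \<Longrightarrow> w \<in> carrier W \<Longrightarrow> klin Y (V \<otimes>\<^sub>K W) (\<lambda>x. tens K V W (f x) w)"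
  by (rule bilin_left[OF tens_bilin]) (auto simp: klinD)

lemma tens_lin_right: "klin Y W f \<Longrightarrow> module K V \<Longrightarrow> v \<in> carrier V \<Longrightarrow> klin Y (V \<otimes>\<^sub>K W) (\<lambda>x. tens K V W v (f x))"
  by (rule bilin_right[OF tens_bilin]) (auto simp: klinD)

lemma tlift_lin_arg: "klin Y (V \<otimes>\<^sub>K W) t \<Longrightarrow> bilin V W U \<beta> \<Longrightarrow> klin Y U (\<lambda>x. tlift K V W U \<beta> (t x))"
  by (rule klin_comp[OF _ tlift_lin])

text \<open>Linearity in a parameter of the integrand, again checked on pure tensors. With
  \<open>tlift_lin_arg\<close> it lets \<open>lin_rules\<close> establish bilinearity of nested sums
  from their syntax.\<close>

lemma tlift_lin_fun:
  assumes t: "t \<in> carrier (V \<otimes>\<^sub>K W)" and Y: "module K Y"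
    and b: "\<And>x. x \<in> carrier Y \<Longrightarrow> bilin V W U (\<beta> x)"
    and l: "\<And>v w. v \<in> carrier V \<Longrightarrow> w \<in> carrier W \<Longrightarrow> klin Y U (\<lambda>x. \<beta> x v w)"
  shows "klin Y U (\<lambda>x. tlift K V W U (\<beta> x) t)"
proof -
  note bb = bilinD[OF b[of "\<zero>\<^bsub>Y\<^esub>"], OF mod_simps(1)[OF Y]]
  show ?thesis
  proof (rule klinI[OF Y bb(3)])
    show "tlift K V W U (\<beta> x) t \<in> carrier U" if "x \<in> carrier Y" for x
      using tlift_closed[OF t b] that .
    show "tlift K V W U (\<beta> (x \<oplus>\<^bsub>Y\<^esub> y)) t = tlift K V W U (\<beta> x) t \<oplus>\<^bsub>U\<^esub> tlift K V W U (\<beta> y) t"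
      if "x \<in> carrier Y" "y \<in> carrier Y" for x y
      by (rule tensor_eq[OF bb(1,2) tlift_lin klin_add[OF tlift_lin tlift_lin] _ t])
        (use that b Y klinD(4)[OF l] in auto)
    show "tlift K V W U (\<beta> (a \<odot>\<^bsub>Y\<^esub> x)) t = a \<odot>\<^bsub>U\<^esub> tlift K V W U (\<beta> x) t"
      if "a \<in> carrier K" "x \<in> carrier Y" for a x
      by (rule tensor_eq[OF bb(1,2) tlift_lin klin_smult[OF tlift_lin] _ t])
        (use that b Y klinD(5)[OF l] in auto)
  qed
qed

lemmas lin_rules = bilinI klin_id tens_lin_left tens_lin_right tlift_lin_arg tlift_lin_fun

lemma tlift_tlift:
  assumes "bilin A B U \<gamma>" "bilin V W (A \<otimes>\<^sub>K B) \<beta>" "t \<in> carrier (V \<otimes>\<^sub>K W)"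
  shows "tlift K A B U \<gamma> (tlift K V W (A \<otimes>\<^sub>K B) \<beta> t) =
    tlift K V W U (\<lambda>v w. tlift K A B U \<gamma> (\<beta> v w)) t"
  by (rule lin_tlift[OF tlift_lin]) fact+

text \<open>The inner \<open>tlift\<close> is the map f \<otimes> id, which has no notation of its
  own; the rule absorbs it into the integrand. \<open>tlift_map_right\<close> does the same for id
  \<otimes> f.\<close>

lemma tlift_map_left:
  assumes \<gamma>: "bilin A B U \<gamma>" and f: "klin V A f" and t: "t \<in> carrier (V \<otimes>\<^sub>K B)"
  shows "tlift K A B U \<gamma> (tlift K V B (A \<otimes>\<^sub>K B) (\<lambda>v w. tens K A B (f v) w) t) =
    tlift K V B U (\<lambda>v w. \<gamma> (f v) w) t"
proof -
  note m = bilinD(1,2)[OF \<gamma>]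
  have "bilin V B (A \<otimes>\<^sub>K B) (\<lambda>v w. tens K A B (f v) w)"
    by (intro lin_rules f) (use m klinD[OF f] in auto)
  then have "tlift K A B U \<gamma> (tlift K V B (A \<otimes>\<^sub>K B) (\<lambda>v w. tens K A B (f v) w) t) =
    tlift K V B U (\<lambda>v w. tlift K A B U \<gamma> (tens K A B (f v) w)) t"
    using tlift_tlift[OF \<gamma> _ t] by simp
  also have "\<dots> = tlift K V B U (\<lambda>v w. \<gamma> (f v) w) t"
    by (rule tlift_cong) (use \<gamma> klinD(3)[OF f] in simp)
  finally show ?thesis .
qed

lemma tlift_map_right:
  assumes \<gamma>: "bilin A B U \<gamma>" and f: "klin W B f" and t: "t \<in> carrier (A \<otimes>\<^sub>K W)"
  shows "tlift K A B U \<gamma> (tlift K A W (A \<otimes>\<^sub>K B) (\<lambda>v w. tens K A B v (f w)) t) =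
    tlift K A W U (\<lambda>v w. \<gamma> v (f w)) t"
proof -
  note m = bilinD(1,2)[OF \<gamma>]
  have "bilin A W (A \<otimes>\<^sub>K B) (\<lambda>v w. tens K A B v (f w))"
    by (intro lin_rules f) (use m klinD[OF f] in auto)
  then have "tlift K A B U \<gamma> (tlift K A W (A \<otimes>\<^sub>K B) (\<lambda>v w. tens K A B v (f w)) t) =
    tlift K A W U (\<lambda>v w. tlift K A B U \<gamma> (tens K A B v (f w))) t"
    using tlift_tlift[OF \<gamma> _ t] by simp
  also have "\<dots> = tlift K A W U (\<lambda>v w. \<gamma> v (f w)) t"
    by (rule tlift_cong) (use \<gamma> klinD(3)[OF f] in simp)
  finally show ?thesis .
qed

definition trilin where
  "trilin A B D U F \<longleftrightarrow> module K A \<and> module K B \<and> module K D \<and>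
    (\<forall>a \<in> carrier A. bilin B D U (\<lambda>b d. F a b d)) \<and>
    (\<forall>b \<in> carrier B. \<forall>d \<in> carrier D. klin A U (\<lambda>a. F a b d))"

lemma trilinI:
  assumes "module K A" "module K B" "module K D"
    and "\<And>a b. a \<in> carrier A \<Longrightarrow> b \<in> carrier B \<Longrightarrow> klin D U (\<lambda>d. F a b d)"
    and "\<And>a d. a \<in> carrier A \<Longrightarrow> d \<in> carrier D \<Longrightarrow> klin B U (\<lambda>b. F a b d)"
    and "\<And>b d. b \<in> carrier B \<Longrightarrow> d \<in> carrier D \<Longrightarrow> klin A U (\<lambda>a. F a b d)"
  shows "trilin A B D U F"
  using assms by (auto simp: trilin_def intro!: bilinI)

lemma trilinD:
  assumes "trilin A B D U F"
  shows "module K A" "module K B" "module K D" "module K U"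
    and "a \<in> carrier A \<Longrightarrow> b \<in> carrier B \<Longrightarrow> d \<in> carrier D \<Longrightarrow> F a b d \<in> carrier U"
    and "a \<in> carrier A \<Longrightarrow> bilin B D U (F a)"
    and "klin Y D f \<Longrightarrow> a \<in> carrier A \<Longrightarrow> b \<in> carrier B \<Longrightarrow> klin Y U (\<lambda>x. F a b (f x))"
    and "klin Y B f \<Longrightarrow> a \<in> carrier A \<Longrightarrow> d \<in> carrier D \<Longrightarrow> klin Y U (\<lambda>x. F a (f x) d)"
    and "klin Y A f \<Longrightarrow> b \<in> carrier B \<Longrightarrow> d \<in> carrier D \<Longrightarrow> klin Y U (\<lambda>x. F (f x) b d)"
proof -
  show m: "module K A" "module K B" "module K D" and b: "a \<in> carrier A \<Longrightarrow> bilin B D U (F a)" for a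
    using assms by (auto simp: trilin_def)
  show "module K U" using bilinD(3)[OF b[OF mod_simps(1)[OF m(1)]]] .
  show "a \<in> carrier A \<Longrightarrow> b \<in> carrier B \<Longrightarrow> d \<in> carrier D \<Longrightarrow> F a b d \<in> carrier U"
    using bilinD(4)[OF b] .
  show "klin Y D f \<Longrightarrow> a \<in> carrier A \<Longrightarrow> b \<in> carrier B \<Longrightarrow> klin Y U (\<lambda>x. F a b (f x))"
    by (rule bilin_right[OF b])
  show "klin Y B f \<Longrightarrow> a \<in> carrier A \<Longrightarrow> d \<in> carrier D \<Longrightarrow> klin Y U (\<lambda>x. F a (f x) d)"
    by (rule bilin_left[OF b])
  show "klin Y A f \<Longrightarrow> b \<in> carrier B \<Longrightarrow> d \<in> carrier D \<Longrightarrow> klin Y U (\<lambda>x. F (f x) b d)"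
    using assms klin_comp[of Y A f U "\<lambda>a. F a b d"] by (auto simp: trilin_def)
qed

text \<open>Fubini for two independent Sweedler sums: linear in \<open>t\<close>, and evident when
  \<open>t\<close> is a pure tensor.\<close>

lemma tlift_swap:
  assumes t: "t \<in> carrier (V \<otimes>\<^sub>K W)" and s: "s \<in> carrier (A \<otimes>\<^sub>K B)"
    and m: "module K V" "module K W" "module K A" "module K B"
    and 1: "\<And>a b. a \<in> carrier A \<Longrightarrow> b \<in> carrier B \<Longrightarrow> bilin V W U (\<lambda>v w. F v w a b)"
    and 2: "\<And>v w. v \<in> carrier V \<Longrightarrow> w \<in> carrier W \<Longrightarrow> bilin A B U (\<lambda>a b. F v w a b)"
  shows "tlift K V W U (\<lambda>v w. tlift K A B U (\<lambda>a b. F v w a b) s) t =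
    tlift K A B U (\<lambda>a b. tlift K V W U (\<lambda>v w. F v w a b) t) s"
proof -
  have b: "bilin V W U (\<lambda>v w. tlift K A B U (\<lambda>a b. F v w a b) s)"
    using m by (intro bilinI tlift_lin_fun s 2 bilinD(5,6)[OF 1])
  show ?thesis
  proof (rule tensor_eq[OF m(1,2) tlift_lin[OF b] _ _ t])
    show "klin (V \<otimes>\<^sub>K W) U (\<lambda>t. tlift K A B U (\<lambda>a b. tlift K V W U (\<lambda>v w. F v w a b) t) s)"
      using m by (intro tlift_lin_fun[OF s] tlift_lin_arg klin_id 1 bilinI)
        (auto intro!: tlift_lin_fun 1 bilinD(5,6)[OF 2])
    show "tlift K V W U (\<lambda>v w. tlift K A B U (\<lambda>a b. F v w a b) s) (tens K V W v w) =
       tlift K A B U (\<lambda>a b. tlift K V W U (\<lambda>v w. F v w a b) (tens K V W v w)) s"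
      if "v \<in> carrier V" "w \<in> carrier W" for v w
      using b 1 that by (auto intro!: tlift_cong)
  qed
qed

end

section \<open>Comodules\<close>

locale coalg = universe K for K :: "'u ring" (structure) +
  fixes C :: "'u coalg"
  assumes coalgebra_C: "coalgebra K C"
begin

lemma C_module [simp]: "module K C"
  and comult_klin: "klin C (C \<otimes>\<^sub>K C) (comult C)"
  and counit_klin: "klin C (self_mod K) (counit C)"
proof -
  show C: "module K C" using coalgebra_C by (auto simp: coalgebra_def Let_def)
  show "klin C (C \<otimes>\<^sub>K C) (comult C)" "klin C (self_mod K) (counit C)"
    using coalgebra_C C by (auto simp: coalgebra_def Let_def klin_def self_mod_module)
qed

lemma comult_closed [simp]: "c \<in> carrier C \<Longrightarrow> comult C c \<in> carrier (C \<otimes>\<^sub>K C)"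
  using klinD(3)[OF comult_klin] .

lemma counit_closed [simp]: "c \<in> carrier C \<Longrightarrow> counit C c \<in> carrier K"
  using klinD(3)[OF counit_klin] by simp

lemma comult_lin: "klin Y C f \<Longrightarrow> klin Y (C \<otimes>\<^sub>K C) (\<lambda>x. comult C (f x))"
  by (rule klin_comp[OF _ comult_klin])

lemma counit_lin: "klin Y C f \<Longrightarrow> module K V \<Longrightarrow> v \<in> carrier V \<Longrightarrow> klin Y V (\<lambda>x. counit C (f x) \<odot>\<^bsub>V\<^esub> v)"
  by (rule klin_smult_left[OF klin_comp[OF _ counit_klin]])

text \<open>A linear coaction without axioms. Colinear maps already make sense at this level, and
  the axioms for constructed comodules are derived from such maps.\<close>

definition precomod :: "'u comod \<Rightarrow> bool" where
  "precomod V \<longleftrightarrow> module K V \<and> klin V (V \<otimes>\<^sub>K C) (coact V)"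

text \<open>Both comodule axioms at a single element, so that they can be checked on generators and
  moved along colinear maps.\<close>

definition comod_at :: "'u comod \<Rightarrow> 'u \<Rightarrow> bool" where
  "comod_at V v \<longleftrightarrow>
    tlift K V C (V \<otimes>\<^sub>K (C \<otimes>\<^sub>K C)) (\<lambda>v0 c. tens K V (C \<otimes>\<^sub>K C) v0 (comult C c)) (coact V v)
      = tlift K V C (V \<otimes>\<^sub>K (C \<otimes>\<^sub>K C))
          (\<lambda>v' c. tlift K V C (V \<otimes>\<^sub>K (C \<otimes>\<^sub>K C)) (\<lambda>v0 v1. tens K V (C \<otimes>\<^sub>K C) v0 (tens K C C v1 c)) (coact V v'))
          (coact V v) \<and>
    tlift K V C V (\<lambda>v0 v1. counit C v1 \<odot>\<^bsub>V\<^esub> v0) (coact V v) = v"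

lemma comodule_iff: "comodule K C V \<longleftrightarrow> precomod V \<and> (\<forall>v \<in> carrier V. comod_at V v)"
  by (auto simp: comodule_def precomod_def comod_at_def klin_def Let_def)

lemma precomodD:
  assumes "precomod V"
  shows "module K V" "klin V (V \<otimes>\<^sub>K C) (coact V)"
    and "v \<in> carrier V \<Longrightarrow> coact V v \<in> carrier (V \<otimes>\<^sub>K C)"
    and "klin Y V f \<Longrightarrow> klin Y (V \<otimes>\<^sub>K C) (\<lambda>x. coact V (f x))"
  using assms klinD(3)[of V "V \<otimes>\<^sub>K C" "coact V"] klin_comp[of Y V f _ "coact V"]
  by (auto simp: precomod_def)

lemma comoduleD:
  assumes "comodule K C V"
  shows "precomod V" "module K V" "klin V (V \<otimes>\<^sub>K C) (coact V)"
    and "v \<in> carrier V \<Longrightarrow> coact V v \<in> carrier (V \<otimes>\<^sub>K C)"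
    and "klin Y V f \<Longrightarrow> klin Y (V \<otimes>\<^sub>K C) (\<lambda>x. coact V (f x))"
    and "v \<in> carrier V \<Longrightarrow> comod_at V v"
proof -
  show p: "precomod V" "v \<in> carrier V \<Longrightarrow> comod_at V v" using assms by (auto simp: comodule_iff)
  show "module K V" "klin V (V \<otimes>\<^sub>K C) (coact V)"
    "v \<in> carrier V \<Longrightarrow> coact V v \<in> carrier (V \<otimes>\<^sub>K C)"
    "klin Y V f \<Longrightarrow> klin Y (V \<otimes>\<^sub>K C) (\<lambda>x. coact V (f x))" using precomodD[OF p(1)] by auto
qed

text \<open>Each axiom equates two expressions linear in the element, so the elements satisfying it
  form a subspace.\<close>

lemma comodule_gens:
  assumes V: "precomod V" and S: "gens V S" and at: "\<And>v. v \<in> S \<Longrightarrow> comod_at V v"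
  shows "comodule K C V"
  unfolding comodule_iff
proof (intro conjI ballI V)
  note p = precomodD[OF V]
  note [simp] = p(1)
  have "submodule {v \<in> carrier V. tlift K V C (V \<otimes>\<^sub>K (C \<otimes>\<^sub>K C)) (\<lambda>v0 c. tens K V (C \<otimes>\<^sub>K C) v0 (comult C c)) (coact V v)
      = tlift K V C (V \<otimes>\<^sub>K (C \<otimes>\<^sub>K C))
          (\<lambda>v' c. tlift K V C (V \<otimes>\<^sub>K (C \<otimes>\<^sub>K C)) (\<lambda>v0 v1. tens K V (C \<otimes>\<^sub>K C) v0 (tens K C C v1 c)) (coact V v'))
          (coact V v)} K V" (is "submodule ?A K V")
    by (rule submod_eq[where W = "V \<otimes>\<^sub>K (C \<otimes>\<^sub>K C)"]; intro lin_rules comult_lin p(3,4)) auto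
  moreover have "submodule {v \<in> carrier V. tlift K V C V (\<lambda>v0 v1. counit C v1 \<odot>\<^bsub>V\<^esub> v0) (coact V v) = v} K V"
    (is "submodule ?B K V")
    by (rule submod_eq[where W = V]; intro lin_rules counit_lin klin_smult p(3,4)) auto
  moreover have "S \<subseteq> ?A" "S \<subseteq> ?B" using at S by (auto simp: comod_at_def gens_def)
  ultimately show "comod_at V v" if "v \<in> carrier V" for v
    using gens_induct[OF S _ _ that] unfolding comod_at_def by blast
qed

section \<open>Colinear maps\<close>

definition colin_at :: "'u comod \<Rightarrow> 'u comod \<Rightarrow> ('u \<Rightarrow> 'u) \<Rightarrow> 'u \<Rightarrow> bool" where
  "colin_at V W f v \<longleftrightarrow>
    coact W (f v) = tlift K V C (W \<otimes>\<^sub>K C) (\<lambda>v0 v1. tens K W C (f v0) v1) (coact V v)"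

definition colin :: "'u comod \<Rightarrow> 'u comod \<Rightarrow> ('u \<Rightarrow> 'u) \<Rightarrow> bool" where
  "colin V W f \<longleftrightarrow> precomod V \<and> precomod W \<and> klin V W f \<and> (\<forall>v \<in> carrier V. colin_at V W f v)"

lemma colinD:
  assumes "colin V W f"
  shows "precomod V" "precomod W" "klin V W f" "v \<in> carrier V \<Longrightarrow> f v \<in> carrier W"
    and "v \<in> carrier V \<Longrightarrow>
      coact W (f v) = tlift K V C (W \<otimes>\<^sub>K C) (\<lambda>v0 v1. tens K W C (f v0) v1) (coact V v)"
  using assms klinD(3)[of V W f v] by (auto simp: colin_def colin_at_def)

lemma comod_maps_iff:
  assumes "precomod V" "precomod W"
  shows "f \<in> comod_maps K C V W \<longleftrightarrow> colin V W f \<and> f \<in> extensional (carrier V)"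
  using assms precomodD(1)[OF assms(1)] precomodD(1)[OF assms(2)]
  by (auto simp: comod_maps_def colin_def colin_at_def Lin_iff)

lemma colin_gens:
  assumes V: "precomod V" "precomod W" and f: "klin V W f"
    and S: "gens V S" and at: "\<And>v. v \<in> S \<Longrightarrow> colin_at V W f v"
  shows "colin V W f"
  unfolding colin_def
proof (intro conjI ballI V f)
  note p = precomodD[OF V(1)] and q = precomodD[OF V(2)]
  note [simp] = p(1) q(1)
  have "submodule {v \<in> carrier V. coact W (f v) =
      tlift K V C (W \<otimes>\<^sub>K C) (\<lambda>v0 v1. tens K W C (f v0) v1) (coact V v)} K V" (is "submodule ?A K V")
    by (rule submod_eq[where W = "W \<otimes>\<^sub>K C"]; intro lin_rules p(3,4) q(3,4) f)
      (auto intro: klinD[OF f])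
  moreover have "S \<subseteq> ?A" using at S by (auto simp: colin_at_def gens_def)
  ultimately show "colin_at V W f v" if "v \<in> carrier V" for v
    using gens_induct[OF S _ _ that] unfolding colin_at_def by blast
qed

lemma colin_cong:
  assumes "colin V W f" "\<And>v. v \<in> carrier V \<Longrightarrow> f v = g v"
  shows "colin V W g"
proof -
  have "tlift K V C (W \<otimes>\<^sub>K C) (\<lambda>v0 v1. tens K W C (f v0) v1) t =
    tlift K V C (W \<otimes>\<^sub>K C) (\<lambda>v0 v1. tens K W C (g v0) v1) t" for t
    by (rule tlift_cong) (use assms(2) in auto)
  then show ?thesis
    using assms klin_cong[OF colinD(3)[OF assms(1)] assms(2)] by (auto simp: colin_def colin_at_def)
qed

lemma colin_restrict [simp]: "colin V W (restrict f (carrier V)) \<longleftrightarrow> colin V W f"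
  by (auto intro: colin_cong)

lemma colin_id: "precomod V \<Longrightarrow> colin V V (\<lambda>v. v)"
  by (auto simp: colin_def colin_at_def precomodD klin_id tlift_self)

lemma colin_zero:
  assumes "precomod V" "precomod W"
  shows "colin V W (\<lambda>v. \<zero>\<^bsub>W\<^esub>)"
  unfolding colin_def colin_at_def
proof (intro conjI ballI assms)
  note p = precomodD[OF assms(1)] and q = precomodD[OF assms(2)]
  note [simp] = p(1) q(1)
  show "klin V W (\<lambda>v. \<zero>\<^bsub>W\<^esub>)" by (rule klin_zero) auto
  have z: "tens K W C \<zero>\<^bsub>W\<^esub> c = \<zero>\<^bsub>W \<otimes>\<^sub>K C\<^esub>" if "c \<in> carrier C" for c
    using klinD(6)[OF bilinD(6)[OF tens_bilin[of W C] that]] by simp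
  fix v assume v: "v \<in> carrier V"
  have "tlift K V C (W \<otimes>\<^sub>K C) (\<lambda>v0 v1. tens K W C \<zero>\<^bsub>W\<^esub> v1) (coact V v) =
    tlift K V C (W \<otimes>\<^sub>K C) (\<lambda>v0 v1. \<zero>\<^bsub>W \<otimes>\<^sub>K C\<^esub>) (coact V v)"
    by (rule tlift_cong) (simp add: z)
  also have "\<dots> = \<zero>\<^bsub>W \<otimes>\<^sub>K C\<^esub>"
    by (rule tensor_eq[where f = "tlift K V C (W \<otimes>\<^sub>K C) (\<lambda>v0 v1. \<zero>\<^bsub>W \<otimes>\<^sub>K C\<^esub>)" and U = "W \<otimes>\<^sub>K C"])
      (use p(3)[OF v] in \<open>auto intro!: tlift_lin bilinI klin_zero tlift_tens\<close>)
  finally show "coact W \<zero>\<^bsub>W\<^esub> = tlift K V C (W \<otimes>\<^sub>K C) (\<lambda>v0 v1. tens K W C \<zero>\<^bsub>W\<^esub> v1) (coact V v)"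
    using klinD(6)[OF q(2)] by simp
qed

lemma colin_comp:
  assumes f: "colin U V f" and g: "colin V W g"
  shows "colin U W (\<lambda>x. g (f x))"
  unfolding colin_def colin_at_def
proof (intro conjI ballI)
  show pre: "precomod U" "precomod W" using f g by (auto simp: colin_def)
  note p = precomodD[OF pre(1)] and q = precomodD[OF colinD(2)[OF f]] and r = precomodD[OF pre(2)]
  note [simp] = p(1) q(1) r(1) colinD(4)[OF f] colinD(4)[OF g]
  show "klin U W (\<lambda>x. g (f x))" by (rule klin_comp[OF colinD(3)[OF f] colinD(3)[OF g]])
  fix x assume x: "x \<in> carrier U"
  note cf = klin_comp[OF _ colinD(3)[OF f]] and cg = klin_comp[OF _ colinD(3)[OF g]]
  have b: "bilin V C (W \<otimes>\<^sub>K C) (\<lambda>v0 v1. tens K W C (g v0) v1)"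
    by (intro lin_rules cg) auto
  have "coact W (g (f x)) = tlift K V C (W \<otimes>\<^sub>K C) (\<lambda>v0 v1. tens K W C (g v0) v1) (coact V (f x))"
    using colinD(5)[OF g] x by simp
  also have "\<dots> = tlift K U C (W \<otimes>\<^sub>K C) (\<lambda>x0 x1. tlift K V C (W \<otimes>\<^sub>K C)
      (\<lambda>v0 v1. tens K W C (g v0) v1) (tens K V C (f x0) x1)) (coact U x)"
    unfolding colinD(5)[OF f x]
    by (rule tlift_tlift[OF b]; (intro lin_rules cf p(3))?) (use x in auto)
  also have "\<dots> = tlift K U C (W \<otimes>\<^sub>K C) (\<lambda>x0 x1. tens K W C (g (f x0)) x1) (coact U x)"
    by (rule tlift_cong) (simp add: tlift_tens[OF b])
  finally show "coact W (g (f x)) = tlift K U C (W \<otimes>\<^sub>K C) (\<lambda>x0 x1. tens K W C (g (f x0)) x1) (coact U x)" .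
qed

text \<open>Colinearity in the form in which it is used: under any bilinear expression, the Sweedler
  factors of \<open>f v\<close> may be replaced by \<open>f v0\<close> and
  \<open>v1\<close>.\<close>

lemma colin_bind:
  assumes f: "colin V W f" and \<gamma>: "bilin W C U \<gamma>" and v: "v \<in> carrier V"
  shows "tlift K W C U \<gamma> (coact W (f v)) = tlift K V C U (\<lambda>v0 v1. \<gamma> (f v0) v1) (coact V v)"
  unfolding colinD(5)[OF f v]
  by (rule tlift_map_left[OF \<gamma> colinD(3)[OF f] precomodD(3)[OF colinD(1)[OF f] v]])

text \<open>Apply f \<otimes> id to the coassociativity axiom at \<open>v\<close>, and
  \<open>f\<close> to the counit axiom. Targets covered by colinear maps from comodules, such as
  sums and cokernels, thus satisfy the axioms.\<close>

lemma comod_at_colin: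
  assumes V: "comodule K C V" and f: "colin V W f" and v: "v \<in> carrier V"
  shows "comod_at W (f v)"
proof -
  note p = comoduleD[OF V] and q = precomodD[OF colinD(2)[OF f]]
  note [simp] = p(2) q(1) colinD(4)[OF f] p(4) q(3)
  note cf = klin_comp[OF _ colinD(3)[OF f]]
  let ?CC = "C \<otimes>\<^sub>K C"
  let ?L = "tlift K V ?CC (W \<otimes>\<^sub>K ?CC) (\<lambda>v0 y. tens K W ?CC (f v0) y)"
  have L: "bilin V ?CC (W \<otimes>\<^sub>K ?CC) (\<lambda>v0 y. tens K W ?CC (f v0) y)"
    by (intro lin_rules cf) auto
  note at = p(6)[OF v, unfolded comod_at_def]
  have "tlift K W C (W \<otimes>\<^sub>K ?CC) (\<lambda>w0 c. tens K W ?CC w0 (comult C c)) (coact W (f v)) =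
    tlift K V C (W \<otimes>\<^sub>K ?CC) (\<lambda>v0 v1. tens K W ?CC (f v0) (comult C v1)) (coact V v)"
    by (rule colin_bind[OF f _ v]; (intro lin_rules comult_lin)?) auto
  also have "\<dots> = ?L (tlift K V C (V \<otimes>\<^sub>K ?CC) (\<lambda>v0 c. tens K V ?CC v0 (comult C c)) (coact V v))"
    by (rule tlift_map_right[OF L comult_klin, symmetric]) (use v in auto)
  also have "\<dots> = ?L (tlift K V C (V \<otimes>\<^sub>K ?CC)
          (\<lambda>v' c. tlift K V C (V \<otimes>\<^sub>K ?CC) (\<lambda>v0 v1. tens K V ?CC v0 (tens K C C v1 c)) (coact V v'))
          (coact V v))"
    using at by simp
  also have "\<dots> = tlift K V C (W \<otimes>\<^sub>K ?CC) (\<lambda>v' c.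
      ?L (tlift K V C (V \<otimes>\<^sub>K ?CC) (\<lambda>v0 v1. tens K V ?CC v0 (tens K C C v1 c)) (coact V v'))) (coact V v)"
    by (rule lin_tlift[OF tlift_lin[OF L]]; (intro lin_rules p(5))?) (use v in auto)
  also have "\<dots> = tlift K V C (W \<otimes>\<^sub>K ?CC) (\<lambda>v' c.
      tlift K W C (W \<otimes>\<^sub>K ?CC) (\<lambda>w0 w1. tens K W ?CC w0 (tens K C C w1 c)) (coact W (f v'))) (coact V v)"
  proof (rule tlift_cong)
    fix v' c assume v': "v' \<in> carrier V" and c: "c \<in> carrier C"
    have "?L (tlift K V C (V \<otimes>\<^sub>K ?CC) (\<lambda>v0 v1. tens K V ?CC v0 (tens K C C v1 c)) (coact V v')) =
      tlift K V C (W \<otimes>\<^sub>K ?CC) (\<lambda>v0 v1. tens K W ?CC (f v0) (tens K C C v1 c)) (coact V v')"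
      by (rule tlift_map_right[OF L]; (intro lin_rules)?) (use v' c in auto)
    also have "\<dots> = tlift K W C (W \<otimes>\<^sub>K ?CC) (\<lambda>w0 w1. tens K W ?CC w0 (tens K C C w1 c)) (coact W (f v'))"
      by (rule colin_bind[OF f _ v', symmetric]; (intro lin_rules)?) (use c in auto)
    finally show "?L (tlift K V C (V \<otimes>\<^sub>K ?CC) (\<lambda>v0 v1. tens K V ?CC v0 (tens K C C v1 c)) (coact V v')) =
      tlift K W C (W \<otimes>\<^sub>K ?CC) (\<lambda>w0 w1. tens K W ?CC w0 (tens K C C w1 c)) (coact W (f v'))" .
  qed
  also have "\<dots> = tlift K W C (W \<otimes>\<^sub>K ?CC) (\<lambda>w' c.
      tlift K W C (W \<otimes>\<^sub>K ?CC) (\<lambda>w0 w1. tens K W ?CC w0 (tens K C C w1 c)) (coact W w')) (coact W (f v))"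
    by (rule colin_bind[OF f _ v, symmetric]; (intro lin_rules q(4))?) auto
  finally have 1: "tlift K W C (W \<otimes>\<^sub>K ?CC) (\<lambda>w0 c. tens K W ?CC w0 (comult C c)) (coact W (f v)) =
    tlift K W C (W \<otimes>\<^sub>K ?CC) (\<lambda>w' c.
      tlift K W C (W \<otimes>\<^sub>K ?CC) (\<lambda>w0 w1. tens K W ?CC w0 (tens K C C w1 c)) (coact W w')) (coact W (f v))" .
  have e: "bilin V C V (\<lambda>v0 v1. counit C v1 \<odot>\<^bsub>V\<^esub> v0)" if "module K V" for V :: "'u comod"
    by (intro lin_rules counit_lin klin_smult) (use that in auto)
  have "tlift K W C W (\<lambda>v0 v1. counit C v1 \<odot>\<^bsub>W\<^esub> v0) (coact W (f v)) =
    tlift K V C W (\<lambda>v0 v1. counit C v1 \<odot>\<^bsub>W\<^esub> f v0) (coact V v)"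
    by (rule colin_bind[OF f e[OF q(1)] v])
  also have "\<dots> = tlift K V C W (\<lambda>v0 v1. f (counit C v1 \<odot>\<^bsub>V\<^esub> v0)) (coact V v)"
    by (rule tlift_cong) (auto simp: klinD(5)[OF colinD(3)[OF f]])
  also have "\<dots> = f (tlift K V C V (\<lambda>v0 v1. counit C v1 \<odot>\<^bsub>V\<^esub> v0) (coact V v))"
    by (rule lin_tlift[OF colinD(3)[OF f] e, symmetric]) (use v in auto)
  also have "\<dots> = f v" using at by simp
  finally show ?thesis using 1 unfolding comod_at_def by simp
qed

end

section \<open>Twisted sums\<close>

context coalg
begin

text \<open>Obtained by applying the map induced by \<open>Q\<close> to the axiom in V \<otimes> (C
  \<otimes> C). It permits the usual rebracketing of three Sweedler factors under any trilinear
  expression.\<close>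

lemma comod_coassoc:
  assumes V: "comodule K C V" and Q: "trilin V C C U Q" and v: "v \<in> carrier V"
  shows "tlift K V C U (\<lambda>v0 v1. tlift K C C U (Q v0) (comult C v1)) (coact V v) =
    tlift K V C U (\<lambda>v' c. tlift K V C U (\<lambda>v0 v1. Q v0 v1 c) (coact V v')) (coact V v)"
proof -
  note p = comoduleD[OF V] and q = trilinD[OF Q]
  note [simp] = p(2) p(4) q(4,5)
  have b: "bilin V (C \<otimes>\<^sub>K C) U (\<lambda>v0 y. tlift K C C U (Q v0) y)"
    by (intro lin_rules q(6-9)) auto
  let ?L = "tlift K V (C \<otimes>\<^sub>K C) U (\<lambda>v0 y. tlift K C C U (Q v0) y)"
  have "tlift K V C U (\<lambda>v0 v1. tlift K C C U (Q v0) (comult C v1)) (coact V v) =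
    ?L (tlift K V C (V \<otimes>\<^sub>K (C \<otimes>\<^sub>K C)) (\<lambda>v0 v1. tens K V (C \<otimes>\<^sub>K C) v0 (comult C v1)) (coact V v))"
    by (rule tlift_map_right[OF b comult_klin, symmetric]) (use v in auto)
  also have "\<dots> = ?L (tlift K V C (V \<otimes>\<^sub>K (C \<otimes>\<^sub>K C))
          (\<lambda>v' c. tlift K V C (V \<otimes>\<^sub>K (C \<otimes>\<^sub>K C)) (\<lambda>v0 v1. tens K V (C \<otimes>\<^sub>K C) v0 (tens K C C v1 c)) (coact V v'))
          (coact V v))"
    using p(6)[OF v] by (simp add: comod_at_def)
  also have "\<dots> = tlift K V C U (\<lambda>v' c. ?L (tlift K V C (V \<otimes>\<^sub>K (C \<otimes>\<^sub>K C))
      (\<lambda>v0 v1. tens K V (C \<otimes>\<^sub>K C) v0 (tens K C C v1 c)) (coact V v'))) (coact V v)"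
    by (rule lin_tlift[OF tlift_lin[OF b]]; (intro lin_rules p(5))?) (use v in auto)
  also have "\<dots> = tlift K V C U (\<lambda>v' c. tlift K V C U (\<lambda>v0 v1. Q v0 v1 c) (coact V v')) (coact V v)"
  proof (rule tlift_cong)
    fix v' c assume *: "v' \<in> carrier V" "c \<in> carrier C"
    have "?L (tlift K V C (V \<otimes>\<^sub>K (C \<otimes>\<^sub>K C)) (\<lambda>v0 v1. tens K V (C \<otimes>\<^sub>K C) v0 (tens K C C v1 c)) (coact V v'))
      = tlift K V C U (\<lambda>v0 v1. tlift K C C U (Q v0) (tens K C C v1 c)) (coact V v')"
      by (rule tlift_map_right[OF b]; (intro lin_rules)?) (use * in auto)
    also have "\<dots> = tlift K V C U (\<lambda>v0 v1. Q v0 v1 c) (coact V v')"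
      by (rule tlift_cong) (use * in \<open>auto simp: q(6)\<close>)
    finally show "?L (tlift K V C (V \<otimes>\<^sub>K (C \<otimes>\<^sub>K C)) (\<lambda>v0 v1. tens K V (C \<otimes>\<^sub>K C) v0 (tens K C C v1 c)) (coact V v'))
      = tlift K V C U (\<lambda>v0 v1. Q v0 v1 c) (coact V v')" .
  qed
  finally show ?thesis .
qed

lemma comod_counit:
  assumes "comodule K C V" "v \<in> carrier V"
  shows "tlift K V C V (\<lambda>v0 v1. counit C v1 \<odot>\<^bsub>V\<^esub> v0) (coact V v) = v"
  using comoduleD(6)[OF assms] by (simp add: comod_at_def)

definition tw :: "'u entw \<Rightarrow> 'u \<Rightarrow> 'u \<Rightarrow> 'u \<Rightarrow> 'u \<Rightarrow> 'u" where
  "tw R r s c g = psi R r s (tens K C (lhom R r s) c g)"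

text \<open>In Sweedler's notation, \<open>twsum R r s V U F v g\<close> is the sum of
  \<open>F v\<^sub>0 g\<^sub>\<psi> v\<^sub>1\<^sup>\<psi>\<close>.\<close>

definition twsum where
  "twsum R r s V U F v g = tlift K V C U
    (\<lambda>v0 v1. tlift K (lhom R r s) C U (\<lambda>g' c'. F v0 g' c') (tw R r s v1 g)) (coact V v)"

text \<open>A bilinear map \<open>b\<close> out of \<open>V \<times> \<R>(r,s)\<close> is twisted if it induces a colinear map out of
  \<open>V \<otimes> \<R>(r,s)\<close> with the coaction \<open>v \<otimes> g \<mapsto> v\<^sub>0 \<otimes> g\<^sub>\<psi> \<otimes> v\<^sub>1\<^sup>\<psi>\<close>.\<close>

definition twisted :: "'u entw \<Rightarrow> 'u \<Rightarrow> 'u \<Rightarrow> 'u comod \<Rightarrow> 'u comod \<Rightarrow> ('u \<Rightarrow> 'u \<Rightarrow> 'u) \<Rightarrow> bool" where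
  "twisted R r s V Y b \<longleftrightarrow> comodule K C V \<and> precomod Y \<and> bilin V (lhom R r s) Y b \<and>
    (\<forall>v \<in> carrier V. \<forall>g \<in> carrier (lhom R r s).
      coact Y (b v g) = twsum R r s V (Y \<otimes>\<^sub>K C) (\<lambda>v0 g' c'. tens K Y C (b v0 g') c') v g)"

lemma twsum_cong:
  assumes "\<And>v g c. v \<in> carrier V \<Longrightarrow> g \<in> carrier (lhom R r s) \<Longrightarrow> c \<in> carrier C \<Longrightarrow> F v g c = F' v g c"
  shows "twsum R r s V U F v g = twsum R r s V U F' v g"
  unfolding twsum_def by (intro tlift_cong assms)

end

section \<open>The entwining axioms under bilinear and trilinear expressions\<close>

locale entw = coalg K C for K :: "'u ring" (structure) and C :: "'u coalg" +
  fixes R :: "'u entw"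
  assumes entwining_R: "entwining K C R"
begin

lemmas entwining' = entwining_R[unfolded entwining_def Let_def, folded tw_def]

lemma hom_module [simp]: "r \<in> lob R \<Longrightarrow> s \<in> lob R \<Longrightarrow> module K (lhom R r s)"
  using entwining' by (auto simp: lin_category_def)

lemma category_R: "category (underlying R)"
  using entwining' by (auto simp: lin_category_def)

lemma id_closed [simp]: "r \<in> lob R \<Longrightarrow> lid R r \<in> carrier (lhom R r r)"
  using category.ident_in[OF category_R] by (auto simp: underlying_def)

lemma cmp_closed [simp]:
  "r \<in> lob R \<Longrightarrow> s \<in> lob R \<Longrightarrow> t \<in> lob R \<Longrightarrow> f \<in> carrier (lhom R r s) \<Longrightarrow> g \<in> carrier (lhom R s t) \<Longrightarrow>
    lcmp R r s t g f \<in> carrier (lhom R r t)"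
  using category.cmp_in[OF category_R] by (auto simp: underlying_def)

lemma cmp_id [simp]:
  "r \<in> lob R \<Longrightarrow> s \<in> lob R \<Longrightarrow> f \<in> carrier (lhom R r s) \<Longrightarrow> lcmp R r r s f (lid R r) = f"
  "r \<in> lob R \<Longrightarrow> s \<in> lob R \<Longrightarrow> f \<in> carrier (lhom R r s) \<Longrightarrow> lcmp R r s s (lid R s) f = f"
  using category.cmp_ident_right[OF category_R] category.cmp_ident_left[OF category_R]
  by (auto simp: underlying_def)

lemma cmp_assoc:
  "\<lbrakk>a \<in> lob R; b \<in> lob R; c \<in> lob R; d \<in> lob R;
      f \<in> carrier (lhom R a b); g \<in> carrier (lhom R b c); h \<in> carrier (lhom R c d)\<rbrakk>
      \<Longrightarrow> lcmp R a c d h (lcmp R a b c g f) = lcmp R a b d (lcmp R b c d h g) f"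
  using category.cmp_assoc[OF category_R] by (auto simp: underlying_def)

lemma cmp_bilin:
  "r \<in> lob R \<Longrightarrow> s \<in> lob R \<Longrightarrow> t \<in> lob R \<Longrightarrow>
    bilin (lhom R s t) (lhom R r s) (lhom R r t) (\<lambda>g f. lcmp R r s t g f)"
  using entwining' by (auto simp: lin_category_def klin_def intro!: bilinI)

lemma tw_bilin:
  assumes "r \<in> lob R" "s \<in> lob R"
  shows "bilin C (lhom R r s) (lhom R r s \<otimes>\<^sub>K C) (tw R r s)"
proof -
  have p: "klin (C \<otimes>\<^sub>K lhom R r s) (lhom R r s \<otimes>\<^sub>K C) (psi R r s)"
    using entwining' assms by (auto simp: klin_def)
  show ?thesis
    unfolding tw_def by (intro bilinI klin_comp[OF _ p] tens_lin_left tens_lin_right klin_id) (use assms in auto)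
qed

lemma tw_cmp:
  assumes "r \<in> lob R" "s \<in> lob R" "t \<in> lob R" "f \<in> carrier (lhom R r s)" "g \<in> carrier (lhom R s t)"
    and "c \<in> carrier C"
  shows "tw R r t c (lcmp R r s t g f) =
    tlift K (lhom R s t) C (lhom R r t \<otimes>\<^sub>K C)
              (\<lambda>g' c'. tlift K (lhom R r s) C (lhom R r t \<otimes>\<^sub>K C)
                 (\<lambda>f' c''. tens K (lhom R r t) C (lcmp R r s t g' f') c'') (tw R r s c' f))
              (tw R s t c g)"
  using entwining' assms by blast

lemma tw_counit:
  "r \<in> lob R \<Longrightarrow> s \<in> lob R \<Longrightarrow> f \<in> carrier (lhom R r s) \<Longrightarrow> c \<in> carrier C \<Longrightarrow>
     tlift K (lhom R r s) C (lhom R r s) (\<lambda>f' c'. counit C c' \<odot>\<^bsub>lhom R r s\<^esub> f') (tw R r s c f)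
        = counit C c \<odot>\<^bsub>lhom R r s\<^esub> f"
  using entwining' by blast

lemma tw_comult:
  assumes "r \<in> lob R" "s \<in> lob R" "f \<in> carrier (lhom R r s)" "c \<in> carrier C"
  shows "tlift K (lhom R r s) C (lhom R r s \<otimes>\<^sub>K (C \<otimes>\<^sub>K C)) (\<lambda>f' c'. tens K (lhom R r s) (C \<otimes>\<^sub>K C) f' (comult C c')) (tw R r s c f)
    = tlift K C C (lhom R r s \<otimes>\<^sub>K (C \<otimes>\<^sub>K C))
            (\<lambda>c1 c2. tlift K (lhom R r s) C (lhom R r s \<otimes>\<^sub>K (C \<otimes>\<^sub>K C))
               (\<lambda>f' c2'. tlift K (lhom R r s) C (lhom R r s \<otimes>\<^sub>K (C \<otimes>\<^sub>K C))
                  (\<lambda>f'' c1'. tens K (lhom R r s) (C \<otimes>\<^sub>K C) f'' (tens K C C c1' c2')) (tw R r s c1 f'))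
               (tw R r s c2 f))
            (comult C c)"
  using entwining' assms by blast

lemma tw_id: "r \<in> lob R \<Longrightarrow> c \<in> carrier C \<Longrightarrow> tw R r r c (lid R r) = tens K (lhom R r r) C (lid R r) c"
  using entwining' by blast

context
  fixes r s assumes r [simp]: "r \<in> lob R" and s [simp]: "s \<in> lob R"
begin

private abbreviation "H \<equiv> lhom R r s"

lemmas tw_lin = bilin_left[OF tw_bilin[OF r s]] bilin_right[OF tw_bilin[OF r s]]

lemma tw_closed [simp]: "c \<in> carrier C \<Longrightarrow> g \<in> carrier H \<Longrightarrow> tw R r s c g \<in> carrier (H \<otimes>\<^sub>K C)"
  using bilinD(4)[OF tw_bilin[OF r s]] .

lemma twsum_inner:
  assumes V: "comodule K C V" and F: "trilin V H C U F" and g: "g \<in> carrier H"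
  shows "bilin V C U (\<lambda>v0 v1. tlift K H C U (\<lambda>g' c'. F v0 g' c') (tw R r s v1 g))"
proof -
  note p = comoduleD[OF V] and q = trilinD[OF F]
  show ?thesis by (intro lin_rules tw_lin q(6-9)) (use p q(4,5) g in auto)
qed

lemma twsum_bilin:
  assumes V: "comodule K C V" and F: "trilin V H C U F"
  shows "bilin V H U (\<lambda>v g. twsum R r s V U F v g)"
proof -
  note p = comoduleD[OF V] and q = trilinD[OF F]
  show ?thesis
    unfolding twsum_def
    by (intro lin_rules p(5) tw_lin q(6-9) twsum_inner[OF V F]) (use p q(4,5) in auto)
qed

lemma lin_twsum:
  assumes V: "comodule K C V" and F: "trilin V H C U F" and h: "klin U U' h"
    and v: "v \<in> carrier V" and g: "g \<in> carrier H"
  shows "h (twsum R r s V U F v g) = twsum R r s V U' (\<lambda>v0 g' c'. h (F v0 g' c')) v g"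
proof -
  note p = comoduleD[OF V] and q = trilinD[OF F]
  show ?thesis
    unfolding twsum_def
    by (subst lin_tlift[OF h twsum_inner[OF V F g]], use p v in simp, intro tlift_cong lin_tlift[OF h])
      (use g q in auto)
qed

text \<open>The counterpart of \<open>colin_bind\<close> for twisted bilinear maps: the linear map
  induced by \<gamma> passes under the twisted sum that expresses the coaction of
  \<open>b v g\<close>.\<close>

lemma twisted_bind:
  assumes b: "twisted R r s V Y b" and \<gamma>: "bilin Y C U \<gamma>" and v: "v \<in> carrier V" and g: "g \<in> carrier H"
  shows "tlift K Y C U \<gamma> (coact Y (b v g)) = twsum R r s V U (\<lambda>v0 g' c'. \<gamma> (b v0 g') c') v g"
proof -
  note b' = b[unfolded twisted_def]
  have V: "comodule K C V" and Y: "precomod Y" and bb: "bilin V H Y b" using b' by auto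
  note p = comoduleD[OF V] and y = precomodD[OF Y]
  note [simp] = p(2) y(1) bilinD(4)[OF bb]
  have F: "trilin V H C (Y \<otimes>\<^sub>K C) (\<lambda>v0 g' c'. tens K Y C (b v0 g') c')"
    by (intro trilinI lin_rules bilin_left[OF bb] bilin_right[OF bb]) auto
  have "tlift K Y C U \<gamma> (coact Y (b v g)) =
    tlift K Y C U \<gamma> (twsum R r s V (Y \<otimes>\<^sub>K C) (\<lambda>v0 g' c'. tens K Y C (b v0 g') c') v g)"
    using b' v g by simp
  also have "\<dots> = twsum R r s V U (\<lambda>v0 g' c'. tlift K Y C U \<gamma> (tens K Y C (b v0 g') c')) v g"
    by (rule lin_twsum[OF V F tlift_lin[OF \<gamma>] v g])
  also have "\<dots> = twsum R r s V U (\<lambda>v0 g' c'. \<gamma> (b v0 g') c') v g"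
    by (rule twsum_cong) (simp add: \<gamma>)
  finally show ?thesis .
qed

text \<open>Coassociativity of the twisted coaction. The entwining axiom for the comultiplication
  turns \<open>comult C c'\<close> into two applications of \<psi>, coassociativity of
  \<open>V\<close> regroups the factors of \<open>v\<close>, and Fubini interchanges the two
  remaining independent sums.\<close>

lemma twsum_coassoc:
  assumes V: "comodule K C V" and G: "trilin V H (C \<otimes>\<^sub>K C) U G" and v: "v \<in> carrier V" and g: "g \<in> carrier H"
  shows "twsum R r s V U (\<lambda>v0 g' c'. G v0 g' (comult C c')) v g =
    twsum R r s V U (\<lambda>v0 g' c'. twsum R r s V U (\<lambda>v0' g'' c''. G v0' g'' (tens K C C c'' c')) v0 g') v g"
proof -
  note p = comoduleD[OF V] and q = trilinD[OF G]
  note [simp] = p(2) p(4) q(4,5)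
  let ?CC = "C \<otimes>\<^sub>K C"
  \<comment> \<open>In the order of the axiom: \<psi> acts first on \<open>c2\<close> and
    \<open>g\<close>, then on \<open>c1\<close> and the resulting arrow.\<close>
  define Q where "Q v0 c1 c2 = tlift K H C U (\<lambda>f' c2'. tlift K H C U
    (\<lambda>f'' c1'. G v0 f'' (tens K C C c1' c2')) (tw R r s c1 f')) (tw R r s c2 g)" for v0 c1 c2
  have Q: "trilin V C C U Q"
    unfolding Q_def by (intro trilinI lin_rules tw_lin q(6-9)) (use g in auto)
  have 1: "tlift K H C U (\<lambda>g' c'. G v0 g' (comult C c')) (tw R r s v1 g) = tlift K C C U (Q v0) (comult C v1)"
    if v0: "v0 \<in> carrier V" and v1: "v1 \<in> carrier C" for v0 v1
  proof -
    let ?L = "tlift K H ?CC U (G v0)"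
    have b: "bilin H ?CC U (G v0)" using q(6) v0 .
    have "tlift K H C U (\<lambda>g' c'. G v0 g' (comult C c')) (tw R r s v1 g) =
      ?L (tlift K H C (H \<otimes>\<^sub>K ?CC) (\<lambda>f' c'. tens K H ?CC f' (comult C c')) (tw R r s v1 g))"
      by (rule tlift_map_right[OF b comult_klin, symmetric]) (use v1 g in auto)
    also have "\<dots> = ?L (tlift K C C (H \<otimes>\<^sub>K ?CC)
            (\<lambda>c1 c2. tlift K H C (H \<otimes>\<^sub>K ?CC)
               (\<lambda>f' c2'. tlift K H C (H \<otimes>\<^sub>K ?CC)
                  (\<lambda>f'' c1'. tens K H ?CC f'' (tens K C C c1' c2')) (tw R r s c1 f'))
               (tw R r s c2 g))
            (comult C v1))"
      by (subst tw_comult) (use v1 g in auto)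
    also have "\<dots> = tlift K C C U (\<lambda>c1 c2. ?L (tlift K H C (H \<otimes>\<^sub>K ?CC)
               (\<lambda>f' c2'. tlift K H C (H \<otimes>\<^sub>K ?CC)
                  (\<lambda>f'' c1'. tens K H ?CC f'' (tens K C C c1' c2')) (tw R r s c1 f'))
               (tw R r s c2 g))) (comult C v1)"
      by (rule lin_tlift[OF tlift_lin[OF b]]; (intro lin_rules tw_lin)?) (use v1 g in auto)
    also have "\<dots> = tlift K C C U (Q v0) (comult C v1)"
    proof (rule tlift_cong)
      fix c1 c2 assume c: "c1 \<in> carrier C" "c2 \<in> carrier C"
      have "?L (tlift K H C (H \<otimes>\<^sub>K ?CC)
               (\<lambda>f' c2'. tlift K H C (H \<otimes>\<^sub>K ?CC)
                  (\<lambda>f'' c1'. tens K H ?CC f'' (tens K C C c1' c2')) (tw R r s c1 f'))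
               (tw R r s c2 g)) =
         tlift K H C U (\<lambda>f' c2'. ?L (tlift K H C (H \<otimes>\<^sub>K ?CC)
                  (\<lambda>f'' c1'. tens K H ?CC f'' (tens K C C c1' c2')) (tw R r s c1 f')))
               (tw R r s c2 g)"
        by (rule lin_tlift[OF tlift_lin[OF b]]; (intro lin_rules tw_lin)?) (use c g in auto)
      also have "\<dots> = Q v0 c1 c2"
        unfolding Q_def
        by (intro tlift_cong, rule tlift_map_right[OF b]; (intro lin_rules)?) (use c g in auto)
      finally show "?L (tlift K H C (H \<otimes>\<^sub>K ?CC)
               (\<lambda>f' c2'. tlift K H C (H \<otimes>\<^sub>K ?CC)
                  (\<lambda>f'' c1'. tens K H ?CC f'' (tens K C C c1' c2')) (tw R r s c1 f'))
               (tw R r s c2 g)) = Q v0 c1 c2" .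
    qed
    finally show ?thesis .
  qed
  have "twsum R r s V U (\<lambda>v0 g' c'. G v0 g' (comult C c')) v g =
    tlift K V C U (\<lambda>v0 v1. tlift K C C U (Q v0) (comult C v1)) (coact V v)"
    unfolding twsum_def by (rule tlift_cong) (rule 1)
  also have "\<dots> = tlift K V C U (\<lambda>v' c. tlift K V C U (\<lambda>v0 v1. Q v0 v1 c) (coact V v')) (coact V v)"
    by (rule comod_coassoc[OF V Q v])
  also have "\<dots> = twsum R r s V U (\<lambda>v0 g' c'. twsum R r s V U (\<lambda>v0' g'' c''. G v0' g'' (tens K C C c'' c')) v0 g') v g"
    unfolding twsum_def Q_def
    by (intro tlift_cong, rule tlift_swap; (intro lin_rules tw_lin q(6-9))?) (use g in auto)
  finally show ?thesis .
qed

text \<open>The entwining axiom for the counit moves the scalar from \<open>c'\<close> to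
  \<open>v1\<close>; linearity of \<open>b\<close> in both arguments carries it over to
  \<open>v0\<close>, where the counit axiom of \<open>V\<close> removes it.\<close>

lemma twsum_counit:
  assumes V: "comodule K C V" and b: "bilin V H U b" and v: "v \<in> carrier V" and g: "g \<in> carrier H"
  shows "twsum R r s V U (\<lambda>v0 g' c'. counit C c' \<odot>\<^bsub>U\<^esub> b v0 g') v g = b v g"
proof -
  note p = comoduleD[OF V] and q = bilinD[OF b]
  note [simp] = p(2) p(4) q(3,4)
  have e: "bilin M C M (\<lambda>v0 v1. counit C v1 \<odot>\<^bsub>M\<^esub> v0)" if "module K M" for M :: "('u, 'u, 'z) module_scheme"
    by (intro lin_rules counit_lin klin_smult) (use that in auto)
  have "tlift K H C U (\<lambda>g' c'. counit C c' \<odot>\<^bsub>U\<^esub> b v0 g') (tw R r s v1 g) = b (counit C v1 \<odot>\<^bsub>V\<^esub> v0) g"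
    if v0: "v0 \<in> carrier V" and v1: "v1 \<in> carrier C" for v0 v1
  proof -
    have "tlift K H C U (\<lambda>g' c'. counit C c' \<odot>\<^bsub>U\<^esub> b v0 g') (tw R r s v1 g) =
      tlift K H C U (\<lambda>g' c'. b v0 (counit C c' \<odot>\<^bsub>H\<^esub> g')) (tw R r s v1 g)"
      by (rule tlift_cong) (use v0 klinD(5)[OF q(5)] in auto)
    also have "\<dots> = b v0 (tlift K H C H (\<lambda>g' c'. counit C c' \<odot>\<^bsub>H\<^esub> g') (tw R r s v1 g))"
      by (rule lin_tlift[OF q(5)[OF v0] e, symmetric]) (use v1 g in auto)
    also have "\<dots> = b v0 (counit C v1 \<odot>\<^bsub>H\<^esub> g)" using tw_counit[OF r s g v1] by simp
    also have "\<dots> = b (counit C v1 \<odot>\<^bsub>V\<^esub> v0) g"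
      using v0 v1 g klinD(5)[OF q(5)] klinD(5)[OF q(6)] by auto
    finally show ?thesis .
  qed
  then have "twsum R r s V U (\<lambda>v0 g' c'. counit C c' \<odot>\<^bsub>U\<^esub> b v0 g') v g =
    tlift K V C U (\<lambda>v0 v1. b (counit C v1 \<odot>\<^bsub>V\<^esub> v0) g) (coact V v)"
    unfolding twsum_def by (intro tlift_cong)
  also have "\<dots> = b (tlift K V C V (\<lambda>v0 v1. counit C v1 \<odot>\<^bsub>V\<^esub> v0) (coact V v)) g"
    by (rule lin_tlift[OF q(6)[OF g] e, symmetric]) (use v in auto)
  also have "\<dots> = b v g" using comod_counit[OF V v] by simp
  finally show ?thesis .
qed

text \<open>\<open>Y\<close> is only assumed to have a coaction; its axioms at \<open>b v g\<close>
  come from those of \<open>V\<close> and from the entwining. In this way V \<otimes> H and induced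
  modules become comodules.\<close>

lemma twisted_comod_at:
  assumes b: "twisted R r s V Y b" and v: "v \<in> carrier V" and g: "g \<in> carrier H"
  shows "comod_at Y (b v g)"
proof -
  note b' = b[unfolded twisted_def]
  have V: "comodule K C V" and Y: "precomod Y" and bb: "bilin V H Y b" using b' by auto
  note p = comoduleD[OF V] and y = precomodD[OF Y]
  note [simp] = p(2) y(1,3) bilinD(4)[OF bb]
  let ?CC = "C \<otimes>\<^sub>K C"
  have G: "trilin V H ?CC (Y \<otimes>\<^sub>K ?CC) (\<lambda>v0 g' z. tens K Y ?CC (b v0 g') z)"
    by (intro trilinI lin_rules bilin_left[OF bb] bilin_right[OF bb]) auto
  have "tlift K Y C (Y \<otimes>\<^sub>K ?CC) (\<lambda>v0 c. tens K Y ?CC v0 (comult C c)) (coact Y (b v g)) =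
    twsum R r s V (Y \<otimes>\<^sub>K ?CC) (\<lambda>v0 g' c'. tens K Y ?CC (b v0 g') (comult C c')) v g"
    by (rule twisted_bind[OF b _ v g]; (intro lin_rules comult_lin)?) auto
  also have "\<dots> = twsum R r s V (Y \<otimes>\<^sub>K ?CC) (\<lambda>v0 g' c'. twsum R r s V (Y \<otimes>\<^sub>K ?CC)
      (\<lambda>v0' g'' c''. tens K Y ?CC (b v0' g'') (tens K C C c'' c')) v0 g') v g"
    by (rule twsum_coassoc[OF V G v g])
  also have "\<dots> = twsum R r s V (Y \<otimes>\<^sub>K ?CC) (\<lambda>v0 g' c'.
      tlift K Y C (Y \<otimes>\<^sub>K ?CC) (\<lambda>v0 v1. tens K Y ?CC v0 (tens K C C v1 c')) (coact Y (b v0 g'))) v g"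
    by (rule twsum_cong, rule twisted_bind[OF b, symmetric]; (intro lin_rules)?) auto
  also have "\<dots> = tlift K Y C (Y \<otimes>\<^sub>K ?CC) (\<lambda>v' c. tlift K Y C (Y \<otimes>\<^sub>K ?CC)
      (\<lambda>v0 v1. tens K Y ?CC v0 (tens K C C v1 c)) (coact Y v')) (coact Y (b v g))"
    by (rule twisted_bind[OF b _ v g, symmetric]; (intro lin_rules y(4))?) auto
  finally have 1: "tlift K Y C (Y \<otimes>\<^sub>K ?CC) (\<lambda>v0 c. tens K Y ?CC v0 (comult C c)) (coact Y (b v g)) =
     tlift K Y C (Y \<otimes>\<^sub>K ?CC) (\<lambda>v' c. tlift K Y C (Y \<otimes>\<^sub>K ?CC)
      (\<lambda>v0 v1. tens K Y ?CC v0 (tens K C C v1 c)) (coact Y v')) (coact Y (b v g))" .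
  have "tlift K Y C Y (\<lambda>v0 v1. counit C v1 \<odot>\<^bsub>Y\<^esub> v0) (coact Y (b v g)) =
    twsum R r s V Y (\<lambda>v0 g' c'. counit C c' \<odot>\<^bsub>Y\<^esub> b v0 g') v g"
    by (rule twisted_bind[OF b _ v g]; (intro lin_rules counit_lin klin_smult)?) auto
  also have "\<dots> = b v g" by (rule twsum_counit[OF V bb v g])
  finally show ?thesis using 1 by (simp add: comod_at_def)
qed

lemma twisted_post:
  assumes b: "twisted R r s V Y b" and F: "colin Y Z F"
  shows "twisted R r s V Z (\<lambda>v g. F (b v g))"
  unfolding twisted_def
proof (intro conjI ballI)
  note b' = b[unfolded twisted_def] and f = colinD[OF F]
  show V: "comodule K C V" and Z: "precomod Z" using b' f by auto
  have bb: "bilin V H Y b" using b' by auto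
  note y = precomodD[OF f(1)] and z = precomodD[OF Z] and p = comoduleD[OF V]
  note [simp] = y(1) z(1) p(2) f(4) bilinD(4)[OF bb]
  show "bilin V H Z (\<lambda>v g. F (b v g))"
    by (intro lin_rules klin_comp[OF _ f(3)] bilin_left[OF bb] bilin_right[OF bb]) auto
  fix v g assume v: "v \<in> carrier V" and g: "g \<in> carrier H"
  show "coact Z (F (b v g)) = twsum R r s V (Z \<otimes>\<^sub>K C) (\<lambda>v0 g' c'. tens K Z C (F (b v0 g')) c') v g"
    by (subst f(5), use v g in simp, rule twisted_bind[OF b _ v g];
        (intro lin_rules klin_comp[OF _ f(3)])?) auto
qed

text \<open>Colinearity of \<open>h\<close> affects only the first Sweedler factor of
  \<open>v\<close>, while the twist acts on the second.\<close>

lemma twisted_pre: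
  assumes h: "colin V' V h" and V': "comodule K C V'" and b: "twisted R r s V Y b"
  shows "twisted R r s V' Y (\<lambda>v g. b (h v) g)"
  unfolding twisted_def
proof (intro conjI ballI V')
  note b' = b[unfolded twisted_def] and f = colinD[OF h]
  show Y: "precomod Y" using b' by auto
  have V: "comodule K C V" and bb: "bilin V H Y b" using b' by auto
  note y = precomodD[OF Y] and p = comoduleD[OF V] and p' = comoduleD[OF V']
  note [simp] = y(1) p(2) p'(2) f(4) bilinD(4)[OF bb]
  show "bilin V' H Y (\<lambda>v g. b (h v) g)"
    by (intro lin_rules bilin_left[OF bb] bilin_right[OF bb] f(3)) auto
  fix v g assume v: "v \<in> carrier V'" and g: "g \<in> carrier H"
  have "coact Y (b (h v) g) = twsum R r s V (Y \<otimes>\<^sub>K C) (\<lambda>v0 g' c'. tens K Y C (b v0 g') c') (h v) g"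
    using b' v g by auto
  also have "\<dots> = twsum R r s V' (Y \<otimes>\<^sub>K C) (\<lambda>v0 g' c'. tens K Y C (b (h v0) g') c') v g"
    unfolding twsum_def f(5)[OF v]
    by (rule tlift_map_left[OF _ f(3)]; (intro lin_rules tw_lin bilin_left[OF bb] bilin_right[OF bb])?)
      (use v g p'(4) in auto)
  finally show "coact Y (b (h v) g) =
    twsum R r s V' (Y \<otimes>\<^sub>K C) (\<lambda>v0 g' c'. tens K Y C (b (h v0) g') c') v g" .
qed

text \<open>Both coactions are given by the same twisted formula over \<open>V\<close>, and
  \<open>F\<close> matches the bilinear maps. This is the colinearity, on generators, of maps out of
  V \<otimes> H and out of induced modules.\<close>

lemma twisted_colin_at:
  assumes b: "twisted R r s V Y b" and b': "twisted R r s V Z b'" and F: "klin Y Z F"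
    and eq: "\<And>v g. v \<in> carrier V \<Longrightarrow> g \<in> carrier H \<Longrightarrow> F (b v g) = b' v g"
    and v: "v \<in> carrier V" and g: "g \<in> carrier H"
  shows "colin_at Y Z F (b v g)"
proof -
  have Y: "precomod Y" and Z: "precomod Z" using b b' by (auto simp: twisted_def)
  note y = precomodD[OF Y] and z = precomodD[OF Z]
  note [simp] = y(1) z(1) klinD(3)[OF F]
  have "coact Z (F (b v g)) = twsum R r s V (Z \<otimes>\<^sub>K C) (\<lambda>v0 g' c'. tens K Z C (b' v0 g') c') v g"
    using b' v g by (simp add: eq twisted_def)
  also have "\<dots> = twsum R r s V (Z \<otimes>\<^sub>K C) (\<lambda>v0 g' c'. tens K Z C (F (b v0 g')) c') v g"
    by (rule twsum_cong) (simp add: eq)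
  also have "\<dots> = tlift K Y C (Z \<otimes>\<^sub>K C) (\<lambda>v0 v1. tens K Z C (F v0) v1) (coact Y (b v g))"
    by (rule twisted_bind[OF b _ v g, symmetric]; (intro lin_rules F)?) auto
  finally show ?thesis by (simp add: colin_at_def)
qed

end

text \<open>By \<psi>(c \<otimes> id) = id \<otimes> c the twist disappears at an identity. The
  units of V \<otimes> H and of induction are colinear for this reason.\<close>

lemma twisted_unit:
  assumes r: "r \<in> lob R" and b: "twisted R r r V Y b"
  shows "colin V Y (\<lambda>v. b v (lid R r))"
  unfolding colin_def colin_at_def
proof (intro conjI ballI)
  note b' = b[unfolded twisted_def]
  have V: "comodule K C V" and bb: "bilin V (lhom R r r) Y b" using b' by auto
  note p = comoduleD[OF V]
  show "precomod V" "precomod Y" using p b' by auto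
  note y = precomodD[OF this(2)]
  note [simp] = y(1) p(2) r bilinD(4)[OF bb]
  show "klin V Y (\<lambda>v. b v (lid R r))" by (intro bilin_left[OF bb] klin_id) auto
  fix v assume v: "v \<in> carrier V"
  have "coact Y (b v (lid R r)) =
    twsum R r r V (Y \<otimes>\<^sub>K C) (\<lambda>v0 g' c'. tens K Y C (b v0 g') c') v (lid R r)"
    using b' v by auto
  also have "\<dots> = tlift K V C (Y \<otimes>\<^sub>K C) (\<lambda>v0 v1. tens K Y C (b v0 (lid R r)) v1) (coact V v)"
    unfolding twsum_def
    by (rule tlift_cong, subst tw_id; (subst tlift_tens)?; (intro lin_rules bilin_right[OF bb])?) (use v in auto)
  finally show "coact Y (b v (lid R r)) =
    tlift K V C (Y \<otimes>\<^sub>K C) (\<lambda>v0 v1. tens K Y C (b v0 (lid R r)) v1) (coact V v)" .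
qed

end

section \<open>Entwined modules\<close>

text \<open>Attaches a coaction to a bare module. Linear algebra reads only the module fields, so
  the rules that follow strip \<open>cmk\<close> and results for the underlying space apply
  unchanged.\<close>

abbreviation cmk :: "('u, 'u) module \<Rightarrow> ('u \<Rightarrow> 'u) \<Rightarrow> 'u comod" where
  "cmk M \<rho> \<equiv> module.extend M (comod.fields \<rho>)"

lemma cmk_simps [simp]:
  "carrier (cmk M \<rho>) = carrier M" "\<zero>\<^bsub>cmk M \<rho>\<^esub> = \<zero>\<^bsub>M\<^esub>" "x \<oplus>\<^bsub>cmk M \<rho>\<^esub> y = x \<oplus>\<^bsub>M\<^esub> y"
  "a \<odot>\<^bsub>cmk M \<rho>\<^esub> x = a \<odot>\<^bsub>M\<^esub> x" "coact (cmk M \<rho>) = \<rho>"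
  by (simp_all add: module.defs comod.defs)

lemma module_cmk [simp]: "module K (cmk M \<rho>) \<longleftrightarrow> module K M"
  unfolding module_def abelian_group_def abelian_monoid_def abelian_group_axioms_def module_axioms_def
    comm_group_def comm_monoid_def comm_monoid_axioms_def group_def monoid_def group_axioms_def Units_def
  by simp

lemma lin_map_cmk_left [simp]: "lin_map K (cmk M \<rho>) N f \<longleftrightarrow> lin_map K M N f"
  by (simp add: lin_map_def)

lemma lin_map_cmk_right [simp]: "lin_map K N (cmk M \<rho>) f \<longleftrightarrow> lin_map K N M f"
  by (simp add: lin_map_def)

lemma mspan_cmk [simp]: "mspan K (cmk M \<rho>) S = mspan K M S"
  by (simp add: mspan_def submodule_def submodule_axioms_def subgroup_def m_inv_def)

lemma tensor_cmk [simp]: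
  "tensor K (cmk M \<rho>) W = tensor K M W" "tens K (cmk M \<rho>) W = tens K M W"
  "tlift K (cmk M \<rho>) W U = tlift K M W U"
proof -
  have 1: "tensor_rel K (cmk M \<rho>) W = tensor_rel K M W" "free_mod K (cmk M \<rho>) W = free_mod K M W"
    "free_gen K (cmk M \<rho>) W = free_gen K M W"
    by (simp_all add: tensor_rel_def free_mod_def free_gen_def fun_eq_iff)
  show 2: "tensor K (cmk M \<rho>) W = tensor K M W" "tens K (cmk M \<rho>) W = tens K M W"
    by (simp_all add: tensor_def tens_def 1 fun_eq_iff)
  show "tlift K (cmk M \<rho>) W U = tlift K M W U"
    by (simp add: tlift_def 2 fun_eq_iff)
qed

context universe
begin

lemma klin_cmk_left [simp]: "klin (cmk M \<rho>) N f \<longleftrightarrow> klin M N f"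
  by (simp add: klin_def)

lemma klin_cmk_right [simp]: "klin N (cmk M \<rho>) f \<longleftrightarrow> klin N M f"
  by (simp add: klin_def)

lemma bilin_cmk_right [simp]: "bilin A B (cmk M \<rho>) \<beta> \<longleftrightarrow> bilin A B M \<beta>"
  by (simp add: bilin_def)

lemma bilin_cmk_left [simp]: "bilin (cmk M \<rho>) B U \<beta> \<longleftrightarrow> bilin M B U \<beta>"
  by (simp add: bilin_def)

lemma gens_cmk [simp]: "gens (cmk M \<rho>) S \<longleftrightarrow> gens M S"
  by (simp add: gens_def)

text \<open>For fixed \<open>h\<close> everything is linear in \<open>x\<close>, so linearity in
  \<open>h\<close> has to be checked only for \<open>x\<close> among generators. It handles the
  action on induced modules, which is defined by a separate lift for each arrow.\<close>

lemma lin_family: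
  assumes Y: "module K Y" and G: "gens M G" and L: "\<And>h. h \<in> carrier Y \<Longrightarrow> klin M U (L h)"
    and l: "\<And>x. x \<in> G \<Longrightarrow> klin Y U (\<lambda>h. L h x)" and x: "x \<in> carrier M"
  shows "klin Y U (\<lambda>h. L h x)"
proof (rule klinI[OF Y])
  note d = klinD[OF L]
  show "module K U" using d(2)[OF mod_simps(1)[OF Y]] .
  show "L h x \<in> carrier U" if "h \<in> carrier Y" for h using d(3)[OF that x] .
  show "L (h \<oplus>\<^bsub>Y\<^esub> h') x = L h x \<oplus>\<^bsub>U\<^esub> L h' x" if "h \<in> carrier Y" "h' \<in> carrier Y" for h h'
    by (rule gens_eq[OF G L klin_add[OF L L] _ x]) (use that Y klinD(4)[OF l] in auto)
  show "L (a \<odot>\<^bsub>Y\<^esub> h) x = a \<odot>\<^bsub>U\<^esub> L h x" if "a \<in> carrier K" "h \<in> carrier Y" for a h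
    by (rule gens_eq[OF G L klin_smult[OF L] _ x]) (use that Y klinD(5)[OF l] in auto)
qed

end

context coalg
begin

lemma precomod_cmk [simp]: "precomod (cmk M \<rho>) \<longleftrightarrow> klin M (M \<otimes>\<^sub>K C) \<rho>"
  by (auto simp: precomod_def klinD)

text \<open>Morphisms without the extensionality demanded by \<open>entmod_maps\<close>, so that
  composites and restrictions can be written as plain functions.\<close>

definition emor :: "'u entw \<Rightarrow> 'u entmod \<Rightarrow> 'u entmod \<Rightarrow> ('u \<Rightarrow> 'u \<Rightarrow> 'u) \<Rightarrow> bool" where
  "emor R M N \<eta> \<longleftrightarrow> (\<forall>r \<in> lob R. colin (em_at M r) (em_at N r) (\<eta> r)) \<and>
    (\<forall>r \<in> lob R. \<forall>s \<in> lob R. \<forall>m \<in> carrier (em_at M r). \<forall>f \<in> carrier (lhom R s r).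
       \<eta> s (em_act M r s m f) = em_act N r s (\<eta> r m) f)"

lemma emorD:
  assumes "emor R M N \<eta>" "r \<in> lob R"
  shows "colin (em_at M r) (em_at N r) (\<eta> r)" "klin (em_at M r) (em_at N r) (\<eta> r)"
    and "m \<in> carrier (em_at M r) \<Longrightarrow> \<eta> r m \<in> carrier (em_at N r)"
    and "s \<in> lob R \<Longrightarrow> m \<in> carrier (em_at M r) \<Longrightarrow> f \<in> carrier (lhom R s r) \<Longrightarrow>
      \<eta> s (em_act M r s m f) = em_act N r s (\<eta> r m) f"
  using assms colinD(3,4)[of "em_at M r" "em_at N r" "\<eta> r"] by (auto simp: emor_def)

lemma emor_comp: "emor R L M \<eta> \<Longrightarrow> emor R M N \<theta> \<Longrightarrow> emor R L N (\<lambda>r x. \<theta> r (\<eta> r x))"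
  unfolding emor_def[of R L N] by (auto intro: colin_comp[OF emorD(1) emorD(1)] simp: emorD)

end

context entw
begin

text \<open>The entwining axiom for composites, read under a trilinear \<open>F\<close>: twisting
  past a composite means twisting past \<open>g\<close> and then past \<open>f\<close>.\<close>

lemma twsum_cmp:
  assumes s: "s \<in> lob R" and b: "b \<in> lob R" and c: "c \<in> lob R"
    and V: "comodule K C V" and F: "trilin V (lhom R s c) C U F" and v: "v \<in> carrier V"
    and f: "f \<in> carrier (lhom R s b)" and g: "g \<in> carrier (lhom R b c)"
  shows "twsum R s c V U F v (lcmp R s b c g f) =
    twsum R b c V U (\<lambda>v0 g' c'. tlift K (lhom R s b) C U
      (\<lambda>f' c''. F v0 (lcmp R s b c g' f') c'') (tw R s b c' f)) v g"
  unfolding twsum_def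
proof (rule tlift_cong)
  note p = comoduleD[OF V] and q = trilinD[OF F]
  note cb = cmp_bilin[OF s b c]
  note [simp] = s b c p(2) q(4,5)
  fix v0 v1 assume v0: "v0 \<in> carrier V" and v1: "v1 \<in> carrier C"
  let ?L = "tlift K (lhom R s c) C U (F v0)"
  have L: "bilin (lhom R s c) C U (F v0)" using q(6)[OF v0] .
  have in1: "bilin (lhom R s b) C (lhom R s c \<otimes>\<^sub>K C) (\<lambda>f' c''. tens K (lhom R s c) C (lcmp R s b c g' f') c'')"
    if "g' \<in> carrier (lhom R b c)" for g'
    by (intro lin_rules bilin_right[OF cb]) (use that in auto)
  have "?L (tw R s c v1 (lcmp R s b c g f)) = ?L (tlift K (lhom R b c) C (lhom R s c \<otimes>\<^sub>K C)
              (\<lambda>g' c'. tlift K (lhom R s b) C (lhom R s c \<otimes>\<^sub>K C)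
                 (\<lambda>f' c''. tens K (lhom R s c) C (lcmp R s b c g' f') c'') (tw R s b c' f))
              (tw R b c v1 g))"
    by (subst tw_cmp[OF s b c f g v1]) simp
  also have "\<dots> = tlift K (lhom R b c) C U (\<lambda>g' c'. ?L (tlift K (lhom R s b) C (lhom R s c \<otimes>\<^sub>K C)
                 (\<lambda>f' c''. tens K (lhom R s c) C (lcmp R s b c g' f') c'') (tw R s b c' f)))
              (tw R b c v1 g)"
    by (rule lin_tlift[OF tlift_lin[OF L]]; (intro lin_rules in1 tw_lin bilin_left[OF cb] bilin_right[OF cb])?)
      (use v1 g f in auto)
  also have "\<dots> = tlift K (lhom R b c) C U (\<lambda>g' c'. tlift K (lhom R s b) C U
      (\<lambda>f' c''. F v0 (lcmp R s b c g' f') c'') (tw R s b c' f)) (tw R b c v1 g)"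
    by (intro tlift_cong, rule tlift_map_left[OF L]; (intro bilin_right[OF cb] klin_id)?)
      (use f in auto)
  finally show "?L (tw R s c v1 (lcmp R s b c g f)) =
    tlift K (lhom R b c) C U (\<lambda>g' c'. tlift K (lhom R s b) C U
      (\<lambda>f' c''. F v0 (lcmp R s b c g' f') c'') (tw R s b c' f)) (tw R b c v1 g)" .
qed

lemma twisted_gens:
  assumes s: "s \<in> lob R" and t: "t \<in> lob R" and Y: "comodule K C Y" and Z: "precomod Z"
    and a: "bilin Y (lhom R t s) Z a" and G: "gens Y G"
    and eq: "\<And>y f. y \<in> G \<Longrightarrow> f \<in> carrier (lhom R t s) \<Longrightarrow>
      coact Z (a y f) = twsum R t s Y (Z \<otimes>\<^sub>K C) (\<lambda>m0 f' c'. tens K Z C (a m0 f') c') y f"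
  shows "twisted R t s Y Z a"
  unfolding twisted_def
proof (intro conjI ballI Y Z a)
  fix y f assume y: "y \<in> carrier Y" and f: "f \<in> carrier (lhom R t s)"
  note p = comoduleD[OF Y] and z = precomodD[OF Z]
  note [simp] = s t p(2) z(1) bilinD(4)[OF a]
  have F: "trilin Y (lhom R t s) C (Z \<otimes>\<^sub>K C) (\<lambda>m0 f' c'. tens K Z C (a m0 f') c')"
    by (intro trilinI lin_rules bilin_left[OF a] bilin_right[OF a]) auto
  show "coact Z (a y f) = twsum R t s Y (Z \<otimes>\<^sub>K C) (\<lambda>m0 f' c'. tens K Z C (a m0 f') c') y f"
    by (rule gens_eq[OF G _ _ _ y, where W = "Z \<otimes>\<^sub>K C"];
        (intro z(4) bilin_left[OF a] bilin_left[OF twsum_bilin[OF t s Y F]] klin_id)?)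
      (use eq f in auto)
qed

text \<open>With \<open>ab\<close> the coaction becomes a twisted sum over a composite;
  \<open>twsum_cmp\<close> splits it, and \<open>twisted_bind\<close> recognizes the outer sum as
  the coaction of \<open>b v g\<close>. This is the compatibility axiom on generators, both for V
  \<otimes> H and for induced modules.\<close>

lemma twisted_act:
  assumes s: "s \<in> lob R" and t: "t \<in> lob R" and r: "r \<in> lob R"
    and b: "twisted R s r V Y b" and b': "twisted R t r V Z b'"
    and a: "bilin Y (lhom R t s) Z a"
    and ab: "\<And>v g f. v \<in> carrier V \<Longrightarrow> g \<in> carrier (lhom R s r) \<Longrightarrow> f \<in> carrier (lhom R t s) \<Longrightarrow>
      a (b v g) f = b' v (lcmp R t s r g f)"
    and v: "v \<in> carrier V" and g: "g \<in> carrier (lhom R s r)" and f: "f \<in> carrier (lhom R t s)"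
  shows "coact Z (a (b v g) f) = twsum R t s Y (Z \<otimes>\<^sub>K C) (\<lambda>m0 f' c'. tens K Z C (a m0 f') c') (b v g) f"
proof -
  have V: "comodule K C V" and Y: "precomod Y" and Z: "precomod Z"
    and bb: "bilin V (lhom R s r) Y b" and bb': "bilin V (lhom R t r) Z b'"
    using b b' by (auto simp: twisted_def)
  note p = comoduleD[OF V] and y = precomodD[OF Y] and z = precomodD[OF Z]
  note [simp] = s t r p(2) y(1) z(1) bilinD(4)[OF bb] bilinD(4)[OF bb'] bilinD(4)[OF a]
  have F: "trilin V (lhom R t r) C (Z \<otimes>\<^sub>K C) (\<lambda>v0 h c'. tens K Z C (b' v0 h) c')"
    by (intro trilinI lin_rules bilin_left[OF bb'] bilin_right[OF bb']) auto
  have "coact Z (a (b v g) f) =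
    twsum R t r V (Z \<otimes>\<^sub>K C) (\<lambda>v0 h c'. tens K Z C (b' v0 h) c') v (lcmp R t s r g f)"
    using b' v g f by (simp add: ab twisted_def)
  also have "\<dots> = twsum R s r V (Z \<otimes>\<^sub>K C) (\<lambda>v0 g' c'. tlift K (lhom R t s) C (Z \<otimes>\<^sub>K C)
      (\<lambda>f' c''. tens K Z C (b' v0 (lcmp R t s r g' f')) c'') (tw R t s c' f)) v g"
    by (rule twsum_cmp[OF t s r V F v f g])
  also have "\<dots> = twsum R s r V (Z \<otimes>\<^sub>K C) (\<lambda>v0 g' c'. tlift K (lhom R t s) C (Z \<otimes>\<^sub>K C)
      (\<lambda>f' c''. tens K Z C (a (b v0 g') f') c'') (tw R t s c' f)) v g"
    by (intro twsum_cong tlift_cong) (simp add: ab)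
  also have "\<dots> = tlift K Y C (Z \<otimes>\<^sub>K C) (\<lambda>m0 m1. tlift K (lhom R t s) C (Z \<otimes>\<^sub>K C)
      (\<lambda>f' c''. tens K Z C (a m0 f') c'') (tw R t s m1 f)) (coact Y (b v g))"
    by (rule twisted_bind[OF s r b _ v g, symmetric];
        (intro lin_rules tw_lin bilin_left[OF a] bilin_right[OF a])?) (use f in auto)
  finally show ?thesis by (simp add: twsum_def)
qed

text \<open>The compatibility of action and coaction in an entwined module says precisely that the
  action is a twisted bilinear map.\<close>

lemma entmodI:
  assumes "\<And>r. r \<in> lob R \<Longrightarrow> comodule K C (em_at M r)"
    and "\<And>r s. r \<in> lob R \<Longrightarrow> s \<in> lob R \<Longrightarrow> twisted R s r (em_at M r) (em_at M s) (em_act M r s)"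
    and "\<And>r m. r \<in> lob R \<Longrightarrow> m \<in> carrier (em_at M r) \<Longrightarrow> em_act M r r m (lid R r) = m"
    and "\<And>r s t m f g. r \<in> lob R \<Longrightarrow> s \<in> lob R \<Longrightarrow> t \<in> lob R \<Longrightarrow> m \<in> carrier (em_at M r) \<Longrightarrow>
        f \<in> carrier (lhom R s r) \<Longrightarrow> g \<in> carrier (lhom R t s) \<Longrightarrow>
          em_act M r t m (lcmp R t s r f g) = em_act M s t (em_act M r s m f) g"
  shows "entwined_module K C R M"
proof -
  have b: "bilin (em_at M r) (lhom R s r) (em_at M s) (em_act M r s)" if "r \<in> lob R" "s \<in> lob R" for r s
    using assms(2) that by (auto simp: twisted_def)
  have l: "lin_map K (em_at M r) (em_at M s) (\<lambda>m. em_act M r s m f)"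
    if "r \<in> lob R" "s \<in> lob R" "f \<in> carrier (lhom R s r)" for r s f
    using bilinD(6)[OF b] that by (auto simp: klin_def)
  have l': "lin_map K (lhom R s r) (em_at M s) (em_act M r s m)"
    if "r \<in> lob R" "s \<in> lob R" "m \<in> carrier (em_at M r)" for r s m
    using bilinD(5)[OF b] that by (auto simp: klin_def)
  show ?thesis
    using assms(2) l l' unfolding entwined_module_def right_module_def twisted_def twsum_def tw_def Let_def
    by (intro conjI ballI) (simp_all add: assms comoduleD(2))
qed

lemma entmodD:
  assumes "entwined_module K C R M" "r \<in> lob R"
  shows "comodule K C (em_at M r)" "precomod (em_at M r)" "module K (em_at M r)"
    and "s \<in> lob R \<Longrightarrow> bilin (em_at M r) (lhom R s r) (em_at M s) (em_act M r s)"
    and "s \<in> lob R \<Longrightarrow> twisted R s r (em_at M r) (em_at M s) (em_act M r s)"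
    and "m \<in> carrier (em_at M r) \<Longrightarrow> em_act M r r m (lid R r) = m"
    and "s \<in> lob R \<Longrightarrow> t \<in> lob R \<Longrightarrow> m \<in> carrier (em_at M r) \<Longrightarrow>
        f \<in> carrier (lhom R s r) \<Longrightarrow> g \<in> carrier (lhom R t s) \<Longrightarrow>
          em_act M r t m (lcmp R t s r f g) = em_act M s t (em_act M r s m f) g"
    and "s \<in> lob R \<Longrightarrow> m \<in> carrier (em_at M r) \<Longrightarrow> f \<in> carrier (lhom R s r) \<Longrightarrow>
      em_act M r s m f \<in> carrier (em_at M s)"
proof -
  note M = assms(1)[unfolded entwined_module_def right_module_def Let_def]
  have co: "comodule K C (em_at M r)" if "r \<in> lob R" for r using M that by auto
  show "comodule K C (em_at M r)" "precomod (em_at M r)" "module K (em_at M r)"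
    using co[OF assms(2)] comoduleD by auto
  show b: "bilin (em_at M r) (lhom R s r) (em_at M s) (em_act M r s)" if "s \<in> lob R" for s
    by (intro bilinI) (use M that assms(2) in \<open>auto simp: klin_def\<close>)
  show "twisted R s r (em_at M r) (em_at M s) (em_act M r s)" if s: "s \<in> lob R"
    unfolding twisted_def
  proof (intro conjI ballI co b assms(2) s comoduleD(1))
    fix m f assume "m \<in> carrier (em_at M r)" "f \<in> carrier (lhom R s r)"
    then show "coact (em_at M s) (em_act M r s m f) =
      twsum R s r (em_at M r) (em_at M s \<otimes>\<^sub>K C) (\<lambda>v0 g' c'. tens K (em_at M s) C (em_act M r s v0 g') c') m f"
      using M assms(2) s unfolding twsum_def tw_def by blast
  qed
  show "m \<in> carrier (em_at M r) \<Longrightarrow> em_act M r r m (lid R r) = m"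
    "s \<in> lob R \<Longrightarrow> t \<in> lob R \<Longrightarrow> m \<in> carrier (em_at M r) \<Longrightarrow>
        f \<in> carrier (lhom R s r) \<Longrightarrow> g \<in> carrier (lhom R t s) \<Longrightarrow>
          em_act M r t m (lcmp R t s r f g) = em_act M s t (em_act M r s m f) g"
    using M assms(2) by auto
  show "s \<in> lob R \<Longrightarrow> m \<in> carrier (em_at M r) \<Longrightarrow> f \<in> carrier (lhom R s r) \<Longrightarrow>
      em_act M r s m f \<in> carrier (em_at M s)"
    using bilinD(4)[OF b] by auto
qed

lemma entmod_maps_iff:
  assumes "\<And>r. r \<in> lob R \<Longrightarrow> precomod (em_at M r)" "\<And>r. r \<in> lob R \<Longrightarrow> precomod (em_at N r)"
  shows "\<eta> \<in> entmod_maps K C R M N \<longleftrightarrow> emor R M N \<eta> \<and> \<eta> \<in> extensional (lob R) \<and>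
    (\<forall>r \<in> lob R. \<eta> r \<in> extensional (carrier (em_at M r)))"
  using assms by (auto simp: entmod_maps_def emor_def PiE_iff comod_maps_iff)

definition em_restrict :: "'u entmod \<Rightarrow> ('u \<Rightarrow> 'u \<Rightarrow> 'u) \<Rightarrow> 'u \<Rightarrow> 'u \<Rightarrow> 'u" where
  "em_restrict M \<eta> = (\<lambda>r \<in> lob R. \<lambda>m \<in> carrier (em_at M r). \<eta> r m)"

lemma emor_cong:
  assumes "emor R M N \<eta>" "entwined_module K C R M"
    "\<And>r m. r \<in> lob R \<Longrightarrow> m \<in> carrier (em_at M r) \<Longrightarrow> \<eta> r m = \<theta> r m"
  shows "emor R M N \<theta>"
  unfolding emor_def
proof (intro conjI ballI)
  show "colin (em_at M r) (em_at N r) (\<theta> r)" if "r \<in> lob R" for r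
    using colin_cong[OF emorD(1)[OF assms(1) that] assms(3)[OF that]] .
  fix r s m f assume *: "r \<in> lob R" "s \<in> lob R" "m \<in> carrier (em_at M r)" "f \<in> carrier (lhom R s r)"
  then show "\<theta> s (em_act M r s m f) = em_act N r s (\<theta> r m) f"
    using emorD(4)[OF assms(1) *(1)] entmodD(8)[OF assms(2)] by (simp flip: assms(3))
qed

subsection \<open>The modules \<open>V \<otimes> H\<^sub>r\<close>\<close>

context
  fixes V :: "'u comod" and r :: 'u
  assumes V: "comodule K C V" and r [simp]: "r \<in> lob R"
begin

private abbreviation "T \<equiv> tensor_H K C R V r"
private abbreviation "Hr r' \<equiv> lhom R r' r"

private lemma V_mod [simp]: "module K V" using comoduleD(2)[OF V] .

private lemma tensor_H_trilin:
  assumes "r' \<in> lob R"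
  shows "trilin V (Hr r') C (V \<otimes>\<^sub>K Hr r' \<otimes>\<^sub>K C) (\<lambda>v0 g' c'. tens K (V \<otimes>\<^sub>K Hr r') C (tens K V (Hr r') v0 g') c')"
  by (intro trilinI lin_rules) (use assms in auto)

private lemma tensor_H_at: "em_at T r' = cmk (V \<otimes>\<^sub>K Hr r') (tlift K V (Hr r') (V \<otimes>\<^sub>K Hr r' \<otimes>\<^sub>K C)
    (\<lambda>v g. twsum R r' r V (V \<otimes>\<^sub>K Hr r' \<otimes>\<^sub>K C) (\<lambda>v0 g' c'. tens K (V \<otimes>\<^sub>K Hr r') C (tens K V (Hr r') v0 g') c') v g))"
  by (simp add: tensor_H_def Let_def twsum_def tw_def)

lemma tensor_H_carrier: "carrier (em_at T r') = carrier (V \<otimes>\<^sub>K Hr r')"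
  by (simp add: tensor_H_at)

lemma tensor_H_twisted:
  assumes [simp]: "r' \<in> lob R"
  shows "twisted R r' r V (em_at T r') (tens K V (Hr r'))"
  unfolding twisted_def tensor_H_at
  using V tlift_lin[OF twsum_bilin[OF assms r V tensor_H_trilin[OF assms]]]
  by (auto simp: tens_bilin tlift_tens[OF twsum_bilin[OF assms r V tensor_H_trilin[OF assms]]])

lemma tensor_H_gens:
  assumes [simp]: "r' \<in> lob R"
  shows "gens (em_at T r') {tens K V (Hr r') v g | v g. v \<in> carrier V \<and> g \<in> carrier (Hr r')}"
  by (simp add: tensor_H_at tensor_gens)

lemma tensor_H_comodule:
  assumes [simp]: "r' \<in> lob R"
  shows "comodule K C (em_at T r')"
proof (rule comodule_gens[OF _ tensor_H_gens[OF assms]])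
  show "precomod (em_at T r')" using tensor_H_twisted[OF assms] by (simp add: twisted_def)
qed (use twisted_comod_at[OF assms r tensor_H_twisted[OF assms]] in auto)

private lemma tensor_H_act_inner:
  assumes [simp]: "r' \<in> lob R" "s \<in> lob R" and f: "f \<in> carrier (lhom R s r')"
  shows "bilin V (Hr r') (V \<otimes>\<^sub>K Hr s) (\<lambda>v g. tens K V (Hr s) v (lcmp R s r' r g f))"
  by (intro lin_rules bilin_left[OF cmp_bilin]) (use f in auto)

private lemma tensor_H_act:
  "em_act T r' s t f = tlift K V (Hr r') (V \<otimes>\<^sub>K Hr s) (\<lambda>v g. tens K V (Hr s) v (lcmp R s r' r g f)) t"
  by (simp add: tensor_H_def Let_def)

lemma tensor_H_act_tens:
  assumes "r' \<in> lob R" "s \<in> lob R" "f \<in> carrier (lhom R s r')" "v \<in> carrier V" "g \<in> carrier (Hr r')"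
  shows "em_act T r' s (tens K V (Hr r') v g) f = tens K V (Hr s) v (lcmp R s r' r g f)"
  unfolding tensor_H_act using tensor_H_act_inner assms by simp

private lemma tensor_H_act_bilin:
  assumes [simp]: "r' \<in> lob R" "s \<in> lob R"
  shows "bilin (em_at T r') (lhom R s r') (em_at T s) (em_act T r' s)"
  unfolding tensor_H_act[abs_def] tensor_H_at
  by (simp, intro lin_rules tensor_H_act_inner bilin_left[OF cmp_bilin] bilin_right[OF cmp_bilin]) auto

lemma tensor_H_entwined: "entwined_module K C R T"
proof (rule entmodI)
  show "comodule K C (em_at T r')" if "r' \<in> lob R" for r' by (rule tensor_H_comodule[OF that])
  show "twisted R s r' (em_at T r') (em_at T s) (em_act T r' s)" if [simp]: "r' \<in> lob R" "s \<in> lob R" for r' s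
    by (rule twisted_gens[OF that tensor_H_comodule _ tensor_H_act_bilin tensor_H_gens])
      (use twisted_act[OF that r tensor_H_twisted tensor_H_twisted tensor_H_act_bilin tensor_H_act_tens]
        comoduleD(1)[OF tensor_H_comodule] in auto)
  have l: "klin (em_at T r') (em_at T s) (\<lambda>t. em_act T r' s t f)"
    if "r' \<in> lob R" "s \<in> lob R" "f \<in> carrier (lhom R s r')" for r' s f
    using bilinD(6)[OF tensor_H_act_bilin] that .
  show "em_act T r' r' m (lid R r') = m" if [simp]: "r' \<in> lob R" and "m \<in> carrier (em_at T r')" for r' m
    by (rule gens_eq[OF tensor_H_gens l klin_id _ that(2)])
      (use comoduleD(2)[OF tensor_H_comodule] in \<open>auto simp: tensor_H_act_tens\<close>)
  show "em_act T r' t m (lcmp R t s r' f g) = em_act T s t (em_act T r' s m f) g"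
    if [simp]: "r' \<in> lob R" "s \<in> lob R" "t \<in> lob R" and m: "m \<in> carrier (em_at T r')"
      and [simp]: "f \<in> carrier (lhom R s r')" "g \<in> carrier (lhom R t s)" for r' s t m f g
    by (rule gens_eq[OF tensor_H_gens l klin_comp[OF l l] _ m])
      (auto simp: tensor_H_act_tens cmp_assoc)
qed

text \<open>Yoneda: \<open>h\<close> extends by v \<otimes> g \<mapsto> h(v)g, which is twisted
  since the action of \<open>N\<close> is twisted and \<open>h\<close> is colinear.\<close>

lemma tensor_H_map:
  assumes N: "entwined_module K C R N" and h: "colin V (em_at N r) h"
  obtains \<eta> where "emor R T N \<eta>"
    "\<And>r' v g. r' \<in> lob R \<Longrightarrow> v \<in> carrier V \<Longrightarrow> g \<in> carrier (Hr r') \<Longrightarrow>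
      \<eta> r' (tens K V (Hr r') v g) = em_act N r r' (h v) g"
proof -
  define \<eta> where "\<eta> r' = tlift K V (Hr r') (em_at N r') (\<lambda>v g. em_act N r r' (h v) g)" for r'
  have b: "twisted R r' r V (em_at N r') (\<lambda>v g. em_act N r r' (h v) g)" if "r' \<in> lob R" for r'
    by (rule twisted_pre[OF that r h V entmodD(5)[OF N r that]])
  then have bb: "bilin V (Hr r') (em_at N r') (\<lambda>v g. em_act N r r' (h v) g)" if "r' \<in> lob R" for r'
    using that by (auto simp: twisted_def)
  have v: "\<eta> r' (tens K V (Hr r') v g) = em_act N r r' (h v) g"
    if "r' \<in> lob R" "v \<in> carrier V" "g \<in> carrier (Hr r')" for r' v g
    unfolding \<eta>_def using bb that by simp
  have l: "klin (em_at T r') (em_at N r') (\<eta> r')" if "r' \<in> lob R" for r'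
    unfolding \<eta>_def tensor_H_at using tlift_lin[OF bb[OF that]] by simp
  have "emor R T N \<eta>"
    unfolding emor_def
  proof (intro conjI ballI)
    fix r' assume [simp]: "r' \<in> lob R"
    show "colin (em_at T r') (em_at N r') (\<eta> r')"
      by (rule colin_gens[OF _ _ l tensor_H_gens])
        (use twisted_colin_at[OF _ r tensor_H_twisted b l v] comoduleD(1)[OF tensor_H_comodule]
          entmodD(2)[OF N] in auto)
    fix s m f assume [simp]: "s \<in> lob R" and m: "m \<in> carrier (em_at T r')" and [simp]: "f \<in> carrier (lhom R s r')"
    show "\<eta> s (em_act T r' s m f) = em_act N r' s (\<eta> r' m) f"
      by (rule gens_eq[OF tensor_H_gens _ _ _ m, where W = "em_at N s"];
          (intro klin_comp[OF _ l] bilin_left[OF tensor_H_act_bilin] bilin_left[OF entmodD(4)[OF N]] klin_id l)?)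
        (use entmodD(7)[OF N r] colinD(4)[OF h] comoduleD(2)[OF tensor_H_comodule] in
          \<open>auto simp: tensor_H_act_tens v\<close>)
  qed
  then show ?thesis using that v by blast
qed

text \<open>Because v \<otimes> g = (v \<otimes> id)g, compatibility with the action determines a
  morphism from its values at the identity.\<close>

lemma tensor_H_map_unique:
  assumes \<eta>: "emor R T N \<eta>" and \<theta>: "emor R T N \<theta>"
    and eq: "\<And>v. v \<in> carrier V \<Longrightarrow> \<eta> r (tens K V (Hr r) v (lid R r)) = \<theta> r (tens K V (Hr r) v (lid R r))"
    and [simp]: "r' \<in> lob R" and m: "m \<in> carrier (em_at T r')"
  shows "\<eta> r' m = \<theta> r' m"
proof (rule gens_eq[OF tensor_H_gens emorD(2)[OF \<eta>] emorD(2)[OF \<theta>] _ m])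
  fix t assume "t \<in> {tens K V (Hr r') v g |v g. v \<in> carrier V \<and> g \<in> carrier (Hr r')}"
  then obtain v g where t: "t = tens K V (Hr r') v g" "v \<in> carrier V" "g \<in> carrier (Hr r')" by auto
  then have "t = em_act T r r' (tens K V (Hr r) v (lid R r)) g" by (simp add: tensor_H_act_tens)
  moreover have "tens K V (Hr r) v (lid R r) \<in> carrier (em_at T r)" using t by (simp add: tensor_H_carrier)
  ultimately show "\<eta> r' t = \<theta> r' t"
    using emorD(4)[OF \<eta> r] emorD(4)[OF \<theta> r] eq t by simp
qed auto

lemma tensor_H_unit: "colin V (em_at T r) (\<lambda>v. tens K V (Hr r) v (lid R r))"
  by (rule twisted_unit[OF r tensor_H_twisted[OF r]])

end

end

section \<open>Restriction and induction\<close>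

lemma restr_simps [simp]:
  "em_at (restr_mod \<alpha> N) r = em_at N (fob \<alpha> r)"
  "em_act (restr_mod \<alpha> N) r s m f = em_act N (fob \<alpha> r) (fob \<alpha> s) m (farr \<alpha> s r f)"
  by (simp_all add: restr_mod_def)

section \<open>Restriction along a morphism of entwining structures\<close>

locale ent_mor = coalg K C + R: entw K C R + S: entw K C S
  for K :: "'u ring" (structure) and C :: "'u coalg" and R :: "'u entw" and S :: "'u entw" +
  fixes \<alpha> :: "('u, 'u, 'u, 'u) func"
  assumes mor: "\<alpha> \<in> ent_maps K C R S"
begin

abbreviation "o\<alpha> \<equiv> fob \<alpha>"
abbreviation "a\<alpha> \<equiv> farr \<alpha>"

lemma functor_\<alpha>: "cat_functor (underlying R) (underlying S) \<alpha>"
  using mor by (auto simp: ent_maps_def lin_functor_def)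

lemma fob_closed [simp]: "r \<in> lob R \<Longrightarrow> o\<alpha> r \<in> lob S"
  using cat_functor.fob_in[OF functor_\<alpha>] by (auto simp: underlying_def)

lemma farr_klin: "r \<in> lob R \<Longrightarrow> s \<in> lob R \<Longrightarrow> klin (lhom R r s) (lhom S (o\<alpha> r) (o\<alpha> s)) (a\<alpha> r s)"
  using mor by (auto simp: ent_maps_def lin_functor_def klin_def)

lemma farr_closed [simp]:
  "r \<in> lob R \<Longrightarrow> s \<in> lob R \<Longrightarrow> f \<in> carrier (lhom R r s) \<Longrightarrow> a\<alpha> r s f \<in> carrier (lhom S (o\<alpha> r) (o\<alpha> s))"
  using klinD(3)[OF farr_klin] .

lemma farr_id [simp]: "r \<in> lob R \<Longrightarrow> a\<alpha> r r (lid R r) = lid S (o\<alpha> r)"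
  using cat_functor.farr_ident[OF functor_\<alpha>] by (auto simp: underlying_def)

lemma farr_cmp:
  "a \<in> lob R \<Longrightarrow> b \<in> lob R \<Longrightarrow> c \<in> lob R \<Longrightarrow> f \<in> carrier (lhom R a b) \<Longrightarrow> g \<in> carrier (lhom R b c) \<Longrightarrow>
    a\<alpha> a c (lcmp R a b c g f) = lcmp S (o\<alpha> a) (o\<alpha> b) (o\<alpha> c) (a\<alpha> b c g) (a\<alpha> a b f)"
  using cat_functor.farr_cmp[OF functor_\<alpha>] by (auto simp: underlying_def)

lemma farr_tw:
  assumes "r \<in> lob R" "s \<in> lob R" "f \<in> carrier (lhom R r s)" "c \<in> carrier C"
  shows "tlift K (lhom R r s) C (lhom S (o\<alpha> r) (o\<alpha> s) \<otimes>\<^sub>K C)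
      (\<lambda>f' c'. tens K (lhom S (o\<alpha> r) (o\<alpha> s)) C (a\<alpha> r s f') c') (tw R r s c f) =
    tw S (o\<alpha> r) (o\<alpha> s) c (a\<alpha> r s f)"
  using mor assms unfolding ent_maps_def tw_def Let_def by blast

lemma farr_lin:
  "r \<in> lob R \<Longrightarrow> s \<in> lob R \<Longrightarrow> klin Y (lhom R r s) f \<Longrightarrow> klin Y (lhom S (o\<alpha> r) (o\<alpha> s)) (\<lambda>x. a\<alpha> r s (f x))"
  by (rule klin_comp[OF _ farr_klin])

text \<open>The defining condition on \<alpha> under a trilinear \<open>F\<close>: twisting commutes
  with \<alpha>.\<close>

lemma twsum_ent:
  assumes r [simp]: "r \<in> lob R" and s [simp]: "s \<in> lob R"
    and F: "trilin V (lhom S (o\<alpha> r) (o\<alpha> s)) C U F" and g: "g \<in> carrier (lhom R r s)"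
  shows "twsum S (o\<alpha> r) (o\<alpha> s) V U F v (a\<alpha> r s g) =
    twsum R r s V U (\<lambda>v0 g' c. F v0 (a\<alpha> r s g') c) v g"
  unfolding twsum_def
proof (rule tlift_cong)
  fix v0 v1 assume v: "v0 \<in> carrier V" "v1 \<in> carrier C"
  show "tlift K (lhom S (o\<alpha> r) (o\<alpha> s)) C U (F v0) (tw S (o\<alpha> r) (o\<alpha> s) v1 (a\<alpha> r s g)) =
    tlift K (lhom R r s) C U (\<lambda>g' c. F v0 (a\<alpha> r s g') c) (tw R r s v1 g)"
    unfolding farr_tw[OF r s g v(2), symmetric]
    by (rule tlift_map_left[OF trilinD(6)[OF F v(1)] farr_klin[OF r s]]) (use g v in auto)
qed

lemma twisted_ent:
  assumes r [simp]: "r \<in> lob R" and s [simp]: "s \<in> lob R"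
    and b: "twisted S (o\<alpha> r) (o\<alpha> s) V Y b"
  shows "twisted R r s V Y (\<lambda>v g. b v (a\<alpha> r s g))"
  unfolding twisted_def
proof (intro conjI ballI)
  show V: "comodule K C V" and Y: "precomod Y" using b by (auto simp: twisted_def)
  have bb: "bilin V (lhom S (o\<alpha> r) (o\<alpha> s)) Y b" using b by (auto simp: twisted_def)
  note [simp] = comoduleD(2)[OF V] precomodD(1)[OF Y] bilinD(4)[OF bb]
  show "bilin V (lhom R r s) Y (\<lambda>v g. b v (a\<alpha> r s g))"
    by (intro lin_rules bilin_left[OF bb] bilin_right[OF bb] farr_lin) auto
  fix v g assume v: "v \<in> carrier V" and g: "g \<in> carrier (lhom R r s)"
  have F: "trilin V (lhom S (o\<alpha> r) (o\<alpha> s)) C (Y \<otimes>\<^sub>K C) (\<lambda>v0 g' c'. tens K Y C (b v0 g') c')"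
    by (intro trilinI lin_rules bilin_left[OF bb] bilin_right[OF bb]) auto
  show "coact Y (b v (a\<alpha> r s g)) =
    twsum R r s V (Y \<otimes>\<^sub>K C) (\<lambda>v0 g' c'. tens K Y C (b v0 (a\<alpha> r s g')) c') v g"
    using b v g twsum_ent[OF r s F g] by (simp add: twisted_def)
qed

lemma restr_entwined:
  assumes N: "entwined_module K C S N"
  shows "entwined_module K C R (restr_mod \<alpha> N)"
proof (rule R.entmodI)
  note n = S.entmodD[OF N fob_closed]
  show "comodule K C (em_at (restr_mod \<alpha> N) r)" if "r \<in> lob R" for r using n(1) that by simp
  show "twisted R s r (em_at (restr_mod \<alpha> N) r) (em_at (restr_mod \<alpha> N) s) (em_act (restr_mod \<alpha> N) r s)"
    if "r \<in> lob R" "s \<in> lob R" for r s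
    using twisted_ent[OF that(2,1) n(5)[OF that(1) fob_closed[OF that(2)]]]
    by (simp add: restr_mod_def)
qed (auto simp: S.entmodD[OF N] farr_cmp)

section \<open>The induced module and its universal property\<close>

context
  fixes M :: "'u entmod"
  assumes M: "entwined_module K C R M"
begin

private abbreviation "Hs s r \<equiv> lhom S s (o\<alpha> r)"
private abbreviation "Ds s \<equiv> \<lambda>r. em_at M r \<otimes>\<^sub>K Hs s r"
private abbreviation "Su s \<equiv> ind_sum K R S \<alpha> M s"
private abbreviation "elt s \<equiv> ind_elt K R S \<alpha> M s"
private abbreviation "rel s \<equiv> ind_rel K R S \<alpha> M s"
private abbreviation "Is s \<equiv> ind_space K R S \<alpha> M s"
private abbreviation "gen s \<equiv> ind_gen K R S \<alpha> M s"
private abbreviation "lft s \<equiv> ind_lift K R S \<alpha> M s"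
private abbreviation "IM \<equiv> ind_mod K C R S \<alpha> M"

private lemmas m = R.entmodD[OF M]
private lemmas m_simps [simp] = m(3)

context
  fixes s assumes s [simp]: "s \<in> lob S"
begin

private lemma D_mod: "r \<in> lob R \<Longrightarrow> module K (Ds s r)"
  by simp

private lemma sum_mod: "module K (Su s)"
  unfolding ind_sum_def by (rule dsum_module) (rule D_mod)

private lemma elt_bilin: "r \<in> lob R \<Longrightarrow> bilin (em_at M r) (Hs s r) (Su s) (elt s r)"
  unfolding ind_sum_def ind_elt_def[abs_def]
  by (intro lin_rules klin_comp[OF _ dinj_lin[OF D_mod]]) auto

private lemma elt_gens:
  "gens (Su s) {elt s r x f | r x f. r \<in> lob R \<and> x \<in> carrier (em_at M r) \<and> f \<in> carrier (Hs s r)}"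
  (is "gens _ ?G")
proof (rule gensI[OF sum_mod])
  show "?G \<subseteq> carrier (Su s)" using bilinD(4)[OF elt_bilin] by auto
  fix N assume N: "submodule N K (Su s)" "?G \<subseteq> N"
  have "{dinj (lob R) (Ds s) r x | r x. r \<in> lob R \<and> x \<in> carrier (Ds s r)} \<subseteq> N"
  proof clarify
    fix r x assume r: "r \<in> lob R" and x: "x \<in> carrier (Ds s r)"
    have l: "klin (Ds s r) (Su s) (dinj (lob R) (Ds s) r)"
      unfolding ind_sum_def by (rule dinj_lin[OF D_mod r])
    have "x \<in> {x \<in> carrier (Ds s r). dinj (lob R) (Ds s) r x \<in> N}"
      by (rule gens_induct[OF tensor_gens submod_vimage[OF l N(1)] _ x])
        (use N(2) r in \<open>auto simp: ind_elt_def\<close>)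
    then show "dinj (lob R) (Ds s) r x \<in> N" by simp
  qed
  then show "carrier (Su s) \<subseteq> N"
    using gens_induct[OF dsum_gens[of "lob R" "Ds s", OF D_mod], of N] N(1) unfolding ind_sum_def by auto
qed

private lemma rel_gen_in:
  assumes "r \<in> lob R" "r' \<in> lob R" "x \<in> carrier (em_at M r')" "g \<in> carrier (lhom R r r')" "f \<in> carrier (Hs s r)"
  shows "elt s r' x (lcmp S s (o\<alpha> r) (o\<alpha> r') (a\<alpha> r r' g) f) \<in> carrier (Su s)"
    "elt s r (em_act M r' r x g) f \<in> carrier (Su s)"
  using assms by (auto intro!: bilinD(4)[OF elt_bilin] m(8))

private lemma rel_sub: "submodule (rel s) K (Su s)"
  unfolding ind_rel_def
  by (rule mspan_sub[OF sum_mod]) (auto intro!: mod_simps(4)[OF sum_mod] rel_gen_in)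

private lemma sum_small: "small (carrier (Su s))"
  unfolding ind_sum_def by (rule dsum_small[OF small_univ])

private lemma Is_squot: "Is s = squot (Su s) (rel s)"
  by (simp add: ind_space_def squot_def)

private lemma gen_sproj: "gen s r x f = sproj (Su s) (rel s) (elt s r x f)"
  by (simp add: ind_gen_def sproj_def)

private lemmas sq = squot_lin[OF sum_mod rel_sub sum_small, folded Is_squot]

lemma ind_space_module [simp]: "module K (Is s)"
  using klinD(2)[OF sq(1)] .

lemma ind_gen_bilin: "r \<in> lob R \<Longrightarrow> bilin (em_at M r) (Hs s r) (Is s) (gen s r)"
  unfolding gen_sproj[abs_def]
  by (intro lin_rules klin_comp[OF _ sq(1)] bilin_left[OF elt_bilin] bilin_right[OF elt_bilin]) auto

lemma ind_gen_closed [simp]: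
  "r \<in> lob R \<Longrightarrow> x \<in> carrier (em_at M r) \<Longrightarrow> f \<in> carrier (Hs s r) \<Longrightarrow> gen s r x f \<in> carrier (Is s)"
  using bilinD(4)[OF ind_gen_bilin] .

lemma ind_gens:
  "gens (Is s) {gen s r x f | r x f. r \<in> lob R \<and> x \<in> carrier (em_at M r) \<and> f \<in> carrier (Hs s r)}"
proof -
  have "{gen s r x f | r x f. r \<in> lob R \<and> x \<in> carrier (em_at M r) \<and> f \<in> carrier (Hs s r)} =
    sproj (Su s) (rel s) ` {elt s r x f | r x f. r \<in> lob R \<and> x \<in> carrier (em_at M r) \<and> f \<in> carrier (Hs s r)}"
    by (auto simp: gen_sproj)
  then show ?thesis using gens_image[OF sq(1,2) elt_gens] by simp
qed

lemma ind_gen_rel: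
  assumes "r \<in> lob R" "r' \<in> lob R" "x \<in> carrier (em_at M r')" "g \<in> carrier (lhom R r r')" "f \<in> carrier (Hs s r)"
  shows "gen s r' x (lcmp S s (o\<alpha> r) (o\<alpha> r') (a\<alpha> r r' g) f) = gen s r (em_act M r' r x g) f"
proof (rule minus_zero_imp_eq[OF ind_space_module])
  note i = rel_gen_in[OF assms]
  have "elt s r' x (lcmp S s (o\<alpha> r) (o\<alpha> r') (a\<alpha> r r' g) f) \<ominus>\<^bsub>Su s\<^esub> elt s r (em_act M r' r x g) f \<in> rel s"
    unfolding ind_rel_def by (rule mspan_incl) (use assms in blast)
  then show "gen s r' x (lcmp S s (o\<alpha> r) (o\<alpha> r') (a\<alpha> r r' g) f) \<ominus>\<^bsub>Is s\<^esub> gen s r (em_act M r' r x g) f = \<zero>\<^bsub>Is s\<^esub>"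
    using sq(3) i mod_simps(4)[OF sum_mod i] by (simp add: gen_sproj klinD(8)[OF sq(1), symmetric])
qed (use assms m(8) in auto)

text \<open>Balanced families of bilinear maps: the condition under which the map induced on the
  direct sum vanishes on \<open>ind_rel\<close>, and thus under which \<open>ind_lift\<close> has
  its intended meaning.\<close>

definition ind_compat where
  "ind_compat U \<beta> \<longleftrightarrow> module K U \<and> (\<forall>r \<in> lob R. bilin (em_at M r) (Hs s r) U (\<beta> r)) \<and>
    (\<forall>r \<in> lob R. \<forall>r' \<in> lob R. \<forall>x \<in> carrier (em_at M r'). \<forall>g \<in> carrier (lhom R r r'). \<forall>f \<in> carrier (Hs s r).
      \<beta> r' x (lcmp S s (o\<alpha> r) (o\<alpha> r') (a\<alpha> r r' g) f) = \<beta> r (em_act M r' r x g) f)"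

text \<open>Justifies the definite description \<open>ind_lift\<close> by three universal properties
  in turn: tensor product on each summand, direct sum, quotient by the balancing relations.\<close>

lemma ind_lift_ex1:
  assumes \<beta>: "ind_compat U \<beta>"
  shows "\<exists>!h. h \<in> Lin K (Is s) U \<and>
     (\<forall>r \<in> lob R. \<forall>x \<in> carrier (em_at M r). \<forall>f \<in> carrier (Hs s r). h (gen s r x f) = \<beta> r x f)"
proof (rule ex_ex1I)
  have U: "module K U" and b: "\<And>r. r \<in> lob R \<Longrightarrow> bilin (em_at M r) (Hs s r) U (\<beta> r)"
    using \<beta> by (auto simp: ind_compat_def)
  obtain h where "klin (dsum (lob R) (Ds s)) U h"
    "\<And>r x. r \<in> lob R \<Longrightarrow> x \<in> carrier (Ds s r) \<Longrightarrow>
      h (dinj (lob R) (Ds s) r x) = tlift K (em_at M r) (Hs s r) U (\<beta> r) x"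
    by (rule dsum_lift[of "lob R" "Ds s" U "\<lambda>r x. tlift K (em_at M r) (Hs s r) U (\<beta> r) x"])
      (use U b in \<open>auto intro: tlift_lin\<close>)
  then have h: "klin (Su s) U h"
    and hv: "\<And>r x f. r \<in> lob R \<Longrightarrow> x \<in> carrier (em_at M r) \<Longrightarrow> f \<in> carrier (Hs s r) \<Longrightarrow>
      h (elt s r x f) = \<beta> r x f"
    using b by (auto simp: ind_sum_def ind_elt_def)
  have rel: "x \<in> {x \<in> carrier (Su s). h x = \<zero>\<^bsub>U\<^esub>}" if "x \<in> rel s" for x
    using that unfolding ind_rel_def
  proof (rule mspan_least[OF _ submod_eq[OF h klin_zero[OF sum_mod U]]])
    show "{elt s r' m' (lcmp S s (o\<alpha> r) (o\<alpha> r') (a\<alpha> r r' g) f)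
        \<ominus>\<^bsub>Su s\<^esub> elt s r (em_act M r' r m' g) f |
      r r' m' g f. r \<in> lob R \<and> r' \<in> lob R \<and> m' \<in> carrier (em_at M r') \<and>
        g \<in> carrier (lhom R r r') \<and> f \<in> carrier (Hs s r)} \<subseteq> {x \<in> carrier (Su s). h x = \<zero>\<^bsub>U\<^esub>}"
    proof clarify
      fix r r' m' g f
      assume *: "r \<in> lob R" "r' \<in> lob R" "m' \<in> carrier (em_at M r')" "g \<in> carrier (lhom R r r')" "f \<in> carrier (Hs s r)"
      note i = rel_gen_in[OF *]
      have "\<beta> r' m' (lcmp S s (o\<alpha> r) (o\<alpha> r') (a\<alpha> r r' g) f) = \<beta> r (em_act M r' r m' g) f"
        using \<beta> * by (simp add: ind_compat_def)
      then show "elt s r' m' (lcmp S s (o\<alpha> r) (o\<alpha> r') (a\<alpha> r r' g) f)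
        \<ominus>\<^bsub>Su s\<^esub> elt s r (em_act M r' r m' g) f \<in> carrier (Su s) \<and>
        h (elt s r' m' (lcmp S s (o\<alpha> r) (o\<alpha> r') (a\<alpha> r r' g) f)
        \<ominus>\<^bsub>Su s\<^esub> elt s r (em_act M r' r m' g) f) = \<zero>\<^bsub>U\<^esub>"
        using * i U by (simp add: sum_mod klinD(8)[OF h] hv m(8) bilinD(4)[OF b])
    qed
  qed
  then have ker: "\<And>x. x \<in> carrier (Su s) \<Longrightarrow> sproj (Su s) (rel s) x = \<zero>\<^bsub>Is s\<^esub> \<Longrightarrow> h x = \<zero>\<^bsub>U\<^esub>"
    using sq(3) by auto
  note f = lin_factor[OF sq(1,2) h ker]
  let ?h = "restrict (\<lambda>y. h (inv_into (carrier (Su s)) (sproj (Su s) (rel s)) y)) (carrier (Is s))"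
  have "?h \<in> Lin K (Is s) U \<and> (\<forall>r \<in> lob R. \<forall>x \<in> carrier (em_at M r). \<forall>f \<in> carrier (Hs s r). ?h (gen s r x f) = \<beta> r x f)"
    using f U hv bilinD(4)[OF elt_bilin] ind_gen_closed by (simp add: Lin_iff) (simp add: gen_sproj)
  then show "\<exists>h. h \<in> Lin K (Is s) U \<and> (\<forall>r \<in> lob R. \<forall>x \<in> carrier (em_at M r). \<forall>f \<in> carrier (Hs s r). h (gen s r x f) = \<beta> r x f)"
    by blast
  fix h h' assume hh: "h \<in> Lin K (Is s) U \<and> (\<forall>r \<in> lob R. \<forall>x \<in> carrier (em_at M r). \<forall>f \<in> carrier (Hs s r). h (gen s r x f) = \<beta> r x f)"
    "h' \<in> Lin K (Is s) U \<and> (\<forall>r \<in> lob R. \<forall>x \<in> carrier (em_at M r). \<forall>f \<in> carrier (Hs s r). h' (gen s r x f) = \<beta> r x f)"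
  show "h = h'"
  proof (rule extensionalityI[of _ "carrier (Is s)"])
    show "h \<in> extensional (carrier (Is s))" "h' \<in> extensional (carrier (Is s))"
      using hh U by (auto simp: Lin_iff)
    have "klin (Is s) U h" "klin (Is s) U h'" using hh U by (auto simp: Lin_iff)
    then show "h x = h' x" if "x \<in> carrier (Is s)" for x
      by (rule gens_eq[OF ind_gens _ _ _ that]) (use hh in auto)
  qed
qed

lemma ind_lift_props:
  assumes "ind_compat U \<beta>"
  shows "klin (Is s) U (lft s U \<beta>)" "lft s U \<beta> \<in> extensional (carrier (Is s))"
    and "r \<in> lob R \<Longrightarrow> x \<in> carrier (em_at M r) \<Longrightarrow> f \<in> carrier (Hs s r) \<Longrightarrow> lft s U \<beta> (gen s r x f) = \<beta> r x f"
  using theI'[OF ind_lift_ex1[OF assms], folded ind_lift_def] assms by (auto simp: Lin_iff ind_compat_def)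

lemma ind_lift_cong:
  assumes "\<And>r x f. r \<in> lob R \<Longrightarrow> x \<in> carrier (em_at M r) \<Longrightarrow> f \<in> carrier (Hs s r) \<Longrightarrow> \<beta> r x f = \<beta>' r x f"
  shows "lft s U \<beta> = lft s U \<beta>'"
  using assms by (simp add: ind_lift_def)

private abbreviation "coI \<equiv> \<lambda>r x f. twsum S s (o\<alpha> r) (em_at M r) (Is s \<otimes>\<^sub>K C)
  (\<lambda>m0 f' c'. tens K (Is s) C (gen s r m0 f') c') x f"

private lemma gen_trilin:
  assumes "r \<in> lob R"
  shows "trilin (em_at M r) (Hs s r) C (Is s \<otimes>\<^sub>K C) (\<lambda>m0 f' c'. tens K (Is s) C (gen s r m0 f') c')"
  by (intro trilinI lin_rules bilin_left[OF ind_gen_bilin] bilin_right[OF ind_gen_bilin]) (use assms in auto)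

text \<open>The coaction on the induced module is well defined. The twist of \<alpha>(g)f is split
  by \<open>twsum_cmp\<close>, the part past \<alpha>(g) is pulled back to \<open>R\<close> by
  \<open>twsum_ent\<close>, the balancing relation moves the twisted arrow onto the module factor,
  and what remains is the coaction of x g in \<open>M\<close>.\<close>

private lemma coI_compat: "ind_compat (Is s \<otimes>\<^sub>K C) coI"
  unfolding ind_compat_def
proof (intro conjI ballI)
  show "module K (Is s \<otimes>\<^sub>K C)" by simp
  show "bilin (em_at M r) (Hs s r) (Is s \<otimes>\<^sub>K C) (coI r)" if "r \<in> lob R" for r
    using S.twsum_bilin[OF s fob_closed[OF that] m(1)[OF that] gen_trilin[OF that]] .
  fix r r' x g f
  assume r [simp]: "r \<in> lob R" and r' [simp]: "r' \<in> lob R" and x: "x \<in> carrier (em_at M r')"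
    and g: "g \<in> carrier (lhom R r r')" and f: "f \<in> carrier (Hs s r)"
  note [simp] = m(8)
  let ?\<gamma> = "\<lambda>x0 c'. tlift K (Hs s r) C (Is s \<otimes>\<^sub>K C) (\<lambda>f' c''. tens K (Is s) C (gen s r x0 f') c'') (tw S s (o\<alpha> r) c' f)"
  have gt: "bilin (em_at M r) C (Is s \<otimes>\<^sub>K C) ?\<gamma>"
    by (intro lin_rules S.tw_lin bilin_left[OF ind_gen_bilin] bilin_right[OF ind_gen_bilin]) (use f in auto)
  have F: "trilin (em_at M r') (lhom S (o\<alpha> r) (o\<alpha> r')) C (Is s \<otimes>\<^sub>K C) (\<lambda>v0 g' c'. tlift K (Hs s r) C (Is s \<otimes>\<^sub>K C)
      (\<lambda>f' c''. tens K (Is s) C (gen s r' v0 (lcmp S s (o\<alpha> r) (o\<alpha> r') g' f')) c'') (tw S s (o\<alpha> r) c' f))"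
    by (intro trilinI lin_rules S.tw_lin bilin_left[OF ind_gen_bilin] bilin_right[OF ind_gen_bilin]
        bilin_left[OF S.cmp_bilin] bilin_right[OF S.cmp_bilin]) (use f in auto)
  have "coI r' x (lcmp S s (o\<alpha> r) (o\<alpha> r') (a\<alpha> r r' g) f) =
    twsum S (o\<alpha> r) (o\<alpha> r') (em_at M r') (Is s \<otimes>\<^sub>K C) (\<lambda>v0 g' c'. tlift K (Hs s r) C (Is s \<otimes>\<^sub>K C)
      (\<lambda>f' c''. tens K (Is s) C (gen s r' v0 (lcmp S s (o\<alpha> r) (o\<alpha> r') g' f')) c'') (tw S s (o\<alpha> r) c' f))
      x (a\<alpha> r r' g)"
    by (rule S.twsum_cmp[OF s _ _ m(1)[OF r'] gen_trilin[OF r'] x f]) (use g in auto)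
  also have "\<dots> = twsum R r r' (em_at M r') (Is s \<otimes>\<^sub>K C) (\<lambda>v0 g' c'. tlift K (Hs s r) C (Is s \<otimes>\<^sub>K C)
      (\<lambda>f' c''. tens K (Is s) C (gen s r' v0 (lcmp S s (o\<alpha> r) (o\<alpha> r') (a\<alpha> r r' g') f')) c'') (tw S s (o\<alpha> r) c' f))
      x g"
    by (rule twsum_ent[OF r r' F g])
  also have "\<dots> = twsum R r r' (em_at M r') (Is s \<otimes>\<^sub>K C) (\<lambda>v0 g' c'. ?\<gamma> (em_act M r' r v0 g') c') x g"
    by (intro twsum_cong tlift_cong) (simp add: ind_gen_rel)
  also have "\<dots> = tlift K (em_at M r) C (Is s \<otimes>\<^sub>K C) ?\<gamma> (coact (em_at M r) (em_act M r' r x g))"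
    by (rule R.twisted_bind[OF r r' m(5)[OF r' r] gt x g, symmetric])
  also have "\<dots> = coI r (em_act M r' r x g) f" by (simp add: twsum_def)
  finally show "coI r' x (lcmp S s (o\<alpha> r) (o\<alpha> r') (a\<alpha> r r' g) f) = coI r (em_act M r' r x g) f" .
qed

lemma ind_mod_at: "em_at IM s = cmk (Is s) (lft s (Is s \<otimes>\<^sub>K C) coI)"
  by (simp add: ind_mod_def twsum_def tw_def)

lemma ind_carrier: "carrier (em_at IM s) = carrier (Is s)"
  by (simp add: ind_mod_at)

lemma ind_lin_iff: "klin (em_at IM s) U f \<longleftrightarrow> klin (Is s) U f"
  by (simp add: ind_mod_at)

lemma ind_mod_gens:
  "gens (em_at IM s) {gen s r x f | r x f. r \<in> lob R \<and> x \<in> carrier (em_at M r) \<and> f \<in> carrier (Hs s r)}"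
  using ind_gens by (simp add: ind_mod_at)

lemma ind_twisted:
  assumes r: "r \<in> lob R"
  shows "twisted S s (o\<alpha> r) (em_at M r) (em_at IM s) (gen s r)"
  unfolding twisted_def ind_mod_at
  using m(1)[OF r] ind_gen_bilin[OF r] ind_lift_props[OF coI_compat] r by auto

lemma ind_comodule: "comodule K C (em_at IM s)"
proof (rule comodule_gens[OF _ ind_mod_gens])
  show "precomod (em_at IM s)" using ind_lift_props[OF coI_compat] by (simp add: ind_mod_at)
qed (use S.twisted_comod_at[OF s fob_closed ind_twisted] in auto)

end

private lemma ind_act_compat:
  assumes [simp]: "s \<in> lob S" "s' \<in> lob S" and h: "h \<in> carrier (lhom S s' s)"
  shows "ind_compat s (Is s') (\<lambda>r x f. gen s' r x (lcmp S s' s (o\<alpha> r) f h))"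
  unfolding ind_compat_def[OF assms(1)]
proof (intro conjI ballI)
  show "bilin (em_at M r) (Hs s r) (Is s') (\<lambda>x f. gen s' r x (lcmp S s' s (o\<alpha> r) f h))" if [simp]: "r \<in> lob R" for r
    by (intro lin_rules bilin_left[OF ind_gen_bilin] bilin_right[OF ind_gen_bilin]
        bilin_left[OF S.cmp_bilin] bilin_right[OF S.cmp_bilin]) (use h in auto)
  fix r r' x g f
  assume *: "r \<in> lob R" "r' \<in> lob R" "x \<in> carrier (em_at M r')" "g \<in> carrier (lhom R r r')" "f \<in> carrier (Hs s r)"
  then show "gen s' r' x (lcmp S s' s (o\<alpha> r') (lcmp S s (o\<alpha> r) (o\<alpha> r') (a\<alpha> r r' g) f) h) =
    gen s' r (em_act M r' r x g) (lcmp S s' s (o\<alpha> r) f h)"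
    using h by (simp add: ind_gen_rel[symmetric] S.cmp_assoc)
qed simp

private lemma ind_act: "em_act IM s s' t h = lft s (Is s') (\<lambda>r x f. gen s' r x (lcmp S s' s (o\<alpha> r) f h)) t"
  by (simp add: ind_mod_def)

lemma ind_act_gen:
  assumes "s \<in> lob S" "s' \<in> lob S" "h \<in> carrier (lhom S s' s)"
    "r \<in> lob R" "x \<in> carrier (em_at M r)" "f \<in> carrier (Hs s r)"
  shows "em_act IM s s' (gen s r x f) h = gen s' r x (lcmp S s' s (o\<alpha> r) f h)"
  unfolding ind_act by (rule ind_lift_props(3)[OF assms(1) ind_act_compat[OF assms(1-3)] assms(4-6)])

private lemma ind_act_bilin:
  assumes [simp]: "s \<in> lob S" "s' \<in> lob S"
  shows "bilin (em_at IM s) (lhom S s' s) (em_at IM s') (em_act IM s s')"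
proof -
  have "klin (Is s) (Is s') (\<lambda>t. em_act IM s s' t h)" if "h \<in> carrier (lhom S s' s)" for h
    unfolding ind_act by (rule ind_lift_props(1)[OF assms(1) ind_act_compat[OF assms that]])
  note l = this
  have "klin (lhom S s' s) (Is s') (\<lambda>h. em_act IM s s' t h)" if "t \<in> carrier (Is s)" for t
  proof (rule lin_family[OF _ ind_gens[OF assms(1)] l _ that])
    fix y assume "y \<in> {gen s r x f |r x f. r \<in> lob R \<and> x \<in> carrier (em_at M r) \<and> f \<in> carrier (Hs s r)}"
    then obtain r x f where [simp]: "y = gen s r x f" "r \<in> lob R" "x \<in> carrier (em_at M r)" "f \<in> carrier (Hs s r)"
      by auto
    have "klin (lhom S s' s) (Is s') (\<lambda>h. gen s' r x (lcmp S s' s (o\<alpha> r) f h))"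
      by (intro bilin_right[OF ind_gen_bilin] bilin_right[OF S.cmp_bilin] klin_id) auto
    then show "klin (lhom S s' s) (Is s') (\<lambda>h. em_act IM s s' y h)"
      by (rule klin_cong) (simp add: ind_act_gen)
  qed auto
  then show ?thesis using l by (intro bilinI) (auto simp: ind_mod_at)
qed

lemma ind_entwined: "entwined_module K C S IM"
proof (rule S.entmodI)
  show "comodule K C (em_at IM s)" if "s \<in> lob S" for s by (rule ind_comodule[OF that])
  show "twisted S s' s (em_at IM s) (em_at IM s') (em_act IM s s')" if [simp]: "s \<in> lob S" "s' \<in> lob S" for s s'
  proof (rule S.twisted_gens[OF that ind_comodule _ ind_act_bilin ind_mod_gens])
    fix y f
    assume "y \<in> {gen s r x f |r x f. r \<in> lob R \<and> x \<in> carrier (em_at M r) \<and> f \<in> carrier (Hs s r)}"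
    then obtain r x g where y: "y = gen s r x g" and [simp]: "r \<in> lob R" "x \<in> carrier (em_at M r)" "g \<in> carrier (Hs s r)"
      by auto
    assume [simp]: "f \<in> carrier (lhom S s' s)"
    show "coact (em_at IM s') (em_act IM s s' y f) = twsum S s' s (em_at IM s) (em_at IM s' \<otimes>\<^sub>K C)
      (\<lambda>m0 f' c'. tens K (em_at IM s') C (em_act IM s s' m0 f') c') y f"
      unfolding y
      by (rule S.twisted_act[OF that fob_closed ind_twisted ind_twisted ind_act_bilin]) (auto simp: ind_act_gen)
  qed (use comoduleD(1)[OF ind_comodule] in auto)
  have l: "klin (em_at IM s) (em_at IM s') (\<lambda>t. em_act IM s s' t f)"
    if "s \<in> lob S" "s' \<in> lob S" "f \<in> carrier (lhom S s' s)" for s s' f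
    using bilinD(6)[OF ind_act_bilin] that .
  show "em_act IM s s t (lid S s) = t" if [simp]: "s \<in> lob S" and t: "t \<in> carrier (em_at IM s)" for s t
    by (rule gens_eq[OF ind_mod_gens l klin_id _ t])
      (use comoduleD(2)[OF ind_comodule] in \<open>auto simp: ind_act_gen\<close>)
  show "em_act IM s u t (lcmp S u s' s f g) = em_act IM s' u (em_act IM s s' t f) g"
    if [simp]: "s \<in> lob S" "s' \<in> lob S" "u \<in> lob S" and t: "t \<in> carrier (em_at IM s)"
      and [simp]: "f \<in> carrier (lhom S s' s)" "g \<in> carrier (lhom S u s')" for s s' u t f g
    by (rule gens_eq[OF ind_mod_gens l klin_comp[OF l l] _ t]) (auto simp: ind_act_gen S.cmp_assoc)
qed

definition ind_unit :: "'u \<Rightarrow> 'u \<Rightarrow> 'u" where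
  "ind_unit r x = gen (o\<alpha> r) r x (lid S (o\<alpha> r))"

text \<open>m \<otimes> f = (m \<otimes> id)f: the units generate the induced module under the
  action of \<open>S\<close>, which is what uniqueness in \<open>ind_unique\<close> rests
  on.\<close>

lemma ind_gen_unit:
  assumes "s \<in> lob S" "r \<in> lob R" "x \<in> carrier (em_at M r)" "f \<in> carrier (Hs s r)"
  shows "gen s r x f = em_act IM (o\<alpha> r) s (ind_unit r x) f"
  using assms by (simp add: ind_unit_def ind_act_gen)

lemma ind_unit_emor: "emor R M (restr_mod \<alpha> IM) ind_unit"
  unfolding emor_def
proof (intro conjI ballI)
  show "colin (em_at M r) (em_at (restr_mod \<alpha> IM) r) (ind_unit r)" if "r \<in> lob R" for r
    using S.twisted_unit[OF fob_closed[OF that] ind_twisted[OF fob_closed[OF that] that]]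
    by (simp add: ind_unit_def[abs_def])
  fix r s x f assume [simp]: "r \<in> lob R" "s \<in> lob R" "x \<in> carrier (em_at M r)" "f \<in> carrier (lhom R s r)"
  have "ind_unit s (em_act M r s x f) = gen (o\<alpha> s) r x (a\<alpha> s r f)"
    by (simp add: ind_unit_def ind_gen_rel[symmetric])
  also have "\<dots> = em_act (restr_mod \<alpha> IM) r s (ind_unit r x) f"
    by (simp add: ind_gen_unit)
  finally show "ind_unit s (em_act M r s x f) = em_act (restr_mod \<alpha> IM) r s (ind_unit r x) f" .
qed

context
  fixes N h
  assumes N: "entwined_module K C S N" and h: "emor R M (restr_mod \<alpha> N) h"
begin

text \<open>The transpose of \<open>h\<close>. The outer restriction makes it equal, as a function,
  to the structure maps of \<open>ex_obj\<close> and to \<open>ind_map\<close> in the cases needed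
  later.\<close>

definition ind_ext :: "'u \<Rightarrow> 'u \<Rightarrow> 'u" where
  "ind_ext = (\<lambda>s \<in> lob S. lft s (em_at N s) (\<lambda>r x f. em_act N (o\<alpha> r) s (h r x) f))"

private lemma h_closed [simp]: "r \<in> lob R \<Longrightarrow> x \<in> carrier (em_at M r) \<Longrightarrow> h r x \<in> carrier (em_at N (o\<alpha> r))"
  using emorD(3)[OF h] by simp

private lemma ext_twisted:
  assumes [simp]: "s \<in> lob S" "r \<in> lob R"
  shows "twisted S s (o\<alpha> r) (em_at M r) (em_at N s) (\<lambda>x f. em_act N (o\<alpha> r) s (h r x) f)"
  by (rule S.twisted_pre[OF _ _ _ m(1) S.entmodD(5)[OF N]]) (use emorD(1)[OF h] in auto)

private lemma ext_compat:
  assumes [simp]: "s \<in> lob S"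
  shows "ind_compat s (em_at N s) (\<lambda>r x f. em_act N (o\<alpha> r) s (h r x) f)"
  unfolding ind_compat_def[OF assms]
proof (intro conjI ballI)
  show "module K (em_at N s)" using S.entmodD(3)[OF N] by simp
  show "bilin (em_at M r) (Hs s r) (em_at N s) (\<lambda>x f. em_act N (o\<alpha> r) s (h r x) f)" if "r \<in> lob R" for r
    using ext_twisted[OF assms that] by (simp add: twisted_def)
  fix r r' x g f
  assume [simp]: "r \<in> lob R" "r' \<in> lob R" "x \<in> carrier (em_at M r')" "g \<in> carrier (lhom R r r')" "f \<in> carrier (Hs s r)"
  show "em_act N (o\<alpha> r') s (h r' x) (lcmp S s (o\<alpha> r) (o\<alpha> r') (a\<alpha> r r' g) f) =
    em_act N (o\<alpha> r) s (h r (em_act M r' r x g)) f"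
    using S.entmodD(7)[OF N, of "o\<alpha> r'" "o\<alpha> r" s "h r' x" "a\<alpha> r r' g" f]
    by (simp add: emorD(4)[OF h])
qed

lemma ind_ext_gen:
  "s \<in> lob S \<Longrightarrow> r \<in> lob R \<Longrightarrow> x \<in> carrier (em_at M r) \<Longrightarrow> f \<in> carrier (Hs s r) \<Longrightarrow>
    ind_ext s (gen s r x f) = em_act N (o\<alpha> r) s (h r x) f"
  unfolding ind_ext_def using ind_lift_props(3)[OF _ ext_compat] by simp

lemma ind_ext_unit: "r \<in> lob R \<Longrightarrow> x \<in> carrier (em_at M r) \<Longrightarrow> ind_ext (o\<alpha> r) (ind_unit r x) = h r x"
  unfolding ind_unit_def by (simp add: ind_ext_gen S.entmodD(6)[OF N])

lemma ind_ext_extensional: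
  "ind_ext \<in> extensional (lob S)" "s \<in> lob S \<Longrightarrow> ind_ext s \<in> extensional (carrier (em_at IM s))"
  using ind_lift_props(2)[OF _ ext_compat] by (auto simp: ind_ext_def ind_carrier)

lemma ind_ext_emor: "emor S IM N ind_ext"
  unfolding emor_def
proof (intro conjI ballI)
  have l: "klin (em_at IM s) (em_at N s) (ind_ext s)" if "s \<in> lob S" for s
    using ind_lift_props(1)[OF that ext_compat[OF that]] that by (simp add: ind_lin_iff ind_ext_def)
  fix s assume s [simp]: "s \<in> lob S"
  show "colin (em_at IM s) (em_at N s) (ind_ext s)"
  proof (rule colin_gens[OF comoduleD(1)[OF ind_comodule[OF s]] S.entmodD(2)[OF N s] l[OF s] ind_mod_gens[OF s]])
    fix y assume "y \<in> {gen s r x f |r x f. r \<in> lob R \<and> x \<in> carrier (em_at M r) \<and> f \<in> carrier (Hs s r)}"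
    then obtain r x f where y: "y = gen s r x f" and r [simp]: "r \<in> lob R" and x: "x \<in> carrier (em_at M r)" "f \<in> carrier (Hs s r)"
      by auto
    show "colin_at (em_at IM s) (em_at N s) (ind_ext s) y"
      unfolding y
      by (rule S.twisted_colin_at[OF s fob_closed[OF r] ind_twisted[OF s r] ext_twisted[OF s r] l[OF s] ind_ext_gen x])
        (auto)
  qed
  fix s' t f assume [simp]: "s' \<in> lob S" and t: "t \<in> carrier (em_at IM s)" and [simp]: "f \<in> carrier (lhom S s' s)"
  show "ind_ext s' (em_act IM s s' t f) = em_act N s s' (ind_ext s t) f"
    by (rule gens_eq[OF ind_mod_gens[OF s] _ _ _ t, where W = "em_at N s'"];
        (intro klin_comp[OF _ l] bilin_left[OF ind_act_bilin] bilin_left[OF S.entmodD(4)[OF N]] klin_id l)?)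
      (use comoduleD(2)[OF ind_comodule] S.entmodD(7)[OF N] in \<open>auto simp: ind_act_gen ind_ext_gen\<close>)
qed

end

lemma ind_unique:
  assumes \<eta>: "emor S IM N \<eta>" and \<theta>: "emor S IM N \<theta>"
    and eq: "\<And>r x. r \<in> lob R \<Longrightarrow> x \<in> carrier (em_at M r) \<Longrightarrow> \<eta> (o\<alpha> r) (ind_unit r x) = \<theta> (o\<alpha> r) (ind_unit r x)"
    and s [simp]: "s \<in> lob S" and t: "t \<in> carrier (em_at IM s)"
  shows "\<eta> s t = \<theta> s t"
proof (rule gens_eq[OF ind_mod_gens emorD(2)[OF \<eta>] emorD(2)[OF \<theta>] _ t])
  fix y assume "y \<in> {gen s r x f |r x f. r \<in> lob R \<and> x \<in> carrier (em_at M r) \<and> f \<in> carrier (Hs s r)}"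
  then obtain r x f where y: "y = gen s r x f" and *: "r \<in> lob R" "x \<in> carrier (em_at M r)" "f \<in> carrier (Hs s r)"
    by auto
  have u: "ind_unit r x \<in> carrier (em_at IM (o\<alpha> r))" using * by (simp add: ind_unit_def ind_carrier)
  then show "\<eta> s y = \<theta> s y"
    using * emorD(4)[OF \<eta> fob_closed s u] emorD(4)[OF \<theta> fob_closed s u] eq by (simp add: y ind_gen_unit)
qed auto

end

end

section \<open>Modules over a representation\<close>

context coalg
begin

text \<open>Restriction along an identity or a composite agrees with the expected module only on
  objects and arrows of \<open>R\<close>; as records the two may differ elsewhere. Equality of
  targets is therefore replaced by this transfer.\<close>

lemma emor_target_cong:
  assumes "\<And>r. r \<in> lob R \<Longrightarrow> em_at N r = em_at N' r"
    and "\<And>r s x f. r \<in> lob R \<Longrightarrow> s \<in> lob R \<Longrightarrow> x \<in> carrier (em_at N r) \<Longrightarrow> f \<in> carrier (lhom R s r) \<Longrightarrow>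
      em_act N r s x f = em_act N' r s x f"
  shows "emor R M N \<eta> \<longleftrightarrow> emor R M N' \<eta>"
proof -
  have *: "emor R M Q \<eta>"
    if h: "emor R M P \<eta>" and a: "\<And>r. r \<in> lob R \<Longrightarrow> em_at P r = em_at Q r"
      "\<And>r s x f. r \<in> lob R \<Longrightarrow> s \<in> lob R \<Longrightarrow> x \<in> carrier (em_at P r) \<Longrightarrow> f \<in> carrier (lhom R s r) \<Longrightarrow>
        em_act P r s x f = em_act Q r s x f" for P Q
    unfolding emor_def
  proof (intro conjI ballI)
    show "colin (em_at M r) (em_at Q r) (\<eta> r)" if "r \<in> lob R" for r
      using emorD(1)[OF h that] a(1)[OF that] by simp
    fix r s m f assume *: "r \<in> lob R" "s \<in> lob R" "m \<in> carrier (em_at M r)" "f \<in> carrier (lhom R s r)"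
    show "\<eta> s (em_act M r s m f) = em_act Q r s (\<eta> r m) f"
      using emorD(4)[OF h *(1-4)] a(2)[OF *(1,2) emorD(3)[OF h *(1,3)] *(4)] by simp
  qed
  show ?thesis
    using *[of N N'] *[of N' N] assms by auto
qed

end

context entw
begin

section \<open>The category of entwined modules and its zero object\<close>

lemma entmod_cat_simps [simp]:
  "Ob (entmod_cat K C R) = {M. entwined_module K C R M}"
  "Hom (entmod_cat K C R) = entmod_maps K C R"
  "ident (entmod_cat K C R) M = em_restrict M (\<lambda>r m. m)"
  by (simp_all add: entmod_cat_def em_restrict_def)

lemma entmod_cmp_apply [simp]:
  "r \<in> lob R \<Longrightarrow> x \<in> carrier (em_at L r) \<Longrightarrow> cmp (entmod_cat K C R) L M N \<theta> \<eta> r x = \<theta> r (\<eta> r x)"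
  by (simp add: entmod_cat_def compose_def)

lemma em_restrict_apply [simp]:
  "r \<in> lob R \<Longrightarrow> x \<in> carrier (em_at M r) \<Longrightarrow> em_restrict M \<eta> r x = \<eta> r x"
  by (simp add: em_restrict_def)

lemma em_restrict_maps:
  assumes M: "entwined_module K C R M" and \<eta>: "emor R M N \<eta>"
  shows "em_restrict M \<eta> \<in> entmod_maps K C R M N"
proof -
  have "emor R M N (em_restrict M \<eta>)" by (rule emor_cong[OF \<eta> M]) simp
  then show ?thesis
    by (subst entmod_maps_iff) (use entmodD(2)[OF M] colinD(2)[OF emorD(1)[OF \<eta>]] in \<open>auto simp: em_restrict_def\<close>)
qed

lemma entmod_mapsD:
  assumes M: "entwined_module K C R M" and N: "entwined_module K C R N"
    and \<eta>: "\<eta> \<in> entmod_maps K C R M N"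
  shows "emor R M N \<eta>" "\<eta> \<in> extensional (lob R)" "r \<in> lob R \<Longrightarrow> \<eta> r \<in> extensional (carrier (em_at M r))"
  using \<eta> entmod_maps_iff[of M N] entmodD(2)[OF M] entmodD(2)[OF N] by auto

lemma entmod_cmp_eq: "cmp (entmod_cat K C R) L M N \<theta> \<eta> = em_restrict L (\<lambda>r x. \<theta> r (\<eta> r x))"
  by (simp add: entmod_cat_def em_restrict_def compose_def)

lemma em_ext:
  assumes "\<eta> \<in> extensional (lob R)" "\<And>r. r \<in> lob R \<Longrightarrow> \<eta> r \<in> extensional (carrier (em_at M r))"
    and "\<theta> \<in> extensional (lob R)" "\<And>r. r \<in> lob R \<Longrightarrow> \<theta> r \<in> extensional (carrier (em_at M r))"
    and "\<And>r x. r \<in> lob R \<Longrightarrow> x \<in> carrier (em_at M r) \<Longrightarrow> \<eta> r x = \<theta> r x"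
  shows "\<eta> = \<theta>"
  by (rule extensionalityI[OF assms(1,3)], rule extensionalityI[OF assms(2,4)]) (use assms(5) in auto)

lemma em_restrict_ext:
  "em_restrict M \<eta> \<in> extensional (lob R)" "r \<in> lob R \<Longrightarrow> em_restrict M \<eta> r \<in> extensional (carrier (em_at M r))"
  by (auto simp: em_restrict_def)

lemma em_restrict_eqI:
  assumes "entwined_module K C R M" "entwined_module K C R N" "\<eta> \<in> entmod_maps K C R M N"
    and "\<And>r x. r \<in> lob R \<Longrightarrow> x \<in> carrier (em_at M r) \<Longrightarrow> \<eta> r x = \<theta> r x"
  shows "em_restrict M \<theta> = \<eta>"
  by (rule em_ext[where M = M]) (use entmod_mapsD[OF assms(1-3)] em_restrict_ext assms(4) in auto)

lemma emor_id: "entwined_module K C R M \<Longrightarrow> emor R M M (\<lambda>r x. x)"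
  unfolding emor_def by (auto intro: colin_id entmodD(2))

lemma entmod_category: "category (entmod_cat K C R)"
proof (unfold_locales, unfold entmod_cat_simps mem_Collect_eq)
  note D = entmod_mapsD
  show "em_restrict M (\<lambda>r m. m) \<in> entmod_maps K C R M M" if "entwined_module K C R M" for M
    using that em_restrict_maps emor_id by blast
  show "cmp (entmod_cat K C R) L M N \<theta> \<eta> \<in> entmod_maps K C R L N"
    if "entwined_module K C R L" "entwined_module K C R M" "entwined_module K C R N"
      "\<eta> \<in> entmod_maps K C R L M" "\<theta> \<in> entmod_maps K C R M N" for L M N \<eta> \<theta>
    unfolding entmod_cmp_eq
    by (rule em_restrict_maps[OF that(1) emor_comp[OF D(1)[OF that(1,2,4)] D(1)[OF that(2,3,5)]]])
  show "cmp (entmod_cat K C R) M M N f (em_restrict M (\<lambda>r m. m)) = f"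
    "cmp (entmod_cat K C R) M N N (em_restrict N (\<lambda>r m. m)) f = f"
    if "entwined_module K C R M" "entwined_module K C R N" "f \<in> entmod_maps K C R M N" for M N f
    using that emorD(3)[OF D(1)[OF that]] unfolding entmod_cmp_eq
    by (auto intro!: em_restrict_eqI[of M N])
  show "cmp (entmod_cat K C R) M L P h (cmp (entmod_cat K C R) M N L g f) =
    cmp (entmod_cat K C R) M N P (cmp (entmod_cat K C R) N L P h g) f"
    if "entwined_module K C R M" "entwined_module K C R N" "entwined_module K C R L" "entwined_module K C R P"
      "f \<in> entmod_maps K C R M N" "g \<in> entmod_maps K C R N L" "h \<in> entmod_maps K C R L P" for M N L P f g h
    using emorD(3)[OF D(1)[OF that(1,2,5)]] unfolding entmod_cmp_eq
    by (intro em_ext[of _ M] em_restrict_ext) auto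
qed

lemma zero_at:
  "em_at (zero_entmod K C) r = cmk \<lparr>carrier = {undefined}, monoid.mult = undefined, monoid.one = undefined,
     ring.zero = undefined, ring.add = (\<lambda>_ _. undefined), smult = (\<lambda>_ _. undefined)\<rparr>
     (\<lambda>_. \<zero>\<^bsub>\<lparr>carrier = {undefined}, monoid.mult = undefined, monoid.one = undefined,
     ring.zero = undefined, ring.add = (\<lambda>_ _. undefined), smult = (\<lambda>_ _. undefined)\<rparr> \<otimes>\<^sub>K C\<^esub>)"
  by (simp add: zero_entmod_def Let_def)

lemma zero_carrier [simp]: "carrier (em_at (zero_entmod K C) r) = {undefined}"
  "\<zero>\<^bsub>em_at (zero_entmod K C) r\<^esub> = undefined"
  by (simp_all add: zero_at)

lemma zero_module: "module K (em_at (zero_entmod K C) r)"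
  unfolding zero_at module_cmk
  by (intro moduleI is_cring abelian_groupI) auto

lemma zero_precomod: "precomod (em_at (zero_entmod K C) r)"
  unfolding zero_at precomod_cmk
  by (rule klin_zero) (use zero_module in \<open>auto simp: zero_at\<close>)

lemma zero_comodule: "comodule K C (em_at (zero_entmod K C) r)"
proof -
  let ?Z = "em_at (zero_entmod K C) r"
  note Z = precomodD[OF zero_precomod[of r]]
  note [simp] = Z(1) Z(3)
  have 0: "coact ?Z undefined = \<zero>\<^bsub>?Z \<otimes>\<^sub>K C\<^esub>" using klinD(6)[OF Z(2)] by simp
  have t: "tlift K ?Z C U \<beta> \<zero>\<^bsub>?Z \<otimes>\<^sub>K C\<^esub> = \<zero>\<^bsub>U\<^esub>" if "bilin ?Z C U \<beta>" for U :: "('u,'u,'z) module_scheme" and \<beta>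
    using klinD(6)[OF tlift_lin[OF that]] .
  have "comod_at ?Z undefined"
    unfolding comod_at_def 0
    by (subst t, (intro lin_rules comult_lin; simp), subst t, (intro lin_rules Z(4); simp),
        subst t, (intro lin_rules counit_lin klin_smult; simp)) simp
  then show ?thesis by (simp add: comodule_iff zero_precomod)
qed

lemma zero_entwined: "entwined_module K C R (zero_entmod K C)"
proof (rule entmodI)
  let ?Z = "em_at (zero_entmod K C)"
  have act: "em_act (zero_entmod K C) r s m f = undefined" for r s m f
    by (simp add: zero_entmod_def Let_def)
  have l: "klin Y (?Z s) (\<lambda>_. undefined)" if "module K Y" for Y :: "('u,'u,'z) module_scheme" and s
    using klin_zero[OF that zero_module] by simp
  show "comodule K C (?Z r)" for r by (rule zero_comodule)
  show "twisted R s r (?Z r) (?Z s) (em_act (zero_entmod K C) r s)" if [simp]: "r \<in> lob R" "s \<in> lob R" for r s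
  \<comment> \<open>The zero space is generated by the empty set, so nothing remains to be checked
    on generators.\<close>
  proof (rule twisted_gens[OF that zero_comodule zero_precomod, where G = "{}"])
    show b: "bilin (?Z r) (lhom R s r) (?Z s) (em_act (zero_entmod K C) r s)"
      unfolding act[abs_def] by (intro bilinI l zero_module) auto
    show "gens (?Z r) {}"
      using submodD(3)[OF zero_module] zero_module by (intro gensI) auto
  qed simp
  show "em_act (zero_entmod K C) r r m (lid R r) = m" if "m \<in> carrier (?Z r)" for r m
    using that by (simp add: act)
  show "em_act (zero_entmod K C) r t m (lcmp R t s r f g) =
    em_act (zero_entmod K C) s t (em_act (zero_entmod K C) r s m f) g" for r s t m f g
    by (simp add: act)
qed

lemma emor_zero:
  assumes M: "entwined_module K C R M" and N: "entwined_module K C R N"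
  shows "emor R M N (\<lambda>r x. \<zero>\<^bsub>em_at N r\<^esub>)"
  unfolding emor_def
proof (intro conjI ballI)
  show "colin (em_at M r) (em_at N r) (\<lambda>x. \<zero>\<^bsub>em_at N r\<^esub>)" if "r \<in> lob R" for r
    by (rule colin_zero[OF entmodD(2)[OF M that] entmodD(2)[OF N that]])
  show "\<zero>\<^bsub>em_at N s\<^esub> = em_act N r s \<zero>\<^bsub>em_at N r\<^esub> f" if "r \<in> lob R" "s \<in> lob R" "f \<in> carrier (lhom R s r)" for r s f
    using klinD(6)[OF bilinD(6)[OF entmodD(4)[OF N that(1,2)] that(3)]] by simp
qed

lemma zero_unique:
  assumes "emor R (zero_entmod K C) N \<eta>" "r \<in> lob R" "x \<in> carrier (em_at (zero_entmod K C) r)"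
  shows "\<eta> r x = \<zero>\<^bsub>em_at N r\<^esub>"
  using klinD(6)[OF emorD(2)[OF assms(1,2)]] assms(3) by simp

end

context ent_mor
begin

lemma restr_emor: "emor S M N \<eta> \<Longrightarrow> emor R (restr_mod \<alpha> M) (restr_mod \<alpha> N) (\<lambda>r. \<eta> (o\<alpha> r))"
  unfolding emor_def by auto

lemma ind_lift_cmk [simp]: "ind_lift K R S \<alpha> M s (cmk U \<rho>) = ind_lift K R S \<alpha> M s U"
  by (simp add: ind_lift_def Lin_def fun_eq_iff)

text \<open>\<open>ex_obj\<close> and \<open>ind_map\<close> lift into the bare space,
  \<open>ind_ext\<close> into the comodule over it. The two lifts coincide because
  \<open>Lin\<close> does not read the coaction.\<close>

lemma ind_lift_at:
  assumes "entwined_module K C S N" "entwined_module K C R M"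
  shows "s \<in> lob S \<Longrightarrow> em_at N s = cmk U \<rho> \<Longrightarrow> emor R M (restr_mod \<alpha> N) h \<Longrightarrow>
    ind_ext M N h s = ind_lift K R S \<alpha> M s U (\<lambda>r x f. em_act N (o\<alpha> r) s (h r x) f)"
  by (simp add: ind_ext_def[OF assms(2,1)])

end

section \<open>The category of modules over a representation\<close>

locale rep = coalg K C for K :: "'u ring" (structure) and C :: "'u coalg" +
  fixes \<R> :: "('x::order, 'u) rep"
  assumes rep: "ent_representation K C \<R>"
begin

abbreviation E :: "'x \<Rightarrow> 'u entw" where "E x \<equiv> fob \<R> x"
abbreviation A where "A x y \<equiv> farr \<R> x y ()"

lemma functor_rep: "cat_functor poset_cat (ent_cat K C) \<R>"
  using rep by (simp add: ent_representation_def)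

lemma entw_E: "entw K C (E x)"
  using cat_functor.fob_in[OF functor_rep, of x]
  by unfold_locales (simp add: poset_cat_def ent_cat_def)

sublocale E: entw K C "E x" for x
  by (rule entw_E)

lemma mor_A: "x \<le> y \<Longrightarrow> ent_mor K C (E x) (E y) (A x y)"
  using cat_functor.farr_in[OF functor_rep, of x y "()"]
  by unfold_locales (simp add: poset_cat_def ent_cat_def)

lemma A_refl:
  "r \<in> lob (E x) \<Longrightarrow> fob (A x x) r = r"
  "r \<in> lob (E x) \<Longrightarrow> s \<in> lob (E x) \<Longrightarrow> f \<in> carrier (lhom (E x) r s) \<Longrightarrow> farr (A x x) r s f = f"
  using cat_functor.farr_ident[OF functor_rep, of x] by (auto simp: poset_cat_def ent_cat_def)

lemma A_trans:
  assumes "x \<le> y" "y \<le> z"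
  shows "r \<in> lob (E x) \<Longrightarrow> fob (A x z) r = fob (A y z) (fob (A x y) r)"
    "r \<in> lob (E x) \<Longrightarrow> s \<in> lob (E x) \<Longrightarrow> f \<in> carrier (lhom (E x) r s) \<Longrightarrow>
      farr (A x z) r s f = farr (A y z) (fob (A x y) r) (fob (A x y) s) (farr (A x y) r s f)"
  using cat_functor.farr_cmp[OF functor_rep, of x y z "()" "()"] assms
  by (auto simp: poset_cat_def ent_cat_def)

lemmas fobA [simp] = ent_mor.fob_closed[OF mor_A]
lemmas restr_entwinedA = ent_mor.restr_entwined[OF mor_A]

lemma emor_refl: "emor (E x) M (restr_mod (A x x) N) h \<longleftrightarrow> emor (E x) M N h"
  by (rule emor_target_cong) (simp_all add: A_refl)

lemma emor_trans:
  assumes "x \<le> y" "y \<le> z"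
  shows "emor (E x) M (restr_mod (A x y) (restr_mod (A y z) N)) h \<longleftrightarrow> emor (E x) M (restr_mod (A x z) N) h"
  by (rule emor_target_cong) (simp_all add: A_trans[OF assms])

lemma rep_cat_simps [simp]:
  "Ob (rep_module_cat K C \<R>) = {M. rep_module K C \<R> M}"
  "Hom (rep_module_cat K C \<R>) = rep_module_maps K C \<R>"
  "ident (rep_module_cat K C \<R>) M = (\<lambda>x. E.em_restrict x (rm_at M x) (\<lambda>r m. m))"
  by (simp_all add: rep_module_cat_def fun_eq_iff)

lemma rep_cmp_eq:
  "cmp (rep_module_cat K C \<R>) L M N \<theta> \<eta> = (\<lambda>x. E.em_restrict x (rm_at L x) (\<lambda>r m. \<theta> x r (\<eta> x r m)))"
  by (simp add: rep_module_cat_def E.entmod_cmp_eq)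

lemma rep_moduleI:
  assumes "\<And>x. entwined_module K C (E x) (rm_at M x)"
    and "\<And>x y. x \<le> y \<Longrightarrow> emor (E x) (rm_at M x) (restr_mod (A x y) (rm_at M y)) (rm_map M x y)"
    and "\<And>x y. x \<le> y \<Longrightarrow> rm_map M x y \<in> extensional (lob (E x))"
    and "\<And>x y r. x \<le> y \<Longrightarrow> r \<in> lob (E x) \<Longrightarrow> rm_map M x y r \<in> extensional (carrier (em_at (rm_at M x) r))"
    and "\<And>x r m. r \<in> lob (E x) \<Longrightarrow> m \<in> carrier (em_at (rm_at M x) r) \<Longrightarrow> rm_map M x x r m = m"
    and "\<And>x y z r m. x \<le> y \<Longrightarrow> y \<le> z \<Longrightarrow> r \<in> lob (E x) \<Longrightarrow> m \<in> carrier (em_at (rm_at M x) r) \<Longrightarrow>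
      rm_map M x z r m = rm_map M y z (fob (A x y) r) (rm_map M x y r m)"
  shows "rep_module K C \<R> M"
  unfolding rep_module_def
proof (intro conjI allI impI)
  show map: "rm_map M x y \<in> entmod_maps K C (E x) (rm_at M x) (restr_mod (A x y) (rm_at M y))" if "x \<le> y" for x y
    by (subst E.entmod_maps_iff)
      (use that assms(1-4) E.entmodD(2)[OF assms(1)] E.entmodD(2)[OF restr_entwinedA[OF that assms(1)]] in auto)
  show "rm_map M x x = ident (entmod_cat K C (E x)) (rm_at M x)" for x
    unfolding E.entmod_cat_simps
    by (rule E.em_restrict_eqI[OF assms(1) restr_entwinedA[OF order_refl assms(1)] map[OF order_refl], symmetric])
      (use assms(5) in auto)
  fix x y z :: 'x assume "x \<le> y \<and> y \<le> z"
  then have xy: "x \<le> y" and yz: "y \<le> z" and xz: "x \<le> z" by auto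
  show "rm_map M x z = cmp (entmod_cat K C (E x)) (rm_at M x) (restr_mod (A x y) (rm_at M y))
    (restr_mod (A x z) (rm_at M z)) (restr_map (E x) (A x y) (rm_map M y z)) (rm_map M x y)"
    unfolding E.entmod_cmp_eq
    by (rule E.em_restrict_eqI[OF assms(1) restr_entwinedA[OF xz assms(1)] map[OF xz], symmetric])
      (use assms(6)[OF xy yz] in \<open>auto simp: restr_map_def\<close>)
qed (use assms(1) in auto)

lemma rep_moduleD:
  assumes "rep_module K C \<R> M"
  shows "entwined_module K C (E x) (rm_at M x)"
    and "x \<le> y \<Longrightarrow> emor (E x) (rm_at M x) (restr_mod (A x y) (rm_at M y)) (rm_map M x y)"
    and "r \<in> lob (E x) \<Longrightarrow> m \<in> carrier (em_at (rm_at M x) r) \<Longrightarrow> rm_map M x x r m = m"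
    and "x \<le> y \<Longrightarrow> y \<le> z \<Longrightarrow> r \<in> lob (E x) \<Longrightarrow> m \<in> carrier (em_at (rm_at M x) r) \<Longrightarrow>
      rm_map M x z r m = rm_map M y z (fob (A x y) r) (rm_map M x y r m)"
proof -
  note M = assms[unfolded rep_module_def]
  show e: "entwined_module K C (E x) (rm_at M x)" for x using M by auto
  show "emor (E x) (rm_at M x) (restr_mod (A x y) (rm_at M y)) (rm_map M x y)" if "x \<le> y" for x y
    using M E.entmod_mapsD(1)[OF e restr_entwinedA[OF that e]] that by blast
  have 1: "rm_map M x x = ident (entmod_cat K C (E x)) (rm_at M x)" for x using M by blast
  show "r \<in> lob (E x) \<Longrightarrow> m \<in> carrier (em_at (rm_at M x) r) \<Longrightarrow> rm_map M x x r m = m"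
    unfolding 1 by simp
  assume xyz: "x \<le> y" "y \<le> z"
  then have 2: "rm_map M x z = cmp (entmod_cat K C (E x)) (rm_at M x) (restr_mod (A x y) (rm_at M y))
    (restr_mod (A x z) (rm_at M z)) (restr_map (E x) (A x y) (rm_map M y z)) (rm_map M x y)"
    using M by blast
  show "r \<in> lob (E x) \<Longrightarrow> m \<in> carrier (em_at (rm_at M x) r) \<Longrightarrow>
      rm_map M x z r m = rm_map M y z (fob (A x y) r) (rm_map M x y r m)"
    unfolding 2 by (simp add: restr_map_def)
qed

lemma rep_maps_iff:
  assumes M: "rep_module K C \<R> M" and N: "rep_module K C \<R> N"
  shows "\<eta> \<in> rep_module_maps K C \<R> M N \<longleftrightarrow> (\<forall>x. \<eta> x \<in> entmod_maps K C (E x) (rm_at M x) (rm_at N x)) \<and>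
    (\<forall>x y r m. x \<le> y \<longrightarrow> r \<in> lob (E x) \<longrightarrow> m \<in> carrier (em_at (rm_at M x) r) \<longrightarrow>
      rm_map N x y r (\<eta> x r m) = \<eta> y (fob (A x y) r) (rm_map M x y r m))"
proof -
  have *: "(cmp (entmod_cat K C (E x)) (rm_at M x) (rm_at N x)
          (restr_mod (A x y) (rm_at N y)) (rm_map N x y) (\<eta> x)
        = cmp (entmod_cat K C (E x)) (rm_at M x)
          (restr_mod (A x y) (rm_at M y)) (restr_mod (A x y) (rm_at N y))
          (restr_map (E x) (A x y) (\<eta> y)) (rm_map M x y)) \<longleftrightarrow>
      (\<forall>r m. r \<in> lob (E x) \<longrightarrow> m \<in> carrier (em_at (rm_at M x) r) \<longrightarrow>
      rm_map N x y r (\<eta> x r m) = \<eta> y (fob (A x y) r) (rm_map M x y r m))" (is "?L = ?R \<longleftrightarrow> ?P") for x y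
  proof
    assume eq: "?L = ?R"
    show ?P
    proof (intro allI impI)
      fix r m assume "r \<in> lob (E x)" "m \<in> carrier (em_at (rm_at M x) r)"
      then show "rm_map N x y r (\<eta> x r m) = \<eta> y (fob (A x y) r) (rm_map M x y r m)"
        using fun_cong[OF fun_cong[OF eq], of r m] by (simp add: restr_map_def)
    qed
  next
    assume ?P
    then show "?L = ?R"
      unfolding E.entmod_cmp_eq
      by (intro E.em_ext[of _ x "rm_at M x"] E.em_restrict_ext) (auto simp: restr_map_def)
  qed
  show ?thesis unfolding rep_module_maps_def mem_Collect_eq * by auto
qed

lemma rep_mapsD:
  assumes M: "rep_module K C \<R> M" and N: "rep_module K C \<R> N" and \<eta>: "\<eta> \<in> rep_module_maps K C \<R> M N"
  shows "\<eta> x \<in> entmod_maps K C (E x) (rm_at M x) (rm_at N x)"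
    and "emor (E x) (rm_at M x) (rm_at N x) (\<eta> x)"
    and "x \<le> y \<Longrightarrow> r \<in> lob (E x) \<Longrightarrow> m \<in> carrier (em_at (rm_at M x) r) \<Longrightarrow>
      rm_map N x y r (\<eta> x r m) = \<eta> y (fob (A x y) r) (rm_map M x y r m)"
  using \<eta> E.entmod_mapsD(1)[OF rep_moduleD(1)[OF M] rep_moduleD(1)[OF N]]
  unfolding rep_maps_iff[OF M N] by auto

lemma rep_category: "category (rep_module_cat K C \<R>)"
proof (unfold_locales, unfold rep_cat_simps mem_Collect_eq)
  note e = rep_moduleD(1)
  show "(\<lambda>x. E.em_restrict x (rm_at M x) (\<lambda>r m. m)) \<in> rep_module_maps K C \<R> M M"
    if M: "rep_module K C \<R> M" for M
    unfolding rep_maps_iff[OF M M]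
    using E.em_restrict_maps[OF e[OF M] E.emor_id[OF e[OF M]]] emorD(3)[OF rep_moduleD(2)[OF M]] by auto
  show "cmp (rep_module_cat K C \<R>) L M N \<theta> \<eta> \<in> rep_module_maps K C \<R> L N"
    if L: "rep_module K C \<R> L" and M: "rep_module K C \<R> M" and N: "rep_module K C \<R> N"
      and \<eta>: "\<eta> \<in> rep_module_maps K C \<R> L M" and \<theta>: "\<theta> \<in> rep_module_maps K C \<R> M N" for L M N \<eta> \<theta>
    unfolding rep_maps_iff[OF L N] rep_cmp_eq
  proof (intro conjI allI impI)
    show "E.em_restrict x (rm_at L x) (\<lambda>r m. \<theta> x r (\<eta> x r m)) \<in> entmod_maps K C (E x) (rm_at L x) (rm_at N x)" for x
      by (rule E.em_restrict_maps[OF e[OF L] emor_comp[OF rep_mapsD(2)[OF L M \<eta>] rep_mapsD(2)[OF M N \<theta>]]])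
    fix x y r m assume *: "x \<le> y" "r \<in> lob (E x)" "m \<in> carrier (em_at (rm_at L x) r)"
    then show "rm_map N x y r (E.em_restrict x (rm_at L x) (\<lambda>r m. \<theta> x r (\<eta> x r m)) r m) =
      E.em_restrict y (rm_at L y) (\<lambda>r m. \<theta> y r (\<eta> y r m)) (fob (A x y) r) (rm_map L x y r m)"
      using rep_mapsD(3)[OF L M \<eta> *] rep_mapsD(3)[OF M N \<theta> *(1,2) emorD(3)[OF rep_mapsD(2)[OF L M \<eta>] *(2,3)]]
        emorD(3)[OF rep_moduleD(2)[OF L *(1)] *(2,3)] by simp
  qed
  show "cmp (rep_module_cat K C \<R>) M M N f (\<lambda>x. E.em_restrict x (rm_at M x) (\<lambda>r m. m)) = f"
    "cmp (rep_module_cat K C \<R>) M N N (\<lambda>x. E.em_restrict x (rm_at N x) (\<lambda>r m. m)) f = f"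
    if M: "rep_module K C \<R> M" and N: "rep_module K C \<R> N" and f: "f \<in> rep_module_maps K C \<R> M N" for M N f
    unfolding rep_cmp_eq
    by (auto intro!: ext E.em_restrict_eqI[OF e[OF M] e[OF N] rep_mapsD(1)[OF M N f], symmetric, THEN sym]
        simp: emorD(3)[OF rep_mapsD(2)[OF M N f]])
  show "cmp (rep_module_cat K C \<R>) M L P h (cmp (rep_module_cat K C \<R>) M N L g f) =
    cmp (rep_module_cat K C \<R>) M N P (cmp (rep_module_cat K C \<R>) N L P h g) f"
    if M: "rep_module K C \<R> M" and N: "rep_module K C \<R> N" and f: "f \<in> rep_module_maps K C \<R> M N" for M N L P f g h
    unfolding rep_cmp_eq
    by (rule ext, rule E.em_ext[OF E.em_restrict_ext E.em_restrict_ext])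
      (auto simp: emorD(3)[OF rep_mapsD(2)[OF M N f]])
qed

lemma ev_functor_functor: "cat_functor (rep_module_cat K C \<R>) (entmod_cat K C (E x)) (ev_functor x)"
proof (intro cat_functor.intro rep_category E.entmod_category cat_functor_axioms.intro)
qed (auto simp: ev_functor_def rep_moduleD(1) rep_mapsD(1) rep_cmp_eq E.entmod_cmp_eq)

end

section \<open>The extension functor\<close>

context rep
begin

section \<open>Units and structure maps of the extension\<close>

definition eunit :: "'x \<Rightarrow> 'x \<Rightarrow> 'u entmod \<Rightarrow> 'u \<Rightarrow> 'u \<Rightarrow> 'u" where
  "eunit x y M r m = ind_gen K (E x) (E y) (A x y) M (fob (A x y) r) r m (lid (E y) (fob (A x y) r))"

abbreviation "ex x M \<equiv> ex_obj K C \<R> x M"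

lemma ex_at: "rm_at (ex x M) y = (if x \<le> y then ind_mod K C (E x) (E y) (A x y) M else zero_entmod K C)"
  by (simp add: ex_obj_def Let_def)

context
  fixes x M assumes M: "entwined_module K C (E x) M"
begin

lemma eunit_eq: "x \<le> y \<Longrightarrow> eunit x y M = ent_mor.ind_unit K (E x) (E y) (A x y) M"
  by (intro ext) (simp add: eunit_def ent_mor.ind_unit_def[OF mor_A M])

lemma ex_entwined: "entwined_module K C (E y) (rm_at (ex x M) y)"
  by (simp add: ex_at E.zero_entwined ent_mor.ind_entwined[OF mor_A M])

lemma eunit_emor: "x \<le> y \<Longrightarrow> emor (E x) M (restr_mod (A x y) (rm_at (ex x M) y)) (eunit x y M)"
  by (simp add: ex_at eunit_eq ent_mor.ind_unit_emor[OF mor_A M])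

lemma eunit_closed:
  "x \<le> y \<Longrightarrow> r \<in> lob (E x) \<Longrightarrow> m \<in> carrier (em_at M r) \<Longrightarrow>
    eunit x y M r m \<in> carrier (em_at (rm_at (ex x M) y) (fob (A x y) r))"
  using emorD(3)[OF eunit_emor] by simp

text \<open>For x \<le> y the units generate the induced module; otherwise the source is zero and
  all morphisms out of it agree. Both cases are covered, so later arguments need no case
  distinction.\<close>

lemma ex_unique:
  assumes \<eta>: "emor (E y) (rm_at (ex x M) y) N \<eta>" and \<theta>: "emor (E y) (rm_at (ex x M) y) N \<theta>"
    and eq: "\<And>r m. x \<le> y \<Longrightarrow> r \<in> lob (E x) \<Longrightarrow> m \<in> carrier (em_at M r) \<Longrightarrow>
      \<eta> (fob (A x y) r) (eunit x y M r m) = \<theta> (fob (A x y) r) (eunit x y M r m)"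
    and s: "s \<in> lob (E y)" and t: "t \<in> carrier (em_at (rm_at (ex x M) y) s)"
  shows "\<eta> s t = \<theta> s t"
proof (cases "x \<le> y")
  case True
  then show ?thesis
    using ent_mor.ind_unique[OF mor_A[OF True] M, of N \<eta> \<theta> s t] assms by (simp add: ex_at eunit_eq)
next
  case False
  then show ?thesis
    using \<eta> \<theta> s t by (simp only: ex_at if_False E.zero_unique)
qed

text \<open>The morphism \<open>h\<close> is demanded only when x \<le> y; in the other case the
  zero morphism serves. This form allows one component to be chosen for every \<open>y\<close> at
  once.\<close>

lemma ex_ext:
  assumes N: "entwined_module K C (E y) N"
    and h: "x \<le> y \<Longrightarrow> emor (E x) M (restr_mod (A x y) N) h"
  obtains F where "F \<in> entmod_maps K C (E y) (rm_at (ex x M) y) N"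
    "\<And>r m. x \<le> y \<Longrightarrow> r \<in> lob (E x) \<Longrightarrow> m \<in> carrier (em_at M r) \<Longrightarrow>
      F (fob (A x y) r) (eunit x y M r m) = h r m"
proof (cases "x \<le> y")
  case True
  interpret ent_mor K C "E x" "E y" "A x y" by (rule mor_A[OF True])
  let ?F = "E.em_restrict y (rm_at (ex x M) y) (ind_ext M N h)"
  have "emor (E y) (rm_at (ex x M) y) N (ind_ext M N h)"
    using ind_ext_emor[OF M N h] True by (simp add: ex_at)
  then have "?F \<in> entmod_maps K C (E y) (rm_at (ex x M) y) N"
    by (rule E.em_restrict_maps[OF ex_entwined])
  moreover have "?F (fob (A x y) r) (eunit x y M r m) = h r m"
    if "r \<in> lob (E x)" "m \<in> carrier (em_at M r)" for r m
    using ind_ext_unit[OF M N h] that eunit_closed[OF True that] True by (simp add: eunit_eq)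
  ultimately show ?thesis using that by blast
next
  case False
  have "E.em_restrict y (zero_entmod K C) (\<lambda>r _. \<zero>\<^bsub>em_at N r\<^esub>) \<in> entmod_maps K C (E y) (zero_entmod K C) N"
    by (rule E.em_restrict_maps[OF E.zero_entwined E.emor_zero[OF E.zero_entwined N]])
  then show ?thesis using that False by (simp add: ex_at)
qed

text \<open>Since m \<otimes> \<beta>(f) = (m \<otimes> id)\<beta>(f), the explicit formula in
  \<open>ex_obj\<close> is the transpose of the unit at \<open>z\<close>. Colinearity and
  compatibility of the structure maps then follow from the universal property.\<close>

lemma ex_map_ext:
  assumes y: "x \<le> y" and z: "y \<le> z"
  shows "rm_map (ex x M) y z = ent_mor.ind_ext K (E x) (E y) (A x y) M
    (restr_mod (A y z) (rm_at (ex x M) z)) (eunit x z M)"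
proof -
  note xz = order_trans[OF y z]
  interpret XY: ent_mor K C "E x" "E y" "A x y" by (rule mor_A[OF y])
  interpret YZ: ent_mor K C "E y" "E z" "A y z" by (rule mor_A[OF z])
  interpret XZ: ent_mor K C "E x" "E z" "A x z" by (rule mor_A[OF xz])
  let ?N = "restr_mod (A y z) (rm_at (ex x M) z)"
  have N: "entwined_module K C (E y) ?N" by (rule YZ.restr_entwined[OF ex_entwined])
  have h: "emor (E x) M (restr_mod (A x y) ?N) (eunit x z M)"
    unfolding emor_trans[OF y z] by (rule eunit_emor[OF xz])
  show ?thesis
  proof (rule extensionalityI[of _ "lob (E y)"])
    show "rm_map (ex x M) y z \<in> extensional (lob (E y))" by (simp add: ex_obj_def Let_def)
    show "XY.ind_ext M ?N (eunit x z M) \<in> extensional (lob (E y))"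
      by (rule XY.ind_ext_extensional(1)[OF M N h])
    fix s assume s [simp]: "s \<in> lob (E y)"
    have at: "em_at ?N s = cmk (ind_space K (E x) (E z) (A x z) M (fob (A y z) s)) (coact (em_at ?N s))"
      using xz by (simp add: ex_at XZ.ind_mod_at[OF M])
    have "rm_map (ex x M) y z s = ind_lift K (E x) (E y) (A x y) M s
             (ind_space K (E x) (E z) (A x z) M (fob (A y z) s))
             (\<lambda>r m f. ind_gen K (E x) (E z) (A x z) M (fob (A y z) s) r m
                (farr (A y z) s (fob (A x y) r) f))"
      using y by (simp add: ex_obj_def Let_def)
    also have "\<dots> = ind_lift K (E x) (E y) (A x y) M s
             (ind_space K (E x) (E z) (A x z) M (fob (A y z) s))
             (\<lambda>r m f. em_act ?N (fob (A x y) r) s (eunit x z M r m) f)"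
    proof (rule XY.ind_lift_cong[OF M s])
      fix r m f assume [simp]: "r \<in> lob (E x)" "m \<in> carrier (em_at M r)" and f [simp]: "f \<in> carrier (lhom (E y) s (fob (A x y) r))"
      note t = A_trans(1)[OF y z, of r, simplified]
      have f': "farr (A y z) s (fob (A x y) r) f \<in> carrier (lhom (E z) (fob (A y z) s) (fob (A x z) r))"
        by (simp add: t)
      have "em_act ?N (fob (A x y) r) s (eunit x z M r m) f =
        em_act (ind_mod K C (E x) (E z) (A x z) M) (fob (A x z) r) (fob (A y z) s) (eunit x z M r m)
          (farr (A y z) s (fob (A x y) r) f)"
        using xz by (simp add: ex_at t)
      also have "\<dots> = ind_gen K (E x) (E z) (A x z) M (fob (A y z) s) r m (farr (A y z) s (fob (A x y) r) f)"
        unfolding eunit_eq[OF xz] by (rule XZ.ind_gen_unit[OF M _ _ _ f', symmetric]) auto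
      finally show "ind_gen K (E x) (E z) (A x z) M (fob (A y z) s) r m (farr (A y z) s (fob (A x y) r) f) =
        em_act ?N (fob (A x y) r) s (eunit x z M r m) f" ..
    qed
    also have "\<dots> = XY.ind_ext M ?N (eunit x z M) s"
      by (rule XY.ind_lift_at[OF N M s at h, symmetric])
    finally show "rm_map (ex x M) y z s = XY.ind_ext M ?N (eunit x z M) s" .
  qed
qed

lemma ex_map:
  assumes z: "y \<le> z"
  shows "emor (E y) (rm_at (ex x M) y) (restr_mod (A y z) (rm_at (ex x M) z)) (rm_map (ex x M) y z)" (is ?e)
    and "rm_map (ex x M) y z \<in> extensional (lob (E y))" (is ?x)
    and "s \<in> lob (E y) \<Longrightarrow> rm_map (ex x M) y z s \<in> extensional (carrier (em_at (rm_at (ex x M) y) s))" (is "_ \<Longrightarrow> ?xs")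
    and "x \<le> y \<Longrightarrow> r \<in> lob (E x) \<Longrightarrow> m \<in> carrier (em_at M r) \<Longrightarrow>
      rm_map (ex x M) y z (fob (A x y) r) (eunit x y M r m) = eunit x z M r m"
proof -
  let ?N = "restr_mod (A y z) (rm_at (ex x M) z)"
  have N: "entwined_module K C (E y) ?N" by (rule restr_entwinedA[OF z ex_entwined])
  show ?x by (simp add: ex_obj_def Let_def)
  have "?e \<and> (s \<in> lob (E y) \<longrightarrow> ?xs)"
  proof (cases "x \<le> y")
    case True
    note xz = order_trans[OF True z]
    interpret XY: ent_mor K C "E x" "E y" "A x y" by (rule mor_A[OF True])
    have h: "emor (E x) M (restr_mod (A x y) ?N) (eunit x z M)"
      unfolding emor_trans[OF True z] by (rule eunit_emor[OF xz])
    show ?thesis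
      unfolding ex_map_ext[OF True z]
      using XY.ind_ext_emor[OF M N h] XY.ind_ext_extensional(2)[OF M N h] True by (simp add: ex_at)
  next
    case False
    \<comment> \<open>Both branches of the definition return the zero of the target, whether or not
      x \<le> z holds.\<close>
    have *: "rm_map (ex x M) y z = E.em_restrict y (zero_entmod K C) (\<lambda>s t. \<zero>\<^bsub>em_at ?N s\<^esub>)"
      using False z fobA[OF z]
      by (auto simp: ex_obj_def E.em_restrict_def restr_mod_def fun_eq_iff Let_def restrict_def
          ent_mor.ind_mod_at[OF mor_A M])
    have at: "rm_at (ex x M) y = zero_entmod K C" using False by (simp add: ex_at)
    show ?thesis
      unfolding * at
      by (intro conjI impI E.em_restrict_ext E.emor_cong[OF E.emor_zero[OF E.zero_entwined N] E.zero_entwined]) auto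
  qed
  then show ?e "s \<in> lob (E y) \<Longrightarrow> ?xs" by auto
  assume y: "x \<le> y"
  note xz = order_trans[OF y z]
  interpret XY: ent_mor K C "E x" "E y" "A x y" by (rule mor_A[OF y])
  have h: "emor (E x) M (restr_mod (A x y) ?N) (eunit x z M)"
    unfolding emor_trans[OF y z] by (rule eunit_emor[OF xz])
  show "r \<in> lob (E x) \<Longrightarrow> m \<in> carrier (em_at M r) \<Longrightarrow>
      rm_map (ex x M) y z (fob (A x y) r) (eunit x y M r m) = eunit x z M r m"
    unfolding ex_map_ext[OF y z] eunit_eq[OF y] by (rule XY.ind_ext_unit[OF M N h])
qed

lemma ex_module: "rep_module K C \<R> (ex x M)"
proof (rule rep_moduleI)
  note mp = ex_map
  show "entwined_module K C (E y) (rm_at (ex x M) y)" for y by (rule ex_entwined)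
  show "rm_map (ex x M) y y s t = t" if "s \<in> lob (E y)" "t \<in> carrier (em_at (rm_at (ex x M) y) s)" for y s t
    by (rule ex_unique[OF _ E.emor_id[OF ex_entwined] _ that])
      (use mp(1,4)[OF order_refl[of y]] in \<open>auto simp: emor_refl\<close>)
  show "rm_map (ex x M) w z s t = rm_map (ex x M) y z (fob (A w y) s) (rm_map (ex x M) w y s t)"
    if wy: "w \<le> y" and yz: "y \<le> z" and s: "s \<in> lob (E w)" and t: "t \<in> carrier (em_at (rm_at (ex x M) w) s)" for w y z s t
  \<comment> \<open>Both sides are morphisms out of the extension at \<open>w\<close>, and both send
    the unit at \<open>w\<close> to the unit at \<open>z\<close>.\<close>
  proof (rule ex_unique[OF mp(1)[OF order_trans[OF wy yz]] _ _ s t])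
    interpret WY: ent_mor K C "E w" "E y" "A w y" by (rule mor_A[OF wy])
    show "emor (E w) (rm_at (ex x M) w) (restr_mod (A w z) (rm_at (ex x M) z))
      (\<lambda>s t. rm_map (ex x M) y z (fob (A w y) s) (rm_map (ex x M) w y s t))"
      using emor_comp[OF mp(1)[OF wy] WY.restr_emor[OF mp(1)[OF yz]]]
      unfolding emor_trans[OF wy yz] .
    fix r m assume xw: "x \<le> w" and r: "r \<in> lob (E x)" and m: "m \<in> carrier (em_at M r)"
    show "rm_map (ex x M) w z (fob (A x w) r) (eunit x w M r m) =
       rm_map (ex x M) y z (fob (A w y) (fob (A x w) r)) (rm_map (ex x M) w y (fob (A x w) r) (eunit x w M r m))"
      using mp(4)[OF wy xw r m] mp(4)[OF order_trans[OF wy yz] xw r m] mp(4)[OF yz order_trans[OF xw wy] r m]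
        A_trans(1)[OF xw wy r] by simp
  qed
qed (use ex_map in auto)

end

text \<open>For x \<le> y, \<open>ind_map\<close> is the transpose of the unit of \<open>N\<close>
  composed with \<eta>; this gives at once that it is a morphism and that the unit is
  natural.\<close>

lemma ex_arr:
  assumes M: "entwined_module K C (E x) M" and N: "entwined_module K C (E x) N"
    and \<eta>: "\<eta> \<in> entmod_maps K C (E x) M N"
  shows "farr (ex_functor K C \<R> x) M N \<eta> y \<in> entmod_maps K C (E y) (rm_at (ex x M) y) (rm_at (ex x N) y)" (is ?m)
    and "x \<le> y \<Longrightarrow> r \<in> lob (E x) \<Longrightarrow> m \<in> carrier (em_at M r) \<Longrightarrow>
      farr (ex_functor K C \<R> x) M N \<eta> y (fob (A x y) r) (eunit x y M r m) = eunit x y N r (\<eta> r m)"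
proof -
  let ?f = "farr (ex_functor K C \<R> x) M N \<eta> y"
  have e: "emor (E x) M N \<eta>" using E.entmod_mapsD(1)[OF M N \<eta>] .
  have "?m \<and> (x \<le> y \<longrightarrow> r \<in> lob (E x) \<longrightarrow> m \<in> carrier (em_at M r) \<longrightarrow>
      ?f (fob (A x y) r) (eunit x y M r m) = eunit x y N r (\<eta> r m))"
  proof (cases "x \<le> y")
    case False
    have "?f = E.em_restrict y (zero_entmod K C) (\<lambda>r m. m)" using False by (simp add: ex_functor_def)
    then show ?thesis
      using False E.em_restrict_maps[OF E.zero_entwined E.emor_id[OF E.zero_entwined]] by (simp add: ex_at)
  next
    case True
    interpret XY: ent_mor K C "E x" "E y" "A x y" by (rule mor_A[OF True])
    let ?IN = "ind_mod K C (E x) (E y) (A x y) N"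
    note IN = XY.ind_entwined[OF N]
    have h: "emor (E x) M (restr_mod (A x y) ?IN) (\<lambda>r m. XY.ind_unit N r (\<eta> r m))"
      by (rule emor_comp[OF e XY.ind_unit_emor[OF N]])
    have "?f = XY.ind_ext M ?IN (\<lambda>r m. XY.ind_unit N r (\<eta> r m))"
    proof (rule extensionalityI[of _ "lob (E y)"])
      show "?f \<in> extensional (lob (E y))" using True by (simp add: ex_functor_def ind_map_def)
      show "XY.ind_ext M ?IN (\<lambda>r m. XY.ind_unit N r (\<eta> r m)) \<in> extensional (lob (E y))"
        by (rule XY.ind_ext_extensional(1)[OF M IN h])
      fix s assume s [simp]: "s \<in> lob (E y)"
      have "?f s = ind_lift K (E x) (E y) (A x y) M s (ind_space K (E x) (E y) (A x y) N s)
        (\<lambda>r m f. ind_gen K (E x) (E y) (A x y) N s r (\<eta> r m) f)"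
        using True by (simp add: ex_functor_def ind_map_def)
      also have "\<dots> = ind_lift K (E x) (E y) (A x y) M s (ind_space K (E x) (E y) (A x y) N s)
        (\<lambda>r m f. em_act ?IN (fob (A x y) r) s (XY.ind_unit N r (\<eta> r m)) f)"
        by (rule XY.ind_lift_cong[OF M s]) (simp add: XY.ind_gen_unit[OF N, symmetric] emorD(3)[OF e])
      also have "\<dots> = XY.ind_ext M ?IN (\<lambda>r m. XY.ind_unit N r (\<eta> r m)) s"
        by (rule XY.ind_lift_at[OF IN M s XY.ind_mod_at[OF N s] h, symmetric])
      finally show "?f s = XY.ind_ext M ?IN (\<lambda>r m. XY.ind_unit N r (\<eta> r m)) s" .
    qed
    then show ?thesis
      using XY.ind_ext_emor[OF M IN h] XY.ind_ext_extensional[OF M IN h] XY.ind_ext_unit[OF M IN h] True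
        E.entmod_maps_iff[of y "rm_at (ex x M) y" "rm_at (ex x N) y" ?f]
        E.entmodD(2)[OF ex_entwined[OF M], of _ y] E.entmodD(2)[OF ex_entwined[OF N], of _ y]
      by (simp add: ex_at eunit_eq[OF M] eunit_eq[OF N])
  qed
  then show ?m "x \<le> y \<Longrightarrow> r \<in> lob (E x) \<Longrightarrow> m \<in> carrier (em_at M r) \<Longrightarrow>
      ?f (fob (A x y) r) (eunit x y M r m) = eunit x y N r (\<eta> r m)" by auto
qed

section \<open>Functoriality of the extension and the adjunction\<close>

lemma ex_fob [simp]: "fob (ex_functor K C \<R> x) = ex_obj K C \<R> x"
  by (simp add: ex_functor_def)

lemma rep_maps_eqI:
  assumes M: "rep_module K C \<R> M" and N: "rep_module K C \<R> N"
    and "\<eta> \<in> rep_module_maps K C \<R> M N" "\<theta> \<in> rep_module_maps K C \<R> M N"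
    and "\<And>x r m. r \<in> lob (E x) \<Longrightarrow> m \<in> carrier (em_at (rm_at M x) r) \<Longrightarrow> \<eta> x r m = \<theta> x r m"
  shows "\<eta> = \<theta>"
proof
  fix x
  note e = E.entmod_mapsD[OF rep_moduleD(1)[OF M] rep_moduleD(1)[OF N]]
  show "\<eta> x = \<theta> x"
    by (rule E.em_ext[of _ x "rm_at M x"])
      (use e(2,3)[OF rep_mapsD(1)[OF M N assms(3)]] e(2,3)[OF rep_mapsD(1)[OF M N assms(4)]] assms(5) in auto)
qed

lemma ex_maps_eqI:
  assumes M: "entwined_module K C (E x) M" and N: "rep_module K C \<R> N"
    and \<eta>: "\<eta> \<in> rep_module_maps K C \<R> (ex x M) N" and \<theta>: "\<theta> \<in> rep_module_maps K C \<R> (ex x M) N"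
    and eq: "\<And>r m. r \<in> lob (E x) \<Longrightarrow> m \<in> carrier (em_at M r) \<Longrightarrow> \<eta> x r (eunit x x M r m) = \<theta> x r (eunit x x M r m)"
  shows "\<eta> = \<theta>"
proof (rule rep_maps_eqI[OF ex_module[OF M] N \<eta> \<theta>])
  note X = ex_module[OF M]
  fix y s t assume s: "s \<in> lob (E y)" and t: "t \<in> carrier (em_at (rm_at (ex x M) y) s)"
  show "\<eta> y s t = \<theta> y s t"
  proof (rule ex_unique[OF M rep_mapsD(2)[OF X N \<eta>] rep_mapsD(2)[OF X N \<theta>] _ s t])
    fix r m assume xy: "x \<le> y" and r: "r \<in> lob (E x)" and m: "m \<in> carrier (em_at M r)"
    have u: "eunit x x M r m \<in> carrier (em_at (rm_at (ex x M) x) r)"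
      using eunit_closed[OF M order_refl r m] A_refl(1)[OF r] by simp
    have "rm_map (ex x M) x y r (eunit x x M r m) = eunit x y M r m"
      using ex_map(4)[OF M xy order_refl r m] A_refl(1)[OF r] by simp
    then show "\<eta> y (fob (A x y) r) (eunit x y M r m) = \<theta> y (fob (A x y) r) (eunit x y M r m)"
      using rep_mapsD(3)[OF X N \<eta> xy r u] rep_mapsD(3)[OF X N \<theta> xy r u] eq[OF r m] by simp
  qed
qed

lemma eunit_at:
  assumes M: "entwined_module K C (E x) M"
  shows "emor (E x) M (rm_at (ex x M) x) (eunit x x M)"
  using eunit_emor[OF M order_refl] unfolding emor_refl .

lemma ex_functor_functor: "cat_functor (entmod_cat K C (E x)) (rep_module_cat K C \<R>) (ex_functor K C \<R> x)"
proof (intro cat_functor.intro rep_category E.entmod_category cat_functor_axioms.intro;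
    unfold E.entmod_cat_simps rep_cat_simps mem_Collect_eq ex_fob)
  let ?F = "farr (ex_functor K C \<R> x)"
  show "rep_module K C \<R> (ex x M)" if "entwined_module K C (E x) M" for M by (rule ex_module[OF that])
  show arr: "?F M N f \<in> rep_module_maps K C \<R> (ex x M) (ex x N)"
    if M: "entwined_module K C (E x) M" and N: "entwined_module K C (E x) N" and f: "f \<in> entmod_maps K C (E x) M N" for M N f
    unfolding rep_maps_iff[OF ex_module[OF M] ex_module[OF N]]
  proof (intro conjI allI impI)
    note fm = ex_arr[OF M N f]
    note fe = E.entmod_mapsD(1)[OF ex_entwined[OF M] ex_entwined[OF N] fm(1)]
    note ff = E.entmod_mapsD(1)[OF M N f]
    show "?F M N f y \<in> entmod_maps K C (E y) (rm_at (ex x M) y) (rm_at (ex x N) y)" for y by (rule fm(1))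
    fix y z s t assume yz: "y \<le> z" and s: "s \<in> lob (E y)" and t: "t \<in> carrier (em_at (rm_at (ex x M) y) s)"
    interpret YZ: ent_mor K C "E y" "E z" "A y z" by (rule mor_A[OF yz])
    show "rm_map (ex x N) y z s (?F M N f y s t) = ?F M N f z (fob (A y z) s) (rm_map (ex x M) y z s t)"
    proof (rule ex_unique[OF M emor_comp[OF fe ex_map(1)[OF N yz]]
          emor_comp[OF ex_map(1)[OF M yz] YZ.restr_emor[OF fe]] _ s t])
      fix r m assume xy: "x \<le> y" and r: "r \<in> lob (E x)" and m: "m \<in> carrier (em_at M r)"
      show "rm_map (ex x N) y z (fob (A x y) r) (?F M N f y (fob (A x y) r) (eunit x y M r m)) =
         ?F M N f z (fob (A y z) (fob (A x y) r)) (rm_map (ex x M) y z (fob (A x y) r) (eunit x y M r m))"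
        using fm(2)[OF xy r m] fm(2)[OF order_trans[OF xy yz] r m] ex_map(4)[OF M yz xy r m]
          ex_map(4)[OF N yz xy r emorD(3)[OF ff r m]] A_trans(1)[OF xy yz r] by simp
    qed
  qed
  have id: "(\<lambda>y. E.em_restrict y (rm_at (ex x M) y) (\<lambda>r m. m)) \<in> rep_module_maps K C \<R> (ex x M) (ex x M)"
    if M: "entwined_module K C (E x) M" for M
    using category.ident_in[OF rep_category, of "ex x M"] ex_module[OF M] by simp
  show "?F M M (E.em_restrict x M (\<lambda>r m. m)) = (\<lambda>y. E.em_restrict y (rm_at (ex x M) y) (\<lambda>r m. m))"
    if M: "entwined_module K C (E x) M" for M
  proof (rule ex_maps_eqI[OF M ex_module[OF M] arr[OF M M E.em_restrict_maps[OF M E.emor_id[OF M]]] id[OF M]])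
    fix r m assume r: "r \<in> lob (E x)" and m: "m \<in> carrier (em_at M r)"
    show "?F M M (E.em_restrict x M (\<lambda>r m. m)) x r (eunit x x M r m) =
      E.em_restrict x (rm_at (ex x M) x) (\<lambda>r m. m) r (eunit x x M r m)"
      using ex_arr(2)[OF M M E.em_restrict_maps[OF M E.emor_id[OF M]] order_refl r m] r m
        emorD(3)[OF eunit_at[OF M] r m] by (simp add: A_refl(1))
  qed
  show "?F L N (cmp (entmod_cat K C (E x)) L M N g f) =
    cmp (rep_module_cat K C \<R>) (ex x L) (ex x M) (ex x N) (?F M N g) (?F L M f)"
    if L: "entwined_module K C (E x) L" and M: "entwined_module K C (E x) M" and N: "entwined_module K C (E x) N"
      and f: "f \<in> entmod_maps K C (E x) L M" and g: "g \<in> entmod_maps K C (E x) M N" for L M N f g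
  proof (rule ex_maps_eqI[OF L ex_module[OF N]])
    have gf: "cmp (entmod_cat K C (E x)) L M N g f \<in> entmod_maps K C (E x) L N"
      using category.cmp_in[OF E.entmod_category, of L x M N f g] L M N f g by simp
    show "?F L N (cmp (entmod_cat K C (E x)) L M N g f) \<in> rep_module_maps K C \<R> (ex x L) (ex x N)"
      by (rule arr[OF L N gf])
    show "cmp (rep_module_cat K C \<R>) (ex x L) (ex x M) (ex x N) (?F M N g) (?F L M f) \<in> rep_module_maps K C \<R> (ex x L) (ex x N)"
      using category.cmp_in[OF rep_category, of "ex x L" "ex x M" "ex x N" "?F L M f" "?F M N g"]
        ex_module[OF L] ex_module[OF M] ex_module[OF N] arr[OF L M f] arr[OF M N g] by simp
    fix r m assume r: "r \<in> lob (E x)" and m: "m \<in> carrier (em_at L r)"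
    note fm = emorD(3)[OF E.entmod_mapsD(1)[OF L M f] r m]
    show "?F L N (cmp (entmod_cat K C (E x)) L M N g f) x r (eunit x x L r m) =
      cmp (rep_module_cat K C \<R>) (ex x L) (ex x M) (ex x N) (?F M N g) (?F L M f) x r (eunit x x L r m)"
      using ex_arr(2)[OF L N gf order_refl r m] ex_arr(2)[OF L M f order_refl r m]
        ex_arr(2)[OF M N g order_refl r fm] r m emorD(3)[OF eunit_at[OF L] r m]
      by (simp add: A_refl(1) rep_cmp_eq)
  qed
qed

text \<open>The component at \<open>y\<close> extends \<open>rm_map N x y\<close> composed with
  \<theta>. Naturality is checked on units through the composition law of \<open>N\<close>, and the
  identity law of \<open>N\<close> gives back \<theta> at \<open>x\<close>.\<close>

lemma ex_adjoint_surj: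
  assumes M: "entwined_module K C (E x) M" and N: "rep_module K C \<R> N"
    and \<theta>: "emor (E x) M (rm_at N x) \<theta>"
  obtains \<eta> where "\<eta> \<in> rep_module_maps K C \<R> (ex x M) N"
    "\<And>r m. r \<in> lob (E x) \<Longrightarrow> m \<in> carrier (em_at M r) \<Longrightarrow> \<eta> x r (eunit x x M r m) = \<theta> r m"
proof -
  note n = rep_moduleD[OF N]
  have "\<exists>F. F \<in> entmod_maps K C (E y) (rm_at (ex x M) y) (rm_at N y) \<and>
    (\<forall>r m. x \<le> y \<longrightarrow> r \<in> lob (E x) \<longrightarrow> m \<in> carrier (em_at M r) \<longrightarrow>
      F (fob (A x y) r) (eunit x y M r m) = rm_map N x y r (\<theta> r m))" for y
    by (rule ex_ext[OF M n(1), of y "\<lambda>r m. rm_map N x y r (\<theta> r m)"])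
      (use emor_comp[OF \<theta> n(2)] in auto)
  then obtain \<eta> where \<eta>: "\<And>y. \<eta> y \<in> entmod_maps K C (E y) (rm_at (ex x M) y) (rm_at N y)"
    and \<eta>u: "\<And>y r m. x \<le> y \<Longrightarrow> r \<in> lob (E x) \<Longrightarrow> m \<in> carrier (em_at M r) \<Longrightarrow>
      \<eta> y (fob (A x y) r) (eunit x y M r m) = rm_map N x y r (\<theta> r m)"
    by metis
  note \<eta>e = E.entmod_mapsD(1)[OF ex_entwined[OF M] n(1) \<eta>]
  have "\<eta> \<in> rep_module_maps K C \<R> (ex x M) N"
    unfolding rep_maps_iff[OF ex_module[OF M] N]
  proof (intro conjI allI impI \<eta>)
    fix y z s t assume yz: "y \<le> z" and s: "s \<in> lob (E y)" and t: "t \<in> carrier (em_at (rm_at (ex x M) y) s)"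
    interpret YZ: ent_mor K C "E y" "E z" "A y z" by (rule mor_A[OF yz])
    show "rm_map N y z s (\<eta> y s t) = \<eta> z (fob (A y z) s) (rm_map (ex x M) y z s t)"
    proof (rule ex_unique[OF M emor_comp[OF \<eta>e n(2)[OF yz]]
          emor_comp[OF ex_map(1)[OF M yz] YZ.restr_emor[OF \<eta>e]] _ s t])
      fix r m assume xy: "x \<le> y" and r: "r \<in> lob (E x)" and m: "m \<in> carrier (em_at M r)"
      show "rm_map N y z (fob (A x y) r) (\<eta> y (fob (A x y) r) (eunit x y M r m)) =
         \<eta> z (fob (A y z) (fob (A x y) r)) (rm_map (ex x M) y z (fob (A x y) r) (eunit x y M r m))"
        using \<eta>u[OF xy r m] \<eta>u[OF order_trans[OF xy yz] r m] ex_map(4)[OF M yz xy r m]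
          n(4)[OF xy yz r emorD(3)[OF \<theta> r m]] A_trans(1)[OF xy yz r] by simp
    qed
  qed
  moreover have "\<eta> x r (eunit x x M r m) = \<theta> r m" if "r \<in> lob (E x)" "m \<in> carrier (em_at M r)" for r m
    using \<eta>u[OF order_refl that] n(3)[OF that(1) emorD(3)[OF \<theta> that]] A_refl(1)[OF that(1)] by simp
  ultimately show ?thesis using that by blast
qed

theorem ex_ev_adjoint:
  "left_adjoint (entmod_cat K C (E x)) (rep_module_cat K C \<R>) (ex_functor K C \<R> x) (ev_functor x)"
  unfolding left_adjoint_def
proof (intro conjI ex_functor_functor ev_functor_functor exI ballI;
    unfold E.entmod_cat_simps rep_cat_simps mem_Collect_eq ex_fob)
  \<comment> \<open>Evaluation at \<open>x\<close> followed by composition with the unit at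
    \<open>x\<close>; injectivity is \<open>ex_maps_eqI\<close>, surjectivity is
    \<open>ex_adjoint_surj\<close>.\<close>
  let ?\<phi> = "\<lambda>M N \<eta>. E.em_restrict x M (\<lambda>r m. \<eta> x r (eunit x x M r m))"
  have ev: "fob (ev_functor x) N = rm_at N x" "farr (ev_functor x) N N' v = v x" for N N' v
    by (simp_all add: ev_functor_def)
  fix M N assume M: "entwined_module K C (E x) M" and N: "rep_module K C \<R> N"
  note X = ex_module[OF M]
  show "bij_betw (?\<phi> M N) (rep_module_maps K C \<R> (ex x M) N) (entmod_maps K C (E x) M (fob (ev_functor x) N))"
    unfolding ev bij_betw_def
  proof (intro conjI inj_onI equalityI subsetI)
    show "\<eta> = \<theta>" if \<eta>: "\<eta> \<in> rep_module_maps K C \<R> (ex x M) N" and \<theta>: "\<theta> \<in> rep_module_maps K C \<R> (ex x M) N"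
      and eq: "?\<phi> M N \<eta> = ?\<phi> M N \<theta>" for \<eta> \<theta>
    proof (rule ex_maps_eqI[OF M N \<eta> \<theta>])
      fix r m assume "r \<in> lob (E x)" "m \<in> carrier (em_at M r)"
      then show "\<eta> x r (eunit x x M r m) = \<theta> x r (eunit x x M r m)"
        using fun_cong[OF fun_cong[OF eq], of r m] by simp
    qed
    show "\<psi> \<in> entmod_maps K C (E x) M (rm_at N x)" if "\<psi> \<in> ?\<phi> M N ` rep_module_maps K C \<R> (ex x M) N" for \<psi>
      using that E.em_restrict_maps[OF M emor_comp[OF eunit_at[OF M] rep_mapsD(2)[OF X N]]] by auto
    show "\<psi> \<in> ?\<phi> M N ` rep_module_maps K C \<R> (ex x M) N" if \<psi>: "\<psi> \<in> entmod_maps K C (E x) M (rm_at N x)" for \<psi>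
    proof -
      obtain \<eta> where "\<eta> \<in> rep_module_maps K C \<R> (ex x M) N"
        "\<And>r m. r \<in> lob (E x) \<Longrightarrow> m \<in> carrier (em_at M r) \<Longrightarrow> \<eta> x r (eunit x x M r m) = \<psi> r m"
        using ex_adjoint_surj[OF M N E.entmod_mapsD(1)[OF M rep_moduleD(1)[OF N] \<psi>]] by blast
      moreover from this have "?\<phi> M N \<eta> = \<psi>"
        by (intro E.em_restrict_eqI[OF M rep_moduleD(1)[OF N] \<psi>]) auto
      ultimately show ?thesis by blast
    qed
  qed
  fix M' N' u v h
  assume M': "entwined_module K C (E x) M'" and N': "rep_module K C \<R> N'"
    and u: "u \<in> entmod_maps K C (E x) M' M" and v: "v \<in> rep_module_maps K C \<R> N N'"
    and h: "h \<in> rep_module_maps K C \<R> (ex x M) N"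
  show "?\<phi> M' N' (cmp (rep_module_cat K C \<R>) (ex x M') (ex x M) N'
        (cmp (rep_module_cat K C \<R>) (ex x M) N N' v h) (farr (ex_functor K C \<R> x) M' M u)) =
    cmp (entmod_cat K C (E x)) M' M (fob (ev_functor x) N')
      (cmp (entmod_cat K C (E x)) M (fob (ev_functor x) N) (fob (ev_functor x) N') (farr (ev_functor x) N N' v) (?\<phi> M N h)) u"
    unfolding E.entmod_cmp_eq
  proof (rule E.em_ext[OF E.em_restrict_ext E.em_restrict_ext])
    fix r m assume r: "r \<in> lob (E x)" and m: "m \<in> carrier (em_at M' r)"
    note um = emorD(3)[OF E.entmod_mapsD(1)[OF M' M u] r m]
    show "?\<phi> M' N' (cmp (rep_module_cat K C \<R>) (ex x M') (ex x M) N'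
        (cmp (rep_module_cat K C \<R>) (ex x M) N N' v h) (farr (ex_functor K C \<R> x) M' M u)) r m =
      E.em_restrict x M' (\<lambda>r xa. E.em_restrict x M (\<lambda>r xa. farr (ev_functor x) N N' v r (?\<phi> M N h r xa)) r (u r xa)) r m"
      using r m um ex_arr(2)[OF M' M u order_refl r m] emorD(3)[OF eunit_at[OF M'] r m]
        emorD(3)[OF eunit_at[OF M] r um]
      by (simp add: rep_cmp_eq ev A_refl(1))
  qed
qed

end

section \<open>Complements, functionals and rank over a field\<close>

context universe
begin

section \<open>Complements and functionals\<close>

lemma klin_minus:
  assumes "klin V W f" "klin V W g"
  shows "klin V W (\<lambda>x. f x \<ominus>\<^bsub>W\<^esub> g x)"
  by (rule klin_cong[OF klin_add[OF assms(1) klin_smult[OF assms(2), of "\<ominus> \<one>"]]])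
    (use klinD[OF assms(1)] klinD[OF assms(2)] in \<open>auto simp: a_minus_def minus_eq_smult\<close>)

lemma mspan_submod: "submodule N K M \<Longrightarrow> mspan K M N = N"
  by (auto simp: mspan_def)

lemma mspan_sub_iff:
  assumes "module K M" "submodule N K M"
  shows "S \<subseteq> N \<Longrightarrow> mspan K M S \<subseteq> N"
  by (rule subsetI, rule mspan_least[OF _ assms(2)])

lemma submod_Union_chain:
  assumes M: "module K M" and ne: "\<C> \<noteq> {}" and c: "\<And>A B. A \<in> \<C> \<Longrightarrow> B \<in> \<C> \<Longrightarrow> A \<subseteq> B \<or> B \<subseteq> A"
    and sub: "\<And>N. N \<in> \<C> \<Longrightarrow> submodule N K M"
  shows "submodule (\<Union>\<C>) K M"
proof (rule submodI[OF M])
  note s = submodD[OF M sub]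
  show "\<Union>\<C> \<subseteq> carrier M" using s(2) by auto
  show "\<zero>\<^bsub>M\<^esub> \<in> \<Union>\<C>" using ne s(3) by auto
  show "x \<oplus>\<^bsub>M\<^esub> y \<in> \<Union>\<C>" if xy: "x \<in> \<Union>\<C>" "y \<in> \<Union>\<C>" for x y
  proof -
    obtain A B where "A \<in> \<C>" "x \<in> A" "B \<in> \<C>" "y \<in> B" using xy by auto
    then obtain Z where "Z \<in> \<C>" "x \<in> Z" "y \<in> Z" using c by blast
    then show ?thesis using s(4) by blast
  qed
  show "a \<odot>\<^bsub>M\<^esub> x \<in> \<Union>\<C>" if "a \<in> carrier K" "x \<in> \<Union>\<C>" for a x
    using that s(6) by blast
qed

lemma smult_inv:
  assumes "module K V" "a \<in> carrier K" "a \<noteq> \<zero>" "v \<in> carrier V"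
  shows "inv a \<odot>\<^bsub>V\<^esub> (a \<odot>\<^bsub>V\<^esub> v) = v"
  using assms module.smult_assoc1[OF assms(1), of "inv a" a v] field_Units by simp

lemma inv_carrier: "a \<in> carrier K \<Longrightarrow> a \<noteq> \<zero> \<Longrightarrow> inv a \<in> carrier K"
  using field_Units by auto

text \<open>A submodule that is maximal among those meeting \<open>W\<close> trivially is a complement of \<open>W\<close>.\<close>

lemma retraction:
  assumes V: "module K V" and W: "submodule W K V"
  obtains r where "klin V V r" "\<And>v. v \<in> carrier V \<Longrightarrow> r v \<in> W" "\<And>w. w \<in> W \<Longrightarrow> r w = w"
proof -
  interpret V: module K V by fact
  note w = submodD[OF V W]
  let ?A = "{N. submodule N K V \<and> N \<inter> W = {\<zero>\<^bsub>V\<^esub>}}"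
  have "\<exists>N\<in>?A. \<forall>B\<in>?A. N \<subseteq> B \<longrightarrow> B = N"
  proof (rule subset_Zorn_nonempty)
    show "?A \<noteq> {}" using submod_zero[OF V] w(3) by auto
    fix \<C> assume ne: "\<C> \<noteq> {}" and ch: "subset.chain ?A \<C>"
    have "submodule (\<Union>\<C>) K V"
      by (rule submod_Union_chain[OF V ne]) (use ch in \<open>auto simp: subset_chain_def\<close>)
    moreover have "\<Union>\<C> \<inter> W = {\<zero>\<^bsub>V\<^esub>}"
      using ch ne unfolding subset_chain_def by blast
    ultimately show "\<Union>\<C> \<in> ?A" by simp
  qed
  then obtain N where N: "submodule N K V" and NW: "N \<inter> W = {\<zero>\<^bsub>V\<^esub>}"
    and max: "\<And>B. submodule B K V \<Longrightarrow> B \<inter> W = {\<zero>\<^bsub>V\<^esub>} \<Longrightarrow> N \<subseteq> B \<Longrightarrow> B = N" by auto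
  note n = submodD[OF V N]
  \<comment> \<open>\<open>w\<close> is the component of \<open>v\<close> in \<open>W\<close> along
    the maximal submodule \<open>N\<close>.\<close>
  define P where "P v w \<longleftrightarrow> w \<in> W \<and> v \<ominus>\<^bsub>V\<^esub> w \<in> N" for v w
  have ex: "\<exists>w. P v w" if v: "v \<in> carrier V" for v
  proof (rule ccontr)
    assume no: "\<nexists>w. P v w"
    \<comment> \<open>If \<open>v\<close> had no decomposition, adjoining it to \<open>N\<close>
      would keep the intersection with \<open>W\<close> trivial: an element m + a v of
      \<open>W\<close> with a nonzero could be solved for \<open>v\<close>. Maximality then puts
      \<open>v\<close> into \<open>N\<close>, where the component zero would do.\<close>
    let ?X = "mspan K V (insert v N)"
    have iN: "insert v N \<subseteq> carrier V" using v n(2) by auto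
    have XW0: "x = \<zero>\<^bsub>V\<^esub>" if x: "x \<in> ?X" "x \<in> W" for x
    proof -
      obtain m a where m: "m \<in> N" "a \<in> carrier K" "x = m \<oplus>\<^bsub>V\<^esub> a \<odot>\<^bsub>V\<^esub> v"
        using mspan_insertE[OF V n(2) v x(1)] mspan_submod[OF N] by metis
      have mV: "m \<in> carrier V" using n(1) m by auto
      show ?thesis
      proof (cases "a = \<zero>")
        case True
        then show ?thesis using m mV v x NW by auto
      next
        case False
        note ia = inv_carrier[OF m(2) False]
        have "v = inv a \<odot>\<^bsub>V\<^esub> (x \<ominus>\<^bsub>V\<^esub> m)"
          using m mV v smult_inv[OF V m(2) False v] V by (simp add: V.M.a_comm[of m])
        then have "v = inv a \<odot>\<^bsub>V\<^esub> x \<ominus>\<^bsub>V\<^esub> inv a \<odot>\<^bsub>V\<^esub> m"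
          using ia mV w(1)[OF x(2)] by (simp add: a_minus_def V.smult_r_distr V.smult_r_minus)
        then have "v \<ominus>\<^bsub>V\<^esub> inv a \<odot>\<^bsub>V\<^esub> x = \<ominus>\<^bsub>V\<^esub> (inv a \<odot>\<^bsub>V\<^esub> m)"
          using ia mV w(1)[OF x(2)] v
          by (metis V.M.a_comm V.M.a_inv_closed V.smult_closed a_minus_def mod_simps(12) V)
        also have "\<dots> = (\<ominus> \<one>) \<odot>\<^bsub>V\<^esub> (inv a \<odot>\<^bsub>V\<^esub> m)" using minus_eq_smult[OF V] ia mV by simp
        also have "\<dots> \<in> N" using n(6) ia m by simp
        finally have "P v (inv a \<odot>\<^bsub>V\<^esub> x)" using w(6)[OF ia x(2)] by (simp add: P_def)
        then show ?thesis using no by blast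
      qed
    qed
    have X: "submodule ?X K V" by (rule mspan_sub[OF V iN])
    have XW: "?X \<inter> W = {\<zero>\<^bsub>V\<^esub>}"
    proof
      show "?X \<inter> W \<subseteq> {\<zero>\<^bsub>V\<^esub>}" by (rule subsetI) (metis IntE XW0 singletonI)
    qed (use submodD(3)[OF V X] w(3) in simp)
    have "N \<subseteq> ?X" by (auto intro: mspan_incl)
    then have "?X = N" by (rule max[OF X XW])
    then have "v \<in> N" using mspan_incl[of v "insert v N" V] by simp
    then have "P v \<zero>\<^bsub>V\<^esub>" using w(3) V v by (simp add: P_def)
    then show False using no by blast
  qed
  have uniq: "a = b" if v: "v \<in> carrier V" and a: "P v a" and b: "P v b" for v a b
  proof (rule minus_zero_imp_eq[OF V])
    have ab: "a \<in> carrier V" "b \<in> carrier V" "a \<in> W" "b \<in> W" using a b w(1) by (auto simp: P_def)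
    then show "a \<in> carrier V" "b \<in> carrier V" by auto
    have "(v \<ominus>\<^bsub>V\<^esub> b) \<ominus>\<^bsub>V\<^esub> (v \<ominus>\<^bsub>V\<^esub> a) = a \<ominus>\<^bsub>V\<^esub> b"
      using v ab by (simp add: a_minus_def V.M.minus_add V.M.a_comm[of v] V.M.a_comm[of a] V.M.a_assoc
          V.M.r_neg1 V.M.r_neg2)
    then have "a \<ominus>\<^bsub>V\<^esub> b \<in> N" using n(5)[of "v \<ominus>\<^bsub>V\<^esub> b" "v \<ominus>\<^bsub>V\<^esub> a"] a b by (simp add: P_def)
    moreover have "a \<ominus>\<^bsub>V\<^esub> b \<in> W" using w(5) ab by simp
    ultimately show "a \<ominus>\<^bsub>V\<^esub> b = \<zero>\<^bsub>V\<^esub>" using NW by auto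
  qed
  define r where "r v = (THE w. P v w)" for v
  have r: "P v (r v)" if "v \<in> carrier V" for v
    unfolding r_def by (rule theI'[OF ex_ex1I]) (use ex uniq that in auto)
  have req: "r v = b" if "v \<in> carrier V" "P v b" for v b using uniq[OF that(1) r[OF that(1)] that(2)] .
  have rW: "r v \<in> W" "v \<ominus>\<^bsub>V\<^esub> r v \<in> N" "r v \<in> carrier V" if "v \<in> carrier V" for v
    using r[OF that] w(1) by (auto simp: P_def)
  have "klin V V r"
  proof (rule klinI[OF V V])
    show "r v \<in> carrier V" if "v \<in> carrier V" for v using rW that by auto
    show "r (v \<oplus>\<^bsub>V\<^esub> v') = r v \<oplus>\<^bsub>V\<^esub> r v'" if v: "v \<in> carrier V" "v' \<in> carrier V" for v v'
    proof (rule req)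
      have "(v \<oplus>\<^bsub>V\<^esub> v') \<ominus>\<^bsub>V\<^esub> (r v \<oplus>\<^bsub>V\<^esub> r v') = (v \<ominus>\<^bsub>V\<^esub> r v) \<oplus>\<^bsub>V\<^esub> (v' \<ominus>\<^bsub>V\<^esub> r v')"
        using v rW(3) by (simp add: a_minus_def V.M.minus_add V.M.a_ac)
      then show "P (v \<oplus>\<^bsub>V\<^esub> v') (r v \<oplus>\<^bsub>V\<^esub> r v')" using rW v n(4) w(4) by (simp add: P_def)
    qed (use v V in auto)
    show "r (a \<odot>\<^bsub>V\<^esub> v) = a \<odot>\<^bsub>V\<^esub> r v" if v: "a \<in> carrier K" "v \<in> carrier V" for a v
    proof (rule req)
      have "a \<odot>\<^bsub>V\<^esub> v \<ominus>\<^bsub>V\<^esub> a \<odot>\<^bsub>V\<^esub> r v = a \<odot>\<^bsub>V\<^esub> (v \<ominus>\<^bsub>V\<^esub> r v)"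
        using v rW(3) by (simp add: a_minus_def V.smult_r_distr V.smult_r_minus)
      then show "P (a \<odot>\<^bsub>V\<^esub> v) (a \<odot>\<^bsub>V\<^esub> r v)" using rW v n(6) w(6) by (simp add: P_def)
    qed (use v V in auto)
  qed
  moreover have "r x = x" if "x \<in> W" for x
    by (rule req) (use that w(1) V n(3) in \<open>auto simp: P_def\<close>)
  ultimately show ?thesis using that rW by blast
qed

text \<open>Subtracting a retraction onto \<open>D\<close> kills \<open>D\<close> and sends
  \<open>c\<close> to a nonzero \<open>c'\<close>; a projection onto the line through
  \<open>c'\<close> followed by reading off the coefficient gives the functional.\<close>

lemma functional:
  assumes V: "module K V" and D: "submodule D K V" and c: "c \<in> carrier V" "c \<notin> D"
  obtains h where "klin V (self_mod K) h" "\<And>d. d \<in> D \<Longrightarrow> h d = \<zero>" "h c = \<one>"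
proof -
  interpret V: module K V by fact
  obtain r where r: "klin V V r" "\<And>v. v \<in> carrier V \<Longrightarrow> r v \<in> D" "\<And>w. w \<in> D \<Longrightarrow> r w = w"
    using retraction[OF V D] by blast
  define c' where "c' = c \<ominus>\<^bsub>V\<^esub> r c"
  have c': "c' \<in> carrier V" using c klinD(3)[OF r(1)] V by (simp add: c'_def)
  have c'0: "c' \<noteq> \<zero>\<^bsub>V\<^esub>"
    using minus_zero_imp_eq[OF V c(1), of "r c"] r(2)[OF c(1)] c(2) klinD(3)[OF r(1) c(1)]
    by (auto simp: c'_def)
  define m where "m a = a \<odot>\<^bsub>V\<^esub> c'" for a
  have m: "klin (self_mod K) V m"
    unfolding m_def by (rule klin_smult_left[OF klin_id[OF self_mod_module] V c'])
  have inj: "a = b" if "a \<in> carrier K" "b \<in> carrier K" "m a = m b" for a b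
  proof (rule ccontr)
    assume "a \<noteq> b"
    then have ab: "a \<ominus> b \<in> carrier K" "a \<ominus> b \<noteq> \<zero>" using that(1,2) by auto
    have "m (a \<ominus>\<^bsub>self_mod K\<^esub> b) = \<zero>\<^bsub>V\<^esub>"
      using klinD(8)[OF m, of a b] that klinD(3)[OF m] V by simp
    moreover have "a \<ominus>\<^bsub>self_mod K\<^esub> b = a \<ominus> b"
      by (simp add: a_minus_def a_inv_def m_inv_def)
    ultimately have "(a \<ominus> b) \<odot>\<^bsub>V\<^esub> c' = \<zero>\<^bsub>V\<^esub>" by (simp add: m_def)
    then have "c' = \<zero>\<^bsub>V\<^esub>"
      using smult_inv[OF V ab c'] inv_carrier[OF ab] V by simp
    then show False using c'0 by simp
  qed
  have Kc: "submodule (m ` carrier K) K V" using submod_image[OF m submod_whole[OF self_mod_module]] by simp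
  obtain q where q: "klin V V q" "\<And>v. v \<in> carrier V \<Longrightarrow> q v \<in> m ` carrier K" "\<And>w. w \<in> m ` carrier K \<Longrightarrow> q w = w"
    using retraction[OF V Kc] by blast
  define p where "p v = q (v \<ominus>\<^bsub>V\<^esub> r v)" for v
  have p: "klin V V p"
    unfolding p_def by (rule klin_comp[OF klin_minus[OF klin_id[OF V] r(1)] q(1)])
  have pm: "\<exists>a\<in>carrier K. p v = m a" if "v \<in> carrier V" for v
    using q(2)[of "v \<ominus>\<^bsub>V\<^esub> r v"] that V klinD(3)[OF r(1) that] by (auto simp: p_def)
  then obtain h where h: "\<And>v. v \<in> carrier V \<Longrightarrow> h v \<in> carrier K \<and> p v = m (h v)" by metis
  have "klin V (self_mod K) h"
  proof (rule klinI[OF V self_mod_module])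
    note md = klinD(4,5)[OF m, unfolded self_mod_simps] and pd = klinD[OF p]
    show "h v \<in> carrier (self_mod K)" if "v \<in> carrier V" for v using h that by simp
    show "h (v \<oplus>\<^bsub>V\<^esub> w) = h v \<oplus>\<^bsub>self_mod K\<^esub> h w" if "v \<in> carrier V" "w \<in> carrier V" for v w
      unfolding self_mod_simps
      by (rule inj) (use that h[of v] h[of w] h[of "v \<oplus>\<^bsub>V\<^esub> w"] V pd(4)[of v w] md(1)[of "h v" "h w"] in auto)
    show "h (a \<odot>\<^bsub>V\<^esub> v) = a \<odot>\<^bsub>self_mod K\<^esub> h v" if "a \<in> carrier K" "v \<in> carrier V" for a v
      unfolding self_mod_simps
      by (rule inj) (use that h[of v] h[of "a \<odot>\<^bsub>V\<^esub> v"] V pd(5)[of a v] md(2)[of a "h v"] in auto)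
  qed
  moreover have "h d = \<zero>" if "d \<in> D" for d
  proof (rule inj)
    have d: "d \<in> carrier V" using submodD(1)[OF V D that] .
    then show "h d \<in> carrier K" using h by auto
    have "p d = \<zero>\<^bsub>V\<^esub>" using r(3)[OF that] d V klinD(6)[OF q(1)] by (simp add: p_def)
    then show "m (h d) = m \<zero>" using h[OF d] klinD(6)[OF m] by simp
  qed simp
  moreover have "h c = \<one>"
  proof (rule inj)
    show "h c \<in> carrier K" using h c by auto
    have "m \<one> = c'" using c' V by (simp add: m_def)
    then have "p c = m \<one>" using q(3)[of c'] by (simp add: p_def c'_def[symmetric]) (metis imageI one_closed)
    then show "m (h c) = m \<one>" using h[OF c(1)] by simp
  qed simp
  ultimately show ?thesis using that by blast
qed

text \<open>Steinitz exchange in its smallest form: if the last vector occurs in \<open>z\<close>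
  with nonzero coefficient, solve for it; otherwise \<open>z\<close> lies in the span of the others
  and induction applies.\<close>

lemma exchange:
  assumes V: "module K V" and S: "finite S" "S \<subseteq> carrier V"
    and z: "z \<in> mspan K V S" "z \<noteq> \<zero>\<^bsub>V\<^esub>"
  shows "\<exists>s\<in>S. s \<in> mspan K V (insert z (S - {s}))"
  using S z
proof (induction S)
  case empty
  then show ?case using mspan_least[OF empty(2) submod_zero[OF V]] by auto
next
  case (insert c S)
  interpret V: module K V by fact
  have Sc: "S \<subseteq> carrier V" and c: "c \<in> carrier V" using insert.prems by auto
  have zV: "z \<in> carrier V" using mspan_carrier[OF V _ insert.prems(2)] insert.prems(1) by auto
  obtain m a where m: "m \<in> mspan K V S" and a: "a \<in> carrier K" and eq: "z = m \<oplus>\<^bsub>V\<^esub> a \<odot>\<^bsub>V\<^esub> c"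
    using mspan_insertE[OF V Sc c insert.prems(2)] .
  have mV: "m \<in> carrier V" using mspan_carrier[OF V Sc m] .
  show ?case
  proof (cases "a = \<zero>")
    case True
    then have "z \<in> mspan K V S" using eq m mV c by simp
    then obtain s where s: "s \<in> S" "s \<in> mspan K V (insert z (S - {s}))"
      using insert.IH Sc insert.prems by auto
    moreover have "insert z (S - {s}) \<subseteq> insert z (insert c S - {s})" by auto
    ultimately show ?thesis using mspan_mono by (intro bexI[of _ s]) blast+
  next
    case False
    let ?N = "mspan K V (insert z (insert c S - {c}))"
    have sub: "submodule ?N K V" by (rule mspan_sub[OF V]) (use zV Sc in auto)
    have "m \<in> ?N" using m mspan_mono[of S "insert z (insert c S - {c})" V] insert.hyps by blast
    moreover have "z \<in> ?N" by (rule mspan_incl) simp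
    ultimately have "z \<ominus>\<^bsub>V\<^esub> m \<in> ?N" using submodD(5)[OF V sub] by auto
    moreover have "z \<ominus>\<^bsub>V\<^esub> m = a \<odot>\<^bsub>V\<^esub> c" using eq mV a c V by (simp add: V.M.a_comm[of m])
    ultimately have "inv a \<odot>\<^bsub>V\<^esub> (a \<odot>\<^bsub>V\<^esub> c) \<in> ?N"
      using submodD(6)[OF V sub inv_carrier[OF a False]] by simp
    then have "c \<in> ?N" using smult_inv[OF V a False c] by simp
    then show ?thesis by blast
  qed
qed

text \<open>Exchange some \<open>s\<close> for \<open>z\<close>; since \<open>f\<close> kills
  \<open>z\<close>, the images of the remaining elements span. This does the work of rank-nullity in
  Fitting's argument, where only a strict descent of the sizes of spanning sets is required.\<close>

lemma rank_drop:
  assumes f: "klin V W f" and S: "finite S" "S \<subseteq> carrier V"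
    and z: "z \<in> mspan K V S" "z \<noteq> \<zero>\<^bsub>V\<^esub>" "f z = \<zero>\<^bsub>W\<^esub>"
  obtains T where "finite T" "T \<subseteq> carrier W" "card T < card S" "mspan K W T = f ` mspan K V S"
proof -
  note V = klinD(1)[OF f] and W = klinD(2)[OF f]
  obtain s where s: "s \<in> S" "s \<in> mspan K V (insert z (S - {s}))"
    using exchange[OF V S z(1,2)] by auto
  let ?T = "f ` (S - {s})"
  have zV: "z \<in> carrier V" using mspan_carrier[OF V S(2) z(1)] .
  have sub: "insert z (S - {s}) \<subseteq> carrier V" using zV S by auto
  have TW: "?T \<subseteq> carrier W" using S klinD(3)[OF f] by auto
  have "mspan K V S \<subseteq> mspan K V (insert z (S - {s}))"
    by (rule mspan_sub_iff[OF V mspan_sub[OF V sub]]) (use s mspan_incl[of _ "insert z (S - {s})" V] in blast)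
  then have "f ` mspan K V S \<subseteq> mspan K W (f ` insert z (S - {s}))"
    using span_image[OF f sub] by blast
  also have "\<dots> \<subseteq> mspan K W ?T"
    by (rule mspan_sub_iff[OF W mspan_sub[OF W TW]])
      (use z(3) submodD(3)[OF W mspan_sub[OF W TW]] mspan_incl[of _ ?T W] in auto)
  finally have "f ` mspan K V S \<subseteq> mspan K W ?T" .
  moreover have "mspan K W ?T \<subseteq> f ` mspan K V S"
    using span_image[OF f S(2)] mspan_mono[of ?T "f ` S" W] by auto
  moreover have "card ?T < card S"
    using card_image_le[of "S - {s}" f] S(1) s(1) card_Diff1_less[of S s] by (meson finite_Diff le_less_trans)
  ultimately show ?thesis using that[of ?T] S(1) TW by auto
qed

text \<open>A retraction onto \<open>W\<close> carries the spanning set of the larger space to one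
  of \<open>W\<close>.\<close>

lemma fin_sub:
  assumes V: "module K V" and W: "submodule W K V" and S: "finite S" "S \<subseteq> carrier V" "W \<subseteq> mspan K V S"
  obtains T where "finite T" "T \<subseteq> W" "mspan K V T = W"
proof -
  obtain r where r: "klin V V r" "\<And>v. v \<in> carrier V \<Longrightarrow> r v \<in> W" "\<And>w. w \<in> W \<Longrightarrow> r w = w"
    using retraction[OF V W] by blast
  have "mspan K V (r ` S) = r ` mspan K V S" using span_image[OF r(1) S(2)] by simp
  also have "\<dots> = W"
  proof
    show "r ` mspan K V S \<subseteq> W" using mspan_carrier[OF V S(2)] r(2) by auto
    show "W \<subseteq> r ` mspan K V S" using S(3) r(3) by force
  qed
  finally show ?thesis using that[of "r ` S"] S r(2) by auto
qed

section \<open>Tensors as finite sums, and their detection by functionals\<close>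

lemma tensor_finite:
  assumes V: "module K V" and W: "module K W" and t: "t \<in> carrier (V \<otimes>\<^sub>K W)"
  shows "\<exists>A B. finite A \<and> A \<subseteq> carrier V \<and> finite B \<and> B \<subseteq> carrier W \<and>
    t \<in> mspan K (V \<otimes>\<^sub>K W) {tens K V W v w | v w. v \<in> A \<and> w \<in> B}"
proof -
  let ?G = "\<lambda>A B. {tens K V W v w | v w. v \<in> A \<and> w \<in> B}"
  let ?P = "\<lambda>t A B. finite A \<and> A \<subseteq> carrier V \<and> finite B \<and> B \<subseteq> carrier W \<and> t \<in> mspan K (V \<otimes>\<^sub>K W) (?G A B)"
  let ?N = "{t \<in> carrier (V \<otimes>\<^sub>K W). \<exists>A B. ?P t A B}"
  have T: "module K (V \<otimes>\<^sub>K W)" using V W by simp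
  have sub: "submodule (mspan K (V \<otimes>\<^sub>K W) (?G A B)) K (V \<otimes>\<^sub>K W)" if "A \<subseteq> carrier V" "B \<subseteq> carrier W" for A B
    by (rule mspan_sub[OF T]) (use that V W in \<open>auto intro!: tens_closed\<close>)
  have mono: "mspan K (V \<otimes>\<^sub>K W) (?G A B) \<subseteq> mspan K (V \<otimes>\<^sub>K W) (?G A' B')" if "A \<subseteq> A'" "B \<subseteq> B'" for A A' B B'
    by (rule mspan_mono) (use that in blast)
  have NI: "t \<in> ?N" if "t \<in> carrier (V \<otimes>\<^sub>K W)" "?P t A B" for t A B
    by (intro CollectI conjI[OF that(1)] exI[of _ A] exI[of _ B]) (rule that(2))
  have "submodule ?N K (V \<otimes>\<^sub>K W)"
  proof (rule submodI[OF T])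
    have "?P \<zero>\<^bsub>V \<otimes>\<^sub>K W\<^esub> {} {}" using submodD(3)[OF T sub[of "{}" "{}"]] by simp
    then show "\<zero>\<^bsub>V \<otimes>\<^sub>K W\<^esub> \<in> ?N" by (rule NI[OF mod_simps(1)[OF T]])
    fix t u assume "t \<in> ?N" "u \<in> ?N"
    then obtain A B A' B' where *: "?P t A B" "t \<in> carrier (V \<otimes>\<^sub>K W)" "?P u A' B'" "u \<in> carrier (V \<otimes>\<^sub>K W)"
      by auto
    have "t \<in> mspan K (V \<otimes>\<^sub>K W) (?G (A \<union> A') (B \<union> B'))" "u \<in> mspan K (V \<otimes>\<^sub>K W) (?G (A \<union> A') (B \<union> B'))"
      using * mono[of A "A \<union> A'" B "B \<union> B'"] mono[of A' "A \<union> A'" B' "B \<union> B'"] by auto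
    then have "?P (t \<oplus>\<^bsub>V \<otimes>\<^sub>K W\<^esub> u) (A \<union> A') (B \<union> B')"
      using submodD(4)[OF T sub[of "A \<union> A'" "B \<union> B'"]] * by auto
    then show "t \<oplus>\<^bsub>V \<otimes>\<^sub>K W\<^esub> u \<in> ?N" by (rule NI[OF mod_simps(2)[OF T *(2,4)]])
  next
    fix a t assume a: "a \<in> carrier K" and "t \<in> ?N"
    then obtain A B where *: "?P t A B" "t \<in> carrier (V \<otimes>\<^sub>K W)" by auto
    then have "?P (a \<odot>\<^bsub>V \<otimes>\<^sub>K W\<^esub> t) A B" using submodD(6)[OF T sub[of A B] a] by simp
    then show "a \<odot>\<^bsub>V \<otimes>\<^sub>K W\<^esub> t \<in> ?N" by (rule NI[OF mod_simps(5)[OF T a *(2)]])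
  qed auto
  moreover have "?G (carrier V) (carrier W) \<subseteq> ?N"
  proof clarify
    fix v w assume vw: "v \<in> carrier V" "w \<in> carrier W"
    then have "?P (tens K V W v w) {v} {w}" by (auto intro: mspan_incl)
    then show "tens K V W v w \<in> carrier (V \<otimes>\<^sub>K W) \<and> (\<exists>A B. ?P (tens K V W v w) A B)"
      using tens_closed[OF V W vw] by blast
  qed
  ultimately show ?thesis using gens_induct[OF tensor_gens[OF V W]] t by blast
qed

text \<open>Write \<open>t\<close> with right factors in a finite set and shrink that set. A factor
  \<open>c\<close> dependent on the others can be redistributed; for an independent one there is a
  functional with value one at \<open>c\<close> and zero on the others, and its hypothesis forces
  the left coefficient of \<open>c\<close> to vanish.\<close>

lemma tensor_separate:
  assumes V: "module K V" and W: "module K W" and t: "t \<in> carrier (V \<otimes>\<^sub>K W)"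
    and z: "\<And>h. klin W (self_mod K) h \<Longrightarrow> tlift K V W V (\<lambda>v w. h w \<odot>\<^bsub>V\<^esub> v) t = \<zero>\<^bsub>V\<^esub>"
  shows "t = \<zero>\<^bsub>V \<otimes>\<^sub>K W\<^esub>"
proof -
  note [simp] = V W
  have T: "module K (V \<otimes>\<^sub>K W)" by simp
  interpret T: module K "V \<otimes>\<^sub>K W" by (rule T)
  let ?G = "\<lambda>S. {tens K V W v w | v w. v \<in> carrier V \<and> w \<in> S}"
  have G: "?G S \<subseteq> carrier (V \<otimes>\<^sub>K W)" if "S \<subseteq> carrier W" for S using that by auto
  have sub: "submodule (mspan K (V \<otimes>\<^sub>K W) (?G S)) K (V \<otimes>\<^sub>K W)" if "S \<subseteq> carrier W" for S
    by (rule mspan_sub[OF T G[OF that]])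
  have b: "bilin V W V (\<lambda>v w. h w \<odot>\<^bsub>V\<^esub> v)" if h: "klin W (self_mod K) h" for h
    by (intro bilinI klin_smult klin_smult_left[OF h] klin_id) (use klinD(3)[OF h] in auto)
  have split: "\<exists>t' v. t' \<in> mspan K (V \<otimes>\<^sub>K W) (?G S) \<and> v \<in> carrier V \<and> t = t' \<oplus>\<^bsub>V \<otimes>\<^sub>K W\<^esub> tens K V W v c"
    if S: "S \<subseteq> carrier W" and c: "c \<in> carrier W" and t: "t \<in> mspan K (V \<otimes>\<^sub>K W) (?G (insert c S))" for t c S
  proof -
    let ?X = "{t' \<oplus>\<^bsub>V \<otimes>\<^sub>K W\<^esub> tens K V W v c | t' v. t' \<in> mspan K (V \<otimes>\<^sub>K W) (?G S) \<and> v \<in> carrier V}"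
    note s = submodD[OF T sub[OF S]] and tc = klinD[OF bilinD(6)[OF tens_bilin[OF V W] c]]
    have "t \<in> ?X"
    proof (rule mspan_least[OF t])
      show "submodule ?X K (V \<otimes>\<^sub>K W)"
      proof (rule submodI[OF T])
        show "?X \<subseteq> carrier (V \<otimes>\<^sub>K W)" using s(1) c by auto
        show "\<zero>\<^bsub>V \<otimes>\<^sub>K W\<^esub> \<in> ?X"
          using s(3) tc(6) by (intro CollectI exI[of _ "\<zero>\<^bsub>V \<otimes>\<^sub>K W\<^esub>"] exI[of _ "\<zero>\<^bsub>V\<^esub>"]) auto
        fix x y assume "x \<in> ?X" "y \<in> ?X"
        then obtain t1 v1 t2 v2 where *: "x = t1 \<oplus>\<^bsub>V \<otimes>\<^sub>K W\<^esub> tens K V W v1 c" "t1 \<in> mspan K (V \<otimes>\<^sub>K W) (?G S)" "v1 \<in> carrier V"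
          "y = t2 \<oplus>\<^bsub>V \<otimes>\<^sub>K W\<^esub> tens K V W v2 c" "t2 \<in> mspan K (V \<otimes>\<^sub>K W) (?G S)" "v2 \<in> carrier V" by auto
        then have "x \<oplus>\<^bsub>V \<otimes>\<^sub>K W\<^esub> y = (t1 \<oplus>\<^bsub>V \<otimes>\<^sub>K W\<^esub> t2) \<oplus>\<^bsub>V \<otimes>\<^sub>K W\<^esub> tens K V W (v1 \<oplus>\<^bsub>V\<^esub> v2) c"
          using s(1) c tc(4) by (simp add: T.M.a_ac)
        moreover have "t1 \<oplus>\<^bsub>V \<otimes>\<^sub>K W\<^esub> t2 \<in> mspan K (V \<otimes>\<^sub>K W) (?G S)" "v1 \<oplus>\<^bsub>V\<^esub> v2 \<in> carrier V"
          using * s(4) by auto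
        ultimately show "x \<oplus>\<^bsub>V \<otimes>\<^sub>K W\<^esub> y \<in> ?X" by blast
      next
        fix a x assume a: "a \<in> carrier K" and "x \<in> ?X"
        then obtain t1 v1 where *: "x = t1 \<oplus>\<^bsub>V \<otimes>\<^sub>K W\<^esub> tens K V W v1 c" "t1 \<in> mspan K (V \<otimes>\<^sub>K W) (?G S)" "v1 \<in> carrier V"
          by auto
        then have "a \<odot>\<^bsub>V \<otimes>\<^sub>K W\<^esub> x = (a \<odot>\<^bsub>V \<otimes>\<^sub>K W\<^esub> t1) \<oplus>\<^bsub>V \<otimes>\<^sub>K W\<^esub> tens K V W (a \<odot>\<^bsub>V\<^esub> v1) c"
          using s(1) c tc(5) a by (simp add: T.smult_r_distr)
        moreover have "a \<odot>\<^bsub>V \<otimes>\<^sub>K W\<^esub> t1 \<in> mspan K (V \<otimes>\<^sub>K W) (?G S)" "a \<odot>\<^bsub>V\<^esub> v1 \<in> carrier V"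
          using * s(6) a by auto
        ultimately show "a \<odot>\<^bsub>V \<otimes>\<^sub>K W\<^esub> x \<in> ?X" by blast
      qed
      show "?G (insert c S) \<subseteq> ?X"
      proof clarify
        fix v w assume v: "v \<in> carrier V" and w: "w \<in> insert c S"
        show "\<exists>t' v'. tens K V W v w = t' \<oplus>\<^bsub>V \<otimes>\<^sub>K W\<^esub> tens K V W v' c \<and> t' \<in> mspan K (V \<otimes>\<^sub>K W) (?G S) \<and> v' \<in> carrier V"
        proof (cases "w = c")
          case True
          then show ?thesis using v s(3) c by (intro exI[of _ "\<zero>\<^bsub>V \<otimes>\<^sub>K W\<^esub>"] exI[of _ v]) auto
        next
          case False
          then have "w \<in> S" using w by simp
          then have "tens K V W v w \<in> mspan K (V \<otimes>\<^sub>K W) (?G S)" using v by (intro mspan_incl) auto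
          then show ?thesis
            using s(1) tc(6) by (intro exI[of _ "tens K V W v w"] exI[of _ "\<zero>\<^bsub>V\<^esub>"]) auto
        qed
      qed
    qed
    then show ?thesis by auto
  qed
  have main: "t = \<zero>\<^bsub>V \<otimes>\<^sub>K W\<^esub>" if "finite S" "S \<subseteq> carrier W" "t \<in> mspan K (V \<otimes>\<^sub>K W) (?G S)"
    "\<And>h. klin W (self_mod K) h \<Longrightarrow> tlift K V W V (\<lambda>v w. h w \<odot>\<^bsub>V\<^esub> v) t = \<zero>\<^bsub>V\<^esub>" for S t
    using that
  proof (induction S arbitrary: t)
    case empty
    then show ?case using mspan_least[OF empty(2) submod_zero[OF T]] by auto
  next
    case (insert c S)
    have S: "S \<subseteq> carrier W" and c: "c \<in> carrier W" using insert.prems by auto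
    obtain t' v where t': "t' \<in> mspan K (V \<otimes>\<^sub>K W) (?G S)" and v: "v \<in> carrier V"
      and eq: "t = t' \<oplus>\<^bsub>V \<otimes>\<^sub>K W\<^esub> tens K V W v c" using split[OF S c insert.prems(2)] by auto
    have t'T: "t' \<in> carrier (V \<otimes>\<^sub>K W)" using mspan_carrier[OF T G[OF S] t'] .
    have "t \<in> mspan K (V \<otimes>\<^sub>K W) (?G S)"
    proof (cases "c \<in> mspan K W S")
      case True
      have "c \<in> {d \<in> carrier W. tens K V W v d \<in> mspan K (V \<otimes>\<^sub>K W) (?G S)}"
        by (rule mspan_least[OF True submod_vimage[OF bilinD(5)[OF tens_bilin[OF V W] v] sub[OF S]]])
          (use S v in \<open>auto intro!: mspan_incl\<close>)
      then show ?thesis using t' submodD(4)[OF T sub[OF S]] eq by auto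
    next
      case False
      obtain h where h: "klin W (self_mod K) h" "\<And>d. d \<in> mspan K W S \<Longrightarrow> h d = \<zero>" "h c = \<one>"
        using functional[OF W mspan_sub[OF W S] c False] by blast
      let ?L = "tlift K V W V (\<lambda>v w. h w \<odot>\<^bsub>V\<^esub> v)"
      note l = tlift_lin[OF b[OF h(1)]]
      have "t' \<in> {t \<in> carrier (V \<otimes>\<^sub>K W). ?L t = \<zero>\<^bsub>V\<^esub>}"
        by (rule mspan_least[OF t' submod_eq[OF l klin_zero[OF T V]]])
          (use S h(2) b[OF h(1)] mspan_incl[of _ S W] in auto)
      then have "?L t = v" using eq t'T v c h b[OF h(1)] by (simp add: klinD(4)[OF l])
      then have "v = \<zero>\<^bsub>V\<^esub>" using insert.prems(3)[OF h(1)] by simp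
      then have "t = t'" using eq t'T klinD(6)[OF bilinD(6)[OF tens_bilin[OF V W] c]] by simp
      then show ?thesis using t' by simp
    qed
    then show ?case using insert.IH[OF S] insert.prems(3) by blast
  qed
  obtain A B where AB: "finite B" "B \<subseteq> carrier W" "A \<subseteq> carrier V"
    "t \<in> mspan K (V \<otimes>\<^sub>K W) {tens K V W v w | v w. v \<in> A \<and> w \<in> B}"
    using tensor_finite[OF V W t] by blast
  moreover have "mspan K (V \<otimes>\<^sub>K W) {tens K V W v w | v w. v \<in> A \<and> w \<in> B} \<subseteq> mspan K (V \<otimes>\<^sub>K W) (?G B)"
    by (rule mspan_mono) (use AB(3) in blast)
  ultimately have "t \<in> mspan K (V \<otimes>\<^sub>K W) (?G B)" by blast
  then show ?thesis using main AB(1,2) z by blast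
qed

end

section \<open>Finite dimensional projective comodules\<close>

context coalg
begin

text \<open>At \<open>f v\<close> the coaction of \<open>W\<close> is pushed forward from
  \<open>V\<close>, where \<open>g\<close> after \<open>f\<close> is the colinear map
  \<open>h\<close>. For surjective \<open>f\<close> this makes induced maps on quotients and
  inverses of bijective colinear maps colinear.\<close>

lemma colin_at_factor:
  assumes f: "colin V W f" and h: "colin V U h" and g: "klin W U g"
    and eq: "\<And>v. v \<in> carrier V \<Longrightarrow> g (f v) = h v" and v: "v \<in> carrier V"
  shows "colin_at W U g (f v)"
proof -
  note [simp] = precomodD(1)[OF colinD(2)[OF f]] precomodD(1)[OF colinD(2)[OF h]]
  have b: "bilin W C (U \<otimes>\<^sub>K C) (\<lambda>w0 w1. tens K U C (g w0) w1)"
    by (intro lin_rules g) (use klinD(3)[OF g] in auto)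
  have "coact U (g (f v)) = tlift K V C (U \<otimes>\<^sub>K C) (\<lambda>v0 v1. tens K U C (h v0) v1) (coact V v)"
    using colinD(5)[OF h v] eq[OF v] by simp
  also have "\<dots> = tlift K V C (U \<otimes>\<^sub>K C) (\<lambda>v0 v1. tens K U C (g (f v0)) v1) (coact V v)"
    by (rule tlift_cong) (simp add: eq)
  also have "\<dots> = tlift K W C (U \<otimes>\<^sub>K C) (\<lambda>w0 w1. tens K U C (g w0) w1) (coact W (f v))"
    by (rule colin_bind[OF f b v, symmetric])
  finally show ?thesis by (simp add: colin_at_def)
qed

text \<open>The axioms hold for \<open>i w\<close> and are reflected back. A linear retraction
  \<open>r\<close> suffices for this, because r \<otimes> id is still a left inverse of i \<otimes>
  id.\<close>

lemma comod_at_mono: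
  assumes V: "comodule K C V" and i: "colin W V i" and r: "klin V W r"
    and ri: "\<And>w. w \<in> carrier W \<Longrightarrow> r (i w) = w" and w: "w \<in> carrier W"
  shows "comod_at W w"
proof -
  note v = comoduleD[OF V] and p = precomodD[OF colinD(1)[OF i]]
  note [simp] = v(2) p(1) colinD(4)[OF i] p(3) klinD(3)[OF r]
  note at = v(6)[OF colinD(4)[OF i w], unfolded comod_at_def]
  let ?CC = "C \<otimes>\<^sub>K C"
  note ci = klin_comp[OF _ colinD(3)[OF i]] and cr = klin_comp[OF _ r]
  let ?I = "tlift K W ?CC (V \<otimes>\<^sub>K ?CC) (\<lambda>w0 z. tens K V ?CC (i w0) z)"
  \<comment> \<open>\<open>?I\<close> is i \<otimes> id and \<open>?J\<close> is r \<otimes> id; an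
    equation in W \<otimes> (C \<otimes> C) may be verified after applying
    \<open>?I\<close>.\<close>
  let ?J = "tlift K V ?CC (W \<otimes>\<^sub>K ?CC) (\<lambda>v0 z. tens K W ?CC (r v0) z)"
  have I: "bilin W ?CC (V \<otimes>\<^sub>K ?CC) (\<lambda>w0 z. tens K V ?CC (i w0) z)" by (intro lin_rules ci) auto
  have J: "bilin V ?CC (W \<otimes>\<^sub>K ?CC) (\<lambda>v0 z. tens K W ?CC (r v0) z)" by (intro lin_rules cr) auto
  have inv: "?J (?I t) = t" if "t \<in> carrier (W \<otimes>\<^sub>K ?CC)" for t
    by (rule tensor_eq[OF _ _ klin_comp[OF tlift_lin[OF I] tlift_lin[OF J]] klin_id _ that])
      (auto simp: tlift_tens[OF I] tlift_tens[OF J] ri)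
  let ?a = "tlift K W C (W \<otimes>\<^sub>K ?CC) (\<lambda>w0 c. tens K W ?CC w0 (comult C c)) (coact W w)"
  let ?b = "tlift K W C (W \<otimes>\<^sub>K ?CC) (\<lambda>w' c. tlift K W C (W \<otimes>\<^sub>K ?CC)
      (\<lambda>w0 w1. tens K W ?CC w0 (tens K C C w1 c)) (coact W w')) (coact W w)"
  have ba: "bilin W C (W \<otimes>\<^sub>K ?CC) (\<lambda>w0 c. tens K W ?CC w0 (comult C c))"
    by (intro lin_rules comult_lin) auto
  have bb: "bilin W C (W \<otimes>\<^sub>K ?CC) (\<lambda>w' c. tlift K W C (W \<otimes>\<^sub>K ?CC)
      (\<lambda>w0 w1. tens K W ?CC w0 (tens K C C w1 c)) (coact W w'))"
    by (intro lin_rules p(4)) auto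
  have "?I ?a = tlift K W C (V \<otimes>\<^sub>K ?CC) (\<lambda>w0 c. tens K V ?CC (i w0) (comult C c)) (coact W w)"
    by (subst lin_tlift[OF tlift_lin[OF I] ba], use w in simp, rule tlift_cong) (simp add: tlift_tens[OF I])
  also have "\<dots> = tlift K V C (V \<otimes>\<^sub>K ?CC) (\<lambda>v0 c. tens K V ?CC v0 (comult C c)) (coact V (i w))"
    by (rule colin_bind[OF i _ w, symmetric]; (intro lin_rules comult_lin)?) auto
  also have "\<dots> = tlift K V C (V \<otimes>\<^sub>K ?CC) (\<lambda>v' c. tlift K V C (V \<otimes>\<^sub>K ?CC)
      (\<lambda>v0 v1. tens K V ?CC v0 (tens K C C v1 c)) (coact V v')) (coact V (i w))"
    using at by simp
  also have "\<dots> = tlift K W C (V \<otimes>\<^sub>K ?CC) (\<lambda>w' c. tlift K V C (V \<otimes>\<^sub>K ?CC)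
      (\<lambda>v0 v1. tens K V ?CC v0 (tens K C C v1 c)) (coact V (i w'))) (coact W w)"
    by (rule colin_bind[OF i _ w]; (intro lin_rules v(5))?) (use v(4) in auto)
  also have "\<dots> = ?I ?b"
  proof (subst lin_tlift[OF tlift_lin[OF I] bb], use w in simp, rule tlift_cong)
    fix w' c assume *: "w' \<in> carrier W" "c \<in> carrier C"
    have "tlift K V C (V \<otimes>\<^sub>K ?CC) (\<lambda>v0 v1. tens K V ?CC v0 (tens K C C v1 c)) (coact V (i w')) =
      tlift K W C (V \<otimes>\<^sub>K ?CC) (\<lambda>w0 w1. tens K V ?CC (i w0) (tens K C C w1 c)) (coact W w')"
      by (rule colin_bind[OF i]; (intro lin_rules)?) (use * in auto)
    also have "\<dots> = ?I (tlift K W C (W \<otimes>\<^sub>K ?CC) (\<lambda>w0 w1. tens K W ?CC w0 (tens K C C w1 c)) (coact W w'))"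
      by (subst lin_tlift[OF tlift_lin[OF I]]; (intro lin_rules tlift_cong)?) (use * in \<open>auto simp: tlift_tens[OF I]\<close>)
    finally show "tlift K V C (V \<otimes>\<^sub>K ?CC) (\<lambda>v0 v1. tens K V ?CC v0 (tens K C C v1 c)) (coact V (i w')) =
      ?I (tlift K W C (W \<otimes>\<^sub>K ?CC) (\<lambda>w0 w1. tens K W ?CC w0 (tens K C C w1 c)) (coact W w'))" .
  qed
  finally have "?I ?a = ?I ?b" .
  moreover have "?a \<in> carrier (W \<otimes>\<^sub>K ?CC)" "?b \<in> carrier (W \<otimes>\<^sub>K ?CC)"
    using tlift_closed[OF _ ba] tlift_closed[OF _ bb] w by auto
  ultimately have 1: "?a = ?b" using inv by metis
  have e: "bilin M C M (\<lambda>v0 v1. counit C v1 \<odot>\<^bsub>M\<^esub> v0)" if "module K M" for M :: "'u comod"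
    by (intro lin_rules counit_lin klin_smult) (use that in auto)
  have "i (tlift K W C W (\<lambda>v0 v1. counit C v1 \<odot>\<^bsub>W\<^esub> v0) (coact W w)) =
    tlift K W C V (\<lambda>v0 v1. counit C v1 \<odot>\<^bsub>V\<^esub> i v0) (coact W w)"
    by (subst lin_tlift[OF colinD(3)[OF i] e[OF p(1)]], use w in simp, rule tlift_cong)
      (simp add: klinD(5)[OF colinD(3)[OF i]])
  also have "\<dots> = tlift K V C V (\<lambda>v0 v1. counit C v1 \<odot>\<^bsub>V\<^esub> v0) (coact V (i w))"
    by (rule colin_bind[OF i e[OF v(2)] w, symmetric])
  also have "\<dots> = i w" using at by simp
  finally have "r (i (tlift K W C W (\<lambda>v0 v1. counit C v1 \<odot>\<^bsub>W\<^esub> v0) (coact W w))) = r (i w)" by simp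
  moreover have "tlift K W C W (\<lambda>v0 v1. counit C v1 \<odot>\<^bsub>W\<^esub> v0) (coact W w) \<in> carrier W"
    by (rule tlift_closed[OF _ e]) (use w in auto)
  ultimately show ?thesis using 1 ri w by (simp add: comod_at_def)
qed

text \<open>The coaction of the subcomodule is \<open>(r \<otimes> 1)\<rho>\<close>.\<close>

lemma subcomodule:
  assumes V: "comodule K C V" and W: "submodule W K V" and r: "klin V V r"
    and rW: "\<And>v. v \<in> carrier V \<Longrightarrow> r v \<in> W" and rid: "\<And>w. w \<in> W \<Longrightarrow> r w = w"
    and stable: "\<And>w. w \<in> W \<Longrightarrow> tlift K V C (V \<otimes>\<^sub>K C) (\<lambda>v0 v1. tens K V C (r v0) v1) (coact V w) = coact V w"
  obtains P where "comodule K C P" "carrier P = W" "colin P V (\<lambda>x. x)" "klin V P r"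
    "\<And>Q f. colin Q V f \<Longrightarrow> (\<And>q. q \<in> carrier Q \<Longrightarrow> f q \<in> W) \<Longrightarrow> colin Q P f"
    "\<And>S. S \<subseteq> W \<Longrightarrow> mspan K V S = W \<Longrightarrow> gens P S"
proof -
  note v = comoduleD[OF V]
  define M :: "('u, 'u) module" where "M = \<lparr>carrier = W, monoid.mult = monoid.mult V, monoid.one = monoid.one V,
    ring.zero = ring.zero V, ring.add = ring.add V, smult = module.smult V\<rparr>"
  have Ms [simp]: "carrier M = W" "\<zero>\<^bsub>M\<^esub> = \<zero>\<^bsub>V\<^esub>" "x \<oplus>\<^bsub>M\<^esub> y = x \<oplus>\<^bsub>V\<^esub> y" "a \<odot>\<^bsub>M\<^esub> x = a \<odot>\<^bsub>V\<^esub> x" for x y a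
    by (simp_all add: M_def)
  note w = submodD[OF v(2) W]
  interpret Vm: module K V by (rule v(2))
  have M [simp]: "module K M"
  proof (intro moduleI is_cring abelian_groupI)
    show "\<exists>y\<in>carrier M. y \<oplus>\<^bsub>M\<^esub> x = \<zero>\<^bsub>M\<^esub>" if "x \<in> carrier M" for x
      using that w(1,6) minus_eq_smult[OF v(2), of x] Vm.M.l_neg[of x]
      by (intro bexI[of _ "(\<ominus> \<one>) \<odot>\<^bsub>V\<^esub> x"]) auto
  qed (use w(1,3,4,6) v(2) in \<open>auto simp: Vm.M.a_ac Vm.smult_l_distr Vm.smult_r_distr Vm.smult_assoc1\<close>)
  note [simp] = v(2) v(4) rW
  have i: "klin M V (\<lambda>x. x)" by (rule klinI) (use w(1) in auto)
  have rM: "klin V M r" by (rule klinI) (use klinD[OF r] in auto)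
  note cr = klin_comp[OF _ rM]
  define \<rho> where "\<rho> x = tlift K V C (M \<otimes>\<^sub>K C) (\<lambda>v0 v1. tens K M C (r v0) v1) (coact V x)" for x
  have br: "bilin V C (M \<otimes>\<^sub>K C) (\<lambda>v0 v1. tens K M C (r v0) v1)" by (intro lin_rules cr) auto
  have \<rho>: "klin M (M \<otimes>\<^sub>K C) \<rho>"
    unfolding \<rho>_def by (rule tlift_lin_arg[OF v(5)[OF i] br])
  let ?P = "cmk M \<rho>"
  have P: "precomod ?P" using \<rho> by simp
  have iv: "klin ?P V (\<lambda>x. x)" using i by simp
  have bi: "bilin M C (V \<otimes>\<^sub>K C) (\<lambda>v0 v1. tens K V C v0 v1)"
    by (intro bilin_left[OF tens_bilin] bilin_right[OF tens_bilin] i klin_id bilinI) (use w(1) in auto)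
  have colP: "colin ?P V (\<lambda>x. x)"
    unfolding colin_def colin_at_def
  proof (intro conjI ballI P v(1) iv)
    fix x assume "x \<in> carrier ?P"
    then have x: "x \<in> W" by simp
    have "tlift K M C (V \<otimes>\<^sub>K C) (\<lambda>v0 v1. tens K V C v0 v1) (\<rho> x) =
      tlift K V C (V \<otimes>\<^sub>K C) (\<lambda>v0 v1. tens K V C (r v0) v1) (coact V x)"
      unfolding \<rho>_def by (rule tlift_map_left[OF bi rM]) (use x w(1) in auto)
    then show "coact V x = tlift K ?P C (V \<otimes>\<^sub>K C) (\<lambda>v0. tens K V C v0) (coact ?P x)"
      using stable[OF x] by simp
  qed
  have "comod_at ?P x" if "x \<in> carrier ?P" for x
    by (rule comod_at_mono[OF V colP _ _ that, where r = r]) (use rM rid in auto)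
  then have "comodule K C ?P" using P by (simp add: comodule_iff)
  moreover have "colin Q ?P f" if f: "colin Q V f" and fW: "\<And>q. q \<in> carrier Q \<Longrightarrow> f q \<in> W" for Q f
    unfolding colin_def colin_at_def
  proof (intro conjI ballI P colinD(1)[OF f])
    note q = precomodD[OF colinD(1)[OF f]]
    have "klin Q M f" by (rule klinI) (use q(1) klinD[OF colinD(3)[OF f]] fW in auto)
    then show "klin Q ?P f" by simp
    fix x assume x: "x \<in> carrier Q"
    have "\<rho> (f x) = tlift K Q C (M \<otimes>\<^sub>K C) (\<lambda>v0 v1. tens K M C (r (f v0)) v1) (coact Q x)"
      unfolding \<rho>_def by (rule colin_bind[OF f br x])
    also have "\<dots> = tlift K Q C (M \<otimes>\<^sub>K C) (\<lambda>v0 v1. tens K M C (f v0) v1) (coact Q x)"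
      by (rule tlift_cong) (simp add: rid fW)
    finally show "coact ?P (f x) = tlift K Q C (?P \<otimes>\<^sub>K C) (\<lambda>v0 v1. tens K ?P C (f v0) v1) (coact Q x)" by simp
  qed
  moreover have "gens ?P S" if S: "S \<subseteq> W" "mspan K V S = W" for S
  proof -
    have SV: "S \<subseteq> carrier V" using S w(2) by auto
    have "r ` mspan K V S = mspan K M (r ` S)" by (rule span_image[OF rM SV])
    moreover have "r ` S = S" "r ` W = W" using rid S by force+
    ultimately show ?thesis using S by (simp add: gens_def)
  qed
  ultimately show ?thesis using that[of ?P] colP rM by simp
qed

text \<open>The coaction of \<open>f x\<close> has left factors \<open>f x0\<close>, which a linear
  retraction onto the image fixes, so the image satisfies the stability condition of
  \<open>subcomodule\<close>.\<close>

lemma image_subcomodule: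
  assumes V: "comodule K C V" and f: "colin V V f"
  obtains P where "comodule K C P" "carrier P = f ` carrier V" "colin P V (\<lambda>x. x)"
    "\<And>Q g. colin Q V g \<Longrightarrow> (\<And>q. q \<in> carrier Q \<Longrightarrow> g q \<in> f ` carrier V) \<Longrightarrow> colin Q P g"
    "\<And>S. S \<subseteq> f ` carrier V \<Longrightarrow> mspan K V S = f ` carrier V \<Longrightarrow> gens P S"
proof -
  note v = comoduleD[OF V] and ff = colinD[OF f]
  note [simp] = v(2) v(4)
  have W: "submodule (f ` carrier V) K V" by (rule submod_image[OF ff(3) submod_whole[OF v(2)]])
  obtain r where r: "klin V V r" "\<And>v. v \<in> carrier V \<Longrightarrow> r v \<in> f ` carrier V" "\<And>w. w \<in> f ` carrier V \<Longrightarrow> r w = w"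
    using retraction[OF v(2) W] by blast
  have b: "bilin V C (V \<otimes>\<^sub>K C) (\<lambda>v0 v1. tens K V C (r v0) v1)"
    by (intro lin_rules r(1)) (use klinD(3)[OF r(1)] in auto)
  have st: "tlift K V C (V \<otimes>\<^sub>K C) (\<lambda>v0 v1. tens K V C (r v0) v1) (coact V w) = coact V w" if w: "w \<in> f ` carrier V" for w
  proof -
    obtain x where x: "x \<in> carrier V" "w = f x" using w by blast
    have "tlift K V C (V \<otimes>\<^sub>K C) (\<lambda>v0 v1. tens K V C (r v0) v1) (coact V w) =
      tlift K V C (V \<otimes>\<^sub>K C) (\<lambda>v0 v1. tens K V C (r (f v0)) v1) (coact V x)"
      unfolding x(2) by (rule colin_bind[OF f b x(1)])
    also have "\<dots> = tlift K V C (V \<otimes>\<^sub>K C) (\<lambda>v0 v1. tens K V C (f v0) v1) (coact V x)"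
      by (rule tlift_cong) (simp add: r(3))
    also have "\<dots> = coact V w" using ff(5)[OF x(1)] x(2) by simp
    finally show ?thesis .
  qed
  show ?thesis
    using subcomodule[OF V W r st] that by metis
qed

text \<open>The subcomodule generated by \<open>v\<close> is spanned by the elements \<open>v\<^sub>0 h(v\<^sub>1)\<close>, where \<open>h\<close>
  runs over the functionals on \<open>C\<close>.\<close>

lemma finite_subcomodule:
  assumes V: "comodule K C V" and v: "v \<in> carrier V"
  obtains P S where "comodule K C P" "colin P V (\<lambda>x. x)" "v \<in> carrier P" "finite S" "gens P S"
proof -
  note p = comoduleD[OF V]
  note [simp] = p(2) p(4)
  \<comment> \<open>The action of the dual algebra of \<open>C\<close> on \<open>V\<close>.\<close>
  define act where "act h x = tlift K V C V (\<lambda>v0 v1. h v1 \<odot>\<^bsub>V\<^esub> v0) (coact V x)" for h x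
  let ?F = "\<lambda>h. klin C (self_mod K) h"
  have hc: "h c \<in> carrier K" if "?F h" "c \<in> carrier C" for h c using klinD(3)[OF that] by simp
  have hl: "klin Y V (\<lambda>x. h (f x) \<odot>\<^bsub>V\<^esub> x0)" if "?F h" "klin Y C f" "x0 \<in> carrier V"
    for h f x0 and Y :: "('u, 'u, 'z) module_scheme"
    by (rule klin_smult_left[OF klin_comp[OF that(2,1)] p(2) that(3)])
  have b: "bilin V C V (\<lambda>v0 v1. h v1 \<odot>\<^bsub>V\<^esub> v0)" if h: "?F h" for h
    by (intro bilinI klin_smult hl[OF h] klin_id hc[OF h]) auto
  have al: "klin V V (act h)" if "?F h" for h
    unfolding act_def[abs_def] by (rule tlift_lin_arg[OF p(3) b[OF that]])
  define W where "W = mspan K V {act h v | h. ?F h}"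
  have aV: "{act h v | h. ?F h} \<subseteq> carrier V" using klinD(3)[OF al] v by auto
  have W: "submodule W K V" unfolding W_def by (rule mspan_sub[OF p(2) aV])
  note w = submodD[OF p(2) W]
  \<comment> \<open>The left factors in a finite expression of the coaction of \<open>v\<close> span
    a space that contains every \<open>act h v\<close>; this bounds the dimension of
    \<open>W\<close>.\<close>
  obtain S B where S: "finite S" "S \<subseteq> carrier V"
    "coact V v \<in> mspan K (V \<otimes>\<^sub>K C) {tens K V C x c | x c. x \<in> S \<and> c \<in> B}" and B: "B \<subseteq> carrier C"
    using tensor_finite[OF p(2) C_module p(4)[OF v]] by blast
  have "act h v \<in> mspan K V S" if h: "?F h" for h
  proof -
    have "coact V v \<in> {t \<in> carrier (V \<otimes>\<^sub>K C). tlift K V C V (\<lambda>v0 v1. h v1 \<odot>\<^bsub>V\<^esub> v0) t \<in> mspan K V S}"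
      by (rule mspan_least[OF S(3) submod_vimage[OF tlift_lin[OF b[OF h]] mspan_sub[OF p(2) S(2)]]])
        (use S(2) B b[OF h] hc[OF h] mspan_incl[of _ S V] submodD(6)[OF p(2) mspan_sub[OF p(2) S(2)]] in \<open>auto simp: subset_iff\<close>)
    then show ?thesis by (simp add: act_def)
  qed
  then have "W \<subseteq> mspan K V S" unfolding W_def by (intro mspan_sub_iff[OF p(2) mspan_sub[OF p(2) S(2)]]) auto
  then obtain B where B: "finite B" "B \<subseteq> W" "mspan K V B = W" using fin_sub[OF p(2) W S(1,2)] by blast
  have vW: "v \<in> W"
  proof -
    have "v = act (counit C) v" using comod_counit[OF V v] by (simp add: act_def)
    then have "v \<in> {act h v | h. ?F h}" using counit_klin by blast
    then show ?thesis unfolding W_def by (rule mspan_incl)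
  qed
  have comp: "act h (act g v) \<in> W" if h: "?F h" and g: "?F g" for h g
  proof -
    \<comment> \<open>The convolution product of \<open>h\<close> and \<open>g\<close>.
      Coassociativity turns two successive actions on \<open>v\<close> into the action of
      \<open>k\<close>, so \<open>W\<close> is stable under the dual algebra.\<close>
    define k where "k c = tlift K C C (self_mod K) (\<lambda>c1 c2. h c1 \<otimes> g c2) (comult C c)" for c
    have hgb: "bilin C C (self_mod K) (\<lambda>c1 c2. h c1 \<otimes> g c2)"
      by (intro bilinI klinI self_mod_module)
        (use hc h g klinD(4,5)[OF h] klinD(4,5)[OF g] in \<open>auto simp: r_distr l_distr m_assoc m_lcomm\<close>)
    have k: "?F k" unfolding k_def by (rule tlift_lin_arg[OF comult_klin hgb])
    have hg: "klin Y V (\<lambda>x. (h (f x) \<otimes> g c) \<odot>\<^bsub>V\<^esub> x0)" "klin Y V (\<lambda>x. (h c \<otimes> g (f x)) \<odot>\<^bsub>V\<^esub> x0)"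
      if "klin Y C f" "x0 \<in> carrier V" "c \<in> carrier C" for f x0 c and Y :: "('u, 'u, 'z) module_scheme"
      using klin_smult_left[OF klin_comp[OF that(1) bilinD(6)[OF hgb that(3)]] p(2) that(2)]
        klin_smult_left[OF klin_comp[OF that(1) bilinD(5)[OF hgb that(3)]] p(2) that(2)] .
    have Q: "trilin V C C V (\<lambda>v0 c1 c2. (h c1 \<otimes> g c2) \<odot>\<^bsub>V\<^esub> v0)"
      by (intro trilinI hg klin_smult klin_id) (use hc[OF h] hc[OF g] in auto)
    have "act h (act g v) = tlift K V C V (\<lambda>v' c. act h (g c \<odot>\<^bsub>V\<^esub> v')) (coact V v)"
      unfolding act_def[of g] by (rule lin_tlift[OF al[OF h] b[OF g]]) (use v in auto)
    also have "\<dots> = tlift K V C V (\<lambda>v' c. tlift K V C V (\<lambda>v0 v1. (h v1 \<otimes> g c) \<odot>\<^bsub>V\<^esub> v0) (coact V v')) (coact V v)"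
    proof (rule tlift_cong)
      fix v' c assume *: "v' \<in> carrier V" "c \<in> carrier C"
      have "act h (g c \<odot>\<^bsub>V\<^esub> v') = g c \<odot>\<^bsub>V\<^esub> act h v'" using * hc[OF g] klinD(5)[OF al[OF h]] by simp
      also have "\<dots> = tlift K V C V (\<lambda>v0 v1. g c \<odot>\<^bsub>V\<^esub> (h v1 \<odot>\<^bsub>V\<^esub> v0)) (coact V v')"
        unfolding act_def
        by (rule lin_tlift[OF klin_smult[OF klin_id] b[OF h]]) (use * hc[OF g] in auto)
      also have "\<dots> = tlift K V C V (\<lambda>v0 v1. (h v1 \<otimes> g c) \<odot>\<^bsub>V\<^esub> v0) (coact V v')"
        by (rule tlift_cong) (use * hc[OF g] hc[OF h] in \<open>simp add: module.smult_assoc1[OF p(2), symmetric] m_comm\<close>)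
      finally show "act h (g c \<odot>\<^bsub>V\<^esub> v') = tlift K V C V (\<lambda>v0 v1. (h v1 \<otimes> g c) \<odot>\<^bsub>V\<^esub> v0) (coact V v')" .
    qed
    also have "\<dots> = tlift K V C V (\<lambda>v0 v1. tlift K C C V (\<lambda>c1 c2. (h c1 \<otimes> g c2) \<odot>\<^bsub>V\<^esub> v0) (comult C v1)) (coact V v)"
      by (rule comod_coassoc[OF V Q v, symmetric])
    also have "\<dots> = act k v"
      unfolding act_def k_def
    proof (rule tlift_cong)
      fix v0 v1 assume *: "v0 \<in> carrier V" "v1 \<in> carrier C"
      show "tlift K C C V (\<lambda>c1 c2. (h c1 \<otimes> g c2) \<odot>\<^bsub>V\<^esub> v0) (comult C v1) =
        tlift K C C (self_mod K) (\<lambda>c1 c2. h c1 \<otimes> g c2) (comult C v1) \<odot>\<^bsub>V\<^esub> v0"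
        by (rule lin_tlift[OF klin_smult_left[OF klin_id[OF self_mod_module] p(2) *(1)] hgb, symmetric])
          (use * in auto)
    qed
    finally show ?thesis unfolding W_def using k by (auto intro: mspan_incl)
  qed
  have actW: "act h x \<in> W" if h: "?F h" and x: "x \<in> W" for h x
  proof -
    have "x \<in> {x \<in> carrier V. act h x \<in> W}"
      by (rule mspan_least[OF x[unfolded W_def] submod_vimage[OF al[OF h] W]]) (use aV comp h in auto)
    then show ?thesis by simp
  qed
  obtain r where r: "klin V V r" "\<And>v. v \<in> carrier V \<Longrightarrow> r v \<in> W" "\<And>w. w \<in> W \<Longrightarrow> r w = w"
    using retraction[OF p(2) W] by blast
  note [simp] = klinD(3)[OF r(1)]
  have br: "bilin V C (V \<otimes>\<^sub>K C) (\<lambda>v0 v1. tens K V C (r v0) v1)" by (intro lin_rules r(1)) auto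
  \<comment> \<open>The projection complementary to \<open>r\<close>. Applying a functional to the
    right factor of (q \<otimes> id)\<rho>(x) gives \<open>q (act h x)\<close>, which is zero as
    \<open>W\<close> is stable. By \<open>tensor_separate\<close> the whole tensor is zero, and this
    is the stability condition for \<open>W\<close>.\<close>
  define q where "q x = x \<ominus>\<^bsub>V\<^esub> r x" for x
  have q: "klin V V q" unfolding q_def by (rule klin_minus[OF klin_id[OF p(2)] r(1)])
  have st: "tlift K V C (V \<otimes>\<^sub>K C) (\<lambda>v0 v1. tens K V C (r v0) v1) (coact V x) = coact V x" if x: "x \<in> W" for x
  proof -
    have xV: "x \<in> carrier V" using w(1) x .
    let ?q = "\<lambda>v0 v1. tens K V C (q v0) v1"
    have bq: "bilin V C (V \<otimes>\<^sub>K C) ?q" by (intro lin_rules q) (use klinD(3)[OF q] in auto)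
    have q0: "tlift K V C (V \<otimes>\<^sub>K C) ?q (coact V x) = \<zero>\<^bsub>V \<otimes>\<^sub>K C\<^esub>"
    proof (rule tensor_separate)
      show "tlift K V C (V \<otimes>\<^sub>K C) ?q (coact V x) \<in> carrier (V \<otimes>\<^sub>K C)"
        by (rule tlift_closed[OF _ bq]) (use xV in auto)
      fix h assume h: "?F h"
      have "tlift K V C V (\<lambda>v w. h w \<odot>\<^bsub>V\<^esub> v) (tlift K V C (V \<otimes>\<^sub>K C) ?q (coact V x)) =
        tlift K V C V (\<lambda>v0 v1. h v1 \<odot>\<^bsub>V\<^esub> q v0) (coact V x)"
        by (rule tlift_map_left[OF b[OF h] q]) (use xV in auto)
      also have "\<dots> = tlift K V C V (\<lambda>v0 v1. q (h v1 \<odot>\<^bsub>V\<^esub> v0)) (coact V x)"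
        by (rule tlift_cong) (simp add: klinD(5)[OF q] hc[OF h])
      also have "\<dots> = q (act h x)"
        unfolding act_def by (rule lin_tlift[OF q b[OF h], symmetric]) (use xV in auto)
      also have "\<dots> = \<zero>\<^bsub>V\<^esub>" using r(3)[OF actW[OF h x]] w(1)[OF actW[OF h x]] by (simp add: q_def)
      finally show "tlift K V C V (\<lambda>v w. h w \<odot>\<^bsub>V\<^esub> v) (tlift K V C (V \<otimes>\<^sub>K C) ?q (coact V x)) = \<zero>\<^bsub>V\<^esub>" .
    qed auto
    have qt: "tens K V C (q y) c = tens K V C y c \<ominus>\<^bsub>V \<otimes>\<^sub>K C\<^esub> tens K V C (r y) c"
      if "y \<in> carrier V" "c \<in> carrier C" for y c
      using that klinD(8)[OF bilinD(6)[OF tens_bilin[of V C] that(2)]] by (simp add: q_def)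
    have "tlift K V C (V \<otimes>\<^sub>K C) ?q t = t \<ominus>\<^bsub>V \<otimes>\<^sub>K C\<^esub> tlift K V C (V \<otimes>\<^sub>K C) (\<lambda>v0 v1. tens K V C (r v0) v1) t"
      if "t \<in> carrier (V \<otimes>\<^sub>K C)" for t
      by (rule tensor_eq[OF _ _ tlift_lin[OF bq] klin_minus[OF klin_id tlift_lin[OF br]] _ that])
        (auto simp: tlift_tens[OF bq] tlift_tens[OF br] qt)
    then have "coact V x \<ominus>\<^bsub>V \<otimes>\<^sub>K C\<^esub> tlift K V C (V \<otimes>\<^sub>K C) (\<lambda>v0 v1. tens K V C (r v0) v1) (coact V x) = \<zero>\<^bsub>V \<otimes>\<^sub>K C\<^esub>"
      using xV q0 by simp
    then have "coact V x = tlift K V C (V \<otimes>\<^sub>K C) (\<lambda>v0 v1. tens K V C (r v0) v1) (coact V x)"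
      by (rule minus_zero_imp_eq[rotated 3]) (use xV tlift_closed[OF _ br] in auto)
    then show ?thesis ..
  qed
  show ?thesis
    by (rule subcomodule[OF V W r st]) (use that B vW in auto)
qed

text \<open>Coproducts of comodules. The coaction is prescribed on the summands and extended by the
  universal property of the underlying direct sum; the axioms hold on the summands' images by
  \<open>comod_at_colin\<close>, and these generate.\<close>

lemma comodule_sum:
  fixes P :: "'i \<Rightarrow> 'u comod"
  assumes I: "small I" and P: "\<And>i. i \<in> I \<Longrightarrow> comodule K C (P i)"
  shows "\<exists>D \<iota>. comodule K C D \<and> (\<forall>i \<in> I. colin (P i) D (\<iota> i)) \<and>
    gens D {\<iota> i x | i x. i \<in> I \<and> x \<in> carrier (P i)} \<and>
    (\<forall>U g. comodule K C U \<longrightarrow> (\<forall>i \<in> I. colin (P i) U (g i)) \<longrightarrow>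
      (\<exists>h. colin D U h \<and> (\<forall>i \<in> I. \<forall>x \<in> carrier (P i). h (\<iota> i x) = g i x)))"
proof -
  have Pm: "module K (P i)" if "i \<in> I" for i using comoduleD(2)[OF P[OF that]] .
  let ?D0 = "dsum I P"
  have D0: "module K ?D0" by (rule dsum_module[OF Pm])
  \<comment> \<open>Dividing by the zero subspace merely copies the direct sum into
    \<open>'u\<close>.\<close>
  let ?Q = "squot ?D0 {\<zero>\<^bsub>?D0\<^esub>}" and ?p = "sproj ?D0 {\<zero>\<^bsub>?D0\<^esub>}"
  note sq = squot_lin[OF D0 submod_zero[OF D0] dsum_small[OF I]]
  have Q [simp]: "module K ?Q" using klinD(2)[OF sq(1)] .
  define \<iota> where "\<iota> i x = ?p (dinj I P i x)" for i x
  have il: "klin (P i) ?Q (\<iota> i)" if "i \<in> I" for i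
    unfolding \<iota>_def by (rule klin_comp[OF dinj_lin[OF Pm that] sq(1)])
  have gQ: "gens ?Q {\<iota> i x | i x. i \<in> I \<and> x \<in> carrier (P i)}"
  proof -
    have "{\<iota> i x | i x. i \<in> I \<and> x \<in> carrier (P i)} = ?p ` {dinj I P i x | i x. i \<in> I \<and> x \<in> carrier (P i)}"
      by (auto simp: \<iota>_def)
    then show ?thesis using gens_image[OF sq(1,2) dsum_gens[OF Pm]] by simp
  qed
  have lift: "\<exists>h. klin ?Q U h \<and> (\<forall>i \<in> I. \<forall>x \<in> carrier (P i). h (\<iota> i x) = g i x)"
    if U: "module K U" and g: "\<And>i. i \<in> I \<Longrightarrow> klin (P i) U (g i)" for U :: "('u, 'u, 'z) module_scheme" and g
  proof -
    obtain h0 where h0: "klin ?D0 U h0" "\<And>i x. i \<in> I \<Longrightarrow> x \<in> carrier (P i) \<Longrightarrow> h0 (dinj I P i x) = g i x"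
      by (rule dsum_lift[of I P U g]) (use Pm U g in auto)
    have ker: "h0 x = \<zero>\<^bsub>U\<^esub>" if "x \<in> carrier ?D0" "?p x = \<zero>\<^bsub>?Q\<^esub>" for x
      using sq(3)[OF that(1)] that(2) klinD(6)[OF h0(1)] by simp
    note f = lin_factor[OF sq(1,2) h0(1) ker]
    have "dinj I P i x \<in> carrier ?D0" if "i \<in> I" "x \<in> carrier (P i)" for i x
      by (rule klinD(3)[OF dinj_lin[of I P i, OF Pm that(1)] that(2)])
    then show ?thesis
      using f(1) f(2) h0(2)
      by (intro exI[of _ "\<lambda>y. h0 (inv_into (carrier ?D0) ?p y)"]) (simp add: \<iota>_def)
  qed
  have cl: "klin (P i) (?Q \<otimes>\<^sub>K C) (\<lambda>x. tlift K (P i) C (?Q \<otimes>\<^sub>K C) (\<lambda>x0 x1. tens K ?Q C (\<iota> i x0) x1) (coact (P i) x))"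
    if "i \<in> I" for i
    by (intro lin_rules comoduleD(3)[OF P[OF that]] il[OF that]) (use Pm[OF that] klinD(3)[OF il[OF that]] in auto)
  obtain \<rho> where \<rho>: "klin ?Q (?Q \<otimes>\<^sub>K C) \<rho>"
    "\<And>i x. i \<in> I \<Longrightarrow> x \<in> carrier (P i) \<Longrightarrow>
      \<rho> (\<iota> i x) = tlift K (P i) C (?Q \<otimes>\<^sub>K C) (\<lambda>x0 x1. tens K ?Q C (\<iota> i x0) x1) (coact (P i) x)"
    using lift[OF _ cl] by auto
  let ?D = "cmk ?Q \<rho>"
  have D: "precomod ?D" using \<rho>(1) by simp
  have ci: "colin (P i) ?D (\<iota> i)" if "i \<in> I" for i
    using D comoduleD(1)[OF P[OF that]] il[OF that] \<rho>(2)[OF that] by (simp add: colin_def colin_at_def)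
  have gD: "gens ?D {\<iota> i x | i x. i \<in> I \<and> x \<in> carrier (P i)}" using gQ by simp
  have "comodule K C ?D"
    by (rule comodule_gens[OF D gD]) (use comod_at_colin[OF P ci] in auto)
  moreover have "\<exists>h. colin ?D U h \<and> (\<forall>i \<in> I. \<forall>x \<in> carrier (P i). h (\<iota> i x) = g i x)"
    if U: "comodule K C U" and g: "\<And>i. i \<in> I \<Longrightarrow> colin (P i) U (g i)" for U g
  proof -
    obtain h where h: "klin ?Q U h" "\<And>i x. i \<in> I \<Longrightarrow> x \<in> carrier (P i) \<Longrightarrow> h (\<iota> i x) = g i x"
      using lift[OF comoduleD(2)[OF U] colinD(3)[OF g]] by auto
    have "colin ?D U h"
    proof (rule colin_gens[OF D comoduleD(1)[OF U] _ gD])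
      show l: "klin ?D U h" using h(1) by simp
      fix y assume "y \<in> {\<iota> i x | i x. i \<in> I \<and> x \<in> carrier (P i)}"
      then obtain i x where y: "y = \<iota> i x" "i \<in> I" "x \<in> carrier (P i)" by auto
      show "colin_at ?D U h y"
        unfolding y(1) by (rule colin_at_factor[OF ci[OF y(2)] g[OF y(2)] l h(2)[OF y(2)] y(3)])
    qed
    then show ?thesis using h(2) by auto
  qed
  ultimately show ?thesis using ci gD by (intro exI[of _ ?D] exI[of _ \<iota>]) simp
qed

section \<open>Projective comodules\<close>

lemma comod_cat_simps [simp]:
  "Ob (comod_cat K C) = {V. comodule K C V}" "Hom (comod_cat K C) = comod_maps K C"
  "cmp (comod_cat K C) U V W g f = compose (carrier U) g f"
  by (simp_all add: comod_cat_def)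

lemma comod_maps_colin:
  assumes "comodule K C V" "comodule K C W"
  shows "f \<in> comod_maps K C V W \<longleftrightarrow> colin V W f \<and> f \<in> extensional (carrier V)"
  using comod_maps_iff comoduleD(1) assms by blast

lemma surj_epi:
  assumes V: "comodule K C V" and W: "comodule K C W" and e: "colin V W e" and s: "e ` carrier V = carrier W"
  shows "epi (comod_cat K C) V W (restrict e (carrier V))"
  unfolding epi_def comod_cat_simps mem_Collect_eq
proof (intro conjI ballI impI)
  show "restrict e (carrier V) \<in> comod_maps K C V W" using e V W by (simp add: comod_maps_colin)
  fix U f g assume "U \<in> Collect (comodule K C)" and f: "f \<in> comod_maps K C W U" and g: "g \<in> comod_maps K C W U"
    and eq: "compose (carrier V) f (restrict e (carrier V)) = compose (carrier V) g (restrict e (carrier V))"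
  then have U: "comodule K C U" by simp
  show "f = g"
  proof (rule extensionalityI[of _ "carrier W"])
    fix w assume "w \<in> carrier W"
    then obtain v where "v \<in> carrier V" "w = e v" using s by auto
    then show "f w = g w" using fun_cong[OF eq, of v] by (simp add: compose_def)
  qed (use f g U W in \<open>auto simp: comod_maps_colin\<close>)
qed

text \<open>Surjective colinear maps are epimorphisms; this restates the categorical lifting
  property elementwise and without extensionality.\<close>

lemma projective_lift:
  assumes P: "projective (comod_cat K C) P" and V: "comodule K C V" and W: "comodule K C W"
    and e: "colin V W e" and s: "e ` carrier V = carrier W" and f: "colin P W f"
  obtains h where "colin P V h" "\<And>x. x \<in> carrier P \<Longrightarrow> e (h x) = f x"
proof -
  have Pc: "comodule K C P" using P by (simp add: projective_def)
  have "restrict f (carrier P) \<in> comod_maps K C P W" using f Pc W by (simp add: comod_maps_colin)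
  then obtain h where h: "h \<in> comod_maps K C P V"
    "compose (carrier P) (restrict e (carrier V)) h = restrict f (carrier P)"
    using P V W surj_epi[OF V W e s] unfolding projective_def comod_cat_simps by blast
  have c: "colin P V h" using h(1) Pc V by (simp add: comod_maps_colin)
  have "e (h x) = f x" if "x \<in> carrier P" for x
    using fun_cong[OF h(2), of x] that colinD(4)[OF c that] by (simp add: compose_def)
  then show ?thesis using that c by blast
qed

text \<open>Lift \<open>f\<close> after \<open>r\<close> from \<open>P\<close> and restrict the lift
  along \<open>i\<close>.\<close>

lemma retract_projective:
  assumes P: "projective (comod_cat K C) P" and V: "comodule K C V"
    and i: "colin V P i" and r: "colin P V r" and ri: "\<And>v. v \<in> carrier V \<Longrightarrow> r (i v) = v"
  shows "projective (comod_cat K C) V"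
  unfolding projective_def comod_cat_simps mem_Collect_eq
proof (intro conjI ballI V allI impI)
  have Pc: "comodule K C P" using P by (simp add: projective_def)
  fix A B e f assume "A \<in> Collect (comodule K C)" "B \<in> Collect (comodule K C)"
    and ef: "epi (comod_cat K C) A B e \<and> f \<in> comod_maps K C V B"
  then have A: "comodule K C A" and B: "comodule K C B" by auto
  have f: "colin V B f" "f \<in> extensional (carrier V)" using ef V B by (auto simp: comod_maps_colin)
  have e: "colin A B e" using ef A B by (auto simp: epi_def comod_maps_colin)
  have "restrict (\<lambda>x. f (r x)) (carrier P) \<in> comod_maps K C P B"
    using colin_comp[OF r f(1)] Pc B by (simp add: comod_maps_colin)
  then obtain h where h: "h \<in> comod_maps K C P A"
    "compose (carrier P) e h = restrict (\<lambda>x. f (r x)) (carrier P)"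
    using P A B ef unfolding projective_def comod_cat_simps by blast
  have c: "colin P A h" using h(1) Pc A by (simp add: comod_maps_colin)
  show "\<exists>h\<in>comod_maps K C V A. compose (carrier V) e h = f"
  proof
    show "restrict (\<lambda>v. h (i v)) (carrier V) \<in> comod_maps K C V A"
      using colin_comp[OF i c] V A by (simp add: comod_maps_colin)
    show "compose (carrier V) e (restrict (\<lambda>v. h (i v)) (carrier V)) = f"
    proof (rule extensionalityI[of _ "carrier V"])
      fix v assume v: "v \<in> carrier V"
      then show "compose (carrier V) e (restrict (\<lambda>v. h (i v)) (carrier V)) v = f v"
        using fun_cong[OF h(2), of "i v"] colinD(4)[OF i v] ri by (simp add: compose_def)
    qed (use f in auto)
  qed
qed

text \<open>A projective \<open>P\<close> splits off the direct sum of finite dimensional subcomodules, one for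
  each of its elements; cutting the section down to finitely many summands gives \<open>\<phi>\<close>.\<close>

lemma projective_finite_rank:
  assumes P: "projective (comod_cat K C) P" and x: "x \<in> carrier P"
  obtains \<phi> S where "colin P P \<phi>" "\<phi> x = x" "finite S" "S \<subseteq> carrier P" "\<phi> ` carrier P \<subseteq> mspan K P S"
proof -
  have Pc: "comodule K C P" using P by (simp add: projective_def)
  note p = comoduleD[OF Pc]
  have "\<exists>Q S. comodule K C Q \<and> colin Q P (\<lambda>x. x) \<and> y \<in> carrier Q \<and> finite S \<and> gens Q S" if "y \<in> carrier P" for y
    using finite_subcomodule[OF Pc that] by metis
  then obtain Q B where Q: "\<And>y. y \<in> carrier P \<Longrightarrow> comodule K C (Q y)" "\<And>y. y \<in> carrier P \<Longrightarrow> colin (Q y) P (\<lambda>x. x)"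
    "\<And>y. y \<in> carrier P \<Longrightarrow> y \<in> carrier (Q y)" "\<And>y. y \<in> carrier P \<Longrightarrow> finite (B y)"
    "\<And>y. y \<in> carrier P \<Longrightarrow> gens (Q y) (B y)" by metis
  obtain D \<iota> where sum: "comodule K C D" "\<forall>y \<in> carrier P. colin (Q y) D (\<iota> y)"
    "gens D {\<iota> y z | y z. y \<in> carrier P \<and> z \<in> carrier (Q y)}"
    "\<forall>U g. comodule K C U \<longrightarrow> (\<forall>y \<in> carrier P. colin (Q y) U (g y)) \<longrightarrow>
      (\<exists>h. colin D U h \<and> (\<forall>y \<in> carrier P. \<forall>z \<in> carrier (Q y). h (\<iota> y z) = g y z))"
    by (rule exE[OF comodule_sum[of "carrier P" Q, OF small_univ Q(1)]], assumption, elim exE conjE,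
        rule that, assumption+)
  note D = sum(1) sum(2)[rule_format] sum(3)
  have lift: "\<exists>h. colin D U h \<and> (\<forall>y \<in> carrier P. \<forall>z \<in> carrier (Q y). h (\<iota> y z) = g y z)"
    if "comodule K C U" "\<And>y. y \<in> carrier P \<Longrightarrow> colin (Q y) U (g y)" for U g
    using sum(4) that by simp
  note d = comoduleD[OF D(1)]
  obtain \<pi> where \<pi>: "colin D P \<pi>" "\<And>y z. y \<in> carrier P \<Longrightarrow> z \<in> carrier (Q y) \<Longrightarrow> \<pi> (\<iota> y z) = z"
    using lift[OF Pc Q(2)] by auto
  \<comment> \<open>Each \<open>y\<close> is hit by its copy in the summand
    \<open>Q y\<close>.\<close>
  have s: "\<pi> ` carrier D = carrier P"
  proof
    show "carrier P \<subseteq> \<pi> ` carrier D"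
    proof
      fix y assume y: "y \<in> carrier P"
      then show "y \<in> \<pi> ` carrier D"
        using \<pi>(2)[OF y Q(3)[OF y]] colinD(4)[OF D(2)[OF y] Q(3)[OF y]] by force
    qed
  qed (use colinD(4)[OF \<pi>(1)] in auto)
  obtain \<sigma> where \<sigma>: "colin P D \<sigma>" "\<And>z. z \<in> carrier P \<Longrightarrow> \<pi> (\<sigma> z) = z"
    using projective_lift[OF P D(1) Pc \<pi>(1) s colin_id[OF p(1)]] by blast
  \<comment> \<open>These maps define, through the universal property of the sum, the projection
    \<open>\<epsilon> F\<close> of \<open>D\<close> onto the summands indexed by
    \<open>F\<close>.\<close>
  have cut: "colin (Q y) D (\<lambda>z. if y \<in> F then \<iota> y z else \<zero>\<^bsub>D\<^esub>)" if "y \<in> carrier P" for y F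
    by (cases "y \<in> F") (use that D(2) colin_zero[OF comoduleD(1)[OF Q(1)] d(1)] in simp_all)
  have "\<exists>h. colin D D h \<and> (\<forall>y \<in> carrier P. \<forall>z \<in> carrier (Q y). h (\<iota> y z) = (if y \<in> F then \<iota> y z else \<zero>\<^bsub>D\<^esub>))" for F
    by (rule lift[OF D(1) cut])
  then obtain \<epsilon> where \<epsilon>: "\<And>F. colin D D (\<epsilon> F)"
    "\<And>F y z. y \<in> carrier P \<Longrightarrow> z \<in> carrier (Q y) \<Longrightarrow> \<epsilon> F (\<iota> y z) = (if y \<in> F then \<iota> y z else \<zero>\<^bsub>D\<^esub>)"
    by metis
  \<comment> \<open>Requiring that all larger \<open>F'\<close> fix \<open>t\<close> makes the
    condition monotone, so that for a sum of two elements the union of their index sets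
    works.\<close>
  let ?N = "{t \<in> carrier D. \<exists>F. finite F \<and> F \<subseteq> carrier P \<and> (\<forall>F'. F \<subseteq> F' \<longrightarrow> \<epsilon> F' t = t)}"
  have "\<sigma> x \<in> ?N"
  proof (rule gens_induct[OF D(3)])
    show "submodule ?N K D"
    proof (rule submodI[OF d(2)])
      note e = klinD[OF colinD(3)[OF \<epsilon>(1)]]
      show "\<zero>\<^bsub>D\<^esub> \<in> ?N" using e(6) d(2) by (auto intro!: exI[of _ "{}"])
      fix t u assume "t \<in> ?N" "u \<in> ?N"
      then obtain F G where "t \<in> carrier D" "u \<in> carrier D" "finite F" "F \<subseteq> carrier P" "\<forall>F'. F \<subseteq> F' \<longrightarrow> \<epsilon> F' t = t"
        "finite G" "G \<subseteq> carrier P" "\<forall>F'. G \<subseteq> F' \<longrightarrow> \<epsilon> F' u = u" by auto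
      then show "t \<oplus>\<^bsub>D\<^esub> u \<in> ?N" using e(4) d(2) by (auto intro!: exI[of _ "F \<union> G"])
    next
      fix a t assume a: "a \<in> carrier K" and "t \<in> ?N"
      then obtain F where "t \<in> carrier D" "finite F" "F \<subseteq> carrier P" "\<forall>F'. F \<subseteq> F' \<longrightarrow> \<epsilon> F' t = t" by auto
      then show "a \<odot>\<^bsub>D\<^esub> t \<in> ?N"
        using klinD(5)[OF colinD(3)[OF \<epsilon>(1)] a] a d(2) by (auto intro!: exI[of _ F])
    qed auto
    show "{\<iota> y z | y z. y \<in> carrier P \<and> z \<in> carrier (Q y)} \<subseteq> ?N"
    proof clarify
      fix y z assume y: "y \<in> carrier P" and z: "z \<in> carrier (Q y)"
      then show "\<iota> y z \<in> carrier D \<and> (\<exists>F. finite F \<and> F \<subseteq> carrier P \<and> (\<forall>F'. F \<subseteq> F' \<longrightarrow> \<epsilon> F' (\<iota> y z) = \<iota> y z))"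
        using colinD(4)[OF D(2)[OF y] z] \<epsilon>(2) by (auto intro!: exI[of _ "{y}"])
    qed
    show "\<sigma> x \<in> carrier D" using colinD(4)[OF \<sigma>(1) x] .
  qed
  then obtain F where F: "finite F" "F \<subseteq> carrier P" "\<epsilon> F (\<sigma> x) = \<sigma> x" by auto
  \<comment> \<open>Finite generators of the finitely many summands kept by
    \<open>\<epsilon> F\<close>; they span its image.\<close>
  define T where "T = (\<Union>y\<in>F. \<iota> y ` B y)"
  have BQ: "B y \<subseteq> carrier (Q y)" if "y \<in> carrier P" for y using Q(5)[OF that] by (simp add: gens_def)
  have T: "finite T" "T \<subseteq> carrier D"
  proof -
    show "finite T" unfolding T_def using F Q(4) by auto
    show "T \<subseteq> carrier D"
      unfolding T_def
    proof clarify
      fix y z assume "y \<in> F" "z \<in> B y"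
      then show "\<iota> y z \<in> carrier D" using F(2) BQ colinD(4)[OF D(2)[of y]] by blast
    qed
  qed
  have eT: "\<epsilon> F t \<in> mspan K D T" if t: "t \<in> carrier D" for t
  proof -
    have "t \<in> {t \<in> carrier D. \<epsilon> F t \<in> mspan K D T}"
    proof (rule gens_induct[OF D(3) submod_vimage[OF colinD(3)[OF \<epsilon>(1)] mspan_sub[OF d(2) T(2)]] _ t], clarify)
      fix y z assume y: "y \<in> carrier P" and z: "z \<in> carrier (Q y)"
      have "\<epsilon> F (\<iota> y z) \<in> mspan K D T"
      proof (cases "y \<in> F")
        case True
        have "\<iota> y z \<in> \<iota> y ` mspan K (Q y) (B y)" using z Q(5)[OF y] by (simp add: gens_def)
        also have "\<dots> = mspan K D (\<iota> y ` B y)" by (rule span_image[OF colinD(3)[OF D(2)[OF y]] BQ[OF y]])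
        also have "\<dots> \<subseteq> mspan K D T" by (rule mspan_mono) (use True in \<open>auto simp: T_def\<close>)
        finally show ?thesis using \<epsilon>(2)[OF y z] True by simp
      next
        case False
        then show ?thesis using \<epsilon>(2)[OF y z] submodD(3)[OF d(2) mspan_sub[OF d(2) T(2)]] by simp
      qed
      then show "\<iota> y z \<in> carrier D \<and> \<epsilon> F (\<iota> y z) \<in> mspan K D T" using colinD(4)[OF D(2)[OF y] z] by simp
    qed
    then show ?thesis by simp
  qed
  let ?\<phi> = "\<lambda>z. \<pi> (\<epsilon> F (\<sigma> z))"
  have "colin P P ?\<phi>" by (rule colin_comp[OF colin_comp[OF \<sigma>(1) \<epsilon>(1)] \<pi>(1)])
  moreover have "?\<phi> x = x" using F(3) \<sigma>(2)[OF x] by simp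
  moreover have "?\<phi> ` carrier P \<subseteq> mspan K P (\<pi> ` T)"
    using eT colinD(4)[OF \<sigma>(1)] span_image[OF colinD(3)[OF \<pi>(1)] T(2)] by blast
  ultimately show ?thesis using that[of ?\<phi> "\<pi> ` T"] T colinD(4)[OF \<pi>(1)] by blast
qed

text \<open>Fitting's argument: the powers of \<open>\<phi>\<close> eventually act bijectively on their image, which
  is then a retract.\<close>

lemma projective_finite_retract:
  assumes P: "projective (comod_cat K C) P" and x: "x \<in> carrier P"
  obtains V where "projective (comod_cat K C) V" "fin_dim K V" "colin V P (\<lambda>v. v)" "x \<in> carrier V"
proof -
  have Pc: "comodule K C P" using P by (simp add: projective_def)
  note p = comoduleD[OF Pc]
  obtain \<phi> S where \<phi>: "colin P P \<phi>" "\<phi> x = x" and S: "finite S" "S \<subseteq> carrier P" "\<phi> ` carrier P \<subseteq> mspan K P S"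
    using projective_finite_rank[OF P x] .
  have pow: "colin P P (\<phi> ^^ n)" for n
  proof (induction n)
    case 0
    show ?case using colin_id[OF p(1)] by (simp add: id_def)
  next
    case (Suc n)
    then show ?case using colin_comp[OF Suc \<phi>(1)] by (simp add: o_def)
  qed
  have powx: "(\<phi> ^^ n) x = x" for n by (induction n) (auto simp: \<phi>(2))
  define Dm where "Dm n = (\<phi> ^^ n) ` carrier P" for n
  have sub: "submodule (Dm n) K P" for n
    unfolding Dm_def by (rule submod_image[OF colinD(3)[OF pow] submod_whole[OF p(2)]])
  have add: "(\<phi> ^^ m) ` Dm n = Dm (m + n)" for m n
    by (simp add: Dm_def funpow_add image_image)
  have DS: "Dm (Suc 0) \<subseteq> mspan K P S" using S(3) by (simp add: Dm_def)
  \<comment> \<open>The sizes of finite spanning sets of the images of all positive powers. The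
    power \<phi>^n attaining the least size is the one wanted: any loss in passing from
    \<open>Dm n\<close> to \<open>Dm (n + n)\<close> would produce a smaller set.\<close>
  let ?G = "\<lambda>k. \<exists>n T. n \<ge> 1 \<and> finite T \<and> card T = k \<and> T \<subseteq> carrier P \<and> mspan K P T = Dm n"
  obtain T1 where "finite T1" "T1 \<subseteq> Dm (Suc 0)" "mspan K P T1 = Dm (Suc 0)"
    using fin_sub[OF p(2) sub S(1,2) DS] .
  moreover have "Dm (Suc 0) \<subseteq> carrier P" using submodD(2)[OF p(2) sub] .
  ultimately have ex: "?G (card T1)" by (intro exI[of _ "Suc 0"] exI[of _ T1]) auto
  obtain n T where n: "n \<ge> 1" and T: "finite T" "T \<subseteq> carrier P" "mspan K P T = Dm n" "card T = (LEAST k. ?G k)"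
    using LeastI[of ?G, OF ex] by auto
  have min: False if "m \<ge> 1" "finite T'" "T' \<subseteq> carrier P" "mspan K P T' = Dm m" "card T' < card T" for m T'
    using Least_le[of ?G "card T'"] that T(4) by auto
  let ?\<sigma> = "\<phi> ^^ n"
  note \<sigma> = colinD(3)[OF pow[of n]]
  have DnP: "Dm n \<subseteq> carrier P" using submodD(2)[OF p(2) sub] .
  \<comment> \<open>A nonzero kernel element in \<open>Dm n\<close> would, by
    \<open>rank_drop\<close>, give \<open>Dm (n + n)\<close> a smaller spanning set.\<close>
  have inj: "z = \<zero>\<^bsub>P\<^esub>" if zD: "z \<in> Dm n" and z0: "?\<sigma> z = \<zero>\<^bsub>P\<^esub>" for z
  proof (rule ccontr)
    assume nz: "z \<noteq> \<zero>\<^bsub>P\<^esub>"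
    obtain T' where "finite T'" "T' \<subseteq> carrier P" "card T' < card T" "mspan K P T' = ?\<sigma> ` mspan K P T"
      using rank_drop[OF \<sigma> T(1,2) zD[folded T(3)] nz z0] by blast
    then show False using min[of "n + n" T'] n T(3) add by simp
  qed
  have le: "Dm (n + n) \<subseteq> Dm n"
  proof -
    have "(\<phi> ^^ n) ` ((\<phi> ^^ n) ` carrier P) \<subseteq> (\<phi> ^^ n) ` carrier P" using colinD(4)[OF pow[of n]] by auto
    then show ?thesis using add[of n n] by (simp add: Dm_def)
  qed
  have eq: "Dm (n + n) = Dm n"
  proof (rule ccontr)
    assume "Dm (n + n) \<noteq> Dm n"
    then obtain c where c: "c \<in> Dm n" "c \<notin> Dm (n + n)" using le by auto
    \<comment> \<open>The same descent with a retraction onto \<open>Dm (n + n)\<close> in place of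
      the power: it maps \<open>Dm n\<close> onto \<open>Dm (n + n)\<close> and kills the nonzero
      element c - r c.\<close>
    obtain r where r: "klin P P r" "\<And>v. v \<in> carrier P \<Longrightarrow> r v \<in> Dm (n + n)" "\<And>w. w \<in> Dm (n + n) \<Longrightarrow> r w = w"
      using retraction[OF p(2) sub] by blast
    have cP: "c \<in> carrier P" using c DnP by auto
    let ?z = "c \<ominus>\<^bsub>P\<^esub> r c"
    have rc: "r c \<in> carrier P" using klinD(3)[OF r(1) cP] .
    have zD: "?z \<in> Dm n" using submodD(5)[OF p(2) sub c(1)] r(2)[OF cP] le by auto
    have nz: "?z \<noteq> \<zero>\<^bsub>P\<^esub>" using minus_zero_imp_eq[OF p(2) cP rc] r(2)[OF cP] c(2) by auto
    have rz: "r ?z = \<zero>\<^bsub>P\<^esub>" using klinD(8)[OF r(1) cP rc] r(3)[OF r(2)[OF cP]] rc p(2) by simp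
    obtain T' where T': "finite T'" "T' \<subseteq> carrier P" "card T' < card T" "mspan K P T' = r ` mspan K P T"
      using rank_drop[OF r(1) T(1,2) zD[folded T(3)] nz rz] by blast
    have "r ` Dm n = Dm (n + n)" using r(2,3) DnP le by force
    then show False using min[of "n + n" T'] n T' T(3) by simp
  qed
  obtain V where V: "comodule K C V" "carrier V = Dm n" "colin V P (\<lambda>x. x)"
    and into: "\<And>Q g. colin Q P g \<Longrightarrow> (\<And>q. q \<in> carrier Q \<Longrightarrow> g q \<in> Dm n) \<Longrightarrow> colin Q V g"
    and gV: "\<And>S. S \<subseteq> Dm n \<Longrightarrow> mspan K P S = Dm n \<Longrightarrow> gens V S"
    using image_subcomodule[OF Pc pow[of n]] unfolding Dm_def by metis
  have \<sigma>P: "colin P V ?\<sigma>" by (rule into[OF pow]) (auto simp: Dm_def)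
  have \<sigma>V: "colin V V ?\<sigma>" using colin_comp[OF V(3) \<sigma>P] by simp
  have surj: "?\<sigma> ` carrier V = carrier V" using add[of n n] eq V(2) by simp
  have z: "\<zero>\<^bsub>V\<^esub> = \<zero>\<^bsub>P\<^esub>" using klinD(6)[OF colinD(3)[OF V(3)]] .
  have ker: "v = \<zero>\<^bsub>V\<^esub>" if "v \<in> carrier V" "?\<sigma> v = \<zero>\<^bsub>V\<^esub>" for v
    using inj[of v] that V(2) z by simp
  \<comment> \<open>The inverse of \<phi>^n on \<open>V\<close>, obtained by factoring the identity
    through it. Then \<tau> after \<phi>^n is a colinear retraction of \<open>P\<close> onto
    \<open>V\<close>.\<close>
  define \<tau> where "\<tau> y = inv_into (carrier V) ?\<sigma> y" for y
  note f = lin_factor[OF colinD(3)[OF \<sigma>V] surj klin_id[OF comoduleD(2)[OF V(1)]] ker, folded \<tau>_def]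
  have \<tau>: "colin V V \<tau>"
    unfolding colin_def
  proof (intro conjI ballI comoduleD(1)[OF V(1)] f(1))
    fix y assume "y \<in> carrier V"
    then obtain v where v: "v \<in> carrier V" "y = ?\<sigma> v" using surj by blast
    show "colin_at V V \<tau> y"
      unfolding v(2)
      by (rule colin_at_factor[OF \<sigma>V colin_id[OF comoduleD(1)[OF V(1)]] f(1) f(2) v(1)])
  qed
  have "projective (comod_cat K C) V"
    by (rule retract_projective[OF P V(1,3) colin_comp[OF \<sigma>P \<tau>]]) (rule f(2))
  moreover have "fin_dim K V"
  proof -
    have "T \<subseteq> Dm n" using mspan_incl[of _ T P] T(3) by auto
    from gV[OF this T(3)] show ?thesis using T(1) by (auto simp: fin_dim_def gens_def)
  qed
  moreover have "x \<in> carrier V" using powx[of n] x V(2) by (auto simp: Dm_def intro: rev_image_eqI)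
  ultimately show ?thesis using that V(3) by blast
qed

lemma finite_projectives_generate:
  assumes sp: "right_semiperfect K C" and Pf: "is_Proj_f K C \<P>"
    and W: "comodule K C W" and U: "comodule K C U" and f: "colin W U f" and g: "colin W U g"
    and w: "w \<in> carrier W" "f w \<noteq> g w"
  obtains V h v where "V \<in> \<P>" "colin V W h" "v \<in> carrier V" "f (h v) \<noteq> g (h v)"
proof -
  obtain P e where P: "projective (comod_cat K C) P" and e: "epi (comod_cat K C) P W e"
    using sp W unfolding right_semiperfect_def enough_projectives_def comod_cat_simps by blast
  have Pc: "comodule K C P" using P by (simp add: projective_def)
  have ec: "colin P W e" using e Pc W by (simp add: epi_def comod_maps_colin)
  have "\<exists>x\<in>carrier P. f (e x) \<noteq> g (e x)"
  proof (rule ccontr)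
    assume no: "\<not> (\<exists>x\<in>carrier P. f (e x) \<noteq> g (e x))"
    have "restrict f (carrier W) \<in> comod_maps K C W U" "restrict g (carrier W) \<in> comod_maps K C W U"
      using f g W U by (simp_all add: comod_maps_colin)
    moreover have "compose (carrier P) (restrict f (carrier W)) e = compose (carrier P) (restrict g (carrier W)) e"
      using no colinD(4)[OF ec] by (auto simp: compose_def)
    ultimately have "restrict f (carrier W) = restrict g (carrier W)"
      using e U unfolding epi_def comod_cat_simps by blast
    then show False using w by (metis restrict_apply')
  qed
  then obtain x where x: "x \<in> carrier P" "f (e x) \<noteq> g (e x)" by auto
  obtain V where V: "projective (comod_cat K C) V" "fin_dim K V" "colin V P (\<lambda>v. v)" "x \<in> carrier V"
    using projective_finite_retract[OF P x(1)] .
  have Vc: "comodule K C V" using V(1) by (simp add: projective_def)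
  \<comment> \<open>The chosen representative is only isomorphic to \<open>V\<close>; the inverse
    isomorphism \<open>j\<close> composes with the map to \<open>W\<close>, and \<open>i x\<close>
    is the element sent to \<open>x\<close>.\<close>
  obtain V' where V': "V' \<in> \<P>" "isomorphic (comod_cat K C) V V'"
    using Pf V(1,2) unfolding is_Proj_f_def by blast
  have V'c: "comodule K C V'" using Pf V'(1) by (auto simp: is_Proj_f_def projective_def)
  obtain i j where "i \<in> comod_maps K C V V'" and j: "j \<in> comod_maps K C V' V"
    and ji: "compose (carrier V) j i = (\<lambda>v \<in> carrier V. v)"
    using V'(2) unfolding isomorphic_def by (auto simp: comod_cat_def)
  then have ic: "colin V V' i" and jc: "colin V' V j" using Vc V'c by (simp_all add: comod_maps_colin)
  have "j (i x) = x" using fun_cong[OF ji, of x] V(4) by (simp add: compose_def)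
  then show ?thesis
    using that[OF V'(1) colin_comp[OF colin_comp[OF jc V(3)] ec], of "i x"] colinD(4)[OF ic V(4)] x by simp
qed

end

section \<open>Cokernels and epimorphisms\<close>

context coalg
begin

definition cok_space :: "'u comod \<Rightarrow> 'u comod \<Rightarrow> ('u \<Rightarrow> 'u) \<Rightarrow> ('u, 'u) module" where
  "cok_space V W f = squot W (f ` carrier V)"

definition cok_proj :: "'u comod \<Rightarrow> 'u comod \<Rightarrow> ('u \<Rightarrow> 'u) \<Rightarrow> 'u \<Rightarrow> 'u" where
  "cok_proj V W f = sproj W (f ` carrier V)"

definition cok :: "'u comod \<Rightarrow> 'u comod \<Rightarrow> ('u \<Rightarrow> 'u) \<Rightarrow> 'u comod" where
  "cok V W f = cmk (cok_space V W f) (\<lambda>y. tlift K W C (cok_space V W f \<otimes>\<^sub>K C)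
     (\<lambda>w0 w1. tens K (cok_space V W f) C (cok_proj V W f w0) w1)
     (coact W (inv_into (carrier W) (cok_proj V W f) y)))"

text \<open>The coaction of \<open>cok\<close> is computed on a chosen representative. The choice
  does not matter: (p \<otimes> id)\<rho> kills the image of \<open>f\<close>, because \<rho>(f y)
  has left factors in that image. The axioms descend along the surjection \<open>p\<close>.\<close>

lemma cok:
  assumes W: "comodule K C W" and f: "colin V W f"
  shows "comodule K C (cok V W f)" "colin W (cok V W f) (cok_proj V W f)"
    and "cok_proj V W f ` carrier W = carrier (cok V W f)"
    and "w \<in> carrier W \<Longrightarrow> cok_proj V W f w = \<zero>\<^bsub>cok V W f\<^esub> \<longleftrightarrow> w \<in> f ` carrier V"
proof -
  note w = comoduleD[OF W] and v = precomodD[OF colinD(1)[OF f]]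
  let ?Q = "cok_space V W f" and ?p = "cok_proj V W f"
  note sq = squot_lin[OF w(2) submod_image[OF colinD(3)[OF f] submod_whole[OF v(1)]] small_univ,
      folded cok_space_def cok_proj_def]
  have Q [simp]: "module K ?Q" using klinD(2)[OF sq(1)] .
  note [simp] = w(2) v(1) klinD(3)[OF sq(1)]
  let ?g = "\<lambda>x. tlift K W C (?Q \<otimes>\<^sub>K C) (\<lambda>w0 w1. tens K ?Q C (?p w0) w1) (coact W x)"
  have b: "bilin W C (?Q \<otimes>\<^sub>K C) (\<lambda>w0 w1. tens K ?Q C (?p w0) w1)" by (intro lin_rules sq(1)) auto
  have g: "klin W (?Q \<otimes>\<^sub>K C) ?g" by (rule tlift_lin_arg[OF w(3) b])
  have t0: "tens K ?Q C \<zero>\<^bsub>?Q\<^esub> c = \<zero>\<^bsub>?Q \<otimes>\<^sub>K C\<^esub>" if "c \<in> carrier C" for c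
    using klinD(6)[OF bilinD(6)[OF tens_bilin[of ?Q C] that]] by simp
  have ker: "?g x = \<zero>\<^bsub>?Q \<otimes>\<^sub>K C\<^esub>" if x: "x \<in> carrier W" "?p x = \<zero>\<^bsub>?Q\<^esub>" for x
  proof -
    obtain y where y: "y \<in> carrier V" "x = f y" using sq(3)[OF x(1)] x(2) by auto
    have "?g x = tlift K V C (?Q \<otimes>\<^sub>K C) (\<lambda>v0 v1. tens K ?Q C (?p (f v0)) v1) (coact V y)"
      unfolding y(2) by (rule colin_bind[OF f b y(1)])
    also have "\<dots> = tlift K V C (?Q \<otimes>\<^sub>K C) (\<lambda>v0 v1. \<zero>\<^bsub>?Q \<otimes>\<^sub>K C\<^esub>) (coact V y)"
    proof (rule tlift_cong)
      fix v0 v1 assume "v0 \<in> carrier V" "v1 \<in> carrier C"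
      moreover from this have "?p (f v0) = \<zero>\<^bsub>?Q\<^esub>" using sq(3)[of "f v0"] colinD(4)[OF f] by auto
      ultimately show "tens K ?Q C (?p (f v0)) v1 = \<zero>\<^bsub>?Q \<otimes>\<^sub>K C\<^esub>" using t0 by simp
    qed
    also have "\<dots> = \<zero>\<^bsub>?Q \<otimes>\<^sub>K C\<^esub>"
      by (rule tensor_eq[where f = "tlift K V C (?Q \<otimes>\<^sub>K C) (\<lambda>v0 v1. \<zero>\<^bsub>?Q \<otimes>\<^sub>K C\<^esub>)" and U = "?Q \<otimes>\<^sub>K C"])
        (use v(3)[OF y(1)] in \<open>auto intro!: tlift_lin bilinI klin_zero tlift_tens\<close>)
    finally show ?thesis .
  qed
  note fac = lin_factor[OF sq(1,2) g ker]
  have P: "precomod (cok V W f)" using fac(1) by (simp add: cok_def)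
  show col: "colin W (cok V W f) ?p"
    using P w(1) sq(1) fac(2) by (simp add: colin_def colin_at_def cok_def)
  show im: "?p ` carrier W = carrier (cok V W f)" using sq(2) by (simp add: cok_def)
  show "comodule K C (cok V W f)"
    unfolding comodule_iff
  proof (intro conjI ballI P)
    fix y assume "y \<in> carrier (cok V W f)"
    then obtain x where "x \<in> carrier W" "y = ?p x" using im by blast
    then show "comod_at (cok V W f) y" using comod_at_colin[OF W col] by simp
  qed
  show "w \<in> carrier W \<Longrightarrow> ?p w = \<zero>\<^bsub>cok V W f\<^esub> \<longleftrightarrow> w \<in> f ` carrier V"
    using sq(3) by (simp add: cok_def)
qed

definition ecok_proj :: "'u entmod \<Rightarrow> 'u entmod \<Rightarrow> ('u \<Rightarrow> 'u \<Rightarrow> 'u) \<Rightarrow> 'u \<Rightarrow> 'u \<Rightarrow> 'u" where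
  "ecok_proj M N \<eta> r = cok_proj (em_at M r) (em_at N r) (\<eta> r)"

definition ecok :: "'u entmod \<Rightarrow> 'u entmod \<Rightarrow> ('u \<Rightarrow> 'u \<Rightarrow> 'u) \<Rightarrow> 'u entmod" where
  "ecok M N \<eta> = \<lparr>em_at = (\<lambda>r. cok (em_at M r) (em_at N r) (\<eta> r)),
     em_act = (\<lambda>r s y f. ecok_proj M N \<eta> s
       (em_act N r s (inv_into (carrier (em_at N r)) (ecok_proj M N \<eta> r) y) f))\<rparr>"

end

context entw
begin

text \<open>\<open>lin_factor\<close> at each object; colinearity and compatibility with the action
  are then verified on elements \<open>p r n\<close>, which exhaust \<open>Q\<close>.\<close>

lemma emor_factor:
  assumes p: "emor R N Q p" "\<And>r. r \<in> lob R \<Longrightarrow> p r ` carrier (em_at N r) = carrier (em_at Q r)"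
    and N: "entwined_module K C R N" and h: "emor R N U h"
    and ker: "\<And>r n. r \<in> lob R \<Longrightarrow> n \<in> carrier (em_at N r) \<Longrightarrow> p r n = \<zero>\<^bsub>em_at Q r\<^esub> \<Longrightarrow> h r n = \<zero>\<^bsub>em_at U r\<^esub>"
  shows "emor R Q U (\<lambda>r y. h r (inv_into (carrier (em_at N r)) (p r) y))"
    and "r \<in> lob R \<Longrightarrow> n \<in> carrier (em_at N r) \<Longrightarrow> h r (inv_into (carrier (em_at N r)) (p r) (p r n)) = h r n"
proof -
  let ?g = "\<lambda>r y. h r (inv_into (carrier (em_at N r)) (p r) y)"
  note f = lin_factor[OF emorD(2)[OF p(1)] p(2) emorD(2)[OF h]]
  have gl: "klin (em_at Q r) (em_at U r) (?g r)" if r: "r \<in> lob R" for r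
    by (rule f(1)[OF r r r ker[OF r]])
  have g: "?g r (p r n) = h r n" if r: "r \<in> lob R" and n: "n \<in> carrier (em_at N r)" for r n
    by (rule f(2)[OF r r r ker[OF r] n])
  then show "r \<in> lob R \<Longrightarrow> n \<in> carrier (em_at N r) \<Longrightarrow> ?g r (p r n) = h r n" .
  show "emor R Q U ?g"
    unfolding emor_def
  proof (intro conjI ballI)
    fix r assume r: "r \<in> lob R"
    show "colin (em_at Q r) (em_at U r) (?g r)"
      unfolding colin_def
    proof (intro conjI ballI)
      show "precomod (em_at Q r)" "precomod (em_at U r)"
        using colinD(2)[OF emorD(1)[OF p(1) r]] colinD(2)[OF emorD(1)[OF h r]] .
      show l: "klin (em_at Q r) (em_at U r) (?g r)" by (rule gl[OF r])
      fix y assume "y \<in> carrier (em_at Q r)"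
      then obtain n where n: "n \<in> carrier (em_at N r)" "y = p r n" using p(2)[OF r] by blast
      show "colin_at (em_at Q r) (em_at U r) (?g r) y"
        unfolding n(2) by (rule colin_at_factor[OF emorD(1)[OF p(1) r] emorD(1)[OF h r] l g[OF r] n(1)])
    qed
    fix s y a assume s: "s \<in> lob R" and y: "y \<in> carrier (em_at Q r)" and a: "a \<in> carrier (lhom R s r)"
    obtain n where n: "n \<in> carrier (em_at N r)" "y = p r n" using p(2)[OF r] y by blast
    show "?g s (em_act Q r s y a) = em_act U r s (?g r y) a"
      using g[OF r n(1)] g[OF s entmodD(8)[OF N r s n(1) a]] emorD(4)[OF p(1) r s n(1) a]
        emorD(4)[OF h r s n(1) a] n(2) by simp
  qed
qed

text \<open>Every element of \<open>V'\<close> is some \<open>p v\<close>, and there colinearity of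
  \<open>p\<close> exchanges the twisted sum over \<open>V'\<close> for the one over
  \<open>V\<close>.\<close>

lemma twisted_factor:
  assumes r [simp]: "r \<in> lob R" and s [simp]: "s \<in> lob R"
    and b: "twisted R s r V Y b" and p: "colin V V' p" "p ` carrier V = carrier V'"
    and V': "comodule K C V'" and a: "bilin V' (lhom R s r) Y a"
    and ap: "\<And>v g. v \<in> carrier V \<Longrightarrow> g \<in> carrier (lhom R s r) \<Longrightarrow> a (p v) g = b v g"
  shows "twisted R s r V' Y a"
  unfolding twisted_def
proof (intro conjI ballI V' a)
  show Y: "precomod Y" using b by (simp add: twisted_def)
  note [simp] = precomodD(1)[OF Y] comoduleD(2)[OF V'] bilinD(4)[OF a]
  fix y g assume "y \<in> carrier V'" and g: "g \<in> carrier (lhom R s r)"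
  then obtain v where v: "v \<in> carrier V" "y = p v" using p(2) by blast
  have "coact Y (a y g) = twsum R s r V (Y \<otimes>\<^sub>K C) (\<lambda>v0 g' c'. tens K Y C (b v0 g') c') v g"
    using b v g ap by (simp add: twisted_def)
  also have "\<dots> = twsum R s r V (Y \<otimes>\<^sub>K C) (\<lambda>v0 g' c'. tens K Y C (a (p v0) g') c') v g"
    by (rule twsum_cong) (simp add: ap)
  also have "\<dots> = twsum R s r V' (Y \<otimes>\<^sub>K C) (\<lambda>v0 g' c'. tens K Y C (a v0 g') c') y g"
    unfolding twsum_def v(2)
    by (rule colin_bind[OF p(1) _ v(1), symmetric]; (intro lin_rules tw_lin bilin_left[OF a] bilin_right[OF a])?)
      (use g in auto)
  finally show "coact Y (a y g) = twsum R s r V' (Y \<otimes>\<^sub>K C) (\<lambda>v0 g' c'. tens K Y C (a v0 g') c') y g" .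
qed

lemma ecok:
  assumes M: "entwined_module K C R M" and N: "entwined_module K C R N" and \<eta>: "emor R M N \<eta>"
  shows "entwined_module K C R (ecok M N \<eta>)"
    and "emor R N (ecok M N \<eta>) (ecok_proj M N \<eta>)"
    and "r \<in> lob R \<Longrightarrow> ecok_proj M N \<eta> r ` carrier (em_at N r) = carrier (em_at (ecok M N \<eta>) r)"
    and "r \<in> lob R \<Longrightarrow> n \<in> carrier (em_at N r) \<Longrightarrow>
      ecok_proj M N \<eta> r n = \<zero>\<^bsub>em_at (ecok M N \<eta>) r\<^esub> \<longleftrightarrow> n \<in> \<eta> r ` carrier (em_at M r)"
proof -
  let ?Q = "ecok M N \<eta>" and ?p = "ecok_proj M N \<eta>"
  note n = entmodD[OF N]
  note c = cok[OF n(1) emorD(1)[OF \<eta>], folded ecok_proj_def]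
  have at: "em_at ?Q r = cok (em_at M r) (em_at N r) (\<eta> r)" for r by (simp add: ecok_def)
  have co: "comodule K C (em_at ?Q r)" and p: "colin (em_at N r) (em_at ?Q r) (?p r)"
    and im: "?p r ` carrier (em_at N r) = carrier (em_at ?Q r)" if "r \<in> lob R" for r
    unfolding at using c(1-3)[of r] that by auto
  have ker: "?p r x = \<zero>\<^bsub>em_at ?Q r\<^esub> \<longleftrightarrow> x \<in> \<eta> r ` carrier (em_at M r)"
    if "r \<in> lob R" "x \<in> carrier (em_at N r)" for r x
    unfolding at using c(4)[of r] that by auto
  show "r \<in> lob R \<Longrightarrow> ?p r ` carrier (em_at N r) = carrier (em_at ?Q r)"
    "r \<in> lob R \<Longrightarrow> n \<in> carrier (em_at N r) \<Longrightarrow> ?p r n = \<zero>\<^bsub>em_at ?Q r\<^esub> \<longleftrightarrow> n \<in> \<eta> r ` carrier (em_at M r)"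
    using im ker by auto
  \<comment> \<open>The image of \<eta> is stable under the action, so the action descends to the
    cokernel and does not depend on the representative picked by \<open>inv_into\<close>.\<close>
  have fac: "klin (em_at ?Q r) (em_at ?Q s) (\<lambda>y. em_act ?Q r s y f)"
    "x \<in> carrier (em_at N r) \<Longrightarrow> em_act ?Q r s (?p r x) f = ?p s (em_act N r s x f)"
    if r: "r \<in> lob R" and s: "s \<in> lob R" and f: "f \<in> carrier (lhom R s r)" for r s f x
  proof -
    have l: "klin (em_at N r) (em_at ?Q s) (\<lambda>x. ?p s (em_act N r s x f))"
      by (rule klin_comp[OF bilinD(6)[OF n(4)[OF r s] f] colinD(3)[OF p[OF s]]])
    have k: "?p s (em_act N r s x f) = \<zero>\<^bsub>em_at ?Q s\<^esub>" if x: "x \<in> carrier (em_at N r)" "?p r x = \<zero>\<^bsub>em_at ?Q r\<^esub>" for x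
    proof -
      obtain m where m: "m \<in> carrier (em_at M r)" "x = \<eta> r m" using ker[OF r x(1)] x(2) by auto
      have "em_act N r s x f = \<eta> s (em_act M r s m f)" using emorD(4)[OF \<eta> r s m(1) f] m(2) by simp
      then show ?thesis using ker[OF s n(8)[OF r s x(1) f]] entmodD(8)[OF M r s m(1) f] by auto
    qed
    note lf = lin_factor[OF colinD(3)[OF p[OF r]] im[OF r] l k]
    show "klin (em_at ?Q r) (em_at ?Q s) (\<lambda>y. em_act ?Q r s y f)"
      "x \<in> carrier (em_at N r) \<Longrightarrow> em_act ?Q r s (?p r x) f = ?p s (em_act N r s x f)"
      using lf by (simp_all add: ecok_def)
  qed
  have sur: "\<exists>x\<in>carrier (em_at N r). y = ?p r x" if "r \<in> lob R" "y \<in> carrier (em_at ?Q r)" for r y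
    using im that by blast
  have bl: "bilin (em_at ?Q r) (lhom R s r) (em_at ?Q s) (em_act ?Q r s)" if r: "r \<in> lob R" and s: "s \<in> lob R" for r s
  proof (rule bilinI)
    fix y assume "y \<in> carrier (em_at ?Q r)"
    then obtain x where x: "x \<in> carrier (em_at N r)" "y = ?p r x" using sur[OF r] by blast
    have "klin (lhom R s r) (em_at ?Q s) (\<lambda>f. ?p s (em_act N r s x f))"
      by (rule klin_comp[OF bilinD(5)[OF n(4)[OF r s] x(1)] colinD(3)[OF p[OF s]]])
    then show "klin (lhom R s r) (em_at ?Q s) (\<lambda>f. em_act ?Q r s y f)"
      by (rule klin_cong) (simp add: x fac(2)[OF r s])
  qed (use comoduleD(2)[OF co] fac(1) r s in auto)
  show "emor R N ?Q ?p"
    unfolding emor_def using p fac(2) by auto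
  show "entwined_module K C R ?Q"
  proof (rule entmodI)
    show "twisted R s r (em_at ?Q r) (em_at ?Q s) (em_act ?Q r s)" if r: "r \<in> lob R" and s: "s \<in> lob R" for r s
      by (rule twisted_factor[OF r s twisted_post[OF s r n(5)[OF r s] p[OF s]] p[OF r] im[OF r] co[OF r] bl[OF r s]])
        (rule fac(2)[OF r s])
    show "em_act ?Q r r y (lid R r) = y" if r: "r \<in> lob R" and y: "y \<in> carrier (em_at ?Q r)" for r y
    proof -
      obtain x where "x \<in> carrier (em_at N r)" "y = ?p r x" using sur[OF r y] by blast
      then show ?thesis using fac(2)[OF r r] n(6)[OF r] r by simp
    qed
    show "em_act ?Q r t y (lcmp R t s r f g) = em_act ?Q s t (em_act ?Q r s y f) g"
      if r: "r \<in> lob R" and s: "s \<in> lob R" and t: "t \<in> lob R" and y: "y \<in> carrier (em_at ?Q r)"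
        and f: "f \<in> carrier (lhom R s r)" and g: "g \<in> carrier (lhom R t s)" for r s t y f g
    proof -
      obtain x where x: "x \<in> carrier (em_at N r)" "y = ?p r x" using sur[OF r y] by blast
      show ?thesis
        using fac(2)[OF r s f x(1)] fac(2)[OF s t g n(8)[OF r s x(1) f]] n(7)[OF r s t x(1) f g]
          fac(2)[OF r t _ x(1), of "lcmp R t s r f g"] x(2) r s t f g by simp
    qed
  qed (rule co)
qed

end

context rep
begin

section \<open>Epimorphisms between modules over the representation\<close>

lemma rep_maps_restrictI:
  assumes M: "rep_module K C \<R> M" and N: "rep_module K C \<R> N"
    and e: "\<And>x. emor (E x) (rm_at M x) (rm_at N x) (\<eta> x)"
    and nat: "\<And>x y r m. x \<le> y \<Longrightarrow> r \<in> lob (E x) \<Longrightarrow> m \<in> carrier (em_at (rm_at M x) r) \<Longrightarrow>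
      rm_map N x y r (\<eta> x r m) = \<eta> y (fob (A x y) r) (rm_map M x y r m)"
  shows "(\<lambda>x. E.em_restrict x (rm_at M x) (\<eta> x)) \<in> rep_module_maps K C \<R> M N"
  unfolding rep_maps_iff[OF M N]
proof (intro conjI allI impI)
  show "E.em_restrict x (rm_at M x) (\<eta> x) \<in> entmod_maps K C (E x) (rm_at M x) (rm_at N x)" for x
    by (rule E.em_restrict_maps[OF rep_moduleD(1)[OF M] e])
  fix x y r m assume *: "x \<le> y" "r \<in> lob (E x)" "m \<in> carrier (em_at (rm_at M x) r)"
  then show "rm_map N x y r (E.em_restrict x (rm_at M x) (\<eta> x) r m) =
    E.em_restrict y (rm_at M y) (\<eta> y) (fob (A x y) r) (rm_map M x y r m)"
    using nat[OF *] emorD(3)[OF rep_moduleD(2)[OF M *(1)] *(2,3)] by simp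
qed

text \<open>The projection to the pointwise cokernel and the zero map agree after composition with
  the given epimorphism, so the cokernel vanishes.\<close>

lemma epi_surj:
  assumes M: "rep_module K C \<R> M" and N: "rep_module K C \<R> N"
    and e: "epi (rep_module_cat K C \<R>) M N e" and r: "r \<in> lob (E x)"
  shows "e x r ` carrier (em_at (rm_at M x) r) = carrier (em_at (rm_at N x) r)"
proof -
  have eM: "e \<in> rep_module_maps K C \<R> M N" using e by (simp add: epi_def)
  note ee = rep_mapsD(2)[OF M N eM]
  note m = rep_moduleD[OF M] and n = rep_moduleD[OF N]
  define Q where "Q x = ecok (rm_at M x) (rm_at N x) (e x)" for x
  define p where "p x = ecok_proj (rm_at M x) (rm_at N x) (e x)" for x
  note q = E.ecok[OF m(1) n(1) ee, folded Q_def p_def]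
  \<comment> \<open>The structure map of \<open>N\<close> followed by the projection at
    \<open>y\<close>; it is to be factored through the projection at \<open>x\<close>.\<close>
  define h where "h x y r n = p y (fob (A x y) r) (rm_map N x y r n)" for x y r n
  have h: "emor (E x) (rm_at N x) (restr_mod (A x y) (Q y)) (h x y)" if xy: "x \<le> y" for x y
    unfolding h_def
    using emor_comp[OF n(2)[OF xy] ent_mor.restr_emor[OF mor_A[OF xy] q(2)]] .
  \<comment> \<open>Whatever the projection at \<open>x\<close> kills lies in the image of
    \<open>e\<close>, and by naturality of \<open>e\<close> its image at \<open>y\<close> lies in
    the image of \<open>e\<close> again.\<close>
  have ker: "h x y r k = \<zero>\<^bsub>em_at (restr_mod (A x y) (Q y)) r\<^esub>"
    if xy: "x \<le> y" and r: "r \<in> lob (E x)" and k: "k \<in> carrier (em_at (rm_at N x) r)" "p x r k = \<zero>\<^bsub>em_at (Q x) r\<^esub>" for x y r k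
  proof -
    obtain l where l: "l \<in> carrier (em_at (rm_at M x) r)" "k = e x r l" using q(4)[OF r k(1)] k(2) by auto
    have "rm_map N x y r k = e y (fob (A x y) r) (rm_map M x y r l)"
      using rep_mapsD(3)[OF M N eM xy r l(1)] l(2) by simp
    moreover have "rm_map N x y r k \<in> carrier (em_at (rm_at N y) (fob (A x y) r))"
      using emorD(3)[OF n(2)[OF xy] r k(1)] by simp
    moreover have "rm_map M x y r l \<in> carrier (em_at (rm_at M y) (fob (A x y) r))"
      using emorD(3)[OF m(2)[OF xy] r l(1)] by simp
    ultimately show ?thesis using q(4)[of "fob (A x y) r" y "rm_map N x y r k"] xy r by (simp add: h_def)
  qed
  \<comment> \<open>The pointwise cokernels with the factored structure maps form the test object.
    Its laws are inherited from \<open>N\<close> because the projections are surjective.\<close>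
  define L where "L = \<lparr>rm_at = Q, rm_map = (\<lambda>x y. E.em_restrict x (Q x)
    (\<lambda>r k. h x y r (inv_into (carrier (em_at (rm_at N x) r)) (p x r) k)))\<rparr>"
  have fac: "emor (E x) (Q x) (restr_mod (A x y) (Q y)) (\<lambda>r k. h x y r (inv_into (carrier (em_at (rm_at N x) r)) (p x r) k))"
    "r \<in> lob (E x) \<Longrightarrow> k \<in> carrier (em_at (rm_at N x) r) \<Longrightarrow>
      h x y r (inv_into (carrier (em_at (rm_at N x) r)) (p x r) (p x r k)) = h x y r k" if xy: "x \<le> y" for x y r k
     apply (rule E.emor_factor(1)[OF q(2,3) n(1) h[OF xy] ker[OF xy]]; assumption)
    apply (rule E.emor_factor(2)[OF q(2,3) n(1) h[OF xy] ker[OF xy]]; assumption)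
    done
  have pc: "p x r k \<in> carrier (em_at (Q x) r)" if "r \<in> lob (E x)" "k \<in> carrier (em_at (rm_at N x) r)" for x r k
    using emorD(3)[OF q(2) that] .
  have Lmap: "rm_map L x y r (p x r k) = p y (fob (A x y) r) (rm_map N x y r k)"
    if "x \<le> y" "r \<in> lob (E x)" "k \<in> carrier (em_at (rm_at N x) r)" for x y r k
    using fac(2)[OF that] pc[OF that(2,3)] that by (simp add: L_def h_def)
  have sur: "\<exists>k\<in>carrier (em_at (rm_at N x) r). y = p x r k" if "r \<in> lob (E x)" "y \<in> carrier (em_at (Q x) r)" for x r y
    using q(3)[OF that(1)] that(2) by blast
  have L: "rep_module K C \<R> L"
  proof (rule rep_moduleI)
    show "entwined_module K C (E x) (rm_at L x)" for x using q(1) by (simp add: L_def)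
    fix x y :: 'x assume xy: "x \<le> y"
    show "emor (E x) (rm_at L x) (restr_mod (A x y) (rm_at L y)) (rm_map L x y)"
      unfolding L_def repmod.simps by (rule E.emor_cong[OF fac(1)[OF xy] q(1)]) simp
    show "rm_map L x y \<in> extensional (lob (E x))" by (simp add: L_def E.em_restrict_ext)
    show "rm_map L x y r \<in> extensional (carrier (em_at (rm_at L x) r))" if "r \<in> lob (E x)" for r
      using that by (simp add: L_def E.em_restrict_ext)
  next
    fix x r y assume r: "r \<in> lob (E x)" and "y \<in> carrier (em_at (rm_at L x) r)"
    then obtain k where k: "k \<in> carrier (em_at (rm_at N x) r)" "y = p x r k" using sur[OF r] by (auto simp: L_def)
    then show "rm_map L x x r y = y"
      using Lmap[OF order_refl r k(1)] n(3)[OF r k(1)] A_refl(1)[OF r] by simp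
  next
    fix x y z r l assume xy: "x \<le> y" and yz: "y \<le> z" and r: "r \<in> lob (E x)" and "l \<in> carrier (em_at (rm_at L x) r)"
    then obtain k where k: "k \<in> carrier (em_at (rm_at N x) r)" "l = p x r k" using sur[OF r] by (auto simp: L_def)
    have kc: "rm_map N x y r k \<in> carrier (em_at (rm_at N y) (fob (A x y) r))"
      using emorD(3)[OF n(2)[OF xy] r k(1)] by simp
    show "rm_map L x z r l = rm_map L y z (fob (A x y) r) (rm_map L x y r l)"
      using Lmap[OF xy r k(1)] Lmap[OF yz _ kc] Lmap[OF order_trans[OF xy yz] r k(1)]
        n(4)[OF xy yz r k(1)] A_trans(1)[OF xy yz r] xy r k(2) by simp
  qed
  have at: "rm_at L x = Q x" for x by (simp add: L_def)
  let ?p = "\<lambda>x. E.em_restrict x (rm_at N x) (p x)"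
  let ?z = "\<lambda>x. E.em_restrict x (rm_at N x) (\<lambda>r _. \<zero>\<^bsub>em_at (Q x) r\<^esub>)"
  have P: "?p \<in> rep_module_maps K C \<R> N L"
    by (rule rep_maps_restrictI[OF N L]) (use q(2) Lmap in \<open>auto simp: at\<close>)
  have Z: "?z \<in> rep_module_maps K C \<R> N L"
  proof (rule rep_maps_restrictI[OF N L])
    show "emor (E x) (rm_at N x) (rm_at L x) (\<lambda>r _. \<zero>\<^bsub>em_at (Q x) r\<^esub>)" for x
      unfolding at by (rule E.emor_zero[OF n(1) q(1)])
    show "rm_map L x y r \<zero>\<^bsub>em_at (Q x) r\<^esub> = \<zero>\<^bsub>em_at (Q y) (fob (A x y) r)\<^esub>" if "x \<le> y" "r \<in> lob (E x)" for x y r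
      using klinD(6)[OF emorD(2)[OF rep_moduleD(2)[OF L that(1)] that(2)]] by (simp add: at)
  qed
  have "cmp (rep_module_cat K C \<R>) M N L ?p e = cmp (rep_module_cat K C \<R>) M N L ?z e"
    unfolding rep_cmp_eq
  proof (rule ext, rule E.em_ext[OF E.em_restrict_ext E.em_restrict_ext])
    fix x r l assume r: "r \<in> lob (E x)" and l: "l \<in> carrier (em_at (rm_at M x) r)"
    note c = emorD(3)[OF ee r l]
    have "p x r (e x r l) = \<zero>\<^bsub>em_at (Q x) r\<^esub>" using q(4)[OF r c] l by auto
    then show "E.em_restrict x (rm_at M x) (\<lambda>r m. ?p x r (e x r m)) r l =
      E.em_restrict x (rm_at M x) (\<lambda>r m. ?z x r (e x r m)) r l" using r l c by simp
  qed
  then have "?p = ?z"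
    using e L P Z unfolding epi_def rep_cat_simps mem_Collect_eq by blast
  then have pz: "?p x r k = ?z x r k" for k by metis
  show ?thesis
  proof
    show "carrier (em_at (rm_at N x) r) \<subseteq> e x r ` carrier (em_at (rm_at M x) r)"
    proof
      fix k assume k: "k \<in> carrier (em_at (rm_at N x) r)"
      then show "k \<in> e x r ` carrier (em_at (rm_at M x) r)" using pz[of k] q(4)[OF r k] r by simp
    qed
  qed (use emorD(3)[OF ee r] in auto)
qed

section \<open>The objects ex(V \<otimes> H) as projective generators\<close>

lemma ex_tensor_H_map:
  assumes V: "comodule K C V" and r: "r \<in> lob (E x)" and N: "rep_module K C \<R> N"
    and h: "colin V (em_at (rm_at N x) r) h"
  obtains k where "k \<in> rep_module_maps K C \<R> (ex x (tensor_H K C (E x) V r)) N"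
    "\<And>v. v \<in> carrier V \<Longrightarrow>
      k x r (eunit x x (tensor_H K C (E x) V r) r (tens K V (lhom (E x) r r) v (lid (E x) r))) = h v"
proof -
  let ?T = "tensor_H K C (E x) V r"
  note T = E.tensor_H_entwined[OF V r]
  note n = rep_moduleD(1)[OF N]
  obtain \<eta> where \<eta>: "emor (E x) ?T (rm_at N x) \<eta>"
    "\<And>r' v g. r' \<in> lob (E x) \<Longrightarrow> v \<in> carrier V \<Longrightarrow> g \<in> carrier (lhom (E x) r' r) \<Longrightarrow>
      \<eta> r' (tens K V (lhom (E x) r' r) v g) = em_act (rm_at N x) r r' (h v) g"
    using E.tensor_H_map[OF V r n h] by blast
  obtain k where k: "k \<in> rep_module_maps K C \<R> (ex x ?T) N"
    "\<And>r' t. r' \<in> lob (E x) \<Longrightarrow> t \<in> carrier (em_at ?T r') \<Longrightarrow> k x r' (eunit x x ?T r' t) = \<eta> r' t"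
    using ex_adjoint_surj[OF T N \<eta>(1)] by blast
  \<comment> \<open>The image of \<open>v\<close> under both units. Transposing twice returns h(v)
    acted on by the identity.\<close>
  have "k x r (eunit x x ?T r (tens K V (lhom (E x) r r) v (lid (E x) r))) = h v" if v: "v \<in> carrier V" for v
    using k(2)[OF r colinD(4)[OF E.tensor_H_unit[OF V r] v]] \<eta>(2)[OF r v E.id_closed[OF r]]
      E.entmodD(6)[OF n r colinD(4)[OF h v]] by simp
  then show ?thesis using that k(1) by blast
qed

text \<open>Uniqueness of the two transposes in succession: units determine a morphism out of the
  extension, and the elements v \<otimes> id determine its restriction to V \<otimes> H.\<close>

lemma ex_tensor_H_eqI:
  assumes V: "comodule K C V" and r: "r \<in> lob (E x)" and N: "rep_module K C \<R> N"
    and f: "f \<in> rep_module_maps K C \<R> (ex x (tensor_H K C (E x) V r)) N"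
    and g: "g \<in> rep_module_maps K C \<R> (ex x (tensor_H K C (E x) V r)) N"
    and eq: "\<And>v. v \<in> carrier V \<Longrightarrow>
      f x r (eunit x x (tensor_H K C (E x) V r) r (tens K V (lhom (E x) r r) v (lid (E x) r))) =
      g x r (eunit x x (tensor_H K C (E x) V r) r (tens K V (lhom (E x) r r) v (lid (E x) r)))"
  shows "f = g"
proof -
  let ?T = "tensor_H K C (E x) V r"
  note T = E.tensor_H_entwined[OF V r]
  note u = emor_comp[OF eunit_at[OF T]]
  show ?thesis
    by (rule ex_maps_eqI[OF T N f g],
        rule E.tensor_H_map_unique[OF V r u[OF rep_mapsD(2)[OF ex_module[OF T] N f]]
          u[OF rep_mapsD(2)[OF ex_module[OF T] N g]]])
      (use eq in auto)
qed

lemma ex_tensor_H_projective: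
  assumes V: "projective (comod_cat K C) V" and r: "r \<in> lob (E x)"
  shows "projective (rep_module_cat K C \<R>) (ex x (tensor_H K C (E x) V r))"
  unfolding projective_def rep_cat_simps mem_Collect_eq
proof (intro conjI ballI allI impI)
  let ?T = "tensor_H K C (E x) V r"
  have Vc: "comodule K C V" using V by (simp add: projective_def)
  note T = E.tensor_H_entwined[OF Vc r]
  show X: "rep_module K C \<R> (ex x ?T)" by (rule ex_module[OF T])
  fix M N e f assume "M \<in> Collect (rep_module K C \<R>)" "N \<in> Collect (rep_module K C \<R>)"
    and ef: "epi (rep_module_cat K C \<R>) M N e \<and> f \<in> rep_module_maps K C \<R> (ex x ?T) N"
  then have M: "rep_module K C \<R> M" and N: "rep_module K C \<R> N" by auto
  have e: "e \<in> rep_module_maps K C \<R> M N" and f: "f \<in> rep_module_maps K C \<R> (ex x ?T) N"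
    using ef by (auto simp: epi_def)
  note ee = rep_mapsD(2)[OF M N e] and fe = rep_mapsD(2)[OF X N f]
  let ?u = "\<lambda>v. eunit x x ?T r (tens K V (lhom (E x) r r) v (lid (E x) r))"
  have u: "colin V (em_at (rm_at (ex x ?T) x) r) ?u"
    by (rule colin_comp[OF E.tensor_H_unit[OF Vc r] emorD(1)[OF eunit_at[OF T] r]])
  \<comment> \<open>The lifting problem moved to comodules: at \<open>x\<close> and \<open>r\<close>
    the epimorphism is surjective and colinear, so projectivity of \<open>V\<close> lifts the
    transpose of \<open>f\<close>.\<close>
  obtain h where h: "colin V (em_at (rm_at M x) r) h" "\<And>v. v \<in> carrier V \<Longrightarrow> e x r (h v) = f x r (?u v)"
    using projective_lift[OF V E.entmodD(1)[OF rep_moduleD(1)[OF M] r] E.entmodD(1)[OF rep_moduleD(1)[OF N] r]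
        emorD(1)[OF ee r] epi_surj[OF M N conjunct1[OF ef] r] colin_comp[OF u emorD(1)[OF fe r]]] by blast
  obtain k where k: "k \<in> rep_module_maps K C \<R> (ex x ?T) M" "\<And>v. v \<in> carrier V \<Longrightarrow> k x r (?u v) = h v"
    using ex_tensor_H_map[OF Vc r M h(1)] by blast
  show "\<exists>h\<in>rep_module_maps K C \<R> (ex x ?T) M. cmp (rep_module_cat K C \<R>) (ex x ?T) M N e h = f"
  proof
    show "k \<in> rep_module_maps K C \<R> (ex x ?T) M" by (rule k(1))
    show "cmp (rep_module_cat K C \<R>) (ex x ?T) M N e k = f"
    proof (rule ex_tensor_H_eqI[OF Vc r N _ f])
      show "cmp (rep_module_cat K C \<R>) (ex x ?T) M N e k \<in> rep_module_maps K C \<R> (ex x ?T) N"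
        using category.cmp_in[OF rep_category, of "ex x ?T" M N k e] X M N k(1) e by simp
      show "cmp (rep_module_cat K C \<R>) (ex x ?T) M N e k x r (?u v) = f x r (?u v)" if "v \<in> carrier V" for v
        unfolding rep_cmp_eq using that r colinD(4)[OF u that] h(2) k(2) by simp
    qed
  qed
qed

lemma ex_tensor_H_generating:
  assumes sp: "right_semiperfect K C" and Pf: "is_Proj_f K C \<P>"
  shows "generating (rep_module_cat K C \<R>) {ex x (tensor_H K C (E x) V r) | x r V. r \<in> lob (E x) \<and> V \<in> \<P>}"
  unfolding generating_def rep_cat_simps mem_Collect_eq
proof (intro conjI ballI impI subsetI)
  have Vc: "comodule K C V" if "V \<in> \<P>" for V using Pf that by (auto simp: is_Proj_f_def projective_def)
  show "P \<in> Collect (rep_module K C \<R>)" if "P \<in> {ex x (tensor_H K C (E x) V r) | x r V. r \<in> lob (E x) \<and> V \<in> \<P>}" for P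
    using that ex_module[OF E.tensor_H_entwined[OF Vc]] by auto
  fix M N f g assume "M \<in> Collect (rep_module K C \<R>)" "N \<in> Collect (rep_module K C \<R>)"
    and f: "f \<in> rep_module_maps K C \<R> M N" and g: "g \<in> rep_module_maps K C \<R> M N" and ne: "f \<noteq> g"
  then have M: "rep_module K C \<R> M" and N: "rep_module K C \<R> N" by auto
  obtain x r w where r: "r \<in> lob (E x)" and w: "w \<in> carrier (em_at (rm_at M x) r)" "f x r w \<noteq> g x r w"
    using rep_maps_eqI[OF M N f g] ne by blast
  note fe = emorD(1)[OF rep_mapsD(2)[OF M N f] r] and ge = emorD(1)[OF rep_mapsD(2)[OF M N g] r]
  obtain V h v where V: "V \<in> \<P>" and h: "colin V (em_at (rm_at M x) r) h" and v: "v \<in> carrier V"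
    and neq: "f x r (h v) \<noteq> g x r (h v)"
    using finite_projectives_generate[OF sp Pf E.entmodD(1)[OF rep_moduleD(1)[OF M] r]
        E.entmodD(1)[OF rep_moduleD(1)[OF N] r] fe ge w] .
  let ?T = "tensor_H K C (E x) V r"
  note T = E.tensor_H_entwined[OF Vc[OF V] r]
  let ?u = "eunit x x ?T r (tens K V (lhom (E x) r r) v (lid (E x) r))"
  obtain k where k: "k \<in> rep_module_maps K C \<R> (ex x ?T) M" "k x r ?u = h v"
    using ex_tensor_H_map[OF Vc[OF V] r M h] v by blast
  have "?u \<in> carrier (em_at (rm_at (ex x ?T) x) r)"
    using emorD(3)[OF eunit_at[OF T] r colinD(4)[OF E.tensor_H_unit[OF Vc[OF V] r] v]] .
  then have "cmp (rep_module_cat K C \<R>) (ex x ?T) M N f k x r ?u \<noteq> cmp (rep_module_cat K C \<R>) (ex x ?T) M N g k x r ?u"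
    unfolding rep_cmp_eq using r k(2) neq by simp
  then have "cmp (rep_module_cat K C \<R>) (ex x ?T) M N f k \<noteq> cmp (rep_module_cat K C \<R>) (ex x ?T) M N g k" by metis
  then show "\<exists>P\<in>{ex x (tensor_H K C (E x) V r) | x r V. r \<in> lob (E x) \<and> V \<in> \<P>}.
    \<exists>h\<in>rep_module_maps K C \<R> P M.
      cmp (rep_module_cat K C \<R>) P M N f h \<noteq> cmp (rep_module_cat K C \<R>) P M N g h"
    using r V k(1) by blast
qed

end

theorem theorem4:
  fixes K :: "'u ring" and C :: "'u coalg" and \<R> :: "('x::order, 'u) rep"
  assumes "infinite (UNIV :: 'u set)"
    and "field K"
    and "coalgebra K C"
    and "right_semiperfect K C"
    and "ent_representation K C \<R>"
  shows "(\<forall>x. left_adjoint (entmod_cat K C (fob \<R> x)) (rep_module_cat K C \<R>)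
                (ex_functor K C \<R> x) (ev_functor x))
    \<and> (\<forall>P. is_Proj_f K C P \<longrightarrow>
         projective_generators (rep_module_cat K C \<R>)
           {fob (ex_functor K C \<R> x) (tensor_H K C (fob \<R> x) V r) |
              x r V. r \<in> lob (fob \<R> x) \<and> V \<in> P})"
proof -
  interpret rep K C \<R>
    using assms by (intro rep.intro coalg.intro universe.intro universe_axioms.intro
        coalg_axioms.intro rep_axioms.intro)
  show ?thesis
  proof (intro conjI allI impI)
    show "left_adjoint (entmod_cat K C (fob \<R> x)) (rep_module_cat K C \<R>) (ex_functor K C \<R> x) (ev_functor x)" for x
      by (rule ex_ev_adjoint)
    fix P assume P: "is_Proj_f K C P"
    then have "projective (comod_cat K C) V" if "V \<in> P" for V
      using that by (simp add: is_Proj_f_def)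
    then show "projective_generators (rep_module_cat K C \<R>)
      {fob (ex_functor K C \<R> x) (tensor_H K C (fob \<R> x) V r) | x r V. r \<in> lob (fob \<R> x) \<and> V \<in> P}"
      using ex_tensor_H_projective ex_tensor_H_generating[OF assms(4) P]
      unfolding projective_generators_def ex_fob by blast
  qed
qed

end
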